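(* The functor $M\mapsto M^{\mathrm{cond}}$ induces an equivalence between the category of $\mathbb M$-modules and the category of light solid abelian groups, with inverse $\mathcal M\mapsto\mathcal M_\bullet( * )$.
   Context: $\mathbb M$ is the ring of column-finite matrices $[c_{kn}]_{k,n\in\mathbb N}$ with integer coefficients; "module" means left module. For a complete linear abelian group $V$ (a topological abelian group with a basis of neighborhoods of $0$ made of open subgroups, and $V\simeq\varprojlim V/V'$ over open subgroups $V'$), $V_\bullet$ is the $\mathbb M$-module of null sequences $(s_n)_{n\in\mathbb N}$ in $V$, with action $[c_{kn}]\cdot(s_n)_n=(\sum_nc_{kn}s_n)_k$. A light condensed abelian group is a sheaf of abelian groups on the site of metrizable Stone spaces (totally disconnected compact metrizable spaces), coverings being jointly surjective finite families. For a topological abelian group $V$, $\underline V$ is the light condensed abelian group $S\mapsto\mathrm{Hom}_{\mathrm{cont}}(S,V)$. For a metrizable Stone space $S$, $\mathbb Z\cdot S$ is the (Markov) free topological abelian group on $S$, i.e. universal for continuous maps from $S$ to topological abelian groups. For a topological abelian group $V$, $V^\vee$ is the group of continuous homomorphisms $V\to\mathbb Z$ ($\mathbb Z$ discrete) with the compact-open topology. The bidual $(\mathbb Z\cdot S)^{\vee\vee}$ is a complete linear abelian group, isomorphic to $\varprojlim_{S'}\mathbb Z\cdot S'$ over the finite discrete quotients $S'$ of $S$. For an $\mathbb M$-module $M$, $M^{\mathrm{cond}}$ is the light condensed abelian group $S\mapsto\mathrm{Hom}_{\mathbb M}\big(((\mathbb Z\cdot S)^{\vee\vee})_\bullet,M\big)$.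 Let $\overline{\mathbb N}=\mathbb N\cup\{\infty\}$ be the one-point compactification of the discrete set $\mathbb N$. For a light condensed abelian group $\mathcal M$, $\mathcal M_\bullet$ is the light condensed abelian group $S\mapsto\ker(\mathcal M(S\times\overline{\mathbb N})\to\mathcal M(S))$, the map being restriction along $S\times\{\infty\}\hookrightarrow S\times\overline{\mathbb N}$; $\mathcal M_\bullet( * )$ is its value at the one-point space. The map $n\mapsto n+1$ (fixing $\infty$) on $\overline{\mathbb N}$ induces an endomorphism $t$ of $\mathcal M_\bullet$, and $\mathcal M$ is called solid if $1-t$ is an automorphism of $\mathcal M_\bullet$. Light solid abelian groups form a full subcategory of light condensed abelian groups. The $\mathbb M$-module structure on $\mathcal M_\bullet( * )$ for $\mathcal M$ solid: the sequence of standard basis vectors, extended by $\infty\mapsto 0$, is a continuous map $\overline{\mathbb N}\to\mathbb Z^{\mathbb N}$ (product topology), and it induces an identification $\mathrm{Hom}(\underline{\mathbb Z^{\mathbb N}},\mathcal M)\simeq\mathcal M_\bullet( * )$; $\mathbb M$ acts on the left-hand side through its right action on row vectors $\mathbb Z^{\mathbb N}$. *)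

theory Defs
  imports "HOL-Analysis.Analysis" "HOL-Algebra.Ring" "HOL-Algebra.Free_Abelian_Groups"
begin

text \<open>
  Abelian groups are multiplicatively written commutative groups with a carrier, as in
  \<open>HOL-Algebra\<close>. Morphisms are compared by equality of functions, so every morphism is
  extensional, i.e. \<open>undefined\<close> outside the carrier of its source.
\<close>


section \<open>Categories and equivalences\<close>

record ('o, 'a) cat =
  Obj :: "'o set"
  Arr :: "'o \<Rightarrow> 'o \<Rightarrow> 'a set"
  Comp :: "'o \<Rightarrow> 'o \<Rightarrow> 'o \<Rightarrow> 'a \<Rightarrow> 'a \<Rightarrow> 'a"  \<comment> \<open>\<open>Comp C A B D g f\<close> is the composite of \<open>f : A \<rightarrow> B\<close> and \<open>g : B \<rightarrow> D\<close>\<close>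
  Ident :: "'o \<Rightarrow> 'a"

definition category :: "('o, 'a) cat \<Rightarrow> bool" where
  "category C \<longleftrightarrow>
     (\<forall>A\<in>Obj C. Ident C A \<in> Arr C A A) \<and>
     (\<forall>A\<in>Obj C. \<forall>B\<in>Obj C. \<forall>D\<in>Obj C. \<forall>f\<in>Arr C A B. \<forall>g\<in>Arr C B D. Comp C A B D g f \<in> Arr C A D) \<and>
     (\<forall>A\<in>Obj C. \<forall>B\<in>Obj C. \<forall>f\<in>Arr C A B.
        Comp C A A B f (Ident C A) = f \<and> Comp C A B B (Ident C B) f = f) \<and>
     (\<forall>A\<in>Obj C. \<forall>B\<in>Obj C. \<forall>D\<in>Obj C. \<forall>E\<in>Obj C. \<forall>f\<in>Arr C A B. \<forall>g\<in>Arr C B D. \<forall>h\<in>Arr C D E.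
        Comp C A D E h (Comp C A B D g f) = Comp C A B E (Comp C B D E h g) f)"

definition isomorphism :: "('o, 'a) cat \<Rightarrow> 'o \<Rightarrow> 'o \<Rightarrow> 'a \<Rightarrow> bool" where
  "isomorphism C A B f \<longleftrightarrow> f \<in> Arr C A B \<and>
     (\<exists>g\<in>Arr C B A. Comp C A B A g f = Ident C A \<and> Comp C B A B f g = Ident C B)"

definition full_subcategory :: "('o, 'a) cat \<Rightarrow> ('o \<Rightarrow> bool) \<Rightarrow> ('o, 'a) cat" where
  "full_subcategory C P = C\<lparr>Obj := {A \<in> Obj C. P A}\<rparr>"

definition is_functor ::
    "('o, 'a) cat \<Rightarrow> ('p, 'b) cat \<Rightarrow> ('o \<Rightarrow> 'p) \<Rightarrow> ('o \<Rightarrow> 'o \<Rightarrow> 'a \<Rightarrow> 'b) \<Rightarrow> bool" where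
  "is_functor C D F Fa \<longleftrightarrow> category C \<and> category D \<and>
     (\<forall>A\<in>Obj C. F A \<in> Obj D) \<and>
     (\<forall>A\<in>Obj C. \<forall>B\<in>Obj C. \<forall>f\<in>Arr C A B. Fa A B f \<in> Arr D (F A) (F B)) \<and>
     (\<forall>A\<in>Obj C. Fa A A (Ident C A) = Ident D (F A)) \<and>
     (\<forall>A\<in>Obj C. \<forall>B\<in>Obj C. \<forall>E\<in>Obj C. \<forall>f\<in>Arr C A B. \<forall>g\<in>Arr C B E.
        Fa A E (Comp C A B E g f) = Comp D (F A) (F B) (F E) (Fa B E g) (Fa A B f))"

definition natural_isomorphism ::
    "('o, 'a) cat \<Rightarrow> ('p, 'b) cat \<Rightarrow> ('o \<Rightarrow> 'p) \<Rightarrow> ('o \<Rightarrow> 'o \<Rightarrow> 'a \<Rightarrow> 'b) \<Rightarrow>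
     ('o \<Rightarrow> 'p) \<Rightarrow> ('o \<Rightarrow> 'o \<Rightarrow> 'a \<Rightarrow> 'b) \<Rightarrow> ('o \<Rightarrow> 'b) \<Rightarrow> bool" where
  "natural_isomorphism C D F Fa G Ga \<eta> \<longleftrightarrow>
     (\<forall>A\<in>Obj C. isomorphism D (F A) (G A) (\<eta> A)) \<and>
     (\<forall>A\<in>Obj C. \<forall>B\<in>Obj C. \<forall>f\<in>Arr C A B.
        Comp D (F A) (F B) (G B) (\<eta> B) (Fa A B f) = Comp D (F A) (G A) (G B) (Ga A B f) (\<eta> A))"

definition equivalence_with_inverse ::
    "('o, 'a) cat \<Rightarrow> ('p, 'b) cat \<Rightarrow> ('o \<Rightarrow> 'p) \<Rightarrow> ('o \<Rightarrow> 'o \<Rightarrow> 'a \<Rightarrow> 'b) \<Rightarrow>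
     ('p \<Rightarrow> 'o) \<Rightarrow> ('p \<Rightarrow> 'p \<Rightarrow> 'b \<Rightarrow> 'a) \<Rightarrow> bool" where
  "equivalence_with_inverse C D F Fa G Ga \<longleftrightarrow>
     is_functor C D F Fa \<and> is_functor D C G Ga \<and>
     (\<exists>\<eta>. natural_isomorphism C C (\<lambda>A. A) (\<lambda>A B f. f)
            (\<lambda>A. G (F A)) (\<lambda>A B f. Ga (F A) (F B) (Fa A B f)) \<eta>) \<and>
     (\<exists>\<epsilon>. natural_isomorphism D D (\<lambda>X. F (G X)) (\<lambda>X Y f. Fa (G X) (G Y) (Ga X Y f))
            (\<lambda>X. X) (\<lambda>X Y f. f) \<epsilon>)"


section \<open>Topological abelian groups\<close>

record 'a topgroup = "'a monoid" +
  topo :: "'a topology"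

definition topological_ab_group :: "('a, 'x) topgroup_scheme \<Rightarrow> bool" where
  "topological_ab_group V \<longleftrightarrow> comm_group V \<and> topspace (topo V) = carrier V \<and>
     continuous_map (prod_topology (topo V) (topo V)) (topo V) (\<lambda>(x, y). x \<otimes>\<^bsub>V\<^esub> y) \<and>
     continuous_map (topo V) (topo V) (\<lambda>x. inv\<^bsub>V\<^esub> x)"

definition cmaps :: "'a topology \<Rightarrow> 'b topology \<Rightarrow> ('a \<Rightarrow> 'b) set" where
  "cmaps S T = {f \<in> extensional (topspace S). continuous_map S T f}"

text \<open>
  The Markov free topological abelian group: the free abelian group on the points, with the
  finest group topology making the inclusion of the space continuous. Its universal property
  is \<open>free_tag_universal\<close> below.
\<close>

definition free_group_with :: "'a topology \<Rightarrow> ('a \<Rightarrow>\<^sub>0 int) topology \<Rightarrow> ('a \<Rightarrow>\<^sub>0 int) topgroup" where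
  "free_group_with S T = \<lparr>carrier = carrier (free_Abelian_group (topspace S)),
     monoid.mult = monoid.mult (free_Abelian_group (topspace S)),
     one = one (free_Abelian_group (topspace S)),
     topo = T\<rparr>"

definition free_group_topologies :: "'a topology \<Rightarrow> ('a \<Rightarrow>\<^sub>0 int) topology set" where
  "free_group_topologies S =
     {T. topological_ab_group (free_group_with S T) \<and> continuous_map S T frag_of}"

definition free_tag :: "'a topology \<Rightarrow> ('a \<Rightarrow>\<^sub>0 int) topgroup" where
  "free_tag S = free_group_with S
     (topology_generated_by (\<Union>T\<in>free_group_topologies S. {U. openin T U}))"

lemma comm_group_free_group_with: "comm_group (free_group_with S T)"
proof (rule comm_groupI)
  fix x assume "x \<in> carrier (free_group_with S T)"
  then show "\<exists>y\<in>carrier (free_group_with S T). y \<otimes>\<^bsub>free_group_with S T\<^esub> x = \<one>\<^bsub>free_group_with S T\<^esub>"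
    by (intro bexI[of _ "- x"]) (auto simp: free_group_with_def free_Abelian_group_def)
qed (auto simp: free_group_with_def free_Abelian_group_def algebra_simps
    dest!: subsetD[OF Poly_Mapping.keys_add])

lemma inv_free_group_with:
  assumes "x \<in> carrier (free_group_with S T)"
  shows "inv\<^bsub>free_group_with S T\<^esub> x = - x"
proof -
  interpret comm_group "free_group_with S T"
    by (rule comm_group_free_group_with)
  show ?thesis
    by (rule inv_equality) (use assms in \<open>auto simp: free_group_with_def free_Abelian_group_def\<close>)
qed

lemma hom_free_group_with:
  "hom (free_group_with S T) V = hom (free_Abelian_group (topspace S)) V"
  by (simp add: hom_def free_group_with_def)

lemma topological_ab_group_pullback:
  fixes V :: "('a, 'x) topgroup_scheme"
  assumes V: "topological_ab_group V" and h: "h \<in> hom (free_Abelian_group (topspace S)) V"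
  shows "topological_ab_group (free_group_with S
    (pullback_topology (carrier (free_Abelian_group (topspace S))) h (topo V)))"
    (is "topological_ab_group (free_group_with S ?T)")
proof -
  let ?F = "free_group_with S ?T"
  have hF: "h \<in> hom ?F V"
    using h by (simp add: hom_free_group_with)
  interpret F: comm_group ?F
    by (rule comm_group_free_group_with)
  interpret V: comm_group V
    using V by (simp add: topological_ab_group_def)
  interpret h: group_hom ?F V h
    using hF by unfold_locales
  have [simp]: "topo ?F = ?T" "carrier ?F = carrier (free_Abelian_group (topspace S))"
    by (auto simp: free_group_with_def)
  have tV: "topspace (topo V) = carrier V"
    using V by (simp add: topological_ab_group_def)
  have tT: "topspace ?T = carrier ?F"
    using h.hom_closed by (auto simp: topspace_pullback_topology tV)
  have hc: "continuous_map ?T (topo V) h"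
    using continuous_map_pullback[OF continuous_map_id[of "topo V"],
        of "carrier (free_Abelian_group (topspace S))" h] by simp
  have "continuous_map (prod_topology ?T ?T) ?T (\<lambda>(x, y). x \<otimes>\<^bsub>?F\<^esub> y)"
  proof (rule continuous_map_pullback')
    have "continuous_map (prod_topology ?T ?T) (topo V) ((\<lambda>(x, y). x \<otimes>\<^bsub>V\<^esub> y) \<circ> (\<lambda>(x, y). (h x, h y)))"
    proof (rule continuous_map_compose)
      show "continuous_map (prod_topology ?T ?T) (prod_topology (topo V) (topo V)) (\<lambda>(x, y). (h x, h y))"
        using hc by (simp add: continuous_map_prod_top)
    qed (use V in \<open>simp add: topological_ab_group_def\<close>)
    then show "continuous_map (prod_topology ?T ?T) (topo V) (h \<circ> (\<lambda>(x, y). x \<otimes>\<^bsub>?F\<^esub> y))"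
      by (rule continuous_map_eq) (use tT h.hom_mult in auto)
    show "topspace (prod_topology ?T ?T) \<subseteq> (\<lambda>(x, y). x \<otimes>\<^bsub>?F\<^esub> y) -` carrier (free_Abelian_group (topspace S))"
      using tT F.m_closed by auto
  qed
  moreover have "continuous_map ?T ?T (\<lambda>x. inv\<^bsub>?F\<^esub> x)"
  proof (rule continuous_map_pullback')
    have "continuous_map ?T (topo V) ((\<lambda>x. inv\<^bsub>V\<^esub> x) \<circ> h)"
      using hc V by (intro continuous_map_compose) (auto simp: topological_ab_group_def)
    then show "continuous_map ?T (topo V) (h \<circ> (\<lambda>x. inv\<^bsub>?F\<^esub> x))"
      by (rule continuous_map_eq) (use tT h.hom_inv in auto)
    show "topspace ?T \<subseteq> (\<lambda>x. inv\<^bsub>?F\<^esub> x) -` carrier (free_Abelian_group (topspace S))"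
      using tT F.inv_closed by auto
  qed
  ultimately show ?thesis
    using tT F.comm_group_axioms by (simp add: topological_ab_group_def)
qed

lemma pullback_in_free_group_topologies:
  assumes V: "topological_ab_group V" and h: "h \<in> hom (free_Abelian_group (topspace S)) V"
    and "continuous_map S (topo V) (\<lambda>s. h (frag_of s))"
  shows "pullback_topology (carrier (free_Abelian_group (topspace S))) h (topo V)
    \<in> free_group_topologies S"
  unfolding free_group_topologies_def
  using topological_ab_group_pullback[OF V h] assms(3)
  by (auto simp: o_def intro!: continuous_map_pullback')

lemma topspace_free_group_topologies:
  "T \<in> free_group_topologies S \<Longrightarrow> topspace T = carrier (free_Abelian_group (topspace S))"
  by (auto simp: free_group_topologies_def topological_ab_group_def free_group_with_def)

lemma carrier_free_tag: "carrier (free_tag S) = carrier (free_Abelian_group (topspace S))"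
  by (simp add: free_tag_def free_group_with_def)

lemma topspace_free_tag: "topspace (topo (free_tag S)) = carrier (free_tag S)"
proof -
  let ?V = "\<lparr>carrier = UNIV, monoid.mult = (\<lambda>_ _. ()), one = (), topo = discrete_topology UNIV\<rparr>"
  have "topological_ab_group ?V"
    by (auto simp: topological_ab_group_def intro!: comm_groupI
        simp flip: prod_topology_discrete_topology)
  then have "pullback_topology (carrier (free_Abelian_group (topspace S))) (\<lambda>_. ()) (topo ?V)
      \<in> free_group_topologies S"
    by (rule pullback_in_free_group_topologies) (auto simp: hom_def)
  then have ne: "free_group_topologies S \<noteq> {}"
    by blast
  show ?thesis (is "?L = ?R")
  proof
    show "?L \<subseteq> ?R"
      using topspace_free_group_topologies
      by (fastforce simp: free_tag_def free_group_with_def dest: openin_subset)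
    show "?R \<subseteq> ?L"
      using ne topspace_free_group_topologies
      by (fastforce simp: free_tag_def free_group_with_def)
  qed
qed

lemma openin_free_tag:
  "\<lbrakk>T \<in> free_group_topologies S; openin T U\<rbrakk> \<Longrightarrow> openin (topo (free_tag S)) U"
  by (auto simp: free_tag_def free_group_with_def intro!: topology_generated_by_Basis)

lemma continuous_map_free_tag_id:
  "T \<in> free_group_topologies S \<Longrightarrow> continuous_map (topo (free_tag S)) T (\<lambda>x. x)"
  unfolding continuous_map_alt
proof (intro conjI allI impI)
  assume T: "T \<in> free_group_topologies S"
  fix U assume "openin T U"
  then show "openin (topo (free_tag S)) ((\<lambda>x. x) -` U \<inter> topspace (topo (free_tag S)))"
    using openin_free_tag[OF T, of U] by auto
qed (simp add: topspace_free_tag carrier_free_tag topspace_free_group_topologies)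

lemma continuous_map_into_free_tag:
  assumes "\<And>T. T \<in> free_group_topologies S \<Longrightarrow> continuous_map Y T f"
    and "f ` topspace Y \<subseteq> carrier (free_tag S)"
  shows "continuous_map Y (topo (free_tag S)) f"
proof -
  let ?B = "\<Union>T\<in>free_group_topologies S. {U. openin T U}"
  have eq: "topo (free_tag S) = topology_generated_by ?B"
    by (simp add: free_tag_def free_group_with_def)
  have "continuous_map Y (topology_generated_by ?B) f"
  proof (rule continuous_on_generated_topo)
    show "openin Y (f -` U \<inter> topspace Y)" if "U \<in> ?B" for U
      using that assms(1) by (auto simp: continuous_map_alt)
    show "f ` topspace Y \<subseteq> \<Union> ?B"
      using assms(2) topspace_free_tag[of S] by (simp add: eq)
  qed
  then show ?thesis
    by (simp add: eq)
qed

theorem free_tag_universal: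
  "topological_ab_group (free_tag S)"
  "continuous_map S (topo (free_tag S)) frag_of"
  "\<lbrakk>topological_ab_group V; continuous_map S (topo V) f\<rbrakk> \<Longrightarrow>
     \<exists>!h. h \<in> hom (free_tag S) V \<inter> extensional (carrier (free_tag S)) \<and>
       continuous_map (topo (free_tag S)) (topo V) h \<and> (\<forall>s\<in>topspace S. h (frag_of s) = f s)"
proof -
  let ?F = "free_tag S"
  let ?T = "topo ?F"
  interpret F: comm_group ?F
    by (simp add: free_tag_def comm_group_free_group_with)
  have mult: "x \<otimes>\<^bsub>?F\<^esub> y = x + y" for x y
    by (simp add: free_tag_def free_group_with_def)
  have inverse: "inv\<^bsub>?F\<^esub> x = - x" if "x \<in> carrier ?F" for x
    using that by (simp add: free_tag_def inv_free_group_with)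
  show "topological_ab_group ?F"
    unfolding topological_ab_group_def
  proof (intro conjI)
    show "comm_group ?F" ..
    show "topspace ?T = carrier ?F"
      by (rule topspace_free_tag)
    show "continuous_map (prod_topology ?T ?T) ?T (\<lambda>(x, y). x \<otimes>\<^bsub>?F\<^esub> y)"
    proof (rule continuous_map_into_free_tag)
      fix T assume T: "T \<in> free_group_topologies S"
      then have "continuous_map (prod_topology T T) T (\<lambda>(x, y). x + y)"
        by (simp add: free_group_topologies_def topological_ab_group_def free_group_with_def)
      moreover have "continuous_map (prod_topology ?T ?T) (prod_topology T T) (\<lambda>(x, y). (x, y))"
        using continuous_map_free_tag_id[OF T] continuous_map_prod_top[of ?T ?T T T "\<lambda>x. x" "\<lambda>x. x"]
        by simp
      ultimately have "continuous_map (prod_topology ?T ?T) T ((\<lambda>(x, y). x + y) \<circ> (\<lambda>(x, y). (x, y)))"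
        by (rule continuous_map_compose[rotated])
      then show "continuous_map (prod_topology ?T ?T) T (\<lambda>(x, y). x \<otimes>\<^bsub>?F\<^esub> y)"
        by (simp add: mult o_def)
    qed (auto simp: topspace_free_tag)
    show "continuous_map ?T ?T (\<lambda>x. inv\<^bsub>?F\<^esub> x)"
    proof (rule continuous_map_into_free_tag)
      fix T assume T: "T \<in> free_group_topologies S"
      then have "continuous_map T T (\<lambda>x. inv\<^bsub>free_group_with S T\<^esub> x)"
        by (simp add: free_group_topologies_def topological_ab_group_def free_group_with_def)
      then have "continuous_map ?T T ((\<lambda>x. inv\<^bsub>free_group_with S T\<^esub> x) \<circ> (\<lambda>x. x))"
        by (rule continuous_map_compose[OF continuous_map_free_tag_id[OF T]])
      then show "continuous_map ?T T (\<lambda>x. inv\<^bsub>?F\<^esub> x)"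
        by (rule continuous_map_eq)
          (simp add: topspace_free_tag inverse, subst inv_free_group_with,
           simp_all add: carrier_free_tag, simp add: free_group_with_def)
    qed (auto simp: topspace_free_tag)
  qed
  show "continuous_map S ?T frag_of"
    by (rule continuous_map_into_free_tag) (auto simp: free_group_topologies_def carrier_free_tag)
  assume V: "topological_ab_group V" and f: "continuous_map S (topo V) f"
  interpret V: comm_group V
    using V by (simp add: topological_ab_group_def)
  have hom_eq: "hom ?F V = hom (free_Abelian_group (topspace S)) V"
    by (simp add: free_tag_def hom_free_group_with)
  have "f ` topspace S \<subseteq> carrier V"
    using V f by (auto simp: topological_ab_group_def dest: continuous_map_image_subset_topspace)
  then obtain h where h: "h \<in> hom (free_Abelian_group (topspace S)) V"
      and hf: "\<And>s. s \<in> topspace S \<Longrightarrow> h (frag_of s) = f s"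
    using V.free_Abelian_group_universal by blast
  have "continuous_map S (topo V) (\<lambda>s. h (frag_of s))"
    using f by (rule continuous_map_eq) (simp add: hf)
  note pb = pullback_in_free_group_topologies[OF V h this]
  have "continuous_map ?T (topo V) (h \<circ> (\<lambda>x. x))"
    by (rule continuous_map_compose[OF continuous_map_free_tag_id[OF pb]])
      (use continuous_map_pullback[OF continuous_map_id[of "topo V"],
        of "carrier (free_Abelian_group (topspace S))" h] in simp)
  then have hc: "continuous_map ?T (topo V) (restrict h (carrier ?F))"
    by (rule continuous_map_eq) (simp add: topspace_free_tag)
  show "\<exists>!h. h \<in> hom ?F V \<inter> extensional (carrier ?F) \<and>
      continuous_map ?T (topo V) h \<and> (\<forall>s\<in>topspace S. h (frag_of s) = f s)"
  proof (rule ex1I[of _ "restrict h (carrier ?F)"])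
    show "restrict h (carrier ?F) \<in> hom ?F V \<inter> extensional (carrier ?F) \<and>
        continuous_map ?T (topo V) (restrict h (carrier ?F)) \<and>
        (\<forall>s\<in>topspace S. restrict h (carrier ?F) (frag_of s) = f s)"
    proof (intro conjI ballI)
      show "restrict h (carrier ?F) \<in> hom ?F V \<inter> extensional (carrier ?F)"
        using h F.m_closed unfolding hom_eq[symmetric] by (auto simp: hom_def)
      show "restrict h (carrier ?F) (frag_of s) = f s" if "s \<in> topspace S" for s
        using that hf by (simp add: carrier_free_tag)
    qed (rule hc)
  next
    fix g assume g: "g \<in> hom ?F V \<inter> extensional (carrier ?F) \<and>
      continuous_map ?T (topo V) g \<and> (\<forall>s\<in>topspace S. g (frag_of s) = f s)"
    interpret A: group "free_Abelian_group (topspace S)"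
      by simp
    interpret g: group_hom "free_Abelian_group (topspace S)" V g
      using g by unfold_locales (simp add: hom_eq)
    interpret h: group_hom "free_Abelian_group (topspace S)" V h
      using h by unfold_locales
    have eq: "g x = h x" if "Poly_Mapping.keys x \<subseteq> topspace S" for x
    proof (rule free_Abelian_group_induct[OF that])
      show "g 0 = h 0"
        using g.hom_one h.hom_one by simp
    next
      fix x y assume *: "Poly_Mapping.keys x \<subseteq> topspace S" "Poly_Mapping.keys y \<subseteq> topspace S"
        "g x = h x" "g y = h y"
      have "g (x - y) = g x \<otimes>\<^bsub>V\<^esub> inv\<^bsub>V\<^esub> g y"
        using * g.hom_mult[of x "- y"] g.hom_inv[of y] by simp
      moreover have "h (x - y) = h x \<otimes>\<^bsub>V\<^esub> inv\<^bsub>V\<^esub> h y"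
        using * h.hom_mult[of x "- y"] h.hom_inv[of y] by simp
      ultimately show "g (x - y) = h (x - y)"
        using * by simp
    qed (use g hf in auto)
    show "g = restrict h (carrier ?F)"
    proof
      fix x show "g x = restrict h (carrier ?F) x"
        using g eq[of x] by (auto simp: carrier_free_tag extensional_def)
    qed
  qed
qed

definition free_tag_map :: "'a topology \<Rightarrow> ('a \<Rightarrow> 'b) \<Rightarrow> ('a \<Rightarrow>\<^sub>0 int) \<Rightarrow> ('b \<Rightarrow>\<^sub>0 int)" where
  "free_tag_map S f = (\<lambda>x\<in>carrier (free_tag S). frag_extend (\<lambda>s. frag_of (f s)) x)"

definition dual_carrier :: "('a, 'x) topgroup_scheme \<Rightarrow> ('a \<Rightarrow> int) set" where
  "dual_carrier V = {\<phi> \<in> hom V integer_group \<inter> extensional (carrier V).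
     continuous_map (topo V) (discrete_topology UNIV) \<phi>}"

definition dual :: "('a, 'x) topgroup_scheme \<Rightarrow> ('a \<Rightarrow> int) topgroup" where
  "dual V = \<lparr>carrier = dual_carrier V,
     monoid.mult = (\<lambda>\<phi> \<psi>. \<lambda>x\<in>carrier V. \<phi> x + \<psi> x),
     one = (\<lambda>x\<in>carrier V. 0),
     topo = topology_generated_by
       {{\<phi> \<in> dual_carrier V. \<phi> ` K \<subseteq> U} | K U. compactin (topo V) K}\<rparr>"

definition dual_map ::
    "('a, 'x) topgroup_scheme \<Rightarrow> ('b, 'y) topgroup_scheme \<Rightarrow> ('a \<Rightarrow> 'b) \<Rightarrow> ('b \<Rightarrow> int) \<Rightarrow> ('a \<Rightarrow> int)" where
  "dual_map V W h = (\<lambda>\<phi>\<in>carrier (dual W). compose (carrier V) \<phi> h)"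

definition bidual_free :: "'a topology \<Rightarrow> ((('a \<Rightarrow>\<^sub>0 int) \<Rightarrow> int) \<Rightarrow> int) topgroup" where
  "bidual_free S = dual (dual (free_tag S))"

definition bidual_free_map ::
    "'a topology \<Rightarrow> 'b topology \<Rightarrow> ('a \<Rightarrow> 'b) \<Rightarrow>
     ((('a \<Rightarrow>\<^sub>0 int) \<Rightarrow> int) \<Rightarrow> int) \<Rightarrow> ((('b \<Rightarrow>\<^sub>0 int) \<Rightarrow> int) \<Rightarrow> int)" where
  "bidual_free_map S T f = dual_map (dual (free_tag T)) (dual (free_tag S))
     (dual_map (free_tag S) (free_tag T) (free_tag_map S f))"


section \<open>Modules over column-finite integer matrices\<close>

type_synonym matrix = "nat \<Rightarrow> nat \<Rightarrow> int"

definition matrix_ring :: "matrix ring" where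
  "matrix_ring = \<lparr>carrier = {c. \<forall>n. finite {k. c k n \<noteq> 0}},
     monoid.mult = (\<lambda>c d k n. \<Sum>m | d m n \<noteq> 0. c k m * d m n),
     one = (\<lambda>k n. if k = n then 1 else 0),
     ring.zero = (\<lambda>k n. 0),
     add = (\<lambda>c d k n. c k n + d k n)\<rparr>"

text \<open>The modules of \<open>HOL-Algebra\<close> are over commutative rings only.\<close>

record ('r, 'm) lmodule = "'m monoid" +
  act :: "'r \<Rightarrow> 'm \<Rightarrow> 'm"

definition left_module :: "('r, 'x) ring_scheme \<Rightarrow> ('r, 'm) lmodule \<Rightarrow> bool" where
  "left_module R M \<longleftrightarrow> comm_group M \<and>
     (\<forall>r\<in>carrier R. \<forall>x\<in>carrier M. act M r x \<in> carrier M) \<and>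
     (\<forall>r\<in>carrier R. \<forall>x\<in>carrier M. \<forall>y\<in>carrier M.
        act M r (x \<otimes>\<^bsub>M\<^esub> y) = act M r x \<otimes>\<^bsub>M\<^esub> act M r y) \<and>
     (\<forall>r\<in>carrier R. \<forall>s\<in>carrier R. \<forall>x\<in>carrier M.
        act M (r \<oplus>\<^bsub>R\<^esub> s) x = act M r x \<otimes>\<^bsub>M\<^esub> act M s x) \<and>
     (\<forall>r\<in>carrier R. \<forall>s\<in>carrier R. \<forall>x\<in>carrier M. act M (r \<otimes>\<^bsub>R\<^esub> s) x = act M r (act M s x)) \<and>
     (\<forall>x\<in>carrier M. act M \<one>\<^bsub>R\<^esub> x = x)"

definition module_homs ::
    "('r, 'x) ring_scheme \<Rightarrow> ('r, 'm) lmodule \<Rightarrow> ('r, 'n) lmodule \<Rightarrow> ('m \<Rightarrow> 'n) set" where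
  "module_homs R M N = {h \<in> hom M N \<inter> extensional (carrier M).
     \<forall>r\<in>carrier R. \<forall>x\<in>carrier M. h (act M r x) = act N r (h x)}"

definition left_modules :: "('r, 'x) ring_scheme \<Rightarrow> (('r, 'm) lmodule, 'm \<Rightarrow> 'm) cat" where
  "left_modules R = \<lparr>Obj = {M. left_module R M},
     Arr = module_homs R,
     Comp = (\<lambda>L M N g f. compose (carrier L) g f),
     Ident = (\<lambda>M. \<lambda>x\<in>carrier M. x)\<rparr>"

definition group_sums :: "('a, 'x) topgroup_scheme \<Rightarrow> (nat \<Rightarrow> 'a) \<Rightarrow> 'a \<Rightarrow> bool" where
  "group_sums V s l \<longleftrightarrow> limitin (topo V) (\<lambda>N. finprod V s {..<N}) l sequentially"

definition null_sequences :: "('a, 'x) topgroup_scheme \<Rightarrow> (matrix, nat \<Rightarrow> 'a) lmodule" where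
  "null_sequences V =
     \<lparr>carrier = {s. (\<forall>n. s n \<in> carrier V) \<and> limitin (topo V) s \<one>\<^bsub>V\<^esub> sequentially},
      monoid.mult = (\<lambda>s t n. s n \<otimes>\<^bsub>V\<^esub> t n),
      one = (\<lambda>n. \<one>\<^bsub>V\<^esub>),
      act = (\<lambda>c s k. THE l. group_sums V (\<lambda>n. s n [^]\<^bsub>V\<^esub> c k n) l)\<rparr>"

definition null_sequences_map ::
    "('a, 'x) topgroup_scheme \<Rightarrow> ('a \<Rightarrow> 'b) \<Rightarrow> (nat \<Rightarrow> 'a) \<Rightarrow> (nat \<Rightarrow> 'b)" where
  "null_sequences_map V h = (\<lambda>s\<in>carrier (null_sequences V). \<lambda>n. h (s n))"


section \<open>Light condensed abelian groups\<close>

text \<open>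
  Metrizable compact spaces have at most the cardinality of the continuum, so up to
  homeomorphism all metrizable Stone spaces are topologies on (subsets of) the following type.
\<close>

type_synonym point = "nat \<Rightarrow> bool"

definition totally_disconnected_space :: "'a topology \<Rightarrow> bool" where
  "totally_disconnected_space X \<longleftrightarrow> (\<forall>C. connectedin X C \<longrightarrow> (\<exists>a. C \<subseteq> {a}))"

definition metrizable_Stone :: "'a topology \<Rightarrow> bool" where
  "metrizable_Stone X \<longleftrightarrow> compact_space X \<and> totally_disconnected_space X \<and> metrizable_space X"

definition MStone :: "point topology set" where
  "MStone = {X. metrizable_Stone X}"

record 'u presheaf =
  sect :: "point topology \<Rightarrow> 'u monoid"
  res :: "point topology \<Rightarrow> point topology \<Rightarrow> (point \<Rightarrow> point) \<Rightarrow> 'u \<Rightarrow> 'u"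
    \<comment> \<open>\<open>res A S T f\<close> goes from \<open>sect A T\<close> to \<open>sect A S\<close> for \<open>f : S \<rightarrow> T\<close>\<close>

definition ab_presheaf :: "'u presheaf \<Rightarrow> bool" where
  "ab_presheaf A \<longleftrightarrow>
     (\<forall>S\<in>MStone. comm_group (sect A S)) \<and>
     (\<forall>S\<in>MStone. \<forall>T\<in>MStone. \<forall>f\<in>cmaps S T. res A S T f \<in> hom (sect A T) (sect A S)) \<and>
     (\<forall>S\<in>MStone. \<forall>x\<in>carrier (sect A S). res A S S (\<lambda>p\<in>topspace S. p) x = x) \<and>
     (\<forall>S\<in>MStone. \<forall>T\<in>MStone. \<forall>U\<in>MStone. \<forall>f\<in>cmaps S T. \<forall>g\<in>cmaps T U. \<forall>x\<in>carrier (sect A U).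
        res A S U (compose (topspace S) g f) x = res A S T f (res A T U g x))"

definition covering :: "nat \<Rightarrow> (nat \<Rightarrow> point topology) \<Rightarrow> (nat \<Rightarrow> point \<Rightarrow> point) \<Rightarrow> point topology \<Rightarrow> bool" where
  "covering n T f S \<longleftrightarrow> (\<forall>i<n. T i \<in> MStone \<and> f i \<in> cmaps (T i) S) \<and>
     topspace S = (\<Union>i<n. f i ` topspace (T i))"

definition matching_family ::
    "'u presheaf \<Rightarrow> nat \<Rightarrow> (nat \<Rightarrow> point topology) \<Rightarrow> (nat \<Rightarrow> point \<Rightarrow> point) \<Rightarrow> (nat \<Rightarrow> 'u) \<Rightarrow> bool" where
  "matching_family A n T f x \<longleftrightarrow> (\<forall>i<n. x i \<in> carrier (sect A (T i))) \<and>
     (\<forall>i<n. \<forall>j<n. \<forall>U\<in>MStone. \<forall>g\<in>cmaps U (T i). \<forall>h\<in>cmaps U (T j).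
        (\<forall>p\<in>topspace U. f i (g p) = f j (h p)) \<longrightarrow> res A U (T i) g (x i) = res A U (T j) h (x j))"

definition light_condensed :: "'u presheaf \<Rightarrow> bool" where
  "light_condensed A \<longleftrightarrow> ab_presheaf A \<and>
     (\<forall>S\<in>MStone. \<forall>n T f x. covering n T f S \<longrightarrow> matching_family A n T f x \<longrightarrow>
        (\<exists>!s. s \<in> carrier (sect A S) \<and> (\<forall>i<n. res A (T i) S (f i) s = x i)))"

definition presheaf_homs :: "'u presheaf \<Rightarrow> 'v presheaf \<Rightarrow> (point topology \<Rightarrow> 'u \<Rightarrow> 'v) set" where
  "presheaf_homs A B = {\<phi> \<in> extensional MStone.
     (\<forall>S\<in>MStone. \<phi> S \<in> hom (sect A S) (sect B S) \<inter> extensional (carrier (sect A S))) \<and>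
     (\<forall>S\<in>MStone. \<forall>T\<in>MStone. \<forall>f\<in>cmaps S T. \<forall>x\<in>carrier (sect A T).
        \<phi> S (res A S T f x) = res B S T f (\<phi> T x))}"

definition light_condensed_groups :: "('u presheaf, point topology \<Rightarrow> 'u \<Rightarrow> 'u) cat" where
  "light_condensed_groups = \<lparr>Obj = {A. light_condensed A},
     Arr = presheaf_homs,
     Comp = (\<lambda>A B D \<psi> \<phi>. \<lambda>S\<in>MStone. compose (carrier (sect A S)) (\<psi> S) (\<phi> S)),
     Ident = (\<lambda>A. \<lambda>S\<in>MStone. \<lambda>x\<in>carrier (sect A S). x)\<rparr>"

definition underlying_condensed :: "('a, 'x) topgroup_scheme \<Rightarrow> (point \<Rightarrow> 'a) presheaf" where
  "underlying_condensed V =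
     \<lparr>sect = (\<lambda>S. \<lparr>carrier = cmaps S (topo V),
        monoid.mult = (\<lambda>f g. \<lambda>p\<in>topspace S. f p \<otimes>\<^bsub>V\<^esub> g p),
        one = (\<lambda>p\<in>topspace S. \<one>\<^bsub>V\<^esub>)\<rparr>),
      res = (\<lambda>S T f g. compose (topspace S) g f)\<rparr>"


section \<open>Solid abelian groups\<close>

text \<open>The one-point compactification of the discrete space of naturals; \<open>None\<close> is infinity.\<close>

definition Nbar :: "nat option topology" where
  "Nbar = Alexandroff_compactification (discrete_topology UNIV)"

text \<open>
  The product of a space with \<open>Nbar\<close>, as a topology on points: the product topology
  transported along the injection \<open>pair_point\<close>.
\<close>

definition pair_point :: "point \<times> nat option \<Rightarrow> point" where
  "pair_point = (\<lambda>(p, a) k. if even k then p (k div 2) else a = Some (k div 2))"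

lemma inj_pair_point: "inj pair_point"
proof (rule injI, clarify)
  fix p q :: point and a b :: "nat option"
  assume eq: "pair_point (p, a) = pair_point (q, b)"
  have "p = q"
  proof
    show "p k = q k" for k
      using fun_cong[OF eq, of "2 * k"] by (simp add: pair_point_def)
  qed
  moreover have *: "a = Some k \<longleftrightarrow> b = Some k" for k
    using fun_cong[OF eq, of "2 * k + 1"] by (simp add: pair_point_def)
  have "a = b"
    using *[of "the a"] *[of "the b"] by (cases a; cases b) simp_all
  ultimately show "p = q \<and> a = b" ..
qed

definition unpair_point :: "point \<Rightarrow> point \<times> nat option" where
  "unpair_point = inv_into UNIV pair_point"

lemma unpair_pair_point [simp]: "unpair_point (pair_point z) = z"
  by (simp add: unpair_point_def inj_pair_point)

definition times_Nbar :: "point topology \<Rightarrow> point topology" where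
  "times_Nbar S = pullback_topology (pair_point ` topspace (prod_topology S Nbar)) unpair_point
     (prod_topology S Nbar)"

lemma homeomorphic_map_pair_point:
  "homeomorphic_map (prod_topology S Nbar) (times_Nbar S) pair_point"
proof -
  have "homeomorphic_maps (prod_topology S Nbar) (times_Nbar S) pair_point unpair_point"
    unfolding homeomorphic_maps_def
  proof (intro conjI)
    show "continuous_map (prod_topology S Nbar) (times_Nbar S) pair_point"
      unfolding times_Nbar_def
    proof (rule continuous_map_pullback')
      show "continuous_map (prod_topology S Nbar) (prod_topology S Nbar) (unpair_point \<circ> pair_point)"
        by (simp add: o_def)
    qed blast
    show "continuous_map (times_Nbar S) (prod_topology S Nbar) unpair_point"
      unfolding times_Nbar_def
      using continuous_map_pullback[OF continuous_map_id[of "prod_topology S Nbar"],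
          of "pair_point ` topspace (prod_topology S Nbar)" unpair_point] by simp
  qed (auto simp: times_Nbar_def topspace_pullback_topology)
  then show ?thesis
    using homeomorphic_maps_map by blast
qed

definition at_infinity :: "point topology \<Rightarrow> point \<Rightarrow> point" where
  "at_infinity S = (\<lambda>p\<in>topspace S. pair_point (p, None))"

definition times_Nbar_map :: "point topology \<Rightarrow> (point \<Rightarrow> point) \<Rightarrow> (nat option \<Rightarrow> nat option) \<Rightarrow> point \<Rightarrow> point" where
  "times_Nbar_map S f g = (\<lambda>q\<in>topspace (times_Nbar S). pair_point (map_prod f g (unpair_point q)))"

definition null_condensed :: "'u presheaf \<Rightarrow> 'u presheaf" where
  "null_condensed A =
     \<lparr>sect = (\<lambda>S. (sect A (times_Nbar S))
        \<lparr>carrier := kernel (sect A (times_Nbar S)) (sect A S) (res A S (times_Nbar S) (at_infinity S))\<rparr>),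
      res = (\<lambda>S T f. res A (times_Nbar S) (times_Nbar T) (times_Nbar_map S f id))\<rparr>"

definition shift :: "'u presheaf \<Rightarrow> point topology \<Rightarrow> 'u \<Rightarrow> 'u" where
  "shift A = (\<lambda>S\<in>MStone. \<lambda>x\<in>carrier (sect (null_condensed A) S).
     res A (times_Nbar S) (times_Nbar S) (times_Nbar_map S id (map_option Suc)) x)"

definition one_minus_shift :: "'u presheaf \<Rightarrow> point topology \<Rightarrow> 'u \<Rightarrow> 'u" where
  "one_minus_shift A = (\<lambda>S\<in>MStone. \<lambda>x\<in>carrier (sect (null_condensed A) S).
     x \<otimes>\<^bsub>sect (null_condensed A) S\<^esub> inv\<^bsub>sect (null_condensed A) S\<^esub> (shift A S x))"

definition solid :: "'u presheaf \<Rightarrow> bool" where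
  "solid A \<longleftrightarrow> isomorphism light_condensed_groups (null_condensed A) (null_condensed A) (one_minus_shift A)"

definition light_solid_groups :: "('u presheaf, point topology \<Rightarrow> 'u \<Rightarrow> 'u) cat" where
  "light_solid_groups = full_subcategory light_condensed_groups solid"


section \<open>From modules to condensed abelian groups\<close>

definition module_hom_group :: "('r, 'x) ring_scheme \<Rightarrow> ('r, 'm) lmodule \<Rightarrow> ('r, 'n) lmodule \<Rightarrow> ('m \<Rightarrow> 'n) monoid" where
  "module_hom_group R M N = \<lparr>carrier = module_homs R M N,
     monoid.mult = (\<lambda>g h. \<lambda>x\<in>carrier M. g x \<otimes>\<^bsub>N\<^esub> h x),
     one = (\<lambda>x\<in>carrier M. \<one>\<^bsub>N\<^esub>)\<rparr>"

type_synonym bidual_seq = "nat \<Rightarrow> ((point \<Rightarrow>\<^sub>0 int) \<Rightarrow> int) \<Rightarrow> int"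

text \<open>
  The modules and condensed groups of the equivalence have their elements in one type \<open>'u\<close>,
  the universe. The elements of \<open>Hom(((\<int>\<cdot>S)\<^sup>\<or>\<^sup>\<or>)\<^sub>\<bullet>, M)\<close> are functions
  \<open>bidual_seq \<Rightarrow> 'u\<close>, so the universe must be closed under such functions; an injection
  \<open>code\<close> provides this, and groups of homomorphisms are transported along it. Every type
  \<open>'a\<close> embeds (by constant functions) in the universe \<open>bidual_seq \<Rightarrow> 'a\<close>, see
  \<open>universe_exists\<close>.
\<close>

lemma universe_exists_aux:
  fixes code :: "((nat \<Rightarrow> 'b) \<Rightarrow> (nat \<Rightarrow> 'b) \<Rightarrow> 'a) \<Rightarrow> (nat \<Rightarrow> 'b) \<Rightarrow> 'a"
  assumes code: "\<And>f z. code f z = f (\<lambda>n. z (2 * n)) (\<lambda>n. z (2 * n + 1))"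
  shows "inj code"
proof (rule injI)
  fix f g assume fg: "code f = code g"
  show "f = g"
  proof (rule ext, rule ext)
    fix x y :: "nat \<Rightarrow> 'b"
    define z where "z = (\<lambda>n. if even n then x (n div 2) else y (n div 2))"
    have x: "(\<lambda>n. z (2 * n)) = x"
      by (rule ext) (simp add: z_def)
    have y: "(\<lambda>n. z (2 * n + 1)) = y"
      by (rule ext) (simp add: z_def)
    have "code f z = code g z"
      by (simp only: fg)
    then show "f x y = g x y"
      by (simp only: code x y)
  qed
qed

lemma universe_exists: "\<exists>code :: (bidual_seq \<Rightarrow> (bidual_seq \<Rightarrow> 'a)) \<Rightarrow> (bidual_seq \<Rightarrow> 'a). inj code"
  by (rule exI, rule universe_exists_aux, rule refl)

definition transport_group :: "('a \<Rightarrow> 'b) \<Rightarrow> 'a monoid \<Rightarrow> 'b monoid" where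
  "transport_group code G = \<lparr>carrier = code ` carrier G,
     monoid.mult = (\<lambda>a b. code (inv_into UNIV code a \<otimes>\<^bsub>G\<^esub> inv_into UNIV code b)),
     one = code \<one>\<^bsub>G\<^esub>\<rparr>"

definition transport_map :: "('a \<Rightarrow> 'b) \<Rightarrow> 'a set \<Rightarrow> ('a \<Rightarrow> 'a) \<Rightarrow> 'b \<Rightarrow> 'b" where
  "transport_map code X h = (\<lambda>a\<in>code ` X. code (h (inv_into UNIV code a)))"

definition condensed_homs ::
    "(matrix, 'u) lmodule \<Rightarrow> point topology \<Rightarrow> (bidual_seq \<Rightarrow> 'u) monoid" where
  "condensed_homs M S = module_hom_group matrix_ring (null_sequences (bidual_free S)) M"

definition cond :: "((bidual_seq \<Rightarrow> 'u) \<Rightarrow> 'u) \<Rightarrow> (matrix, 'u) lmodule \<Rightarrow> 'u presheaf" where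
  "cond code M =
     \<lparr>sect = (\<lambda>S. transport_group code (condensed_homs M S)),
      res = (\<lambda>S T f. transport_map code (carrier (condensed_homs M T))
        (\<lambda>\<phi>. compose (carrier (null_sequences (bidual_free S))) \<phi>
          (null_sequences_map (bidual_free S) (bidual_free_map S T f))))\<rparr>"

definition cond_map ::
    "((bidual_seq \<Rightarrow> 'u) \<Rightarrow> 'u) \<Rightarrow> (matrix, 'u) lmodule \<Rightarrow> (matrix, 'u) lmodule \<Rightarrow> ('u \<Rightarrow> 'u) \<Rightarrow>
     point topology \<Rightarrow> 'u \<Rightarrow> 'u" where
  "cond_map code M N h = (\<lambda>S\<in>MStone. transport_map code (carrier (condensed_homs M S))
     (\<lambda>\<phi>. compose (carrier (null_sequences (bidual_free S))) h \<phi>))"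


section \<open>From solid abelian groups to modules\<close>

definition one_point :: "point topology" where
  "one_point = discrete_topology {\<lambda>_. False}"

definition int_power_nat :: "(nat \<Rightarrow> int) topgroup" where
  "int_power_nat = \<lparr>carrier = UNIV, monoid.mult = (\<lambda>v w n. v n + w n), one = (\<lambda>n. 0),
     topo = product_topology (\<lambda>_. discrete_topology UNIV) UNIV\<rparr>"

text \<open>
  The sequence of standard basis vectors, extended by \<open>\<infinity> \<mapsto> 0\<close>, as a continuous map from
  the product of the one-point space with \<open>Nbar\<close>.
\<close>

definition basis_sequence :: "point \<Rightarrow> nat \<Rightarrow> int" where
  "basis_sequence = (\<lambda>q\<in>topspace (times_Nbar one_point). \<lambda>k.
     if snd (unpair_point q) = Some k then 1 else 0)"

definition eval_basis :: "(point topology \<Rightarrow> (point \<Rightarrow> nat \<Rightarrow> int) \<Rightarrow> 'u) \<Rightarrow> 'u" where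
  "eval_basis \<phi> = \<phi> (times_Nbar one_point) basis_sequence"

definition row_times :: "matrix \<Rightarrow> (nat \<Rightarrow> int) \<Rightarrow> (nat \<Rightarrow> int)" where
  "row_times c v = (\<lambda>n. \<Sum>k | c k n \<noteq> 0. v k * c k n)"

definition matrix_act_hom ::
    "matrix \<Rightarrow> (point topology \<Rightarrow> (point \<Rightarrow> nat \<Rightarrow> int) \<Rightarrow> 'u) \<Rightarrow>
     (point topology \<Rightarrow> (point \<Rightarrow> nat \<Rightarrow> int) \<Rightarrow> 'u)" where
  "matrix_act_hom c \<phi> = (\<lambda>S\<in>MStone. \<lambda>g\<in>carrier (sect (underlying_condensed int_power_nat) S).
     \<phi> S (\<lambda>p\<in>topspace S. row_times c (g p)))"

text \<open>
  For solid \<open>A\<close>, \<open>eval_basis\<close> is a bijection from the homomorphisms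
  \<open>underlying_condensed int_power_nat \<rightarrow> A\<close> to the null sequences of \<open>A\<close> over the
  point; the action is transported along it.
\<close>

definition null_module :: "'u presheaf \<Rightarrow> (matrix, 'u) lmodule" where
  "null_module A =
     \<lparr>carrier = carrier (sect (null_condensed A) one_point),
      monoid.mult = monoid.mult (sect (null_condensed A) one_point),
      one = one (sect (null_condensed A) one_point),
      act = (\<lambda>c x. eval_basis (matrix_act_hom c
        (inv_into (presheaf_homs (underlying_condensed int_power_nat) A) eval_basis x)))\<rparr>"

definition null_module_map ::
    "'u presheaf \<Rightarrow> 'u presheaf \<Rightarrow> (point topology \<Rightarrow> 'u \<Rightarrow> 'u) \<Rightarrow> 'u \<Rightarrow> 'u" where
  "null_module_map A B \<phi> = (\<lambda>x\<in>carrier (null_module A). \<phi> (times_Nbar one_point) x)"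

end

theory Submission
  imports Defs "HOL-Library.Function_Algebras"
begin

text \<open>A null sequence in the bidual of the free group on \<open>S\<close> is the same as a homomorphism from
the group \<open>C(S)\<close> of integer-valued continuous functions to the finitely supported integer sequences. A
tree of retractions of \<open>S\<close> onto finite sets yields a dual basis \<open>(iota n, rho n)\<close> of
\<open>C(S)\<close>, so these null sequences form a cyclic module, generated by \<open>rho\<close>. For a
surjection \<open>T \<rightarrow> S\<close> the complex \<open>C(S) \<rightarrow> C(T) \<rightarrow> C(T
\<times>\<^sub>S T) \<rightarrow> C(T \<times>\<^sub>S T \<times>\<^sub>S T)\<close> is exact, and it splits
since subgroups of the group of finitely supported sequences are free; this is the sheaf property of \<open>cond
M\<close>.

In a solid group \<open>A\<close> the inverse of \<open>1 - t\<close> sums null sequences. Hence a null sequence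
\<open>x\<close> can be integrated against a continuous map from \<open>S\<close> to the integer sequences, which
gives a section of \<open>A\<close> over \<open>S\<close>. Integration identifies the null sequences with the
homomorphisms out of \<open>\<int>\<^sup>\<nat>\<close>. The counit of the equivalence sends a homomorphism
\<open>phi\<close> of modules to the integral of \<open>n \<mapsto> iota n\<close> against \<open>phi
rho\<close>. It is surjective since a section over \<open>S\<close> is built from the differences of its pullbacks
along successive retractions, which form a null sequence.\<close>

text \<open>The module \<open>M\<close> is arbitrary, so homomorphisms into \<open>M\<close> merely
  turn cokernels into kernels. The sheaf property therefore needs the null measures on
  \<open>fibre_product T f\<close>, \<open>T\<close> and \<open>S\<close> to form a right exact
  sequence. Null measures are contravariant in the group of functions, so right exactness has to
  come from additive splittings of functions; splitting the map from functions on \<open>T\<close>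
  to functions on the fibre product takes exactness one place further on, whence the triple fibre
  products. Metrizability enters through countability: a sequence of clopen sets separates points,
  which gives dual bases indexed by the naturals, and subgroups of finitely supported sequences
  split by division with remainder.

  On the solid side an infinite sum is known only as the solution of an equation for its tails.
  Identities between sums are proved by guessing the tails, as a section over
  \<open>times_Nbar S\<close>, and checking that equation. For the counit, the successive
  differences of a section must depend on the step alone before they form a null sequence; this is
  arranged on the closed subset \<open>D\<close> of \<open>times_Nbar S\<close>.\<close>

abbreviation Sec where
 "Sec A S == carrier(sect A S)"

abbreviation sect_mult ("_ \<cdot>[_,_]/ _" [70, 0, 0, 71] 70) where
 "x \<cdot>[A,S] y == x \<otimes>\<^bsub>sect A S\<^esub> y"

abbreviation sect_inv ("inv[_,_] _" [0, 0, 81] 80) where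
 "inv[A,S] x == inv\<^bsub>sect A S\<^esub> x"

abbreviation sect_one ("\<one>[_,_]") where
 "\<one>[A,S] == \<one>\<^bsub>sect A S\<^esub>"

abbreviation locally_constant :: "'a topology => ('a => 'b) => bool" where
 "locally_constant X == continuous_map X (discrete_topology UNIV)"

abbreviation at_inf :: "point => point" where
 "at_inf == %p. pair_point (p, None)"

section \<open>Clopen sets and light profinite spaces\<close>

definition clopenin :: "'a topology => 'a set => bool" where
 "clopenin X U \<longleftrightarrow> openin X U & closedin X U"

lemma clopenin_subset: "clopenin X U ==> U <= topspace X" by (simp add: clopenin_def openin_subset)

lemma clopenin_empty [simp]: "clopenin X {}" by (simp add: clopenin_def)

lemma clopenin_topspace [simp]: "clopenin X (topspace X)" by (simp add: clopenin_def)

lemma clopenin_Int: "clopenin X U ==> clopenin X V ==> clopenin X (U Int V)" by (auto simp: clopenin_def)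

lemma clopenin_Un: "clopenin X U ==> clopenin X V ==> clopenin X (U Un V)" by (auto simp: clopenin_def)

lemma clopenin_Diff: "clopenin X U ==> clopenin X V ==> clopenin X (U - V)" by (auto simp: clopenin_def)

lemma clopenin_UN: "finite I ==> (!!i. i : I ==> clopenin X (U i)) ==> clopenin X (\<Union>i\<in>I. U i)"
 by (induction I rule: finite_induct) (auto intro: clopenin_Un)

lemma clopenin_INT:
 assumes "finite I" and "!!i. i : I ==> clopenin X (U i)"
 shows "clopenin X {x : topspace X. ALL i:I. x : U i}" using assms
proof (induction I rule: finite_induct)
 case (insert i I)
 have "{x : topspace X. ALL i:insert i I. x : U i} = U i Int {x : topspace X. ALL i:I. x : U i}"
  using insert.prems clopenin_subset by fastforce
 thus ?case using insert by (simp add: clopenin_Int)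
qed simp

lemma clopenin_vimage:
 "continuous_map X Y f ==> clopenin Y V ==> clopenin X {x : topspace X. f x : V}"
 by (simp add: clopenin_def openin_continuous_map_preimage closedin_continuous_map_preimage)

lemma clopenin_const: "clopenin X {x : topspace X. P}" by (cases P) simp_all

lemma clopenin_conj:
 "clopenin X {x : topspace X. P x} ==> clopenin X {x : topspace X. Q x} ==>
  clopenin X {x : topspace X. P x & Q x}"
 using clopenin_Int[of X "{x : topspace X. P x}" "{x : topspace X. Q x}"]
 by (simp add: Collect_conj_eq inf.left_commute inf_assoc[symmetric])

lemma clopenin_not:
 assumes "clopenin X {x : topspace X. P x}"
 shows "clopenin X {x : topspace X. ~ P x}"
proof -
 have "{x : topspace X. ~ P x} = topspace X - {x : topspace X. P x}" by auto
 thus ?thesis by (simp add: clopenin_Diff assms)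
qed

lemma clopenin_subtopology:
 "clopenin X V ==> clopenin (subtopology X C) (V Int C)"
 by (auto simp: clopenin_def openin_subtopology closedin_subtopology)

lemma continuous_map_discrete_iff:
 "locally_constant X f \<longleftrightarrow> (ALL a. clopenin X {x : topspace X. f x = a})"
proof
 assume f: "locally_constant X f"
 show "ALL a. clopenin X {x : topspace X. f x = a}"
  using clopenin_vimage[OF f, of "{_}"] by (simp add: clopenin_def)
next
 assume *: "ALL a. clopenin X {x : topspace X. f x = a}"
 have "openin X {x : topspace X. f x : U}" for U
 proof -
  have "{x : topspace X. f x : U} = (\<Union>a\<in>U. {x : topspace X. f x = a})" by auto
  thus ?thesis using * by (auto simp: clopenin_def)
 qed
 thus "locally_constant X f" by (simp add: continuous_map)
qed

lemma continuous_map_discrete_restrict: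
 assumes "clopenin X U" "locally_constant X f"
  "locally_constant X g"
 shows "locally_constant X (%x. if x : U then f x else g x)" unfolding continuous_map_discrete_iff
proof
 fix a
 have "{x : topspace X. (if x : U then f x else g x) = a} =
   (U Int {x : topspace X. f x = a}) Un ({x : topspace X. g x = a} - U)"
  using clopenin_subset[OF assms(1)] by auto
 thus "clopenin X {x : topspace X. (if x : U then f x else g x) = a}"
  using assms by (simp add: continuous_map_discrete_iff clopenin_Un clopenin_Int clopenin_Diff)
qed

text \<open>A countable clopen family that tells points apart replaces metric and connectedness
  arguments by finitely many bits at a time; on a compact space it amounts to an embedding into the
  Cantor set.\<close>

definition separating :: "'a topology => (nat => 'a set) => bool" where
 "separating X V \<longleftrightarrow> (ALL n. clopenin X (V n)) &
   (ALL x:topspace X. ALL y:topspace X. (ALL n. x : V n \<longleftrightarrow> y : V n) --> x = y)"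

text \<open>The working form of \<open>metrizable_Stone\<close>, proved equivalent below. Separating
  families for closed subspaces, products and finite sums are written down directly, on any type of
  points, whereas \<open>MStone\<close> fixes the type \<open>point\<close>.\<close>

definition light_profinite :: "'a topology => bool" where
 "light_profinite X \<longleftrightarrow> compact_space X & (EX V. separating X V)"

lemma light_profinite_compact: "light_profinite X ==> compact_space X" by (simp add: light_profinite_def)

lemma compactin_subcover:
 "compactin X K ==> K <= \<Union>\<U> ==> ALL U:\<U>. openin X U ==> EX F. finite F & F <= \<U> & K <= \<Union>F"
 by (simp add: compactin_def)

text \<open>In a compact Hausdorff space quasi-components agree with connected components, which are
  singletons here, and different quasi-components are separated by a clopen set.\<close>

lemma clopenin_separation:
 assumes "compact_space X" "Hausdorff_space X" "totally_disconnected_space X"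
  and "x : topspace X" "y : topspace X" "x ~= y"
 obtains V where "clopenin X V" "x : V" "y ~: V"
proof -
 have "EX a. quasi_component_of_set X x <= {a}" using assms(1-3) connectedin_connected_component_of[of X x]
  by (simp add: totally_disconnected_space_def quasi_eq_connected_component_of)
 moreover have "quasi_component_of X x x" using assms by simp
 ultimately have "~ quasi_component_of X x y" using assms(6) by (metis CollectI singletonD subsetD)
 thus thesis using assms that by (auto simp: quasi_component_of clopenin_def)
qed

text \<open>For each \<open>n\<close> the pairs of points at distance at least 1/(n+1) form a
  compact set, covered by the open rectangles \<open>?W V\<close> with \<open>V\<close> clopen.
  Finitely many \<open>V\<close> suffice for each \<open>n\<close>; together they are countable in
  number and separate points.\<close>

lemma metrizable_Stone_imp_light_profinite:
 assumes "metrizable_Stone X"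
 shows "light_profinite X"
proof -
 have X: "compact_space X" "totally_disconnected_space X" "metrizable_space X"
  using assms by (auto simp: metrizable_Stone_def)
 then obtain M d where Md: "Metric_space M d" "X = Metric_space.mtopology M d"
  by (auto simp: metrizable_space_def)
 interpret Metric_space M d by (fact Md(1))
 have H: "Hausdorff_space X" using X metrizable_imp_Hausdorff_space by blast
 let ?P = "prod_topology X X"
 let ?W = "%V. V \<times> (topspace X - V)"
 have "EX F. finite F & (ALL V:F. clopenin X V) &
   (ALL x:topspace X. ALL y:topspace X. 1 / Suc n <= d x y --> (EX V:F. x : V & y ~: V))" for n
 proof -
  let ?K = "{z : topspace ?P. d (fst z) (snd z) : {1 / Suc n..}}"
  have "continuous_map ?P euclideanreal (%z. d (fst z) (snd z))"
   using continuous_map_mdist[of ?P "metric (M, d)" fst snd] Md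
   by (simp add: continuous_map_fst continuous_map_snd)
  hence "closedin ?P ?K" by (rule closedin_continuous_map_preimage) auto
  moreover have "compact_space ?P" using X by (simp add: compact_space_prod_topology)
  ultimately have "compactin ?P ?K" by (simp add: closedin_compact_space)
  moreover have cov: "?K <= \<Union>(?W ` {V. clopenin X V})"
  proof
   fix z assume z: "z : ?K"
   then obtain x y where xy: "z = (x, y)" "x : topspace X" "y : topspace X" "1 / Suc n <= d x y"
    by (cases z) auto
   hence "x ~= y" using Md by auto
   then obtain V where "clopenin X V" "x : V" "y ~: V"
    using clopenin_separation[OF X(1) H X(2)] xy by metis
   thus "z : \<Union>(?W ` {V. clopenin X V})" using xy by auto
  qed
  moreover have "ALL U:?W ` {V. clopenin X V}. openin ?P U"
   by (auto simp: openin_prod_Times_iff clopenin_def)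
  ultimately have "EX G. finite G & G <= ?W ` {V. clopenin X V} & ?K <= \<Union>G"
   by (rule compactin_subcover)
  then obtain G where G: "finite G" "G <= ?W ` {V. clopenin X V}" "?K <= \<Union>G" by blast
  then obtain F where F: "F <= {V. clopenin X V}" "finite F" "G = ?W ` F"
   using finite_subset_image[OF G(1,2)] by blast
  have "EX V:F. x : V & y ~: V"
   if "x : topspace X" "y : topspace X" "1 / Suc n <= d x y" for x y
  proof -
   have "(x, y) : ?K" using that by simp
   thus ?thesis using G F by auto
  qed
  thus ?thesis using F by (intro exI[of _ F]) auto
 qed
 then obtain F where F: "!!n. finite (F n)" "!!n V. V : F n ==> clopenin X V"
   "!!n x y. [|x : topspace X; y : topspace X; 1 / Suc n <= d x y|] ==> EX V:F n. x : V & y ~: V" by metis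
 \<comment> \<open>Adding the empty set makes the family nonempty, so that it is the range of a
   sequence.\<close>
 have "countable (insert {} (\<Union>n. F n))" using F by (auto intro: countable_finite)
 then obtain V :: "nat => 'a set" where V: "range V = insert {} (\<Union>n. F n)"
  using range_from_nat_into[of "insert {} (\<Union>n. F n)"] by blast
 have "separating X V" unfolding separating_def
 proof (intro conjI allI ballI impI)
  show "clopenin X (V n)" for n using V F(2) rangeI[of V n] by auto
  fix x y assume xy: "x : topspace X" "y : topspace X" "ALL n. x : V n \<longleftrightarrow> y : V n"
  show "x = y"
  proof (rule ccontr)
   assume "x ~= y"
   hence "d x y > 0" using xy Md by (simp add: mdist_pos_less)
   then obtain n where "1 / Suc n < d x y" by (meson nat_approx_posE)
   then obtain W where "W : F n" "x : W" "y ~: W" using F(3)[of x y n] xy by auto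
   moreover obtain m where "V m = W" using V `W : F n` by (metis UN_I UNIV_I insertCI imageE)
   ultimately show False using xy by auto
  qed
 qed
 thus ?thesis using X by (auto simp: light_profinite_def)
qed

lemma light_profinite_imp_Hausdorff:
 assumes "light_profinite X"
 shows "Hausdorff_space X"
proof -
 obtain V where V: "separating X V" using assms by (auto simp: light_profinite_def)
 show ?thesis unfolding Hausdorff_space_def
 proof (intro allI impI)
  fix x y assume xy: "x : topspace X & y : topspace X & x ~= y"
  then obtain n where n: "(x : V n) ~= (y : V n)" using V unfolding separating_def by blast
  have "openin X (V n)" "openin X (topspace X - V n)" using V by (auto simp: separating_def clopenin_def)
  thus "EX U W. openin X U & openin X W & x : U & y : W & disjnt U W"
   using n xy by (metis Diff_disjoint DiffI disjnt_def inf_commute)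
 qed
qed

abbreviation Cantor :: "point topology" where
 "Cantor == product_topology (%_. discrete_topology UNIV) UNIV"

lemma separating_Cantor: "separating Cantor (%n. {p. p n})"
proof -
 have "locally_constant Cantor (%p. p n)" for n by (rule continuous_map_product_projection) simp
 hence "clopenin Cantor {p : topspace Cantor. p n : {True}}" for n
  by (rule clopenin_vimage) (simp add: clopenin_def)
 thus ?thesis by (simp add: separating_def) (auto simp: fun_eq_iff)
qed

lemma compact_Cantor: "compact_space Cantor"
 by (simp add: compact_space_product_topology compact_space_discrete_topology)

lemma light_profinite_Cantor: "light_profinite Cantor"
 using separating_Cantor compact_Cantor by (auto simp: light_profinite_def)

lemma continuous_map_into_Cantor:
 "continuous_map X Cantor f \<longleftrightarrow> (ALL n. clopenin X {x : topspace X. f x n})" (is "?l \<longleftrightarrow> ?r")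
proof
 assume f: ?l
 have "clopenin X {x : topspace X. f x : {p. p n}}" for n
  using separating_Cantor by (intro clopenin_vimage[OF f]) (simp add: separating_def)
 thus ?r by simp
next
 assume r: ?r
 have "clopenin X {x : topspace X. f x n = a}" for n a
  using r clopenin_not[of X "%x. f x n"] by (cases a) auto
 thus ?l by (simp add: continuous_map_componentwise_UNIV continuous_map_discrete_iff)
qed

lemma homeomorphic_map_onto_image:
 assumes "compact_space X" "Hausdorff_space Y" "continuous_map X Y f" "inj_on f (topspace X)"
 shows "homeomorphic_map X (subtopology Y (f ` topspace X)) f"
proof -
 have im: "f ` topspace X <= topspace Y" using assms(3) by (simp add: continuous_map_image_subset_topspace)
 show ?thesis
 proof (rule continuous_imp_homeomorphic_map)
  show "continuous_map X (subtopology Y (f ` topspace X)) f"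
   using assms by (simp add: continuous_map_in_subtopology)
 qed (use assms im in \<open>auto simp: Hausdorff_space_subtopology\<close>)
qed

text \<open>The sequence of memberships in the separating sets embeds the space into the Cantor set.
  The image is a topology on \<open>point\<close>, and metrizability is transported back from
  it.\<close>

lemma light_profinite_imp_metrizable_Stone_aux:
 assumes "light_profinite X"
 obtains S e where "homeomorphic_map X S e" "metrizable_Stone X" "S : MStone" "EX C. S = subtopology Cantor C"
proof -
 obtain V where V: "separating X V" using assms by (auto simp: light_profinite_def)
 define e where "e = (%x n. x : V n)"
 have "continuous_map X Cantor e" unfolding continuous_map_into_Cantor
 proof
  fix n
  have "{x : topspace X. e x n} = V n"
   using V clopenin_subset[of X "V n"] by (auto simp: e_def separating_def)
  thus "clopenin X {x : topspace X. e x n}" using V by (simp add: separating_def)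
 qed
 moreover have "inj_on e (topspace X)" using V by (auto simp: e_def separating_def fun_eq_iff inj_on_def)
 ultimately have h: "homeomorphic_map X (subtopology Cantor (e ` topspace X)) e" (is "homeomorphic_map X ?S e")
  using light_profinite_imp_Hausdorff[OF light_profinite_Cantor] assms
  by (intro homeomorphic_map_onto_image) (auto simp: light_profinite_def)
 have td: "totally_disconnected_space Y" if "separating Y W" for Y :: "'b topology" and W
  unfolding totally_disconnected_space_def
 proof (intro allI impI)
  fix C assume C: "connectedin Y C"
  have "x = y" if "x : C" "y : C" for x y
  proof -
   have "x : W n \<longleftrightarrow> y : W n" for n
    using connectedin_clopen_cases[OF C, of "W n"] `separating Y W` that
    by (auto simp: separating_def clopenin_def disjnt_iff)
   moreover have "x : topspace Y" "y : topspace Y" using C that connectedin_subset_topspace by blast+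
   ultimately show ?thesis using `separating Y W` by (auto simp: separating_def)
  qed
  thus "EX a. C <= {a}" by blast
 qed
 have mS: "metrizable_space ?S"
  by (intro metrizable_space_subtopology) (simp add: metrizable_space_product_topology)
 have cS: "compact_space ?S"
  using homeomorphic_compact_space[OF homeomorphic_map_imp_homeomorphic_space[OF h]] assms
  by (simp add: light_profinite_def)
 have "separating ?S (%n. {p. p n} Int e ` topspace X)"
  using separating_Cantor clopenin_subtopology unfolding separating_def by fastforce
 hence "metrizable_Stone ?S" using td mS cS by (auto simp: metrizable_Stone_def)
 moreover have "metrizable_space X"
  using mS h homeomorphic_metrizable_space homeomorphic_map_imp_homeomorphic_space by blast
 hence "metrizable_Stone X" using td V assms by (auto simp: metrizable_Stone_def light_profinite_def)
 ultimately show thesis using that h by (auto simp: MStone_def)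
qed

lemma metrizable_Stone_iff_light_profinite: "metrizable_Stone X \<longleftrightarrow> light_profinite X"
 using metrizable_Stone_imp_light_profinite light_profinite_imp_metrizable_Stone_aux by metis

text \<open>Spaces whose points are pairs are excluded from \<open>MStone\<close> by their type
  alone; as test objects for sections they are replaced by such a homeomorphic copy.\<close>

lemma light_profinite_representative:
 assumes "light_profinite X"
 obtains S e where "S : MStone" "homeomorphic_map X S e"
 using light_profinite_imp_metrizable_Stone_aux[OF assms] by metis

lemma MStone_iff: "S : MStone \<longleftrightarrow> light_profinite S"
 by (simp add: MStone_def metrizable_Stone_iff_light_profinite)

lemma light_profinite_subtopology:
 assumes "light_profinite X" "closedin X C"
 shows "light_profinite (subtopology X C)"
proof -
 obtain V where V: "separating X V" using assms by (auto simp: light_profinite_def)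
 have "separating (subtopology X C) (%n. V n Int C)"
  using V clopenin_subtopology unfolding separating_def by fastforce
 moreover have "compact_space (subtopology X C)"
  using assms by (simp add: closedin_compact_space compact_space_subtopology light_profinite_compact)
 ultimately show ?thesis by (auto simp: light_profinite_def)
qed

lemma light_profinite_prod_topology:
 assumes "light_profinite X" "light_profinite Y"
 shows "light_profinite (prod_topology X Y)"
proof -
 obtain V where V: "separating X V" using assms by (auto simp: light_profinite_def)
 obtain W where W: "separating Y W" using assms by (auto simp: light_profinite_def)
 define Z where "Z n = (if even n then V (n div 2) \<times> topspace Y else topspace X \<times> W (n div 2))" for n
 have "clopenin (prod_topology X Y) (Z n)" for n
  using V W by (auto simp: Z_def separating_def clopenin_def openin_prod_Times_iff closedin_prod_Times_iff)
 moreover have "z = z'" if z: "z : topspace (prod_topology X Y)" "z' : topspace (prod_topology X Y)"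
   and eq: "ALL n. z : Z n \<longleftrightarrow> z' : Z n" for z z'
 proof -
  have "fst z : V n \<longleftrightarrow> fst z' : V n" "snd z : W n \<longleftrightarrow> snd z' : W n" for n
   using eq[rule_format, of "2 * n"] eq[rule_format, of "2 * n + 1"] z by (auto simp: Z_def mem_Times_iff)
  thus ?thesis using V W z unfolding separating_def by (simp add: mem_Times_iff prod_eq_iff)
 qed
 ultimately have "separating (prod_topology X Y) Z" by (simp add: separating_def)
 thus ?thesis using assms by (auto simp: light_profinite_def compact_space_prod_topology)
qed

lemma light_profinite_homeomorphic_map:
 assumes "light_profinite X" "homeomorphic_map X Y h"
 shows "light_profinite Y"
proof -
 obtain g where g: "continuous_map Y X g" "!!y. y : topspace Y ==> h (g y) = y"
  using assms(2) by (auto simp: homeomorphic_map_maps homeomorphic_maps_def)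
 obtain V where V: "separating X V" using assms by (auto simp: light_profinite_def)
 have "separating Y (%n. {y : topspace Y. g y : V n})" unfolding separating_def
 proof (intro conjI allI ballI impI)
  show "clopenin Y {y : topspace Y. g y : V n}" for n
   using V by (intro clopenin_vimage[OF g(1)]) (simp add: separating_def)
  fix x y assume "x : topspace Y" "y : topspace Y"
   "ALL n. x : {y : topspace Y. g y : V n} \<longleftrightarrow> y : {y : topspace Y. g y : V n}"
  moreover from this have "g x = g y" using V g(1) unfolding separating_def
   by (metis (no_types, lifting) continuous_map_image_subset_topspace image_subset_iff mem_Collect_eq)
  ultimately show "x = y" using g(2) by metis
 qed
 moreover have "compact_space Y"
  using homeomorphic_compact_space[OF homeomorphic_map_imp_homeomorphic_space[OF assms(2)]] assms
  by (simp add: light_profinite_def)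
 ultimately show ?thesis by (auto simp: light_profinite_def)
qed

lemma light_profinite_sum_topology:
 assumes "!!i. i < n ==> light_profinite (T i)"
 shows "light_profinite (sum_topology T {..<n::nat})"
proof -
 let ?Y = "sum_topology T {..<n}"
 have "ALL i. EX V. i < n --> separating (T i) V" using assms by (auto simp: light_profinite_def)
 then obtain V where V: "!!i. i < n ==> separating (T i) (V i)" by metis
 \<comment> \<open>Slot 0 of each summand holds the whole summand, which separates points of
   different summands; slot \<open>Suc j\<close> holds the \<open>j\<close>-th separating
   set.\<close>
 define Z where "Z m = (case prod_decode m of (i, j) => if i < n then
   (case j of 0 => {i} \<times> topspace (T i) | Suc j => {i} \<times> V i j) else {})" for m
 have piece: "clopenin ?Y ({i} \<times> U)" if "i < n" "clopenin (T i) U" for i U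
 proof -
  have [simp]: "{x. j = i & x : U} = (if j = i then U else {})" for j by auto
  show ?thesis using that clopenin_subset[OF that(2)]
   by (auto simp: clopenin_def openin_sum_topology closedin_sum_topology)
 qed
 have "separating ?Y Z" unfolding separating_def
 proof (intro conjI allI ballI impI)
  fix m show "clopenin ?Y (Z m)"
   using piece V by (auto simp: Z_def separating_def split: prod.split nat.split)
 next
  fix x y assume xy: "x : topspace ?Y" "y : topspace ?Y" and eq: "ALL m. x : Z m \<longleftrightarrow> y : Z m"
  obtain i s j t where ij: "x = (i, s)" "y = (j, t)" by (cases x; cases y) auto
  have st: "i < n" "j < n" "s : topspace (T i)" "t : topspace (T j)" using xy ij by auto
  have "i = j" using eq[rule_format, of "prod_encode (i, 0)"] st ij by (simp add: Z_def)
  moreover have "s : V i k \<longleftrightarrow> t : V i k" for k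
   using eq[rule_format, of "prod_encode (i, Suc k)"] st ij `i = j` by (simp add: Z_def)
  ultimately show "x = y" using V[of i] st ij by (auto simp: separating_def)
 qed
 moreover have "compact_space ?Y"
 proof -
  have "compactin ?Y ((%x. (i, x)) ` topspace (T i))" if "i < n" for i
   using assms[OF that] that continuous_map_component_injection[of i "{..<n}" T]
   by (intro image_compactin) (auto simp: light_profinite_def compact_space_def)
  hence "compactin ?Y (\<Union>((%i. (%x. (i, x)) ` topspace (T i)) ` {..<n}))"
   by (intro compactin_Union) auto
  moreover have "(\<Union>((%i. (%x. (i, x)) ` topspace (T i)) ` {..<n})) = topspace ?Y" by auto
  ultimately show ?thesis by (simp add: compact_space_def)
 qed
 ultimately show ?thesis by (auto simp: light_profinite_def)
qed

section \<open>The space \<open>Nbar\<close> and products with it\<close>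

lemma topspace_Nbar [simp]: "topspace Nbar = UNIV" by (auto simp: Nbar_def notin_range_Some)

lemma openin_Nbar: "openin Nbar U \<longleftrightarrow> (None : U --> finite {n. Some n ~: U})"
proof (cases "None : U")
 case True
 have "U = insert None (Some ` (UNIV - {n. Some n ~: U}))"
 proof (rule Set.set_eqI)
  show "a : U \<longleftrightarrow> a : insert None (Some ` (UNIV - {n. Some n ~: U}))" for a
   using True by (cases a) auto
 qed
 moreover have "{n. Some n ~: insert None (Some ` (UNIV - C))} = C" for C :: "nat set" by auto
 ultimately show ?thesis unfolding Nbar_def openin_Alexandroff_compactification
  by (auto simp: compactin_discrete_topology)
next
 case False
 have "U = Some ` {n. Some n : U}"
 proof
  show "U <= Some ` {n. Some n : U}"
  proof
   fix a assume "a : U"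
   thus "a : Some ` {n. Some n : U}" using False by (cases a) auto
  qed
 qed auto
 thus ?thesis using False unfolding Nbar_def openin_Alexandroff_compactification by auto
qed

lemma clopenin_Nbar_Some: "clopenin Nbar {Some n}"
proof -
 have "{m. Some m ~: UNIV - {Some n}} = {n}" by auto
 thus ?thesis by (simp add: clopenin_def closedin_def openin_Nbar)
qed

lemma compact_Nbar: "compact_space Nbar" by (simp add: Nbar_def)

lemma light_profinite_Nbar: "light_profinite Nbar"
proof -
 have "separating Nbar (%n. {Some n})"
  using clopenin_Nbar_Some by (auto simp: separating_def) (metis option.exhaust)
 thus ?thesis using compact_Nbar by (auto simp: light_profinite_def)
qed

text \<open>Neighbourhoods of infinity are cofinite, so the preimage of one is the complement of
  finitely many preimages of isolated points.\<close>

lemma continuous_map_into_Nbar: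
 "continuous_map X Nbar k \<longleftrightarrow> (ALL n. clopenin X {x : topspace X. k x = Some n})" (is "?l \<longleftrightarrow> ?r")
proof
 assume ?l
 thus ?r using clopenin_vimage[OF _ clopenin_Nbar_Some] by fastforce
next
 assume r: ?r
 have "openin X {x : topspace X. k x : U}" if U: "openin Nbar U" for U
 proof (cases "None : U")
  case True
  hence fin: "finite {n. Some n ~: U}" using U by (simp add: openin_Nbar)
  have "{x : topspace X. k x : U} =
    topspace X - (\<Union>n\<in>{n. Some n ~: U}. {x : topspace X. k x = Some n})"
   using True by auto (metis option.exhaust)
  moreover have "clopenin X (\<Union>n\<in>{n. Some n ~: U}. {x : topspace X. k x = Some n})"
   using r fin by (intro clopenin_UN) auto
  ultimately show ?thesis by (simp add: clopenin_def openin_diff)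
 next
  case False
  hence "{x : topspace X. k x : U} = (\<Union>n\<in>{n. Some n : U}. {x : topspace X. k x = Some n})"
   by auto (metis option.exhaust)
  thus ?thesis using r by (auto simp: clopenin_def)
 qed
 thus ?l by (simp add: continuous_map)
qed

text \<open>The set is a finite union of clopen slices. The uniform bound \<open>N\<close> is what
  keeps it away from infinity; most continuity proofs over \<open>Nbar\<close> below reduce to this
  criterion.\<close>

lemma clopenin_prod_Nbar:
 assumes slice: "!!m. clopenin X {x : topspace X. P x (Some m)}"
  and inf: "!!x. x : topspace X ==> ~ P x None"
  and bound: "!!x m. x : topspace X ==> P x (Some m) ==> m < N"
 shows "clopenin (prod_topology X Nbar) {z : topspace (prod_topology X Nbar). P (fst z) (snd z)}"
proof -
 have "{z : topspace (prod_topology X Nbar). P (fst z) (snd z)} =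
   (\<Union>m<N. {x : topspace X. P x (Some m)} \<times> {Some m})"
  using inf bound by auto (metis lessThan_iff not_None_eq)
 moreover have "clopenin (prod_topology X Nbar) (\<Union>m<N. {x : topspace X. P x (Some m)} \<times> {Some m})"
  using slice clopenin_Nbar_Some
  by (intro clopenin_UN) (auto simp: clopenin_def openin_prod_Times_iff closedin_prod_Times_iff)
 ultimately show ?thesis by simp
qed

text \<open>Converse of the preceding criterion: a clopen set that avoids infinity is compact and
  covered by the open slices over the isolated points.\<close>

lemma clopenin_prod_Nbar_bounded:
 assumes "compact_space X"
  and W: "clopenin (prod_topology X Nbar) {z : topspace (prod_topology X Nbar). P (fst z) (snd z)}"
  and inf: "!!x. x : topspace X ==> ~ P x None"
 obtains N where "!!x m. x : topspace X ==> P x (Some m) ==> m < N"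
proof -
 let ?P = "prod_topology X Nbar"
 let ?W = "{z : topspace ?P. P (fst z) (snd z)}"
 let ?B = "%m. topspace X \<times> {Some m}"
 have "compactin ?P ?W" using W assms(1) compact_Nbar
  by (intro closedin_compact_space) (auto simp: compact_space_prod_topology clopenin_def)
 moreover have "?W <= \<Union>(range ?B)" using inf by auto (metis not_None_eq)
 moreover have "ALL U:range ?B. openin ?P U"
  using clopenin_Nbar_Some by (auto simp: openin_prod_Times_iff clopenin_def)
 ultimately have "EX F. finite F & F <= range ?B & ?W <= \<Union>F" by (rule compactin_subcover)
 then obtain F where F: "finite F" "F <= range ?B" "?W <= \<Union>F" by blast
 then obtain M where M: "finite M" "?W <= (\<Union>m\<in>M. ?B m)"
  using finite_subset_image[OF F(1,2)] by blast
 have "m < Suc (Max (insert 0 M))" if "x : topspace X" "P x (Some m)" for x m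
 proof -
  have "(x, Some m) : ?W" using that by simp
  hence "(x, Some m) : (\<Union>m\<in>M. ?B m)" using M(2) by (rule rev_subsetD)
  hence "m : M" by auto
  thus ?thesis using M by (simp add: le_imp_less_Suc)
 qed
 thus thesis using that by blast
qed

lemma topspace_times_Nbar [simp]:
 "topspace (times_Nbar S) = pair_point ` (topspace S \<times> UNIV)"
 by (auto simp: times_Nbar_def topspace_pullback_topology)

lemma continuous_map_unpair_point: "continuous_map (times_Nbar S) (prod_topology S Nbar) unpair_point"
 using homeomorphic_map_pair_point[of S] unfolding times_Nbar_def
 using continuous_map_pullback[OF continuous_map_id[of "prod_topology S Nbar"],
    of "pair_point ` topspace (prod_topology S Nbar)" unpair_point] by simp

lemma continuous_map_pair_point: "continuous_map (prod_topology S Nbar) (times_Nbar S) pair_point"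
 using homeomorphic_map_pair_point homeomorphic_imp_continuous_map by blast

lemma light_profinite_one_point: "light_profinite one_point"
proof -
 have "separating one_point (%_. {})" by (simp add: one_point_def separating_def)
 thus ?thesis by (auto simp: light_profinite_def one_point_def compact_space_discrete_topology)
qed

lemma one_point_MStone [simp]: "one_point : MStone" by (simp add: MStone_iff light_profinite_one_point)

lemma times_Nbar_MStone [simp]: "S : MStone ==> times_Nbar S : MStone" unfolding MStone_iff
 using light_profinite_homeomorphic_map[OF _ homeomorphic_map_pair_point]
  light_profinite_prod_topology light_profinite_Nbar by blast

lemma subtopology_MStone: "S : MStone ==> closedin S C ==> subtopology S C : MStone"
 by (simp add: MStone_iff light_profinite_subtopology)

lemma sum_fun_apply: "(\<Sum>i\<in>I. f i) x = (\<Sum>i\<in>I. f i x)"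
 by (induction I rule: infinite_finite_induct) auto

text \<open>The points outside \<open>U\<close> are covered by clopen sets that miss
  \<open>x\<close>. Finitely many of them suffice, and the complement of their union is the required
  neighbourhood.\<close>

lemma light_profinite_base:
 assumes "light_profinite X" "openin X U" "x : U"
 obtains W where "clopenin X W" "x : W" "W <= U"
proof -
 obtain V where V: "separating X V" using assms by (auto simp: light_profinite_def)
 have xX: "x : topspace X" using assms openin_subset by blast
 let ?K = "topspace X - U"
 let ?U = "{T. clopenin X T & x ~: T}"
 have "compactin X ?K" using assms by (intro closedin_compact_space) (auto simp: light_profinite_compact)
 moreover have "?K <= \<Union>?U"
 proof
  fix y assume y: "y : ?K"
  then obtain n where n: "(x : V n) ~= (y : V n)" using V xX assms(3) unfolding separating_def by blast
  have "clopenin X (V n)" "clopenin X (topspace X - V n)"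
   using V by (simp_all add: separating_def clopenin_Diff)
  thus "y : \<Union>?U" using n y xX by (cases "x : V n") auto
 qed
 moreover have "ALL T:?U. openin X T" by (simp add: clopenin_def)
 ultimately have "EX F. finite F & F <= ?U & ?K <= \<Union>F" by (rule compactin_subcover)
 then obtain F where F: "finite F" "F <= ?U" "?K <= \<Union>F" by blast
 hence "clopenin X (\<Union>T\<in>F. T)" by (intro clopenin_UN) auto
 hence "clopenin X (topspace X - \<Union>F)" by (simp add: clopenin_Diff)
 thus thesis using F xX by (intro that[of "topspace X - \<Union>F"]) auto
qed

lemma continuous_map_into_light_profinite:
 assumes "light_profinite X" "f ` topspace Y <= topspace X"
  and "!!W. clopenin X W ==> clopenin Y {y : topspace Y. f y : W}"
 shows "continuous_map Y X f" unfolding continuous_map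
proof (intro conjI allI impI)
 fix U assume U: "openin X U"
 have "{y : topspace Y. f y : U} = (\<Union>W\<in>{W. clopenin X W & W <= U}. {y : topspace Y. f y : W})"
  using light_profinite_base[OF assms(1) U] by auto blast
 thus "openin Y {y : topspace Y. f y : U}" using assms(3) by (auto simp: clopenin_def)
qed (rule assms(2))

text \<open>The pairs at which \<open>g\<close> takes different values form a compact set, covered
  by the open sets of pairs that differ in the \<open>i\<close>-th bit. Finitely many bits therefore
  determine \<open>g\<close>.\<close>

lemma separating_determines:
 assumes X: "compact_space X" and V: "separating X V"
  and g: "locally_constant X g"
 obtains N where "!!x y. [|x : topspace X; y : topspace X; !!i. i < N ==> x : V i \<longleftrightarrow> y : V i|] ==> g x = g y"
proof -
 let ?P = "prod_topology X X"
 let ?K = "{z : topspace ?P. g (fst z) ~= g (snd z)}"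
 let ?D = "%i. (V i \<times> (topspace X - V i)) Un ((topspace X - V i) \<times> V i)"
 have gg: "locally_constant ?P (%z. (g (fst z), g (snd z)))"
 proof -
  have "continuous_map ?P X fst" "continuous_map ?P X snd" by (rule continuous_map_fst continuous_map_snd)+
  hence "locally_constant ?P (g o fst)"
    "locally_constant ?P (g o snd)" using g continuous_map_compose by blast+
  hence "continuous_map ?P (prod_topology (discrete_topology UNIV) (discrete_topology UNIV))
    (%z. (g (fst z), g (snd z)))"
   by (simp add: continuous_map_pairedI o_def)
  thus ?thesis by (simp add: prod_topology_discrete_topology[symmetric])
 qed
 have "closedin ?P {z : topspace ?P. (g (fst z), g (snd z)) : {w. fst w ~= snd w}}"
  by (rule closedin_continuous_map_preimage[OF gg]) simp
 moreover have "compact_space ?P" using X by (simp add: compact_space_prod_topology)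
 ultimately have "compactin ?P ?K" by (simp add: closedin_compact_space)
 moreover have "?K <= \<Union>(range ?D)"
 proof
  fix z assume z: "z : ?K"
  hence "fst z : topspace X" "snd z : topspace X" "fst z ~= snd z" by auto
  then obtain n where "(fst z : V n) ~= (snd z : V n)" using V unfolding separating_def by blast
  thus "z : \<Union>(range ?D)" using z by (auto simp: mem_Times_iff)
 qed
 moreover have "ALL U:range ?D. openin ?P U"
  using V by (auto intro!: openin_Un openin_diff simp: openin_prod_Times_iff separating_def clopenin_def)
 ultimately have "EX F. finite F & F <= range ?D & ?K <= \<Union>F" by (rule compactin_subcover)
 then obtain F where F: "finite F" "F <= range ?D" "?K <= \<Union>F" by blast
 then obtain I where I: "finite I" "?K <= (\<Union>i\<in>I. ?D i)"
  using finite_subset_image[OF F(1,2)] by blast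
 have "g x = g y" if "x : topspace X" "y : topspace X" "!!i. i < Suc (Max (insert 0 I)) ==> x : V i \<longleftrightarrow> y : V i" for x y
 proof (rule ccontr)
  assume "g x ~= g y"
  hence "(x, y) : (\<Union>i\<in>I. ?D i)" using that I(2) by (intro subsetD[OF I(2)]) auto
  then obtain i where "i : I" "(x : V i) ~= (y : V i)" by auto
  thus False using that(3)[of i] I(1) by (simp add: le_imp_less_Suc)
 qed
 thus thesis using that by blast
qed

section \<open>Integer-valued continuous functions and null sequences of measures\<close>

text \<open>Continuous functions vanish outside the space, so that they form a group under the
 pointwise operations of the function type.\<close>

definition cont_int :: "'a topology => ('a => int) set" where
 "cont_int X = {g. locally_constant X g & (ALL x. x ~: topspace X --> g x = 0)}"

definition additive_on :: "'g set => ('g::ab_group_add => 'h::ab_group_add) => bool" where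
 "additive_on G f \<longleftrightarrow> (ALL x:G. ALL y:G. f (x + y) = f x + f y)"

definition add_subgroup :: "'g::ab_group_add set => bool" where
 "add_subgroup G \<longleftrightarrow> 0 : G & (ALL x:G. ALL y:G. x - y : G)"

lemma add_subgroup_0: "add_subgroup G ==> 0 : G" by (simp add: add_subgroup_def)

lemma add_subgroup_diff: "add_subgroup G ==> x : G ==> y : G ==> x - y : G" by (simp add: add_subgroup_def)

lemma add_subgroup_uminus: "add_subgroup G ==> x : G ==> - x : G"
 using add_subgroup_diff[of G 0 x] by (simp add: add_subgroup_def)

lemma add_subgroup_add: "add_subgroup G ==> x : G ==> y : G ==> x + y : G"
 using add_subgroup_diff[of G x "- y"] add_subgroup_uminus[of G y] by simp

lemma add_subgroup_sum: "add_subgroup G ==> (!!i. i : I ==> f i : G) ==> (\<Sum>i\<in>I. f i) : G"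
 by (induction I rule: infinite_finite_induct) (auto simp: add_subgroup_0 add_subgroup_add)

lemma additive_on_add: "additive_on G f ==> x : G ==> y : G ==> f (x + y) = f x + f y"
 by (simp add: additive_on_def)

lemma additive_on_0: "additive_on G f ==> add_subgroup G ==> f 0 = 0"
 using additive_on_add[of G f 0 0] by (simp add: add_subgroup_0)

lemma additive_on_diff:
 "additive_on G f ==> add_subgroup G ==> x : G ==> y : G ==> f (x - y) = f x - f y"
 using additive_on_add[of G f "x - y" y] by (simp add: add_subgroup_diff)

lemma additive_on_sum:
 assumes "additive_on G f" "add_subgroup G" "!!i. i : I ==> h i : G"
 shows "f (\<Sum>i\<in>I. h i) = (\<Sum>i\<in>I. f (h i))" using assms(3)
proof (induction I rule: infinite_finite_induct)
 case (insert i I)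
 hence "f (h i + (\<Sum>i\<in>I. h i)) = f (h i) + f (\<Sum>i\<in>I. h i)"
  by (intro additive_on_add[OF assms(1)] add_subgroup_sum assms(2)) auto
 thus ?case using insert by simp
qed (simp_all add: additive_on_0[OF assms(1,2)])

lemma add_subgroup_int_scale:
 assumes G: "add_subgroup G" and g: "g : G"
 shows "(%x. c * g x :: int) : G"
proof -
 have nat: "(%x. int n * h x) : G" if "h : G" for n h
 proof (induction n)
  case (Suc n)
  hence "(%x. int n * h x) + h : G" using that by (rule add_subgroup_add[OF G])
  moreover have "(%x. int n * h x) + h = (%x. int (Suc n) * h x)" by (simp add: fun_eq_iff algebra_simps)
  ultimately show ?case by simp
 qed (use add_subgroup_0[OF G] in \<open>simp add: zero_fun_def\<close>)
 show ?thesis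
 proof (cases c)
  case (nonneg n)
  thus ?thesis using nat[OF g, of n] by simp
 next
  case (neg n)
  thus ?thesis
   using nat[OF add_subgroup_uminus[OF G g], of "Suc n"] by (simp add: left_diff_distrib ring_distribs)
 qed
qed

lemma additive_on_int_scale:
 fixes f :: "('a => int) => int"
 assumes f: "additive_on G f" and G: "add_subgroup G" and g: "g : G"
 shows "f (%x. c * g x) = c * f g"
proof -
 have nat: "f (%x. int n * g x) = int n * f g" for n
 proof (induction n)
  case 0
  show ?case using additive_on_0[OF f G] by (simp add: zero_fun_def)
 next
  case (Suc n)
  have "(%x. int (Suc n) * g x) = (%x. int n * g x) + g" by (simp add: fun_eq_iff algebra_simps)
  thus ?case
   using Suc additive_on_add[OF f add_subgroup_int_scale[OF G g] g, of "int n"] by (simp add: algebra_simps)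
 qed
 show ?thesis
 proof (cases c)
  case (nonneg n)
  thus ?thesis using nat[of n] by simp
 next
  case (neg n)
  have "f (0 - (%x. int (Suc n) * g x)) = f 0 - f (%x. int (Suc n) * g x)"
   by (rule additive_on_diff[OF f G add_subgroup_0[OF G] add_subgroup_int_scale[OF G g]])
  moreover have "0 - (%x. int (Suc n) * g x) = (%x. c * g x)"
   using neg by (simp add: fun_eq_iff left_diff_distrib ring_distribs)
  ultimately show ?thesis
   using nat[of "Suc n"] neg additive_on_0[OF f G] by (simp add: left_diff_distrib ring_distribs)
 qed
qed

lemma cont_intI:
 "locally_constant X g ==> (!!x. x ~: topspace X ==> g x = 0) ==> g : cont_int X" by (simp add: cont_int_def)

lemma cont_int_continuous: "g : cont_int X ==> locally_constant X g" by (simp add: cont_int_def)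

lemma cont_int_outside: "g : cont_int X ==> x ~: topspace X ==> g x = 0" by (simp add: cont_int_def)

lemma cont_int_clopenin: "g : cont_int X ==> clopenin X {x : topspace X. g x = a}"
 by (simp add: cont_int_def continuous_map_discrete_iff)

lemma continuous_map_discrete_binop:
 assumes "locally_constant X f" "locally_constant X g"
 shows "locally_constant X (%x. F (f x) (g x))"
proof -
 have "continuous_map X (prod_topology (discrete_topology UNIV) (discrete_topology UNIV)) (%x. (f x, g x))"
  using assms by (simp add: continuous_map_pairedI)
 hence "locally_constant X (%x. (f x, g x))" by (simp add: prod_topology_discrete_topology[symmetric])
 hence "locally_constant X (case_prod F o (%x. (f x, g x)))"
  by (rule continuous_map_compose) (simp add: continuous_map_def)
 thus ?thesis by (simp add: o_def)
qed

lemma add_subgroup_cont_int [simp]: "add_subgroup (cont_int X)" unfolding add_subgroup_def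
proof (intro conjI ballI)
 show "0 : cont_int X" by (simp add: cont_int_def zero_fun_def)
 fix f g assume "f : cont_int X" "g : cont_int X"
 thus "f - g : cont_int X" unfolding cont_int_def using continuous_map_discrete_binop[of X f g "(-)"]
  by (auto simp: fun_diff_def)
qed

definition indicat :: "'a set => 'a => int" where
 "indicat U = (%x. if x : U then 1 else 0)"

lemma indicat_cont_int: "clopenin X U ==> indicat U : cont_int X" using clopenin_subset[of X U]
 by (auto intro!: cont_intI continuous_map_discrete_restrict simp: indicat_def)

lemma cont_int_finite_range:
 assumes "compact_space X" "g : cont_int X"
 shows "finite (g ` topspace X)"
proof -
 have "compactin (discrete_topology UNIV) (g ` topspace X)"
  using assms by (intro image_compactin[of X]) (auto simp: compact_space_def cont_int_def)
 thus ?thesis by (simp add: compactin_discrete_topology)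
qed

text \<open>The value 0 off the space \<open>X\<close> keeps the result among the normalised
  functions of \<open>cont_int X\<close>.\<close>

definition pull_fun :: "'a topology => ('a => 'b) => ('b => int) => 'a => int" where
 "pull_fun X f g = (%x. if x : topspace X then g (f x) else 0)"

lemma pull_fun_cont_int:
 assumes "continuous_map X Y f" "g : cont_int Y"
 shows "pull_fun X f g : cont_int X"
proof (rule cont_intI)
 have "locally_constant X (g o f)" using assms continuous_map_compose cont_int_continuous by blast
 thus "locally_constant X (pull_fun X f g)" by (rule continuous_map_eq) (simp add: pull_fun_def)
qed (simp add: pull_fun_def)

lemma additive_on_pull_fun: "additive_on G (pull_fun X f)"
 by (simp add: additive_on_def pull_fun_def fun_eq_iff)

definition additive_maps :: "'a topology => 'b topology => (('a => int) => 'b => int) set" where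
 "additive_maps X Y = {Lambda. additive_on (cont_int X) Lambda & Lambda ` cont_int X <= cont_int Y}"

lemma pull_fun_additive_maps: "continuous_map X Y f ==> pull_fun X f : additive_maps Y X"
 using pull_fun_cont_int[of X Y f] by (auto simp: additive_maps_def additive_on_pull_fun)

text \<open>Null sequences in the group of homomorphisms \<open>cont_int X \<rightarrow> \<int>\<close>, i.e. homomorphisms from
 \<open>cont_int X\<close> to the finitely supported sequences.\<close>

definition null_measures :: "'a topology => (nat => ('a => int) => int) set" where
 "null_measures X = {v. (ALL n. additive_on (cont_int X) (v n) & (ALL g. g ~: cont_int X --> v n g = 0)) &
   (ALL g:cont_int X. EX N. ALL n>=N. v n g = 0)}"

lemma null_measures_additive: "v : null_measures X ==> additive_on (cont_int X) (v n)"
 by (simp add: null_measures_def)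

lemma null_measures_outside: "v : null_measures X ==> g ~: cont_int X ==> v n g = 0"
 by (simp add: null_measures_def)

lemma null_measures_bound:
 assumes "v : null_measures X"
 obtains N where "!!n. n >= N ==> v n g = 0"
 using assms unfolding null_measures_def by (cases "g : cont_int X") blast+

lemma null_measures_bound2:
 assumes "v : null_measures X" "w : null_measures Y"
 obtains N where "!!n. n >= N ==> v n g = 0" "!!n. n >= N ==> w n h = 0"
proof -
 obtain N M where "!!n. n >= N ==> v n g = 0" "!!n. n >= M ==> w n h = 0"
  using null_measures_bound assms by metis
 thus thesis by (intro that[of "max N M"]) auto
qed

lemma null_measures_finite: "v : null_measures X ==> finite {n. v n g ~= 0}"
 using null_measures_bound[of v X g] by (metis (mono_tags, lifting) finite_nat_set_iff_bounded mem_Collect_eq not_le)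

lemma sum_support_bound:
 fixes c d :: "nat => 'b::semiring_0"
 assumes "!!n. n >= N ==> d n = 0"
 shows "(\<Sum>n | d n ~= 0. c n * d n) = (\<Sum>n<N. c n * d n)"
 using assms by (intro sum.mono_neutral_left) (auto simp: not_le[symmetric])

lemma add_subgroup_null_measures [simp]: "add_subgroup (null_measures X)" unfolding add_subgroup_def
proof (intro conjI ballI)
 show "0 : null_measures X" by (simp add: null_measures_def additive_on_def)
 fix v w assume vw: "v : null_measures X" "w : null_measures X"
 have "EX N. ALL n>=N. (v - w) n g = 0" for g
  using null_measures_bound2[OF vw, of g g] by (metis fun_diff_def diff_0_right)
 thus "v - w : null_measures X" using vw by (auto simp: null_measures_def additive_on_def)
qed

definition push_measure ::
  "'a topology => (('a => int) => 'b => int) => (nat => ('b => int) => int) => (nat => ('a => int) => int)" where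
 "push_measure X Lambda v = (%n g. if g : cont_int X then v n (Lambda g) else 0)"

lemma push_measure_null:
 assumes "Lambda : additive_maps X Y" "v : null_measures Y"
 shows "push_measure X Lambda v : null_measures X" unfolding null_measures_def
proof (safe)
 have L: "Lambda g : cont_int Y" if "g : cont_int X" for g using assms that by (auto simp: additive_maps_def)
 show "additive_on (cont_int X) (push_measure X Lambda v n)" for n unfolding additive_on_def
 proof (intro ballI)
  fix g h assume gh: "g : cont_int X" "h : cont_int X"
  hence "Lambda (g + h) = Lambda g + Lambda h"
   using assms(1) by (auto simp: additive_maps_def additive_on_def)
  moreover have "v n (Lambda g + Lambda h) = v n (Lambda g) + v n (Lambda h)"
   using gh L null_measures_additive[OF assms(2), of n] by (auto simp: additive_on_def)
  moreover have "g + h : cont_int X" using gh by (simp add: add_subgroup_add)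
  ultimately show "push_measure X Lambda v n (g + h) = push_measure X Lambda v n g + push_measure X Lambda v n h"
   using gh by (simp add: push_measure_def)
 qed
 show "EX N. ALL n>=N. push_measure X Lambda v n g = 0" for g
  using null_measures_bound[OF assms(2), of "Lambda g"] unfolding push_measure_def by metis
qed (simp add: push_measure_def)

lemma push_measure_add: "push_measure X Lambda (v + w) = push_measure X Lambda v + push_measure X Lambda w"
 by (simp add: push_measure_def fun_eq_iff)

lemma push_measure_compose:
 assumes "Lambda : additive_maps X Y"
 shows "push_measure X Lambda (push_measure Y Lambda' v) = push_measure X (Lambda' o Lambda) v"
 using assms by (auto simp: push_measure_def fun_eq_iff additive_maps_def)

lemma push_measure_id: "v : null_measures X ==> push_measure X (%g. g) v = v"
 by (auto simp: push_measure_def fun_eq_iff null_measures_outside)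

lemma push_measure_cong:
 "(!!g. g : cont_int X ==> Lambda g = Lambda' g) ==> push_measure X Lambda v = push_measure X Lambda' v"
 by (auto simp: push_measure_def intro!: ext)

section \<open>Dual bases from trees of retractions\<close>

text \<open>The functionals \<open>rho\<close> embed the group of functions in the finitely
  supported sequences, and \<open>iota\<close> provides a left inverse. Vanishing members are
  allowed, so finite and infinite spaces are treated alike.\<close>

definition dual_basis :: "'a topology => (nat => ('a => int) => int) => (nat => 'a => int) => bool" where
 "dual_basis X rho iota \<longleftrightarrow> rho : null_measures X & (ALL n. iota n : cont_int X) &
   (ALL g:cont_int X. ALL x. g x = (\<Sum>n | rho n g ~= 0. iota n x * rho n g))"

text \<open>Step \<open>k\<close> alters the finite-valued map \<open>r k\<close> only on
  \<open>U k\<close>, a clopen part of the fibre over \<open>q k\<close>, which is sent to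
  \<open>p k\<close> instead. Hence g(r (k+1) s) - g(r k s) is g(p k) - g(q k) for \<open>s\<close>
  in \<open>U k\<close> and 0 elsewhere, and \<open>r_clopen\<close> makes these differences
  telescope to \<open>g\<close>. Idle steps have \<open>U k\<close> empty and
  \<open>p k = q k\<close>.\<close>

locale retraction_tree =
 fixes X :: "'a topology" and b :: 'a and r :: "nat => 'a => 'a" and p q :: "nat => 'a" and U :: "nat => 'a set"
 assumes light: "light_profinite X" and b: "b : topspace X"
  and p: "p k : topspace X" and q: "q k : topspace X" and U: "clopenin X (U k)"
  and r_0: "s : topspace X ==> r 0 s = b"
  and r_Suc: "s : topspace X ==> r (Suc k) s = (if s : U k then p k else r k s)"
  and r_U: "s : U k ==> r k s = q k"
  and U_empty: "U k = {} ==> p k = q k"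
  and r_clopen: "clopenin X W ==> \<forall>\<^sub>F k in sequentially. ALL s:topspace X. r k s : W \<longleftrightarrow> s : W"
begin

lemma r_in: "s : topspace X ==> r k s : topspace X" by (induction k) (auto simp: r_0 r_Suc b p)

lemma clopenin_r: "clopenin X {s : topspace X. r k s = a}"
proof (induction k arbitrary: a)
 case 0
 have "{s : topspace X. r 0 s = a} = {s : topspace X. b = a}" by (auto simp: r_0)
 thus ?case by (simp add: clopenin_const)
next
 case (Suc k)
 have "{s : topspace X. r (Suc k) s = a} =
   (U k Int {s : topspace X. p k = a}) Un ({s : topspace X. r k s = a} - U k)"
  using clopenin_subset[OF U[of k]] by (auto simp: r_Suc)
 thus ?case using Suc U by (simp add: clopenin_Un clopenin_Int clopenin_Diff clopenin_const)
qed

lemma finite_r: "finite (r k ` topspace X)"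
proof (induction k)
 case 0
 show ?case by (rule finite_subset[of _ "{b}"]) (auto simp: r_0)
next
 case (Suc k)
 show ?case by (rule finite_subset[of _ "insert (p k) (r k ` topspace X)"]) (auto simp: r_Suc Suc)
qed

lemma clopenin_r_set: "clopenin X {s : topspace X. r k s : W}"
proof -
 have "{s : topspace X. r k s : W} = (\<Union>a\<in>W Int r k ` topspace X. {s : topspace X. r k s = a})"
  by auto
 thus ?thesis using clopenin_r finite_r by (auto intro: clopenin_UN)
qed

text \<open>For \<open>s\<close> in \<open>U k\<close> the points \<open>p k\<close> and
  \<open>q k\<close> are \<open>r (Suc k) s\<close> and \<open>r k s\<close>, and for large
  \<open>k\<close> both lie on the same side of \<open>W\<close> as \<open>s\<close>.\<close>

lemma pq_clopen:
 assumes "clopenin X W"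
 shows "\<forall>\<^sub>F k in sequentially. p k : W \<longleftrightarrow> q k : W"
 using r_clopen[OF assms] eventually_sequentially_Suc[THEN iffD2, OF r_clopen[OF assms]]
proof eventually_elim
 case (elim k)
 show ?case
 proof (cases "U k = {}")
  case False
  then obtain s where s: "s : U k" by blast
  moreover have "s : topspace X" using s clopenin_subset[OF U] by blast
  ultimately show ?thesis using elim r_Suc[of s k] r_U[of s k] by metis
 qed (simp add: U_empty)
qed

lemma r_fun:
 assumes "g : cont_int X"
 shows "\<forall>\<^sub>F k in sequentially. ALL s:topspace X. g (r k s) = g s"
proof -
 have "\<forall>\<^sub>F k in sequentially. ALL a:g ` topspace X. ALL s:topspace X.
   r k s : {x : topspace X. g x = a} \<longleftrightarrow> s : {x : topspace X. g x = a}"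
  using cont_int_finite_range[OF light_profinite_compact[OF light] assms] r_clopen cont_int_clopenin[OF assms]
  by (intro eventually_ball_finite) blast+
 thus ?thesis by eventually_elim (auto simp: r_in)
qed

lemma pq_fun:
 assumes "g : cont_int X"
 shows "\<forall>\<^sub>F k in sequentially. g (p k) = g (q k)"
proof -
 have "\<forall>\<^sub>F k in sequentially. ALL a:g ` topspace X.
   p k : {x : topspace X. g x = a} \<longleftrightarrow> q k : {x : topspace X. g x = a}"
  using cont_int_finite_range[OF light_profinite_compact[OF light] assms] pq_clopen cont_int_clopenin[OF assms]
  by (intro eventually_ball_finite) blast+
 thus ?thesis by eventually_elim (use p q in auto)
qed

text \<open>Index 0 belongs to the base point and index \<open>Suc k\<close> to step
  \<open>k\<close>. The same shift reappears as \<open>m - 1\<close> in the indexing of retractions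
  over \<open>Nbar\<close>.\<close>

definition iota :: "nat => 'a => int" where
 "iota n = (case n of 0 => indicat (topspace X) | Suc k => indicat (U k))"

definition rho :: "nat => ('a => int) => int" where
 "rho n g = (if g : cont_int X then case n of 0 => g b | Suc k => g (p k) - g (q k) else 0)"

lemma iota_cont_int: "iota n : cont_int X" by (cases n) (simp_all add: iota_def indicat_cont_int U)

lemma rho_null: "rho : null_measures X" unfolding null_measures_def
proof (safe)
 show "additive_on (cont_int X) (rho n)" for n
  by (cases n) (simp_all add: additive_on_def rho_def add_subgroup_add)
 fix g assume g: "g : cont_int X"
 then obtain N where N: "!!k. k >= N ==> g (p k) = g (q k)"
  using pq_fun[OF g] by (auto simp: eventually_sequentially)
 have "rho n g = 0" if "n >= Suc N" for n using that N g by (cases n) (auto simp: rho_def)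
 thus "EX N. ALL n>=N. rho n g = 0" by blast
qed (simp add: rho_def)

text \<open>The sum telescopes: the term with index \<open>Suc k\<close> is the change of
  \<open>g\<close> from \<open>r k s\<close> to \<open>r (Suc k) s\<close>, and the term with index
  0 is the value at the base point.\<close>

lemma partial_sum:
 assumes "g : cont_int X" "s : topspace X"
 shows "(\<Sum>n<Suc k. iota n s * rho n g) = g (r k s)"
proof (induction k)
 case 0
 show ?case using assms by (simp add: iota_def rho_def r_0 indicat_def)
next
 case (Suc k)
 have "(\<Sum>n<Suc (Suc k). iota n s * rho n g) = g (r k s) + iota (Suc k) s * rho (Suc k) g"
  using Suc by simp
 also have "... = g (r (Suc k) s)" using assms r_U[of s k] by (simp add: iota_def rho_def r_Suc indicat_def)
 finally show ?case .
qed

lemma dual_basis: "dual_basis X rho iota" unfolding dual_basis_def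
proof (intro conjI ballI allI)
 fix g x assume g: "g : cont_int X"
 show "g x = (\<Sum>n | rho n g ~= 0. iota n x * rho n g)"
 proof (cases "x : topspace X")
  case True
  obtain N where N: "!!n. n >= N ==> rho n g = 0" using null_measures_bound[OF rho_null] by blast
  obtain M where M: "!!k. k >= M ==> g (r k x) = g x"
   using r_fun[OF g] True by (auto simp: eventually_sequentially)
  have "(\<Sum>n | rho n g ~= 0. iota n x * rho n g) = (\<Sum>n<Suc (max N M). iota n x * rho n g)"
   by (rule sum_support_bound) (use N in auto)
  also have "... = g x" using partial_sum[OF g True] M by simp
  finally show ?thesis ..
 qed (use g in \<open>simp add: cont_int_outside cont_int_outside[OF iota_cont_int]\<close>)
qed (rule rho_null iota_cont_int)+

text \<open>Uniform convergence of \<open>r k\<close> to the identity, packed into one continuous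
  map that is the identity at infinity. Pulling a section back along it produces the null sequence
  of its approximations.\<close>

lemma continuous_map_r:
 "continuous_map (prod_topology X Nbar) X (%z. case snd z of None => fst z | Some k => r k (fst z))"
proof (rule continuous_map_into_light_profinite[OF light])
 let ?P = "prod_topology X Nbar"
 let ?R = "%z. case snd z of None => fst z | Some k => r k (fst z)"
 show "?R ` topspace ?P <= topspace X" by (auto simp: r_in split: option.split)
 fix W assume W: "clopenin X W"
 \<comment> \<open>The preimage of \<open>W\<close> differs from the cylinder
   \<open>fst z : W\<close> exactly on \<open>?D\<close>, a condition that fails at infinity and
   beyond a uniform bound.\<close>
 let ?D = "%s a. EX k. a = Some k & (r k s : W) ~= (s : W)"
 obtain N where N: "!!k s. k >= N ==> s : topspace X ==> r k s : W \<longleftrightarrow> s : W"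
  using r_clopen[OF W] by (auto simp: eventually_sequentially)
 have "clopenin ?P {z : topspace ?P. ?D (fst z) (snd z)}"
 proof (rule clopenin_prod_Nbar[where N = N])
  show "clopenin X {s : topspace X. ?D s (Some m)}" for m
  proof -
   have "{s : topspace X. ?D s (Some m)} = ({s : topspace X. r m s : W} - W) Un (W - {s : topspace X. r m s : W})"
    using clopenin_subset[OF W] by auto
   thus ?thesis using W clopenin_r_set by (simp add: clopenin_Un clopenin_Diff)
  qed
 qed (use N not_le in blast)+
 moreover have "clopenin ?P {z : topspace ?P. fst z : W}"
  using clopenin_vimage[OF continuous_map_fst W] by blast
 moreover have "{z : topspace ?P. ?R z : W} = ({z : topspace ?P. fst z : W} - {z : topspace ?P. ?D (fst z) (snd z)})
   Un ({z : topspace ?P. ?D (fst z) (snd z)} - {z : topspace ?P. fst z : W})"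
  by (auto split: option.splits)
 ultimately show "clopenin ?P {z : topspace ?P. ?R z : W}" by (simp only: clopenin_Un clopenin_Diff)
qed

end

text \<open>These are the values over which the fibre is not contained in one side of
  \<open>W\<close>; there are none exactly when \<open>W\<close> is a union of fibres.\<close>

definition bad_fibres :: "'a topology => ('a => 'a) => 'a set => 'a set" where
 "bad_fibres X r W = {c : r ` topspace X. EX s:topspace X. r s = c & (s : W) ~= (c : W)}"

definition finite_retraction :: "'a topology => ('a => 'a) => bool" where
 "finite_retraction X r \<longleftrightarrow> (ALL s:topspace X. r s : topspace X & r (r s) = r s) &
   finite (r ` topspace X) & (ALL a. clopenin X {s : topspace X. r s = a})"

definition split_fibre :: "'a topology => ('a => 'a) => 'a => 'a => 'a set => ('a => 'a) => bool" where
 "split_fibre X r p q U r' \<longleftrightarrow> p : topspace X & q : topspace X & clopenin X U & (ALL s:U. r s = q) &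
   (U = {} --> p = q) & r' = (%s. if s : U then p else r s)"

text \<open>A step splits a bad fibre of the first set in the list that is not yet a union of fibres.\<close>

definition refining_step :: "'a topology => (nat => 'a set) => ('a => 'a) => ('a => 'a) => bool" where
 "refining_step X V r r' \<longleftrightarrow> (EX p q U. split_fibre X r p q U r') &
   (ALL j. bad_fibres X r (V j) = {} --> bad_fibres X r' (V j) = {}) &
   (ALL j. (ALL i<j. bad_fibres X r (V i) = {}) --> bad_fibres X r (V j) ~= {} -->
    card (bad_fibres X r' (V j)) < card (bad_fibres X r (V j)))"

lemma bad_fibres_empty_iff:
 "bad_fibres X r W = {} \<longleftrightarrow> (ALL s:topspace X. r s : W \<longleftrightarrow> s : W)"
proof
 assume empty: "bad_fibres X r W = {}"
 show "ALL s:topspace X. r s : W \<longleftrightarrow> s : W"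
 proof (rule ballI, rule ccontr)
  fix s assume "s : topspace X" "(r s : W) ~= (s : W)"
  hence "r s : bad_fibres X r W" unfolding bad_fibres_def by blast
  thus False using empty by blast
 qed
next
 assume *: "ALL s:topspace X. r s : W \<longleftrightarrow> s : W"
 have "c ~: bad_fibres X r W" for c
 proof
  assume "c : bad_fibres X r W"
  then obtain s where "s : topspace X" "r s = c" "(s : W) ~= (c : W)" unfolding bad_fibres_def by blast
  thus False using * by metis
 qed
 thus "bad_fibres X r W = {}" by blast
qed

lemma refining_step_exists:
 assumes V: "!!n. clopenin X (V n)" and r: "finite_retraction X r" and b: "b : topspace X"
 obtains r' where "finite_retraction X r'" "refining_step X V r r'"
proof (cases "EX j. bad_fibres X r (V j) ~= {}")
 case False
 have "split_fibre X r b b {} r" using b by (simp add: split_fibre_def)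
 hence "EX p q U. split_fibre X r p q U r" by blast
 hence "refining_step X V r r" using False by (simp add: refining_step_def)
 with r show ?thesis by (rule that)
next
 case True
 define j where "j = (LEAST j. bad_fibres X r (V j) ~= {})"
 have least: "bad_fibres X r (V i) = {}" if "i < j" for i
  using not_less_Least[OF that[unfolded j_def]] by blast
 have j: "bad_fibres X r (V j) ~= {}" unfolding j_def by (rule LeastI_ex[OF True])
 then obtain q where q: "q : bad_fibres X r (V j)" by blast
 then obtain p where p: "p : topspace X" "r p = q" "(p : V j) ~= (q : V j)" unfolding bad_fibres_def by blast
 have rr: "r s : topspace X" "r (r s) = r s" if "s : topspace X" for s
  using r that by (auto simp: finite_retraction_def)
 have qX: "q : topspace X" "r q = q" using p rr by auto
 \<comment> \<open>The part of the fibre over \<open>q\<close> on the other side of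
   \<open>V j\<close>. It contains \<open>p\<close> but not \<open>q\<close>, so that sending it to
   \<open>p\<close> again gives a retraction.\<close>
 define U where "U = {s : topspace X. r s = q & (s : V j) ~= (q : V j)}"
 define r' where "r' = (%s. if s : U then p else r s)"
 have pU: "p : U" and qU: "q ~: U" using p by (auto simp: U_def)
 have clU: "clopenin X U"
 proof -
  have "U = {s : topspace X. r s = q} Int (if q : V j then topspace X - V j else V j)"
   using clopenin_subset[OF V] by (auto simp: U_def)
  thus ?thesis using r V by (auto simp: finite_retraction_def clopenin_Int clopenin_Diff)
 qed
 have UX: "s : topspace X" "r s = q" if "s : U" for s using that by (auto simp: U_def)
 have rU: "r s ~: U" if "s : topspace X" for s using that rr qU by (auto simp: U_def)
 have "finite_retraction X r'" unfolding finite_retraction_def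
 proof (intro conjI ballI allI)
  fix s assume s: "s : topspace X"
  show "r' s : topspace X" "r' (r' s) = r' s" using s pU rU rr p by (auto simp: r'_def)
 next
  have "r' ` topspace X <= insert p (r ` topspace X)" by (auto simp: r'_def)
  thus "finite (r' ` topspace X)" using r by (metis finite_insert finite_subset finite_retraction_def)
  fix a
  have "{s : topspace X. r' s = a} = (U Int {s : topspace X. p = a}) Un ({s : topspace X. r s = a} - U)"
   using UX by (auto simp: r'_def)
  thus "clopenin X {s : topspace X. r' s = a}"
   using r clU by (simp add: finite_retraction_def clopenin_Un clopenin_Int clopenin_Diff clopenin_const)
 qed
 moreover have "refining_step X V r r'" unfolding refining_step_def
 proof (intro conjI allI impI)
  have "split_fibre X r p q U r'" using p qX clU UX pU by (auto simp: split_fibre_def r'_def)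
  thus "EX p q U. split_fibre X r p q U r'" by blast
 next
  fix i assume "bad_fibres X r (V i) = {}"
  hence *: "r s : V i \<longleftrightarrow> s : V i" if "s : topspace X" for s
   using that by (simp add: bad_fibres_empty_iff)
  \<comment> \<open>A set that is a union of fibres contains both or neither of \<open>p\<close> and
    \<open>q\<close>, since \<open>r p = q\<close>; moving points from \<open>q\<close> to
    \<open>p\<close> does not disturb it.\<close>
  have "r' s : V i \<longleftrightarrow> s : V i" if "s : topspace X" for s
   using *[OF that] *[OF p(1)] p(2) UX(2)[of s] by (auto simp: r'_def)
  thus "bad_fibres X r' (V i) = {}" by (simp add: bad_fibres_empty_iff)
 next
  fix i assume i: "ALL l<i. bad_fibres X r (V l) = {}" "bad_fibres X r (V i) ~= {}"
  hence "i = j" using j least by (metis linorder_neqE_nat)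
  have "bad_fibres X r' (V j) <= bad_fibres X r (V j) - {q}"
  proof
   fix c assume "c : bad_fibres X r' (V j)"
   then obtain s where s: "s : topspace X" "r' s = c" "(s : V j) ~= (c : V j)"
    unfolding bad_fibres_def by auto
   \<comment> \<open>All of \<open>U\<close> lies on the same side of \<open>V j\<close> as
     \<open>p\<close>, so the new fibre over \<open>p\<close> gets no bad point from
     \<open>U\<close>.\<close>
   have "s ~: U" using s p by (auto simp: r'_def U_def)
   hence "r s = c" "c ~= q" using s by (auto simp: r'_def U_def)
   thus "c : bad_fibres X r (V j) - {q}" using s unfolding bad_fibres_def by blast
  qed
  hence "bad_fibres X r' (V j) \<subset> bad_fibres X r (V j)" using q by blast
  moreover have "finite (bad_fibres X r (V j))" using r by (auto simp: bad_fibres_def finite_retraction_def)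
  ultimately show "card (bad_fibres X r' (V i)) < card (bad_fibres X r (V i))"
   using `i = j` by (simp add: psubset_card_mono)
 qed
 ultimately show ?thesis by (rule that)
qed

text \<open>The number of bad fibres of the first unresolved set \<open>V j\<close> drops at every
  step and resolved sets stay resolved, so each initial segment of the separating family is resolved
  eventually. Every clopen set depends on such a segment by
  \<open>separating_determines\<close>.\<close>

theorem retraction_tree_exists:
 fixes X :: "'a topology"
 assumes X: "light_profinite X" and b: "b : topspace X"
 obtains r p q U where "retraction_tree X b r p q U"
proof -
 obtain V where V: "separating X V" using X by (auto simp: light_profinite_def)
 have clV: "!!n. clopenin X (V n)" using V by (simp add: separating_def)
 have "EX f. ALL n. (finite_retraction X (f n) & (n = 0 --> f n = (%_. b))) & refining_step X V (f n) (f (Suc n))"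
 proof (rule dependent_nat_choice)
  have "(%_. b) ` topspace X <= {b}" by auto
  hence "finite ((%_. b) ` topspace X)" by (rule finite_subset) simp
  hence "finite_retraction X (%_. b)" using b clopenin_const[of X] by (simp add: finite_retraction_def)
  thus "EX r. finite_retraction X r & (0 = (0::nat) --> r = (%_. b))" by blast
 next
  fix r and n :: nat assume "finite_retraction X r & (n = 0 --> r = (%_. b))"
  then obtain r' where "finite_retraction X r'" "refining_step X V r r'"
   using refining_step_exists[where V = V, OF clV _ b] by metis
  thus "EX r'. (finite_retraction X r' & (Suc n = 0 --> r' = (%_. b))) & refining_step X V r r'" by blast
 qed
 then obtain r where r: "!!n. finite_retraction X (r n)" "r 0 = (%_. b)" "!!n. refining_step X V (r n) (r (Suc n))"
  by auto
 have "ALL n. EX p q U. split_fibre X (r n) p q U (r (Suc n))" using r(3) by (simp add: refining_step_def)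
 then obtain p q U where pqU: "!!n. split_fibre X (r n) (p n) (q n) (U n) (r (Suc n))" by metis
 let ?B = "%n j. bad_fibres X (r n) (V j)"
 have mono: "?B m j = {}" if "?B n j = {}" "n <= m" for n m j using that(2)
 proof (induction m rule: dec_induct)
  case (step m)
  thus ?case using r(3)[of m] by (simp add: refining_step_def)
 qed (fact that(1))
 have resolve: "EX m>=n. ?B m j = {}" if "!!i. i < j ==> ?B n i = {}" for n j using that
 proof (induction "card (?B n j)" arbitrary: n rule: less_induct)
  case less
  show ?case
  proof (cases "?B n j = {}")
   case False
   have "card (?B (Suc n) j) < card (?B n j)"
    using r(3)[of n] False less.prems unfolding refining_step_def by blast
   moreover have "?B (Suc n) i = {}" if "i < j" for i
    using mono[OF less.prems[OF that], of "Suc n"] by simp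
   ultimately have "EX m>=Suc n. ?B m j = {}" by (rule less.hyps)
   thus ?thesis using Suc_leD by blast
  qed blast
 qed
 have all: "EX n. ALL i<j. ?B n i = {}" for j
 proof (induction j)
  case (Suc j)
  then obtain n where n: "!!i. i < j ==> ?B n i = {}" by blast
  then obtain m where m: "m >= n" "?B m j = {}" using resolve by blast
  have "?B m i = {}" if "i < Suc j" for i using that n m mono by (metis less_Suc_eq)
  thus ?case by blast
 qed simp
 have "retraction_tree X b r p q U"
 proof
  fix W assume W: "clopenin X W"
  have "locally_constant X (%x. x : W)"
   using continuous_map_discrete_restrict[OF W, of "%_. True" "%_. False"]
   by (rule back_subst[of "locally_constant X"]) auto
  then obtain N where N: "!!x y. [|x : topspace X; y : topspace X; !!i. i < N ==> x : V i \<longleftrightarrow> y : V i|] ==> x : W \<longleftrightarrow> y : W"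
   using separating_determines[OF light_profinite_compact[OF X] V, of "%x. x : W"] by metis
  obtain n where n: "!!i. i < N ==> ?B n i = {}" using all by blast
  have "r k s : W \<longleftrightarrow> s : W" if "k >= n" "s : topspace X" for k s
  proof (rule N)
   show "r k s : topspace X" using r(1)[of k] that by (simp add: finite_retraction_def)
   show "r k s : V i \<longleftrightarrow> s : V i" if "i < N" for i
    using mono[OF n[OF that] `k >= n`] `s : topspace X` by (simp add: bad_fibres_empty_iff)
  qed fact
  thus "\<forall>\<^sub>F k in sequentially. ALL s:topspace X. r k s : W \<longleftrightarrow> s : W"
   unfolding eventually_sequentially by blast
 next
  fix k s
  show "r (Suc k) s = (if s : U k then p k else r k s)" using pqU[of k] by (simp add: split_fibre_def)
 qed (use X b pqU r(2) in \<open>auto simp: split_fibre_def\<close>)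
 thus thesis by (rule that)
qed

lemma dual_basis_exists:
 assumes "light_profinite X"
 obtains rho iota where "dual_basis X rho iota"
proof (cases "topspace X = {}")
 case True
 have "dual_basis X 0 0" using True by (auto simp: dual_basis_def add_subgroup_0 cont_int_outside)
 thus thesis by (rule that)
next
 case False
 then obtain b where "b : topspace X" by blast
 then obtain r p q U where "retraction_tree X b r p q U" using retraction_tree_exists[OF assms] by metis
 thus thesis using retraction_tree.dual_basis that by metis
qed

section \<open>Splitting exact sequences of groups of functions\<close>

text \<open>The image of \<open>d\<close> is a subgroup of the finitely supported sequences. Subtracting suitable
 multiples of elements whose leading coefficients generate the ideals of leading coefficients
 kills the coordinates of \<open>d g\<close> one by one from the top.\<close>

lemma kernel_retraction:
 fixes G :: "('a => int) set" and d :: "('a => int) => nat => int"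
 assumes G: "add_subgroup G" and d: "additive_on G d"
  and fin: "!!g. g : G ==> EX N. ALL n>=N. d g n = 0"
 obtains P where "additive_on G P" "!!g. g : G ==> P g : G" "!!g. g : G ==> d (P g) = 0"
  "!!g. g : G ==> d g = 0 ==> P g = g"
proof -
 have dn: "additive_on G (%g. d g n)" for n using d by (simp add: additive_on_def)
 have scale: "d (%x. c * g x) n = c * d g n" if "g : G" for c g n using additive_on_int_scale[OF dn G that] .
 define H where "H N = {g : G. ALL i>=N. d g i = 0}" for N
 have HG: "g : G" if "g : H N" for g N using that by (simp add: H_def)
 have H_sub: "add_subgroup (H N)" for N unfolding add_subgroup_def
  using additive_on_0[OF d G] additive_on_diff[OF d G] G
  by (auto simp: H_def add_subgroup_0 add_subgroup_diff)
 \<comment> \<open>A generator of the ideal of \<open>n\<close>-th coordinates on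
   \<open>H (Suc n)\<close>: a nonzero value of least absolute value divides all others, by division
   with remainder. If all values vanish, 0 serves.\<close>
 have "EX gamma:H (Suc n). ALL g:H (Suc n). d gamma n dvd d g n" for n
 proof (cases "EX g:H (Suc n). d g n ~= 0")
  case False
  thus ?thesis using add_subgroup_0[OF H_sub] by (intro bexI[of _ 0]) auto
 next
  case True
  define m where "m = (LEAST m. EX g:H (Suc n). d g n ~= 0 & nat \<bar>d g n\<bar> = m)"
  have "EX m. EX g:H (Suc n). d g n ~= 0 & nat \<bar>d g n\<bar> = m" using True by blast
  hence "EX g:H (Suc n). d g n ~= 0 & nat \<bar>d g n\<bar> = m" unfolding m_def by (rule LeastI_ex)
  then obtain gamma where gamma: "gamma : H (Suc n)" "d gamma n ~= 0" "nat \<bar>d gamma n\<bar> = m"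
   by blast
  have "d gamma n dvd d g n" if g: "g : H (Suc n)" for g
  proof (rule ccontr)
   assume "~ d gamma n dvd d g n"
   hence mod: "d g n mod d gamma n ~= 0" by (simp add: dvd_eq_mod_eq_0)
   define h where "h = g - (%x. (d g n div d gamma n) * gamma x)"
   have hH: "h : H (Suc n)"
    unfolding h_def using g gamma(1) H_sub by (intro add_subgroup_diff add_subgroup_int_scale)
   have "d h n = d g n - (d g n div d gamma n) * d gamma n"
    unfolding h_def using additive_on_diff[OF dn G HG[OF g] add_subgroup_int_scale[OF G HG[OF gamma(1)]]]
     scale[OF HG[OF gamma(1)]] by simp
   also have "... = d g n mod d gamma n" by (simp add: minus_div_mult_eq_mod)
   finally have dh: "d h n = d g n mod d gamma n" .
   hence "m <= nat \<bar>d h n\<bar>" unfolding m_def using hH mod by (intro Least_le bexI[of _ h]) auto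
   moreover have "\<bar>d h n\<bar> < \<bar>d gamma n\<bar>"
    unfolding dh using gamma(2) abs_mod_less by blast
   ultimately show False using gamma(3) by linarith
  qed
  thus ?thesis using gamma(1) by blast
 qed
 then obtain gamma where gamma: "!!n. gamma n : H (Suc n)" "!!n g. g : H (Suc n) ==> d (gamma n) n dvd d g n"
  by metis
 have gammaG: "gamma n : G" for n using gamma(1) HG by blast
 define red where "red n g = g - (%x. (d g n div d (gamma n) n) * gamma n x)" for n g
 have d_red: "d (red n g) i = d g i - (d g n div d (gamma n) n) * d (gamma n) i" if "g : G" for n g i
  unfolding red_def using additive_on_diff[OF dn G that add_subgroup_int_scale[OF G gammaG]] scale[OF gammaG] by simp
 have red_H: "red n g : H n" if g: "g : H (Suc n)" for n g
 proof -
  have "red n g : H (Suc n)"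
   unfolding red_def using g gamma(1) H_sub by (intro add_subgroup_diff add_subgroup_int_scale)
  moreover have "d (red n g) n = 0" using d_red[OF HG[OF g]] gamma(2)[OF g] by simp
  ultimately show ?thesis by (auto simp: H_def) (metis Suc_leI le_neq_implies_less)
 qed
 have red_add: "red n (g + h) = red n g + red n h" if gh: "g : H (Suc n)" "h : H (Suc n)" for n g h
 proof -
  have "d (g + h) n = d g n + d h n" using additive_on_add[OF dn HG[OF gh(1)] HG[OF gh(2)]] .
  moreover have "(d g n + d h n) div d (gamma n) n = d g n div d (gamma n) n + d h n div d (gamma n) n"
   using gamma(2)[OF gh(1)] by (rule div_plus_div_distrib_dvd_left)
  ultimately show ?thesis by (simp add: red_def fun_eq_iff algebra_simps)
 qed
 have red_id: "red n g = g" if "d g n = 0" for n g using that by (simp add: red_def fun_eq_iff)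
 \<comment> \<open>\<open>R n\<close> clears the coordinates \<open>n - 1\<close> down to 0, so it
   maps \<open>H n\<close> into \<open>H 0\<close>, the kernel of \<open>d\<close>.\<close>
 define R where "R = rec_nat (%g. g) (%n R g. R (red n g))"
 have R_0: "R 0 g = g" and R_Suc: "R (Suc n) g = R n (red n g)" for n g by (simp_all add: R_def)
 have R_H: "R n g : H 0" if "g : H n" for n g
  using that by (induction n arbitrary: g) (auto simp: R_0 R_Suc red_H)
 have R_add: "R n (g + h) = R n g + R n h" if "g : H n" "h : H n" for n g h
  using that by (induction n arbitrary: g h) (auto simp: R_0 R_Suc red_add red_H)
 \<comment> \<open>Coordinates that already vanish are left alone by \<open>red\<close>. The
   reduction may therefore start at any sufficiently large index, and two elements can be reduced
   from a common one.\<close>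
 have R_mono: "R m g = R n g" if "g : H n" "n <= m" for n m g using that(2)
 proof (induction m rule: dec_induct)
  case (step m)
  have "d g m = 0" using that(1) step by (simp add: H_def)
  thus ?case using step by (simp add: R_Suc red_id)
 qed simp
 have ex: "EX n. g : H n" if "g : G" for g using fin[OF that] that by (auto simp: H_def)
 define P where "P g = R (LEAST n. g : H n) g" for g
 have P: "P g = R n g" if "g : H n" for g n
  unfolding P_def using R_mono[of g "LEAST n. g : H n" n] LeastI[of "%n. g : H n", OF that] Least_le[of "%n. g : H n", OF that] by simp
 show thesis
 proof (rule that[of P])
  show "additive_on G P" unfolding additive_on_def
  proof (intro ballI)
   fix g h assume "g : G" "h : G"
   then obtain n m where "g : H n" "h : H m" using ex by meson
   hence "g : H (max n m)" "h : H (max n m)" by (auto simp: H_def)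
   moreover from this have "g + h : H (max n m)" by (rule add_subgroup_add[OF H_sub])
   ultimately show "P (g + h) = P g + P h" using P R_add by metis
  qed
  fix g assume g: "g : G"
  then obtain n where n: "g : H n" using ex by blast
  hence "P g : H 0" using P R_H by simp
  thus "P g : G" "d (P g) = 0" by (auto simp: H_def fun_eq_iff)
  show "P g = g" if "d g = 0" using P[of g 0] g that by (simp add: H_def R_0)
 qed
qed

text \<open>Here \<open>d\<close> and \<open>d'\<close> are sequence-valued stand-ins for
  \<open>delta\<close> and for the next map of the complex. \<open>kernel_retraction\<close> gives
  projections \<open>P\<close> onto the kernel and \<open>P'\<close> onto the image of
  \<open>delta\<close>. The chosen preimage \<open>c h\<close> of \<open>P' h\<close> need not be
  additive in \<open>h\<close>, but \<open>c h - P (c h)\<close> depends only on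
  \<open>delta (c h)\<close>, and so \<open>K\<close> is additive.\<close>

lemma exact_splitting:
 fixes G :: "('a => int) set" and G' :: "('b => int) set"
  and d :: "('a => int) => nat => int" and d' :: "('b => int) => nat => int"
 assumes G: "add_subgroup G" and G': "add_subgroup G'"
  and delta: "additive_on G delta" "!!g. g : G ==> delta g : G'"
  and d: "additive_on G d" "!!g. g : G ==> EX N. ALL n>=N. d g n = 0" "!!g. g : G ==> d g = 0 \<longleftrightarrow> delta g = 0"
  and d': "additive_on G' d'" "!!h. h : G' ==> EX N. ALL n>=N. d' h n = 0" "!!h. h : G' ==> d' h = 0 \<longleftrightarrow> h : delta ` G"
 obtains K where "additive_on G' K" "!!h. h : G' ==> K h : G" "!!g. g : G ==> delta (K (delta g)) = delta g"
proof -
 obtain P where P: "additive_on G P" "!!g. g : G ==> P g : G" "!!g. g : G ==> d (P g) = 0"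
   "!!g. g : G ==> d g = 0 ==> P g = g"
  by (rule kernel_retraction[OF G d(1)], erule d(2), rule that, assumption+)
 obtain P' where P': "additive_on G' P'" "!!g. g : G' ==> P' g : G'" "!!g. g : G' ==> d' (P' g) = 0"
   "!!g. g : G' ==> d' g = 0 ==> P' g = g"
  by (rule kernel_retraction[OF G' d'(1)], erule d'(2), rule that, assumption+)
 define c where "c h = (SOME g. g : G & delta g = P' h)" for h
 have c: "c h : G & delta (c h) = P' h" if "h : G'" for h
 proof -
  have "P' h : delta ` G" using d'(3)[OF P'(2)[OF that]] P'(3)[OF that] by simp
  hence "EX g. g : G & delta g = P' h" by (metis imageE)
  thus ?thesis unfolding c_def by (rule someI_ex)
 qed
 have P_eq: "g - P g = g' - P g'" if "g : G" "g' : G" "delta g = delta g'" for g g'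
 proof -
  have "delta (g - g') = 0" using additive_on_diff[OF delta(1) G] that by simp
  hence "P (g - g') = g - g'" using P(4) d(3) add_subgroup_diff[OF G that(1,2)] by simp
  hence "P g - P g' = g - g'" using additive_on_diff[OF P(1) G that(1,2)] by simp
  thus ?thesis by (simp add: algebra_simps)
 qed
 define K where "K h = c h - P (c h)" for h
 show thesis
 proof (rule that[of K])
  show "additive_on G' K" unfolding additive_on_def
  proof (intro ballI)
   fix h k assume hk: "h : G'" "k : G'"
   note hk' = add_subgroup_add[OF G' hk]
   have "delta (c (h + k)) = delta (c h + c k)"
    using c[OF hk(1)] c[OF hk(2)] c[OF hk'] additive_on_add[OF delta(1)] additive_on_add[OF P'(1) hk] by simp
   hence "K (h + k) = (c h + c k) - P (c h + c k)"
    unfolding K_def using c[OF hk(1)] c[OF hk(2)] c[OF hk'] by (intro P_eq) (auto simp: add_subgroup_add[OF G])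
   thus "K (h + k) = K h + K k"
    unfolding K_def using c[OF hk(1)] c[OF hk(2)] additive_on_add[OF P(1)] by simp
  qed
  show "K h : G" if "h : G'" for h
   unfolding K_def using c[OF that] P(2) by (simp add: add_subgroup_diff[OF G])
  fix g assume g: "g : G"
  hence "d' (delta g) = 0" using d'(3) delta(2) by blast
  hence cdelta: "delta (c (delta g)) = delta g" "c (delta g) : G" using c delta(2)[OF g] P'(4) by auto
  hence "K (delta g) = g - P g" unfolding K_def by (intro P_eq g)
  moreover have "delta (P g) = 0" using P(2,3) d(3) g by blast
  ultimately show "delta (K (delta g)) = delta g" using additive_on_diff[OF delta(1) G g] P(2) g by simp
 qed
qed

text \<open>By the expansion in a dual basis a function is determined by its coefficients. This
  supplies the maps into finitely supported sequences on which the splitting lemmas operate.\<close>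

lemma cont_int_embedding:
 assumes "light_profinite X"
 obtains rho where "rho : null_measures X" "ALL g:cont_int X. (%n. rho n g) = 0 \<longleftrightarrow> g = 0"
proof -
 obtain rho iota where "dual_basis X rho iota" using dual_basis_exists[OF assms] .
 hence rho: "rho : null_measures X" and g: "!!g x. g : cont_int X ==> g x = (\<Sum>n | rho n g ~= 0. iota n x * rho n g)"
  by (simp_all add: dual_basis_def)
 show thesis
 proof (rule that[OF rho], intro ballI iffI)
  fix h assume h: "h : cont_int X" "(%n. rho n h) = 0"
  show "h = 0" using g[OF h(1)] fun_cong[OF h(2)] by (intro ext) simp
 next
  fix h assume "h : cont_int X" "h = (0 :: 'a => int)"
  thus "(%n. rho n h) = 0"
   using additive_on_0[OF null_measures_additive[OF rho] add_subgroup_cont_int] by (intro ext) simp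
 qed
qed

section \<open>Descent of continuous functions along surjections\<close>

lemma additive_on_plus: "additive_on G f ==> additive_on G g ==> additive_on G (%x. f x + g x)"
 by (simp add: additive_on_def algebra_simps)

lemma additive_on_minus: "additive_on G f ==> additive_on G g ==> additive_on G (%x. f x - g x)"
 by (simp add: additive_on_def algebra_simps)

definition fibre_product :: "'a topology => ('a => 'b) => ('a \<times> 'a) topology" where
 "fibre_product T f = subtopology (prod_topology T T) {(t, t'). f t = f t'}"

lemma topspace_fibre_product [simp]:
 "topspace (fibre_product T f) = {(t, t'). t : topspace T & t' : topspace T & f t = f t'}"
 by (auto simp: fibre_product_def)

lemma closedin_equalizer:
 assumes "Hausdorff_space S" "continuous_map Y S f" "continuous_map Y S g"
 shows "closedin Y {y : topspace Y. f y = g y}"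
proof -
 have "closedin (prod_topology S S) ((%x. (x, x)) ` topspace S)"
  using assms(1) Hausdorff_space_closedin_diagonal by blast
 moreover have "continuous_map Y (prod_topology S S) (%y. (f y, g y))"
  using assms by (simp add: continuous_map_pairedI)
 ultimately have "closedin Y {y : topspace Y. (f y, g y) : (%x. (x, x)) ` topspace S}"
  by (intro closedin_continuous_map_preimage)
 moreover have "{y : topspace Y. (f y, g y) : (%x. (x, x)) ` topspace S} = {y : topspace Y. f y = g y}"
  using assms(2) continuous_map_image_subset_topspace by fastforce
 ultimately show ?thesis by simp
qed

locale light_surjection =
 fixes T :: "'a topology" and S :: "'b topology" and f :: "'a => 'b"
 assumes T: "light_profinite T" and S: "light_profinite S"
  and f: "continuous_map T S f" and surj: "f ` topspace T = topspace S"
begin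

lemma continuous_f_fst_snd:
 "continuous_map Y (prod_topology T Z) h ==> continuous_map Y S (%y. f (fst (h y)))"
 "continuous_map Y (prod_topology Z' T) h' ==> continuous_map Y S (%y. f (snd (h' y)))"
 using continuous_map_compose[OF continuous_map_compose[OF _ continuous_map_fst] f, of Y Z h]
  continuous_map_compose[OF continuous_map_compose[OF _ continuous_map_snd] f, of Y Z' h']
 by (simp_all add: o_def)

lemma light_fibre_product: "light_profinite (fibre_product T f)"
proof -
 let ?P = "prod_topology T T"
 have "closedin ?P {z : topspace ?P. f (fst z) = f (snd z)}"
  using continuous_f_fst_snd[OF continuous_map_id[of ?P, unfolded id_def]]
  by (intro closedin_equalizer[OF light_profinite_imp_Hausdorff[OF S]]) simp_all
 moreover have "fibre_product T f = subtopology ?P {z : topspace ?P. f (fst z) = f (snd z)}"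
  unfolding fibre_product_def
  by (subst subtopology_restrict[symmetric], rule arg_cong[where f = "subtopology ?P"]) auto
 ultimately show ?thesis by (simp add: light_profinite_subtopology light_profinite_prod_topology T)
qed

lemma continuous_fst: "continuous_map (fibre_product T f) T fst"
 and continuous_snd: "continuous_map (fibre_product T f) T snd" unfolding fibre_product_def
 by (rule continuous_map_from_subtopology continuous_map_fst continuous_map_snd)+

text \<open>The first Cech differential of the cover \<open>f\<close> with integer-valued functions
  as coefficients.\<close>

definition coboundary :: "('a => int) => 'a \<times> 'a => int" where
 "coboundary g = pull_fun (fibre_product T f) fst g - pull_fun (fibre_product T f) snd g"

lemma coboundary_apply:
 "[|t : topspace T; t' : topspace T; f t = f t'|] ==> coboundary g (t, t') = g t - g t'"
 by (simp add: coboundary_def pull_fun_def)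

lemma coboundary_cont_int: "g : cont_int T ==> coboundary g : cont_int (fibre_product T f)"
 unfolding coboundary_def
 by (intro add_subgroup_diff pull_fun_cont_int[OF continuous_fst] pull_fun_cont_int[OF continuous_snd]) simp_all

lemma additive_on_coboundary: "additive_on G coboundary"
 by (simp add: additive_on_def coboundary_def pull_fun_def fun_eq_iff)

lemma quotient_f: "quotient_map T S f"
proof (rule continuous_closed_imp_quotient_map[OF f _ surj])
 show "closed_map T S f"
  using continuous_imp_closed_map[OF f light_profinite_compact[OF T] light_profinite_imp_Hausdorff[OF S]] .
qed

text \<open>A function that is constant on the fibres descends to \<open>S\<close>. The descended
  function is read off along an arbitrary section \<open>sig\<close>; it is continuous because
  \<open>f\<close>, a closed surjection, is a quotient map.\<close>

lemma coboundary_0_iff: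
 assumes g: "g : cont_int T"
 shows "coboundary g = 0 \<longleftrightarrow> (EX h:cont_int S. g = pull_fun T f h)"
proof
 assume 0: "coboundary g = 0"
 define sig where "sig = inv_into (topspace T) f"
 have sig: "sig s : topspace T" "f (sig s) = s" if "s : topspace S" for s
  using that surj by (auto simp: sig_def inv_into_into f_inv_into_f)
 define h where "h = pull_fun S sig g"
 have hf: "h (f t) = g t" if "t : topspace T" for t
 proof -
  have ft: "f t : topspace S" using that surj by blast
  hence "coboundary g (sig (f t), t) = 0" using 0 by simp
  thus ?thesis
   using coboundary_apply[of "sig (f t)" t g] sig[OF ft] that ft by (simp add: h_def pull_fun_def)
 qed
 have "locally_constant T (h o f)" using cont_int_continuous[OF g] by (rule continuous_map_eq) (simp add: hf)
 hence "locally_constant S h" using continuous_compose_quotient_map_eq[OF quotient_f] by blast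
 hence "h : cont_int S" by (rule cont_intI) (simp add: h_def pull_fun_def)
 moreover have "g = pull_fun T f h" using hf cont_int_outside[OF g] by (auto simp: pull_fun_def fun_eq_iff)
 ultimately show "EX h:cont_int S. g = pull_fun T f h" by blast
next
 assume "EX h:cont_int S. g = pull_fun T f h"
 thus "coboundary g = 0" by (auto simp: coboundary_def pull_fun_def fun_eq_iff)
qed

section \<open>Triple fibre products and the cocycle condition\<close>

abbreviation triple :: "('a \<times> 'a \<times> 'a) topology" where
 "triple == subtopology (prod_topology T (prod_topology T T)) {z. f (fst z) = f (fst (snd z)) & f (fst z) = f (snd (snd z))}"

lemma light_triple: "light_profinite triple"
proof -
 let ?P = "prod_topology T (prod_topology T T)"
 let ?A = "{z : topspace ?P. f (fst z) = f (fst (snd z))}" and ?B = "{z : topspace ?P. f (fst z) = f (snd (snd z))}"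
 have c: "continuous_map ?P S (%z. f (fst z))" "continuous_map ?P S (%z. f (fst (snd z)))" "continuous_map ?P S (%z. f (snd (snd z)))"
  using continuous_f_fst_snd(1)[OF continuous_map_id[of ?P, unfolded id_def]] continuous_f_fst_snd[OF continuous_map_snd[of T "prod_topology T T"]] by simp_all
 have "closedin ?P (?A Int ?B)"
  using c by (intro closedin_Int closedin_equalizer[OF light_profinite_imp_Hausdorff[OF S]])
 moreover have "triple = subtopology ?P (?A Int ?B)"
  by (subst subtopology_restrict[symmetric], rule arg_cong[where f = "subtopology ?P"]) blast
 ultimately show ?thesis by (simp add: light_profinite_subtopology light_profinite_prod_topology T)
qed

lemma continuous_triple:
 "continuous_map triple (fibre_product T f) (%z. (fst z, fst (snd z)))"
 "continuous_map triple (fibre_product T f) (%z. (fst (snd z), snd (snd z)))"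
 "continuous_map triple (fibre_product T f) (%z. (fst z, snd (snd z)))"
proof -
 let ?P = "prod_topology T (prod_topology T T)"
 have c: "continuous_map ?P T fst" "continuous_map ?P T (%z. fst (snd z))" "continuous_map ?P T (%z. snd (snd z))"
  using continuous_map_compose[OF continuous_map_snd continuous_map_fst] continuous_map_compose[OF continuous_map_snd continuous_map_snd]
  by (simp_all add: continuous_map_fst o_def)
 have "continuous_map ?P (prod_topology T T) (%z. (fst z, fst (snd z)))"
   "continuous_map ?P (prod_topology T T) (%z. (fst (snd z), snd (snd z)))"
   "continuous_map ?P (prod_topology T T) (%z. (fst z, snd (snd z)))"
  using continuous_map_pairedI c by blast+
 thus "continuous_map triple (fibre_product T f) (%z. (fst z, fst (snd z)))"
  "continuous_map triple (fibre_product T f) (%z. (fst (snd z), snd (snd z)))"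
  "continuous_map triple (fibre_product T f) (%z. (fst z, snd (snd z)))"
  unfolding fibre_product_def continuous_map_in_subtopology by (auto intro: continuous_map_from_subtopology)
qed

definition coboundary2 :: "('a \<times> 'a => int) => 'a \<times> 'a \<times> 'a => int" where
 "coboundary2 F = pull_fun triple (%z. (fst z, fst (snd z))) F + pull_fun triple (%z. (fst (snd z), snd (snd z))) F
   - pull_fun triple (%z. (fst z, snd (snd z))) F"

lemma coboundary2_apply:
 "[|t : topspace T; t' : topspace T; t'' : topspace T; f t = f t'; f t = f t''|] ==>
  coboundary2 F (t, t', t'') = F (t, t') + F (t', t'') - F (t, t'')"
 by (simp add: coboundary2_def pull_fun_def)

lemma coboundary2_cont_int: "F : cont_int (fibre_product T f) ==> coboundary2 F : cont_int triple"
 unfolding coboundary2_def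
 by (intro add_subgroup_diff add_subgroup_add continuous_triple[THEN pull_fun_cont_int]) simp_all

lemma additive_on_coboundary2: "additive_on G coboundary2"
 unfolding coboundary2_def by (intro additive_on_plus additive_on_minus additive_on_pull_fun)

text \<open>A cocycle is a coboundary locally on \<open>S\<close>: by compactness it depends only on the classes of its
 arguments in a finite partition of \<open>T\<close>, and the set of classes that meet a fibre can only shrink
 near that fibre.\<close>

lemma cocycle_is_coboundary:
 assumes F: "F : cont_int (fibre_product T f)" and 0: "coboundary2 F = 0"
 obtains G where "G : cont_int T" "F = coboundary G"
proof -
 let ?X = "fibre_product T f"
 have cocycle: "F (t, t') = F (t, t'') - F (t', t'')"
  if "t : topspace T" "t' : topspace T" "t'' : topspace T" "f t = f t'" "f t = f t''" for t t' t''
  using coboundary2_apply[OF that, of F] 0 by simp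
 obtain V where V: "separating T V" using T by (auto simp: light_profinite_def)
 have clV: "clopenin T (V n)" for n using V by (simp add: separating_def)
 \<comment> \<open>Even indices test the first coordinate and odd indices the second.\<close>
 define Z where "Z n = {z : topspace ?X. (if even n then fst z else snd z) : V (n div 2)}" for n
 have "separating ?X Z" unfolding separating_def
 proof (intro conjI allI ballI impI)
  show "clopenin ?X (Z n)" for n
   unfolding Z_def using clopenin_vimage[OF continuous_fst clV] clopenin_vimage[OF continuous_snd clV]
   by (cases "even n") simp_all
  fix y z assume yz: "y : topspace ?X" "z : topspace ?X" "ALL n. y : Z n \<longleftrightarrow> z : Z n"
  have "fst y : V n \<longleftrightarrow> fst z : V n" "snd y : V n \<longleftrightarrow> snd z : V n" for n
   using yz(3)[rule_format, of "2 * n"] yz(3)[rule_format, of "2 * n + 1"] yz(1,2) by (simp_all add: Z_def)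
  moreover have "fst y : topspace T" "fst z : topspace T" "snd y : topspace T" "snd z : topspace T"
   using yz(1,2) by auto
  ultimately have "fst y = fst z" "snd y = snd z" using V unfolding separating_def by blast+
  thus "y = z" by (rule prod_eqI)
 qed
 then obtain N where N: "!!y z. [|y : topspace ?X; z : topspace ?X; !!i. i < N ==> y : Z i \<longleftrightarrow> z : Z i|] ==> F y = F z"
  using separating_determines[OF light_profinite_compact[OF light_fibre_product] _ cont_int_continuous[OF F]] by metis
 \<comment> \<open>The class of \<open>t\<close> is given by its first \<open>N\<close> bits. The
   sets \<open>Z i\<close> with \<open>i < N\<close> only involve \<open>V j\<close> with
   \<open>j < N\<close>, so \<open>F\<close> depends on the classes of its two arguments.\<close>
 define q where "q t = {i. i < N & t : V i}" for t
 have q_cont: "locally_constant T q" unfolding continuous_map_discrete_iff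
 proof
  fix a
  have "{t : topspace T. q t = a} = {t : topspace T. a <= {..<N} & (ALL i:{..<N}. t : (if i : a then V i else topspace T - V i))}"
   using clopenin_subset[OF clV] by (auto simp: q_def split: if_splits)
  also have "clopenin T ..."
   using clopenin_INT[of "{..<N}" T "%i. if i : a then V i else topspace T - V i"] clV
   by (intro clopenin_conj clopenin_const) (auto simp: clopenin_Diff)
  finally show "clopenin T {t : topspace T. q t = a}" .
 qed
 have F_q: "F (t, t') = F (u, u')"
  if "t : topspace T" "t' : topspace T" "u : topspace T" "u' : topspace T" "f t = f t'" "f u = f u'" "q t = q u" "q t' = q u'" for t t' u u'
 proof (rule N)
  fix i assume "i < N"
  hence "i div 2 < N" by linarith
  thus "(t, t') : Z i \<longleftrightarrow> (u, u') : Z i" using that by (auto simp: Z_def q_def set_eq_iff)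
 qed (use that in auto)
 have finq: "finite (q ` topspace T)" by (rule finite_subset[of _ "Pow {..<N}"]) (auto simp: q_def)
 define works where "works G W \<longleftrightarrow> G : cont_int T & (ALL t:topspace T. ALL t':topspace T. f t = f t' --> f t : W --> F (t, t') = G t - G t')" for G W
 have local: "EX W G. clopenin S W & s : W & works G W" if s: "s : topspace S" for s
 proof -
  let ?A = "q ` {t : topspace T. f t = s}"
  obtain t0 where t0: "t0 : topspace T" "f t0 = s" using s surj by (metis imageE)
  \<comment> \<open>The points of \<open>S\<close> whose fibre meets a class that the fibre over
    \<open>s\<close> misses. There are finitely many classes and \<open>f\<close> is a closed map,
    so this set is closed; it does not contain \<open>s\<close>.\<close>
  let ?C = "\<Union>a\<in>q ` topspace T - ?A. f ` {t : topspace T. q t = a}"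
  have "closedin S ?C"
  proof (rule closedin_Union)
   show "closedin S C" if "C : (%a. f ` {t : topspace T. q t = a}) ` (q ` topspace T - ?A)" for C
   proof -
    from that obtain a where a: "C = f ` {t : topspace T. q t = a}" by (rule imageE)
    have "closedin T {t : topspace T. q t = a}"
     using q_cont by (simp add: continuous_map_discrete_iff clopenin_def)
    thus ?thesis
     using continuous_imp_closed_map[OF f light_profinite_compact[OF T] light_profinite_imp_Hausdorff[OF S]] a
     by (auto simp: closed_map_def)
   qed
  qed (use finq in auto)
  hence "openin S (topspace S - ?C)" "s : topspace S - ?C" using s by auto
  then obtain W where W: "clopenin S W" "s : W" "W <= topspace S - ?C"
   by (rule light_profinite_base[OF S]) (rule that)
  have qA: "q t : ?A" if "t : topspace T" "f t : W" for t
  proof (rule ccontr)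
   assume "q t ~: ?A"
   hence "q t : q ` topspace T - ?A" using `t : topspace T` by (intro DiffI imageI)
   moreover have "f t : f ` {u : topspace T. q u = q t}" using `t : topspace T` by (intro imageI) simp
   ultimately have "f t : ?C" by (rule UN_I)
   thus False using that(2) W(3) by (meson DiffD2 subsetD)
  qed
  define rep where "rep a = (SOME t. t : topspace T & f t = s & q t = a)" for a
  have rep: "rep a : topspace T & f (rep a) = s & q (rep a) = a" if "a : ?A" for a
   unfolding rep_def by (rule someI_ex) (use that in blast)
  \<comment> \<open>On the fibre over \<open>s\<close> a cocycle is the coboundary of its value
    against a fixed point \<open>t0\<close>. Replacing each point by the representative
    \<open>rep\<close> of its class in that fibre carries this primitive to all points over
    \<open>W\<close>.\<close>
  define G where "G = pull_fun T q (%a. F (rep a, t0))"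
  have "locally_constant T ((%a. F (rep a, t0)) o q)"
   by (rule continuous_map_compose[OF q_cont]) (simp add: continuous_map_def)
  hence "locally_constant T G" by (rule continuous_map_eq) (simp add: G_def pull_fun_def)
  hence "G : cont_int T" by (rule cont_intI) (simp add: G_def pull_fun_def)
  moreover have "F (t, t') = G t - G t'" if t: "t : topspace T" "t' : topspace T" "f t = f t'" "f t : W" for t t'
  proof -
   have a: "q t : ?A" "q t' : ?A" using qA t by auto
   have "F (t, t') = F (rep (q t), rep (q t'))" by (rule F_q) (use t rep[OF a(1)] rep[OF a(2)] in auto)
   also have "... = F (rep (q t), t0) - F (rep (q t'), t0)"
    by (rule cocycle) (use t0 rep[OF a(1)] rep[OF a(2)] in auto)
   finally show ?thesis using t by (simp add: G_def pull_fun_def)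
  qed
  ultimately have "works G W" by (simp add: works_def)
  thus ?thesis using W by blast
 qed
 let ?U = "{W. clopenin S W & (EX G. works G W)}"
 have "compactin S (topspace S)" using light_profinite_compact[OF S] by (simp add: compact_space_def)
 moreover have "topspace S <= \<Union>?U" using local by blast
 moreover have "ALL U:?U. openin S U" by (simp add: clopenin_def)
 ultimately have "EX E. finite E & E <= ?U & topspace S <= \<Union>E" by (rule compactin_subcover)
 then obtain E where E: "finite E" "E <= ?U" "topspace S <= \<Union>E" by blast
 have "EX G. works G (\<Union>E)" using E(1,2)
 proof (induction E rule: finite_induct)
  case empty
  show ?case
   by (intro exI[of _ 0]) (simp add: works_def add_subgroup_0[OF add_subgroup_cont_int] del: zero_fun_apply)
 next
  case (insert W E)
  then obtain G G' where G: "works G (\<Union>E)" and G': "works G' W" and W: "clopenin S W" by auto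
  \<comment> \<open>A fibre lies over \<open>W\<close> entirely or not at all, so a difference
    within a fibre never mixes \<open>G'\<close> with \<open>G\<close>.\<close>
  define H where "H t = (if t : {t : topspace T. f t : W} then G' t else G t)" for t
  have "H : cont_int T"
  proof (rule cont_intI)
   show "locally_constant T H"
    unfolding H_def using G G' by (intro continuous_map_discrete_restrict clopenin_vimage[OF f W])
     (auto simp: works_def cont_int_def)
   show "H x = 0" if "x ~: topspace T" for x using that G by (simp add: H_def works_def cont_int_def)
  qed
  moreover have "F (t, t') = H t - H t'"
   if "t : topspace T" "t' : topspace T" "f t = f t'" "f t : \<Union>(insert W E)" for t t'
   using that G G' by (cases "f t : W") (simp_all add: works_def H_def)
  ultimately have "works H (\<Union>(insert W E))" by (simp add: works_def)
  thus ?case by blast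
 qed
 then obtain G where G: "works G (\<Union>E)" by blast
 have "F z = coboundary G z" for z
 proof (cases "z : topspace ?X")
  case True
  then obtain t t' where z: "z = (t, t')" "t : topspace T" "t' : topspace T" "f t = f t'" by auto
  moreover have "f t : \<Union>E" using z E(3) surj by blast
  ultimately show ?thesis using G coboundary_apply by (simp add: works_def)
 next
  case False
  thus ?thesis using cont_int_outside[OF F] by (simp add: coboundary_def pull_fun_def)
 qed
 thus thesis using that G by (auto simp: works_def fun_eq_iff)
qed

lemma coboundary2_coboundary: "coboundary2 (coboundary g) = 0"
 by (auto simp: coboundary2_def coboundary_def pull_fun_def fun_eq_iff)

lemma measure_embedding:
 assumes "rho : null_measures Y" "additive_on G delta" "!!g. g : G ==> delta g : cont_int Y"
 shows "additive_on G (%g n. rho n (delta g))" "!!g. g : G ==> EX N. ALL n>=N. rho n (delta g) = 0"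
proof -
 show "additive_on G (%g n. rho n (delta g))" unfolding additive_on_def
 proof (intro ballI ext)
  fix x y n assume "x : G" "y : G"
  thus "rho n (delta (x + y)) = ((%n. rho n (delta x)) + (%n. rho n (delta y))) n"
   using additive_on_add[OF assms(2)] additive_on_add[OF null_measures_additive[OF assms(1)]] assms(3) by simp
 qed
 show "EX N. ALL n>=N. rho n (delta g) = 0" for g using null_measures_bound[OF assms(1)] by metis
qed

text \<open>\<open>kernel_retraction\<close>, applied to the coboundary followed by an embedding
  into sequences, projects onto the functions constant on fibres. These are functions on
  \<open>S\<close>, read off along a section \<open>sig\<close> that need not be continuous.\<close>

lemma retraction_exists:
 obtains Lambda where "Lambda : additive_maps T S" "!!g. g : cont_int S ==> Lambda (pull_fun T f g) = g"
proof -
 obtain rho where rho: "rho : null_measures (fibre_product T f)" "ALL g:cont_int (fibre_product T f). (%n. rho n g) = 0 \<longleftrightarrow> g = 0"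
  using cont_int_embedding[OF light_fibre_product] .
 obtain P where P: "additive_on (cont_int T) P" "!!g. g : cont_int T ==> P g : cont_int T"
   "!!g. g : cont_int T ==> (%n. rho n (coboundary (P g))) = 0"
   "!!g. g : cont_int T ==> (%n. rho n (coboundary g)) = 0 ==> P g = g"
  by (rule kernel_retraction[OF add_subgroup_cont_int measure_embedding(1)[OF rho(1) additive_on_coboundary coboundary_cont_int]],
   assumption, erule measure_embedding(2)[OF rho(1) additive_on_coboundary coboundary_cont_int, rotated], assumption,
   rule that, assumption+)
 define sig where "sig = inv_into (topspace T) f"
 have sig: "sig s : topspace T" "f (sig s) = s" if "s : topspace S" for s
  using that surj by (auto simp: sig_def inv_into_into f_inv_into_f)
 have sig_pull: "pull_fun S sig (pull_fun T f h) = h" if "h : cont_int S" for h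
  using sig cont_int_outside[OF that] by (auto simp: pull_fun_def fun_eq_iff)
 define Lambda where "Lambda g = pull_fun S sig (P g)" for g
 show thesis
 proof (rule that[of Lambda])
  have "Lambda g : cont_int S" if g: "g : cont_int T" for g
  proof -
   have "coboundary (P g) = 0" using rho(2) coboundary_cont_int[OF P(2)[OF g]] P(3)[OF g] by blast
   then obtain h where "h : cont_int S" "P g = pull_fun T f h"
    using coboundary_0_iff[OF P(2)[OF g]] by blast
   thus ?thesis by (simp add: Lambda_def sig_pull)
  qed
  thus "Lambda : additive_maps T S"
   using P(1) by (auto simp: additive_maps_def additive_on_def Lambda_def pull_fun_def fun_eq_iff)
  fix g assume g: "g : cont_int S"
  have gT: "pull_fun T f g : cont_int T" using pull_fun_cont_int[OF f g] .
  have "coboundary (pull_fun T f g) = 0" using coboundary_0_iff[OF gT] g by blast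
  hence "P (pull_fun T f g) = pull_fun T f g" using P(4)[OF gT] rho(2) coboundary_cont_int[OF gT] by simp
  thus "Lambda (pull_fun T f g) = g" by (simp add: Lambda_def sig_pull g)
 qed
qed

text \<open>By \<open>cocycle_is_coboundary\<close> the image of \<open>coboundary\<close> is the
  kernel of \<open>coboundary2\<close>, so it is a direct summand and \<open>exact_splitting\<close>
  applies.\<close>

lemma homotopy_exists:
 obtains K where "K : additive_maps (fibre_product T f) T"
  "!!g. g : cont_int T ==> coboundary (K (coboundary g)) = coboundary g"
proof -
 obtain rho where rho: "rho : null_measures (fibre_product T f)" "ALL g:cont_int (fibre_product T f). (%n. rho n g) = 0 \<longleftrightarrow> g = 0"
  using cont_int_embedding[OF light_fibre_product] .
 obtain tau where tau: "tau : null_measures triple" "ALL g:cont_int triple. (%n. tau n g) = 0 \<longleftrightarrow> g = 0"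
  using cont_int_embedding[OF light_triple] .
 have rho0: "(%n. rho n (coboundary g)) = 0 \<longleftrightarrow> coboundary g = 0" if "g : cont_int T" for g
  using rho(2) coboundary_cont_int[OF that] by blast
 have tau0: "(%n. tau n (coboundary2 F)) = 0 \<longleftrightarrow> F : coboundary ` cont_int T" if F: "F : cont_int (fibre_product T f)" for F
 proof -
  have "(%n. tau n (coboundary2 F)) = 0 \<longleftrightarrow> coboundary2 F = 0"
   using tau(2) coboundary2_cont_int[OF F] by blast
  also have "... \<longleftrightarrow> F : coboundary ` cont_int T"
   using cocycle_is_coboundary[OF F] coboundary2_coboundary by blast
  finally show ?thesis .
 qed
 obtain K where K: "additive_on (cont_int (fibre_product T f)) K" "!!h. h : cont_int (fibre_product T f) ==> K h : cont_int T"
   "!!g. g : cont_int T ==> coboundary (K (coboundary g)) = coboundary g"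
 proof (rule exact_splitting)
  show "add_subgroup (cont_int T)" "add_subgroup (cont_int (fibre_product T f))" by simp_all
  show "additive_on (cont_int T) coboundary" "!!g. g : cont_int T ==> coboundary g : cont_int (fibre_product T f)"
   by (rule additive_on_coboundary, erule coboundary_cont_int)
  show "additive_on (cont_int T) (%g n. rho n (coboundary g))"
   "!!g. g : cont_int T ==> EX N. ALL n>=N. rho n (coboundary g) = 0"
   using measure_embedding[OF rho(1) additive_on_coboundary coboundary_cont_int] by blast+
  show "additive_on (cont_int (fibre_product T f)) (%g n. tau n (coboundary2 g))"
   "!!g. g : cont_int (fibre_product T f) ==> EX N. ALL n>=N. tau n (coboundary2 g) = 0"
   using measure_embedding[OF tau(1) additive_on_coboundary2 coboundary2_cont_int] by blast+
  show "!!g. g : cont_int T ==> (%n. rho n (coboundary g)) = 0 \<longleftrightarrow> coboundary g = 0"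
   by (rule rho0)
  show "!!F. F : cont_int (fibre_product T f) ==> (%n. tau n (coboundary2 F)) = 0 \<longleftrightarrow> F : coboundary ` cont_int T"
   by (rule tau0)
 qed (rule that, assumption+)
 thus thesis by (intro that[of K]) (auto simp: additive_maps_def)
qed

text \<open>The transpose of the retraction \<open>Lambda\<close> is a right inverse of the
  pushforward.\<close>

lemma null_measures_lift:
 assumes "u : null_measures S"
 obtains v where "v : null_measures T" "push_measure S (pull_fun T f) v = u"
proof -
 obtain Lambda where Lambda: "Lambda : additive_maps T S" "!!g. g : cont_int S ==> Lambda (pull_fun T f g) = g"
  by (rule retraction_exists) (rule that, assumption+)
 have "push_measure S (pull_fun T f) (push_measure T Lambda u) = push_measure S (%g. g) u"
  unfolding push_measure_compose[OF pull_fun_additive_maps[OF f]]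
  by (rule push_measure_cong) (simp add: Lambda)
 thus thesis using that[OF push_measure_null[OF Lambda(1) assms]] push_measure_id[OF assms] by simp
qed

text \<open>The preimage \<open>w\<close> is \<open>v\<close> composed with the homotopy
  \<open>K\<close>. Since \<open>v\<close> kills functions pulled back from \<open>S\<close>, it
  kills the kernel of \<open>coboundary\<close>, to which \<open>K (coboundary g) - g\<close>
  belongs.\<close>

lemma null_measures_kernel:
 assumes v: "v : null_measures T" and 0: "push_measure S (pull_fun T f) v = 0"
 obtains w where "w : null_measures (fibre_product T f)"
  "v = push_measure T (pull_fun (fibre_product T f) fst) w - push_measure T (pull_fun (fibre_product T f) snd) w"
proof -
 let ?X = "fibre_product T f"
 obtain K where K: "K : additive_maps ?X T" "!!g. g : cont_int T ==> coboundary (K (coboundary g)) = coboundary g"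
  by (rule homotopy_exists) (rule that, assumption+)
 define w where "w = push_measure ?X K v"
 have w: "w : null_measures ?X" unfolding w_def by (rule push_measure_null[OF K(1) v])
 have v0: "v n g = 0" if g: "g : cont_int T" "coboundary g = 0" for n g
 proof -
  obtain h where "h : cont_int S" "g = pull_fun T f h" using g coboundary_0_iff by blast
  thus ?thesis using fun_cong[OF fun_cong[OF 0, of n], of h] by (simp add: push_measure_def)
 qed
 have "v n g = w n (pull_fun ?X fst g) - w n (pull_fun ?X snd g)" if g: "g : cont_int T" for n g
 proof -
  have fs: "pull_fun ?X fst g : cont_int ?X" "pull_fun ?X snd g : cont_int ?X"
   using g pull_fun_cont_int continuous_fst continuous_snd by blast+
  have Kg: "K (coboundary g) : cont_int T"
   using K(1) coboundary_cont_int[OF g] by (auto simp: additive_maps_def)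
  have "w n (pull_fun ?X fst g) - w n (pull_fun ?X snd g) = w n (coboundary g)" unfolding coboundary_def
   by (rule additive_on_diff[OF null_measures_additive[OF w] add_subgroup_cont_int fs, symmetric])
  also have "... = v n (K (coboundary g))"
   using coboundary_cont_int[OF g] by (simp add: w_def push_measure_def)
  also have "... = v n g"
  proof -
   have "coboundary (K (coboundary g) - g) = 0"
    using additive_on_diff[OF additive_on_coboundary add_subgroup_cont_int Kg g] K(2)[OF g] by simp
   hence "v n (K (coboundary g) - g) = 0" using v0 Kg g by (simp add: add_subgroup_diff)
   thus ?thesis using additive_on_diff[OF null_measures_additive[OF v] add_subgroup_cont_int Kg g] by simp
  qed
  finally show ?thesis ..
 qed
 hence "v = push_measure T (pull_fun ?X fst) w - push_measure T (pull_fun ?X snd) w"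
  using null_measures_outside[OF v] by (auto simp: push_measure_def fun_eq_iff)
 thus thesis using w that by blast
qed

end

section \<open>Sections of light condensed abelian groups\<close>

text \<open>\<open>res\<close> is meant for extensional maps; truncating here lets composites and
  equations between maps be stated for plain functions.\<close>

definition pull :: "'u presheaf => point topology => point topology => (point => point) => 'u => 'u" where
 "pull A S T f = res A S T (restrict f (topspace S))"

lemma restrict_cmaps: "continuous_map S T f ==> restrict f (topspace S) : cmaps S T"
 by (simp add: cmaps_def continuous_map_eq[of S T f])

lemma cmapsD: "f : cmaps S T ==> continuous_map S T f" "f : cmaps S T ==> f : extensional (topspace S)"
 by (simp_all add: cmaps_def)

lemma res_eq_pull: "f : cmaps S T ==> res A S T f = pull A S T f"
 by (simp add: pull_def cmaps_def extensional_restrict)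

lemma pull_cong: "(!!p. p : topspace S ==> f p = g p) ==> pull A S T f = pull A S T g"
 unfolding pull_def by (metis restrict_ext)

definition on_pairs :: "(point => nat option => 'b) => point => 'b" where
 "on_pairs k q = (case unpair_point q of (p, a) => k p a)"

lemma on_pairs_pair_point [simp]: "on_pairs k (pair_point (p, a)) = k p a" by (simp add: on_pairs_def)

lemma continuous_map_pair_pointI:
 assumes "continuous_map X S f" "continuous_map X Nbar g"
 shows "continuous_map X (times_Nbar S) (%x. pair_point (f x, g x))"
 using continuous_map_compose[OF continuous_map_pairedI[OF assms] continuous_map_pair_point] by (simp add: o_def)

lemma continuous_map_on_pairs:
 "continuous_map (prod_topology S Nbar) T (%z. k (fst z) (snd z)) ==> continuous_map (times_Nbar S) T (on_pairs k)"
 using continuous_map_compose[OF continuous_map_unpair_point, of S T "%z. k (fst z) (snd z)"]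
 by (simp add: on_pairs_def[abs_def] o_def case_prod_unfold)

lemma continuous_map_on_pairs_discrete:
 fixes k :: "point => nat option => 'b::zero"
 assumes slice: "!!m. locally_constant S (%p. k p (Some m))"
  and None: "!!p. k p None = 0" and bound: "!!p m. p : topspace S ==> m >= N ==> k p (Some m) = 0"
 shows "locally_constant (times_Nbar S) (on_pairs k)"
proof (rule continuous_map_on_pairs)
 have nonzero: "clopenin (prod_topology S Nbar) {z : topspace (prod_topology S Nbar). k (fst z) (snd z) : B}" if "0 ~: B" for B
 proof (rule clopenin_prod_Nbar[where N = N])
  show "clopenin S {p : topspace S. k p (Some m) : B}" for m
   by (rule clopenin_vimage[OF slice]) (simp add: clopenin_def)
  show "m < N" if "p : topspace S" "k p (Some m) : B" for p m
   using that `0 ~: B` bound[of p m] by (metis not_le)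
 qed (use that None in simp)
 show "locally_constant (prod_topology S Nbar) (%z. k (fst z) (snd z))" unfolding continuous_map_discrete_iff
 proof
  fix a
  show "clopenin (prod_topology S Nbar) {z : topspace (prod_topology S Nbar). k (fst z) (snd z) = a}"
   using nonzero[of "{a}"] clopenin_not[OF nonzero[of "- {0}"]] by (cases "a = 0") simp_all
 qed
qed

definition pair_map :: "(point => point) => (nat option => nat option) => point => point" where
 "pair_map f g = on_pairs (%p a. pair_point (f p, g a))"

lemma pair_map_pair_point [simp]: "pair_map f g (pair_point (p, a)) = pair_point (f p, g a)"
 by (simp add: pair_map_def)

lemma continuous_map_pair_map:
 assumes "continuous_map S T f" "continuous_map Nbar Nbar g"
 shows "continuous_map (times_Nbar S) (times_Nbar T) (pair_map f g)" unfolding pair_map_def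
proof (rule continuous_map_on_pairs)
 show "continuous_map (prod_topology S Nbar) (times_Nbar T) (%z. pair_point (f (fst z), g (snd z)))"
  using continuous_map_compose[OF continuous_map_fst assms(1)] continuous_map_compose[OF continuous_map_snd assms(2)]
  by (intro continuous_map_pair_pointI) (simp_all add: o_def)
qed

lemma continuous_map_Suc: "continuous_map Nbar Nbar (map_option Suc)" unfolding continuous_map_into_Nbar
proof
 fix n
 have "{x : topspace Nbar. map_option Suc x = Some n} = (case n of 0 => {} | Suc m => {Some m})"
  by (auto split: nat.split)
 thus "clopenin Nbar {x : topspace Nbar. map_option Suc x = Some n}"
  by (simp add: clopenin_Nbar_Some split: nat.split)
qed

lemma continuous_map_at:
 "continuous_map S (times_Nbar S) (%p. pair_point (p, a))" by (intro continuous_map_pair_pointI) simp_all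

definition nbar_point :: "nat option => point" where
 "nbar_point a = pair_point (%_. False, a)"

text \<open>A copy of \<open>Nbar\<close> among the topologies on \<open>point\<close>; null
  sequences over the one-point space are sections over it that vanish at infinity.\<close>

abbreviation Nbar1 :: "point topology" where
 "Nbar1 == times_Nbar one_point"

lemma topspace_one_point [simp]: "topspace one_point = {%_. False}" by (simp add: one_point_def)

lemma continuous_map_nbar_point: "continuous_map Nbar Nbar1 nbar_point"
 unfolding nbar_point_def by (intro continuous_map_pair_pointI) simp_all

lemma continuous_map_into_Nbar1:
 "continuous_map S Nbar k ==> continuous_map S Nbar1 (%p. nbar_point (k p))"
 using continuous_map_compose[OF _ continuous_map_nbar_point, of S k] by (simp add: o_def)

lemma times_Nbar_map_eq:
 "q : topspace (times_Nbar S) ==> times_Nbar_map S f g q = pair_map f g q" by (auto simp: times_Nbar_map_def)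

lemma times_Nbar_map_cmaps:
 assumes "continuous_map S T f" "continuous_map Nbar Nbar g"
 shows "times_Nbar_map S f g : cmaps (times_Nbar S) (times_Nbar T)"
proof -
 have "times_Nbar_map S f g = restrict (pair_map f g) (topspace (times_Nbar S))"
  using times_Nbar_map_eq[of _ S f g] by (auto simp: times_Nbar_map_def restrict_def fun_eq_iff)
 thus ?thesis using restrict_cmaps[OF continuous_map_pair_map[OF assms]] by simp
qed

lemma res_times_Nbar_map:
 assumes "continuous_map S T f" "continuous_map Nbar Nbar g"
 shows "res A (times_Nbar S) (times_Nbar T) (times_Nbar_map S f g) = pull A (times_Nbar S) (times_Nbar T) (pair_map f g)"
 unfolding res_eq_pull[OF times_Nbar_map_cmaps[OF assms]] by (rule pull_cong[OF times_Nbar_map_eq])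

lemma at_infinity_cmaps: "at_infinity S : cmaps S (times_Nbar S)"
 using restrict_cmaps[OF continuous_map_at[of S None]] by (simp add: at_infinity_def)

lemma res_at_infinity: "res A S (times_Nbar S) (at_infinity S) = pull A S (times_Nbar S) (at_inf)"
 unfolding res_eq_pull[OF at_infinity_cmaps] by (rule pull_cong) (simp add: at_infinity_def)

abbreviation null :: "'u presheaf => point topology => 'u set" where
 "null A S == Sec (null_condensed A) S"

lemma null_iff:
 "x : null A S \<longleftrightarrow> x : Sec A (times_Nbar S) &
   pull A S (times_Nbar S) (at_inf) x = \<one>[A,S]"
 by (simp add: null_condensed_def kernel_def res_at_infinity)

lemma mult_null_condensed [simp]:
 "x \<cdot>[null_condensed A,S] y = x \<cdot>[A,times_Nbar S] y"
 "\<one>[null_condensed A,S] = \<one>[A,times_Nbar S]" by (simp_all add: null_condensed_def)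

abbreviation shift_map :: "point => point" where
 "shift_map == pair_map (%p. p) (map_option Suc)"

lemma continuous_map_shift_map: "continuous_map (times_Nbar S) (times_Nbar S) shift_map"
 by (intro continuous_map_pair_map continuous_map_Suc) simp

section \<open>Pullbacks and the shift on presheaves of groups\<close>

locale ab_presheaf =
 fixes A :: "'u presheaf"
 assumes ab_presheaf: "Defs.ab_presheaf A"
begin

lemma comm_group_sect: "S : MStone ==> comm_group (sect A S)"
 using ab_presheaf by (simp add: Defs.ab_presheaf_def)

lemma group_sect: "S : MStone ==> group (sect A S)" using comm_group_sect comm_group.axioms(2) by blast

lemma pull_hom:
 "[|S : MStone; T : MStone; continuous_map S T f|] ==> pull A S T f : hom (sect A T) (sect A S)"
 using ab_presheaf restrict_cmaps[of S T f] by (simp add: Defs.ab_presheaf_def pull_def)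

lemma pull_group_hom:
 "[|S : MStone; T : MStone; continuous_map S T f|] ==> group_hom (sect A T) (sect A S) (pull A S T f)"
 by (simp add: group_hom_def group_hom_axioms_def pull_hom group_sect)

lemma pull_closed [simp]:
 "[|S : MStone; T : MStone; continuous_map S T f; x : Sec A T|] ==> pull A S T f x : Sec A S"
 using pull_hom by (auto simp: hom_def)

lemma pull_mult:
 "[|S : MStone; T : MStone; continuous_map S T f; x : Sec A T; y : Sec A T|] ==>
  pull A S T f (x \<cdot>[A,T] y) = pull A S T f x \<cdot>[A,S] pull A S T f y"
 using pull_hom by (auto simp: hom_def)

lemma pull_one:
 "[|S : MStone; T : MStone; continuous_map S T f|] ==> pull A S T f \<one>[A,T] = \<one>[A,S]"
 using group_hom.hom_one[OF pull_group_hom] .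

lemma pull_inv:
 "[|S : MStone; T : MStone; continuous_map S T f; x : Sec A T|] ==>
  pull A S T f (inv[A,T] x) = inv[A,S] (pull A S T f x)"
 using group_hom.hom_inv[OF pull_group_hom] .

lemma pull_pull:
 assumes "S : MStone" "T : MStone" "U : MStone" "continuous_map S T f" "continuous_map T U g" "x : Sec A U"
 shows "pull A S T f (pull A T U g x) = pull A S U (%p. g (f p)) x"
proof -
 have "res A S U (compose (topspace S) (restrict g (topspace T)) (restrict f (topspace S))) x
   = pull A S T f (pull A T U g x)"
  using ab_presheaf assms restrict_cmaps[OF assms(4)] restrict_cmaps[OF assms(5)]
  unfolding Defs.ab_presheaf_def pull_def by blast
 moreover have "compose (topspace S) (restrict g (topspace T)) (restrict f (topspace S)) = restrict (%p. g (f p)) (topspace S)"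
  using continuous_map_image_subset_topspace[OF assms(4)] by (auto simp: compose_def fun_eq_iff)
 ultimately show ?thesis by (simp add: pull_def)
qed

lemma pull_id: "[|S : MStone; x : Sec A S; !!p. p : topspace S ==> f p = p|] ==> pull A S S f x = x"
 using ab_presheaf pull_cong[of S f "%p. p" A S] by (auto simp: Defs.ab_presheaf_def pull_def)

lemma subgroup_null: "S : MStone ==> subgroup (null A S) (sect A (times_Nbar S))"
 using group_hom.subgroup_kernel[OF pull_group_hom[OF _ times_Nbar_MStone continuous_map_at[of S None]]]
 by (simp add: null_condensed_def res_at_infinity)

lemma null_carrier: "x : null A S ==> x : Sec A (times_Nbar S)" by (simp add: null_iff)

lemma comm_group_null: "S : MStone ==> comm_group (sect (null_condensed A) S)"
proof -
 assume S: "S : MStone"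
 interpret G: comm_group "sect A (times_Nbar S)" using S by (simp add: comm_group_sect)
 have "comm_group ((sect A (times_Nbar S))\<lparr>carrier := null A S\<rparr>)"
  by (rule group.group_comm_groupI[OF G.subgroup_imp_group[OF subgroup_null[OF S]]])
   (use subgroup.subset[OF subgroup_null[OF S]] G.m_comm in auto)
 thus ?thesis by (simp add: null_condensed_def)
qed

lemma inv_null:
 assumes "S : MStone" "x : null A S"
 shows "inv[null_condensed A,S] x = inv[A,times_Nbar S] x"
proof -
 have "inv\<^bsub>(sect A (times_Nbar S))\<lparr>carrier := null A S\<rparr>\<^esub> x = inv[A,times_Nbar S] x"
  using group.m_inv_consistent[OF group_sect subgroup_null] assms by simp
 thus ?thesis by (simp add: null_condensed_def)
qed

lemma shift_eq:
 "[|S : MStone; x : null A S|] ==> shift A S x = pull A (times_Nbar S) (times_Nbar S) shift_map x"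
 using res_times_Nbar_map[OF continuous_map_id[of S] continuous_map_Suc, of A]
 by (simp add: shift_def id_def)

lemma pull_null:
 assumes S: "S : MStone" "T : MStone" and f: "continuous_map S T f" "continuous_map Nbar Nbar g" "g None = None"
  and x: "x : null A T"
 shows "pull A (times_Nbar S) (times_Nbar T) (pair_map f g) x : null A S"
proof -
 note c = continuous_map_pair_map[OF f(1,2)]
 have "pull A S (times_Nbar S) (at_inf) (pull A (times_Nbar S) (times_Nbar T) (pair_map f g) x)
   = pull A S (times_Nbar T) (%p. pair_point (f p, None)) x"
  using S x f(3) by (subst pull_pull[OF _ _ _ continuous_map_at c]) (simp_all add: null_iff)
 also have "... = pull A S T f (pull A T (times_Nbar T) (at_inf) x)"
  using S x by (subst pull_pull[OF _ _ _ f(1) continuous_map_at]) (simp_all add: null_iff)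
 also have "... = \<one>[A,S]" using x S f by (simp add: null_iff pull_one)
 finally show ?thesis using x S c by (simp add: null_iff)
qed

lemma shift_closed: "S : MStone ==> x : null A S ==> shift A S x : null A S"
 using pull_null[OF _ _ _ continuous_map_Suc, of S S "%p. p" x] by (simp add: shift_eq)

lemma one_minus_shift_eq:
 "[|S : MStone; x : null A S|] ==> one_minus_shift A S x = x \<cdot>[A,times_Nbar S] inv[A,times_Nbar S] (shift A S x)"
 by (simp add: one_minus_shift_def inv_null shift_closed)

lemma one_minus_shift_eq_iff:
 assumes "S : MStone" "x : null A S" "y : null A S"
 shows "one_minus_shift A S x = y \<longleftrightarrow> x = y \<cdot>[A,times_Nbar S] shift A S x"
proof -
 interpret G: comm_group "sect A (times_Nbar S)" using assms by (simp add: comm_group_sect)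
 note [simp] = null_carrier[OF assms(2)] null_carrier[OF assms(3)] null_carrier[OF shift_closed[OF assms(1,2)]]
 show ?thesis
  by (simp add: one_minus_shift_eq assms) (metis G.inv_closed G.inv_solve_right null_carrier[OF shift_closed[OF assms(1,2)]] null_carrier[OF assms(2)] null_carrier[OF assms(3)])
qed

lemma one_minus_shift_hom:
 assumes S: "S : MStone"
 shows "one_minus_shift A S : hom (sect (null_condensed A) S) (sect (null_condensed A) S) Int extensional (null A S)"
proof
 interpret G: comm_group "sect A (times_Nbar S)" using S by (simp add: comm_group_sect)
 have sub: "subgroup (null A S) (sect A (times_Nbar S))" by (rule subgroup_null[OF S])
 show "one_minus_shift A S : hom (sect (null_condensed A) S) (sect (null_condensed A) S)"
 proof (rule homI)
  fix x assume x: "x : null A S"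
  show "one_minus_shift A S x : null A S"
   using subgroup.m_closed[OF sub x subgroup.m_inv_closed[OF sub shift_closed[OF S x]]] S x
   by (simp add: one_minus_shift_eq)
  fix y assume y: "y : null A S"
  note xy = subgroup.m_closed[OF sub x y]
  note [simp] = null_carrier[OF x] null_carrier[OF y] null_carrier[OF shift_closed[OF S x]] null_carrier[OF shift_closed[OF S y]]
  have "shift A S (x \<cdot>[A,times_Nbar S] y) = shift A S x \<cdot>[A,times_Nbar S] shift A S y"
   using S x y xy continuous_map_shift_map by (simp add: shift_eq pull_mult)
  thus "one_minus_shift A S (x \<cdot>[null_condensed A,S] y)
    = one_minus_shift A S x \<cdot>[null_condensed A,S] one_minus_shift A S y"
   using S x y xy by (simp add: one_minus_shift_eq G.inv_mult G.m_ac)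
 qed
 show "one_minus_shift A S : extensional (null A S)" using S by (simp add: one_minus_shift_def)
qed

lemma res_null_condensed:
 "f : cmaps S T ==> res (null_condensed A) S T f = pull A (times_Nbar S) (times_Nbar T) (pair_map f id)"
 using res_times_Nbar_map[OF cmapsD(1) continuous_map_id[of Nbar], of f S T A] by (simp add: null_condensed_def)

lemma one_minus_shift_natural:
 assumes S: "S : MStone" "T : MStone" and f: "continuous_map S T f" and x: "x : null A T"
 shows "one_minus_shift A S (pull A (times_Nbar S) (times_Nbar T) (pair_map f id) x)
  = pull A (times_Nbar S) (times_Nbar T) (pair_map f id) (one_minus_shift A T x)"
proof -
 note c = continuous_map_pair_map[OF f continuous_map_id]
 have n: "pull A (times_Nbar S) (times_Nbar T) (pair_map f id) x : null A S"
  using pull_null[OF S f continuous_map_id _ x] by simp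
 have "shift A S (pull A (times_Nbar S) (times_Nbar T) (pair_map f id) x)
   = pull A (times_Nbar S) (times_Nbar T) (%p. pair_map f id (shift_map p)) x"
  using S x by (simp add: shift_eq n pull_pull[OF _ _ _ continuous_map_shift_map c] null_carrier)
 also have "... = pull A (times_Nbar S) (times_Nbar T) (%p. shift_map (pair_map f id p)) x"
  by (rule fun_cong[OF pull_cong]) auto
 also have "... = pull A (times_Nbar S) (times_Nbar T) (pair_map f id) (shift A T x)"
  using S x by (simp add: shift_eq pull_pull[OF _ _ _ c continuous_map_shift_map] null_carrier)
 finally have "shift A S (pull A (times_Nbar S) (times_Nbar T) (pair_map f id) x)
   = pull A (times_Nbar S) (times_Nbar T) (pair_map f id) (shift A T x)" .
 thus ?thesis using S x n c shift_closed[OF S(2) x] group.inv_closed[OF group_sect]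
  by (simp add: one_minus_shift_eq pull_mult pull_inv null_carrier)
qed

lemma one_minus_shift_presheaf_hom: "one_minus_shift A : presheaf_homs (null_condensed A) (null_condensed A)"
 unfolding presheaf_homs_def
proof (intro CollectI conjI ballI)
 show "one_minus_shift A : extensional MStone" by (simp add: one_minus_shift_def)
qed (use one_minus_shift_hom one_minus_shift_natural in \<open>auto simp: res_null_condensed dest: cmapsD\<close>)

end

lemma bij_betw_iff_ex1:
 assumes "f ` X <= Y"
 shows "bij_betw f X Y \<longleftrightarrow> (ALL y:Y. EX! x. x : X & f x = y)"
proof
 assume b: "bij_betw f X Y"
 show "ALL y:Y. EX! x. x : X & f x = y"
 proof
  fix y assume "y : Y"
  then obtain x where "x : X" "f x = y" using b by (metis bij_betw_imp_surj_on imageE)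
  thus "EX! x. x : X & f x = y" using b by (intro ex1I[of _ x]) (auto simp: bij_betw_def inj_on_def)
 qed
next
 assume *: "ALL y:Y. EX! x. x : X & f x = y"
 have Y: "f x : Y" if "x : X" for x using assms that by blast
 show "bij_betw f X Y"
 proof (rule bij_betwI')
  show "f x = f y \<longleftrightarrow> x = y" if "x : X" "y : X" for x y
   using * Y[OF that(2)] that by metis
  show "EX x:X. y = f x" if "y : Y" for y using * that by metis
 qed (rule Y)
qed

lemma inv_presheaf_hom:
 assumes phi: "phi : presheaf_homs A B"
  and bij: "!!S. S : MStone ==> bij_betw (phi S) (Sec A S) (Sec B S)"
  and A: "!!S. S : MStone ==> group (sect A S)"
  and resA: "!!S T f x. [|S : MStone; T : MStone; f : cmaps S T; x : Sec A T|] ==> res A S T f x : Sec A S"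
 defines "psi == \<lambda>S\<in>MStone. \<lambda>y\<in>Sec B S. inv_into (Sec A S) (phi S) y"
 shows "psi : presheaf_homs B A"
  and "Comp light_condensed_groups A B A psi phi = Ident light_condensed_groups A"
  and "Comp light_condensed_groups B A B phi psi = Ident light_condensed_groups B"
proof -
 have psi1: "psi S y : Sec A S" "phi S (psi S y) = y" if "S : MStone" "y : Sec B S" for S y
  using that bij[OF that(1)] by (simp_all add: psi_def bij_betw_def inv_into_into f_inv_into_f)
 have psi2: "psi S (phi S x) = x" "phi S x : Sec B S" if "S : MStone" "x : Sec A S" for S x
  using that bij[OF that(1)] by (auto simp: psi_def bij_betw_def)
 have hom: "phi S (x \<cdot>[A,S] y) = phi S x \<cdot>[B,S] phi S y"
  if "S : MStone" "x : Sec A S" "y : Sec A S" for S x y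
  using phi that by (auto simp: presheaf_homs_def hom_def)
 have nat: "phi S (res A S T f x) = res B S T f (phi T x)"
  if "S : MStone" "T : MStone" "f : cmaps S T" "x : Sec A T" for S T f x
  using phi that by (auto simp: presheaf_homs_def)
 show "psi : presheaf_homs B A" unfolding presheaf_homs_def
 proof (intro CollectI conjI ballI)
  show "psi : extensional MStone" by (simp add: psi_def)
 next
  fix S assume S: "S : MStone"
  interpret group "sect A S" by (rule A[OF S])
  show "psi S : hom (sect B S) (sect A S) Int extensional (Sec B S)"
  proof
   show "psi S : hom (sect B S) (sect A S)"
   proof (rule homI)
    fix x y assume xy: "x : Sec B S" "y : Sec B S"
    have "x \<cdot>[B,S] y = phi S (psi S x \<cdot>[A,S] psi S y)" using S xy psi1 by (simp add: hom)
    thus "psi S (x \<cdot>[B,S] y) = psi S x \<cdot>[A,S] psi S y" using S xy psi1 by (simp add: psi2)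
   qed (use S psi1 in blast)
   show "psi S : extensional (Sec B S)" using S by (simp add: psi_def)
  qed
 next
  fix S T f x assume *: "S : MStone" "T : MStone" "f : cmaps S T" "x : Sec B T"
  have "res B S T f x = phi S (res A S T f (psi T x))" using * psi1 by (simp add: nat)
  thus "psi S (res B S T f x) = res A S T f (psi T x)" using * psi1 resA by (simp add: psi2)
 qed
 show "Comp light_condensed_groups A B A psi phi = Ident light_condensed_groups A"
  using psi2 by (auto simp: light_condensed_groups_def compose_def restrict_def fun_eq_iff)
 show "Comp light_condensed_groups B A B phi psi = Ident light_condensed_groups B"
  using psi1 by (auto simp: light_condensed_groups_def compose_def restrict_def fun_eq_iff)
qed

lemma isomorphism_presheafI:
 assumes "phi : presheaf_homs A B"
  and "!!S. S : MStone ==> bij_betw (phi S) (Sec A S) (Sec B S)"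
  and "!!S. S : MStone ==> group (sect A S)"
  and "!!S T f x. [|S : MStone; T : MStone; f : cmaps S T; x : Sec A T|] ==> res A S T f x : Sec A S"
 shows "isomorphism light_condensed_groups A B phi"
proof -
 have arr: "Arr light_condensed_groups A B = presheaf_homs A B" "Arr light_condensed_groups B A = presheaf_homs B A"
  by (simp_all add: light_condensed_groups_def)
 show ?thesis unfolding isomorphism_def arr
  by (intro conjI bexI[OF _ inv_presheaf_hom(1)[OF assms]] assms(1) inv_presheaf_hom(2,3)[OF assms])
qed

lemma isomorphism_presheafD:
 assumes iso: "isomorphism light_condensed_groups A B phi" and S: "S : MStone"
 shows "bij_betw (phi S) (Sec A S) (Sec B S)"
proof -
 obtain psi where phi: "phi : presheaf_homs A B" and psi: "psi : presheaf_homs B A"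
  and eq: "(\<lambda>S\<in>MStone. compose (Sec A S) (psi S) (phi S)) = (\<lambda>S\<in>MStone. \<lambda>x\<in>Sec A S. x)"
   "(\<lambda>S\<in>MStone. compose (Sec B S) (phi S) (psi S)) = (\<lambda>S\<in>MStone. \<lambda>x\<in>Sec B S. x)"
  using iso by (auto simp: isomorphism_def light_condensed_groups_def)
 have "phi S : Sec A S \<rightarrow> Sec B S" "psi S : Sec B S \<rightarrow> Sec A S"
  using phi psi S by (auto simp: presheaf_homs_def hom_def)
 moreover have "psi S (phi S x) = x" if "x : Sec A S" for x
  using fun_cong[OF fun_cong[OF eq(1), of S], of x] S that by (simp add: compose_def)
 moreover have "phi S (psi S x) = x" if "x : Sec B S" for x
  using fun_cong[OF fun_cong[OF eq(2), of S], of x] S that by (simp add: compose_def)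
 ultimately show ?thesis by (rule bij_betwI)
qed

context ab_presheaf
begin

lemma res_null_closed:
 "[|S : MStone; T : MStone; f : cmaps S T; x : null A T|] ==> res (null_condensed A) S T f x : null A S"
 using pull_null[OF _ _ cmapsD(1) continuous_map_id, of S T f x] by (simp add: res_null_condensed)

lemma solid_iff_bij: "solid A \<longleftrightarrow> (ALL S:MStone. bij_betw (one_minus_shift A S) (null A S) (null A S))"
proof
 show "solid A ==> ALL S:MStone. bij_betw (one_minus_shift A S) (null A S) (null A S)"
  unfolding solid_def using isomorphism_presheafD by blast
 assume *: "ALL S:MStone. bij_betw (one_minus_shift A S) (null A S) (null A S)"
 show "solid A" unfolding solid_def by (rule isomorphism_presheafI[OF one_minus_shift_presheaf_hom])
   (use * comm_group_null comm_group.axioms(2) res_null_closed in blast)+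
qed

text \<open>This fixed point form of the bijectivity of 1 - t is the one used later: a candidate for
  the tails of a sum only has to be checked against the equation.\<close>

lemma solid_iff:
 "solid A \<longleftrightarrow> (ALL S:MStone. ALL y:null A S. EX! z. z : null A S & z = y \<cdot>[A,times_Nbar S] shift A S z)"
proof -
 have "bij_betw (one_minus_shift A S) (null A S) (null A S) \<longleftrightarrow>
   (ALL y:null A S. EX! z. z : null A S & z = y \<cdot>[A,times_Nbar S] shift A S z)" if S: "S : MStone" for S
 proof -
  have "bij_betw (one_minus_shift A S) (null A S) (null A S) \<longleftrightarrow> (ALL y:null A S. EX! z. z : null A S & one_minus_shift A S z = y)"
   using one_minus_shift_hom[OF S] by (intro bij_betw_iff_ex1) (auto simp: hom_def)
  also have "... \<longleftrightarrow> (ALL y:null A S. EX! z. z : null A S & z = y \<cdot>[A,times_Nbar S] shift A S z)"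
  proof (intro ball_cong refl)
   fix y assume y: "y : null A S"
   have "z : null A S & one_minus_shift A S z = y \<longleftrightarrow> z : null A S & z = y \<cdot>[A,times_Nbar S] shift A S z" for z
    using one_minus_shift_eq_iff[OF S _ y] by blast
   thus "(EX! z. z : null A S & one_minus_shift A S z = y) \<longleftrightarrow>
     (EX! z. z : null A S & z = y \<cdot>[A,times_Nbar S] shift A S z)"
    by presburger
  qed
  finally show ?thesis .
 qed
 thus ?thesis by (simp add: solid_iff_bij)
qed

end

section \<open>Gluing of sections\<close>

locale light_condensed_group =
 fixes A :: "'u presheaf"
 assumes light_condensed: "light_condensed A"
begin

sublocale ab_presheaf A by standard (use light_condensed in \<open>simp add: light_condensed_def\<close>)

lemma covering_restrict:
 fixes n :: nat
 assumes "!!i. i < n ==> T i : MStone & continuous_map (T i) S (f i)"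
  and "topspace S <= (\<Union>i<n. f i ` topspace (T i))"
 shows "covering n T (%i. restrict (f i) (topspace (T i))) S" unfolding covering_def
proof (intro conjI allI impI)
 fix i assume "i < n"
 thus "T i : MStone" "restrict (f i) (topspace (T i)) : cmaps (T i) S"
  using assms(1) restrict_cmaps by blast+
next
 have "f i ` topspace (T i) <= topspace S" if "i < n" for i
  using assms(1)[OF that] continuous_map_image_subset_topspace by blast
 hence "topspace S = (\<Union>i<n. f i ` topspace (T i))" using assms(2) by blast
 thus "topspace S = (\<Union>i<n. restrict (f i) (topspace (T i)) ` topspace (T i))" by simp
qed

lemma gluing:
 fixes n :: nat
 assumes S: "S : MStone" and T: "!!i. i < n ==> T i : MStone & continuous_map (T i) S (f i)"
  and cover: "topspace S <= (\<Union>i<n. f i ` topspace (T i))"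
  and x: "!!i. i < n ==> x i : Sec A (T i)"
  and match: "!!i j U g h. [|i < n; j < n; U : MStone; continuous_map U (T i) g; continuous_map U (T j) h;
   !!p. p : topspace U ==> f i (g p) = f j (h p)|] ==> pull A U (T i) g (x i) = pull A U (T j) h (x j)"
 shows "EX! s. s : Sec A S & (ALL i<n. pull A (T i) S (f i) s = x i)"
proof -
 let ?f = "%i. restrict (f i) (topspace (T i))"
 have "matching_family A n T ?f x" unfolding matching_family_def
 proof (intro conjI allI impI ballI)
  fix i j U g h
  assume *: "i < n" "j < n" "U : MStone" "g : cmaps U (T i)" "h : cmaps U (T j)"
   "ALL p:topspace U. ?f i (g p) = ?f j (h p)"
  have "f i (g p) = f j (h p)" if p: "p : topspace U" for p
  proof -
   have "g p : topspace (T i)" "h p : topspace (T j)"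
    using * p continuous_map_image_subset_topspace[OF cmapsD(1)] by blast+
   thus ?thesis using bspec[OF *(6) p] by simp
  qed
  thus "res A U (T i) g (x i) = res A U (T j) h (x j)" using * by (simp add: res_eq_pull match cmapsD)
 qed (rule x)
 hence "EX! s. s : Sec A S & (ALL i<n. res A (T i) S (?f i) s = x i)"
  using light_condensed S covering_restrict[OF T cover] unfolding light_condensed_def by blast
 thus ?thesis by (simp only: pull_def)
qed

lemma cover_eqI:
 fixes n :: nat
 assumes S: "S : MStone" and T: "!!i. i < n ==> T i : MStone & continuous_map (T i) S (f i)"
  and cover: "topspace S <= (\<Union>i<n. f i ` topspace (T i))"
  and xy: "x : Sec A S" "y : Sec A S"
  and eq: "!!i. i < n ==> pull A (T i) S (f i) x = pull A (T i) S (f i) y"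
 shows "x = y"
proof -
 have "EX! s. s : Sec A S & (ALL i<n. pull A (T i) S (f i) s = pull A (T i) S (f i) x)"
 proof (rule gluing[OF S T cover])
  fix i j U g h assume *: "i < n" "j < n" "U : MStone" "continuous_map U (T i) g" "continuous_map U (T j) h"
   "!!p. p : topspace U ==> f i (g p) = f j (h p)"
  thus "pull A U (T i) g (pull A (T i) S (f i) x) = pull A U (T j) h (pull A (T j) S (f j) x)"
   using T S xy fun_cong[OF pull_cong[of U "%p. f i (g p)" "%p. f j (h p)" A S]] by (simp add: pull_pull)
 qed (use T S xy in auto)
 thus ?thesis using xy eq by metis
qed

text \<open>The empty family covers the empty space, so the group of sections over it is
  trivial.\<close>

lemma empty_eqI: "[|S : MStone; topspace S = {}; x : Sec A S; y : Sec A S|] ==> x = y"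
 by (rule cover_eqI[where n = 0]) auto

lemma cover2_eqI:
 assumes "S : MStone" "T : MStone" "T' : MStone" "continuous_map T S f" "continuous_map T' S f'"
  and "topspace S <= f ` topspace T Un f' ` topspace T'"
  and "x : Sec A S" "y : Sec A S"
  and "pull A T S f x = pull A T S f y" "pull A T' S f' x = pull A T' S f' y"
 shows "x = y"
proof (rule cover_eqI[where n = 2 and T = "%i. if i = 0 then T else T'" and f = "%i. if i = 0 then f else f'"])
 have "(\<Union>i<2::nat. (if i = 0 then f else f') ` topspace (if i = 0 then T else T')) = f ` topspace T Un f' ` topspace T'"
  by (auto simp: numeral_2_eq_2 lessThan_Suc)
 thus "topspace S <= (\<Union>i<2::nat. (if i = 0 then f else f') ` topspace (if i = 0 then T else T'))"
  using assms by simp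
qed (use assms in auto)

text \<open>Coverings are only required to be jointly surjective, so two closed pieces suffice,
  however they overlap. Equations can thus be checked on loci defined by equalities of continuous
  maps.\<close>

lemma closed_cover_eqI:
 assumes S: "S : MStone" and C: "closedin S C" "closedin S D" "topspace S <= C Un D"
  and xy: "x : Sec A S" "y : Sec A S"
  and eq: "pull A (subtopology S C) S (%p. p) x = pull A (subtopology S C) S (%p. p) y"
   "pull A (subtopology S D) S (%p. p) x = pull A (subtopology S D) S (%p. p) y"
 shows "x = y"
proof (rule cover2_eqI[OF S subtopology_MStone[OF S C(1)] subtopology_MStone[OF S C(2)] _ _ _ xy eq])
 show "topspace S <= (%p. p) ` topspace (subtopology S C) Un (%p. p) ` topspace (subtopology S D)"
  using C by auto
qed (simp_all add: continuous_map_from_subtopology)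

text \<open>The section with value \<open>x\<close> at the index \<open>k p\<close>, where
  \<open>x\<close> is viewed as a function on \<open>Nbar\<close> that vanishes at infinity.\<close>

definition npull :: "point topology => (point => nat option) => 'u => 'u" where
 "npull S k x = pull A S Nbar1 (%p. nbar_point (k p)) x"

lemma npull_cong: "(!!p. p : topspace S ==> k p = k' p) ==> npull S k x = npull S k' x"
 unfolding npull_def by (rule fun_cong[OF pull_cong]) simp

lemma npull_closed [simp]:
 "[|S : MStone; continuous_map S Nbar k; x : null A one_point|] ==> npull S k x : Sec A S"
 by (simp add: npull_def null_carrier continuous_map_into_Nbar1)

lemma npull_mult:
 "[|S : MStone; continuous_map S Nbar k; x : null A one_point; y : null A one_point|] ==>
  npull S k (x \<cdot>[A,Nbar1] y) = npull S k x \<cdot>[A,S] npull S k y"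
 by (simp add: npull_def null_carrier continuous_map_into_Nbar1 pull_mult)

lemma pull_npull:
 "[|S : MStone; T : MStone; continuous_map S T f; continuous_map T Nbar k; x : null A one_point|] ==>
  pull A S T f (npull T k x) = npull S (%p. k (f p)) x"
 by (simp add: npull_def null_carrier continuous_map_into_Nbar1 pull_pull)

lemma npull_None:
 assumes "S : MStone" "x : null A one_point" "!!p. p : topspace S ==> k p = None"
 shows "npull S k x = \<one>[A,S]"
proof -
 have c: "continuous_map S one_point (%_. %_. False)" by simp
 have "npull S k x = pull A S Nbar1 (%p. pair_point (%_. False, None)) x"
  unfolding npull_def by (rule fun_cong[OF pull_cong]) (simp add: assms(3) nbar_point_def)
 also have "... = pull A S one_point (%_. %_. False) (pull A one_point Nbar1 (at_inf) x)"
  using assms c by (simp add: pull_pull[OF _ _ _ c continuous_map_at] null_carrier)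
 also have "... = \<one>[A,S]" using assms c by (simp add: null_iff pull_one)
 finally show ?thesis .
qed

text \<open>On each of the two closed sets one of the sections on the right is trivial.\<close>

lemma npull_split:
 assumes S: "S : MStone" and x: "x : null A one_point"
  and c: "continuous_map S Nbar u" "continuous_map S Nbar v" "continuous_map S Nbar w"
  and split: "!!p. p : topspace S ==> u p = v p & w p = None \<or> u p = w p & v p = None"
 shows "npull S u x = npull S v x \<cdot>[A,S] npull S w x"
proof -
 have Hn: "Hausdorff_space Nbar" by (rule light_profinite_imp_Hausdorff[OF light_profinite_Nbar])
 let ?C = "{p : topspace S. u p = v p} Int {p : topspace S. w p = None}"
 let ?D = "{p : topspace S. u p = w p} Int {p : topspace S. v p = None}"
 have cl: "closedin S ?C" "closedin S ?D" using c by (auto intro!: closedin_Int closedin_equalizer[OF Hn])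
 have id: "continuous_map (subtopology S C) S (%p. p)" for C by (simp add: continuous_map_from_subtopology)
 have vw: "npull S v x : Sec A S" "npull S w x : Sec A S" "npull S u x : Sec A S" using S x c by simp_all
 interpret G: comm_group "sect A S" by (rule comm_group_sect[OF S])
 show ?thesis
 proof (rule closed_cover_eqI[OF S cl])
  show "topspace S <= ?C Un ?D" using split by blast
  note SC = subtopology_MStone[OF S cl(1)] and SD = subtopology_MStone[OF S cl(2)]
  interpret GC: comm_group "sect A (subtopology S ?C)" by (rule comm_group_sect[OF SC])
  interpret GD: comm_group "sect A (subtopology S ?D)" by (rule comm_group_sect[OF SD])
  have cC: "continuous_map (subtopology S C) Nbar u" "continuous_map (subtopology S C) Nbar v"
    "continuous_map (subtopology S C) Nbar w" for C
   using c by (simp_all add: continuous_map_from_subtopology)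
  have "npull (subtopology S ?C) u x = npull (subtopology S ?C) v x" "npull (subtopology S ?C) w x = \<one>[A,subtopology S ?C]"
   by (rule npull_cong, simp, rule npull_None[OF SC x], simp)
  thus "pull A (subtopology S ?C) S (%p. p) (npull S u x)
    = pull A (subtopology S ?C) S (%p. p) (npull S v x \<cdot>[A,S] npull S w x)"
   using S x c vw cC[of ?C] SC by (simp add: pull_mult[OF SC S id] pull_npull[OF SC S id])
  have "npull (subtopology S ?D) u x = npull (subtopology S ?D) w x" "npull (subtopology S ?D) v x = \<one>[A,subtopology S ?D]"
   by (rule npull_cong, simp, rule npull_None[OF SD x], simp)
  thus "pull A (subtopology S ?D) S (%p. p) (npull S u x)
    = pull A (subtopology S ?D) S (%p. p) (npull S v x \<cdot>[A,S] npull S w x)"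
   using S x c vw cC[of ?D] SD by (simp add: pull_mult[OF SD S id] pull_npull[OF SD S id])
 qed (use vw in simp_all)
qed

end

section \<open>Null families\<close>

text \<open>A null family \<open>k\<close> on \<open>S\<close> pulls a null sequence \<open>x\<close> back to the null sequence
 \<open>m \<mapsto> x\<^bsub>k(p, m)\<^esub>\<close> of functions of \<open>p \<in> S\<close>, where \<open>x\<^bsub>None\<^esub> = 0\<close>.\<close>

definition null_family :: "point topology => (point => nat option => nat option) => bool" where
 "null_family S k \<longleftrightarrow> (ALL p:topspace S. k p None = None) &
   (ALL m n. clopenin S {p : topspace S. k p (Some m) = Some n}) &
   (ALL n. EX N. ALL p:topspace S. ALL m. k p (Some m) = Some n --> m < N)"

lemma null_familyI:
 assumes "!!p. p : topspace S ==> k p None = None"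
  and "!!m n. clopenin S {p : topspace S. k p (Some m) = Some n}"
  and "!!n. EX N. ALL p:topspace S. ALL m. k p (Some m) = Some n --> m < N"
 shows "null_family S k" using assms by (simp add: null_family_def)

lemma null_family_None: "null_family S k ==> p : topspace S ==> k p None = None"
 by (simp add: null_family_def)

lemma null_family_clopenin: "null_family S k ==> clopenin S {p : topspace S. k p (Some m) = Some n}"
 by (simp add: null_family_def)

lemma null_family_bound:
 assumes "null_family S k"
 obtains N where "!!p m. p : topspace S ==> k p (Some m) = Some n ==> m < N"
 using assms unfolding null_family_def by blast

lemma null_family_bound_below:
 assumes "null_family S k"
 obtains N where "!!p m n. p : topspace S ==> k p (Some m) = Some n ==> n < L ==> m < N"
proof -
 have "EX N. ALL p:topspace S. ALL m n. k p (Some m) = Some n --> n < L --> m < N"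
 proof (induction L)
  case (Suc L)
  then obtain N where N: "!!p m n. p : topspace S ==> k p (Some m) = Some n ==> n < L ==> m < N" by blast
  obtain M where M: "!!p m. p : topspace S ==> k p (Some m) = Some L ==> m < M"
   using null_family_bound[OF assms] by blast
  have "m < max N M" if "p : topspace S" "k p (Some m) = Some n" "n < Suc L" for p m n
   using N[OF that(1,2)] M[of p m] that by (auto simp: less_Suc_eq less_max_iff_disj)
  thus ?case by blast
 qed simp
 thus thesis using that by blast
qed

text \<open>The bound on the slots that hold a given index is continuity at infinity: the indices
  tend to infinity uniformly in \<open>p\<close>.\<close>

lemma null_family_continuous:
 assumes "null_family S k"
 shows "continuous_map (times_Nbar S) Nbar (on_pairs k)"
proof (rule continuous_map_on_pairs)
 show "continuous_map (prod_topology S Nbar) Nbar (%z. k (fst z) (snd z))" unfolding continuous_map_into_Nbar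
 proof
  fix n
  obtain N where N: "!!p m. p : topspace S ==> k p (Some m) = Some n ==> m < N"
   using null_family_bound[OF assms] by blast
  show "clopenin (prod_topology S Nbar) {z : topspace (prod_topology S Nbar). k (fst z) (snd z) = Some n}"
   by (rule clopenin_prod_Nbar[where N = N])
    (use null_family_clopenin[OF assms] N null_family_None[OF assms] in auto)
 qed
qed

lemma null_family_shift:
 assumes "null_family S k"
 shows "null_family S (%p a. k p (map_option Suc a))"
proof (rule null_familyI)
 fix n
 obtain N where "!!p m. p : topspace S ==> k p (Some m) = Some n ==> m < N"
  using null_family_bound[OF assms] by blast
 thus "EX N. ALL p:topspace S. ALL m. k p (map_option Suc (Some m)) = Some n --> m < N"
  by (metis Suc_lessD option.map(2))
qed (use assms null_family_clopenin null_family_None in auto)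

lemma null_family_compose:
 assumes "null_family T k" "continuous_map S T f"
 shows "null_family S (%p. k (f p))"
proof -
 have f: "f p : topspace T" if "p : topspace S" for p
  using assms(2) that continuous_map_image_subset_topspace by blast
 show ?thesis
 proof (rule null_familyI)
  fix m n
  have "{p : topspace S. k (f p) (Some m) = Some n} = {p : topspace S. f p : {q : topspace T. k q (Some m) = Some n}}"
   using f by auto
  thus "clopenin S {p : topspace S. k (f p) (Some m) = Some n}"
   using clopenin_vimage[OF assms(2) null_family_clopenin[OF assms(1)]] by simp
  show "EX N. ALL p:topspace S. ALL m. k (f p) (Some m) = Some n --> m < N"
   using null_family_bound[OF assms(1), of n] f by metis
 qed (use f null_family_None[OF assms(1)] in auto)
qed

text \<open>Slot \<open>m\<close> is filled from slot \<open>h p (Some m)\<close> of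
  \<open>k\<close>. For a given value only finitely many intermediate slots occur, so the conditions
  stay clopen and bounded.\<close>

lemma null_family_bind:
 assumes k: "null_family S k" and h: "null_family S h"
 shows "null_family S (%p a. Option.bind (h p a) (%n. k p (Some n)))"
proof (rule null_familyI)
 fix l
 obtain L where L: "!!p n. p : topspace S ==> k p (Some n) = Some l ==> n < L"
  using null_family_bound[OF k] by blast
 obtain N where N: "!!p m n. p : topspace S ==> h p (Some m) = Some n ==> n < L ==> m < N"
  using null_family_bound_below[OF h] by blast
 show "EX N. ALL p:topspace S. ALL m. Option.bind (h p (Some m)) (%n. k p (Some n)) = Some l --> m < N"
  using L N by (intro exI[of _ N]) (auto simp: bind_eq_Some_conv)
 fix m
 have "{p : topspace S. Option.bind (h p (Some m)) (%n. k p (Some n)) = Some l} =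
   (\<Union>n<L. {p : topspace S. h p (Some m) = Some n} Int {p : topspace S. k p (Some n) = Some l})"
  using L by (auto simp: bind_eq_Some_conv)
 thus "clopenin S {p : topspace S. Option.bind (h p (Some m)) (%n. k p (Some n)) = Some l}"
  using k h by (auto intro!: clopenin_UN clopenin_Int null_family_clopenin)
qed (use null_family_None[OF h] in simp)

section \<open>Summation in solid groups\<close>

locale solid_group = light_condensed_group A for A :: "'u presheaf" +
 assumes solid: "solid A"
begin

lemma solid_unique: "[|S : MStone; y : null A S|] ==> EX! z. z : null A S & z = y \<cdot>[A,times_Nbar S] shift A S z"
 using solid unfolding solid_iff by blast

text \<open>The tails of a null sequence form the null sequence \<open>(1 - t)\<inverse> y\<close>.\<close>

definition tails :: "point topology => 'u => 'u" where
 "tails S y = (THE z. z : null A S & z = y \<cdot>[A,times_Nbar S] shift A S z)"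

lemma tails:
 assumes "S : MStone" "y : null A S"
 shows "tails S y : null A S" "tails S y = y \<cdot>[A,times_Nbar S] shift A S (tails S y)"
 using theI'[OF solid_unique[OF assms]] by (auto simp: tails_def)

lemma tails_eqI:
 "[|S : MStone; y : null A S; z : null A S; z = y \<cdot>[A,times_Nbar S] shift A S z|] ==> tails S y = z"
 using solid_unique[of S y] tails[of S y] by blast

text \<open>The tail starting at index 0 is the sum of the whole sequence.\<close>

definition total :: "point topology => 'u => 'u" where
 "total S y = pull A S (times_Nbar S) (%p. pair_point (p, Some 0)) (tails S y)"

lemma total_closed [simp]: "S : MStone ==> y : null A S ==> total S y : Sec A S"
 using tails(1)[of S y] by (simp add: total_def null_carrier continuous_map_at)

lemma total_eqI:
 "[|S : MStone; y : null A S; z : null A S; z = y \<cdot>[A,times_Nbar S] shift A S z|] ==>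
  total S y = pull A S (times_Nbar S) (%p. pair_point (p, Some 0)) z"
 using tails_eqI[of S y z] by (simp add: total_def)

lemma total_mult:
 assumes S: "S : MStone" and y: "y : null A S" "y' : null A S"
 shows "total S (y \<cdot>[A,times_Nbar S] y') = total S y \<cdot>[A,S] total S y'"
proof -
 interpret G: comm_group "sect A (times_Nbar S)" using S by (simp add: comm_group_sect)
 let ?z = "tails S y" and ?z' = "tails S y'"
 note z = tails[OF S y(1)] and z' = tails[OF S y(2)]
 note m = subgroup.m_closed[OF subgroup_null[OF S]]
 note [simp] = null_carrier[OF y(1)] null_carrier[OF y(2)] null_carrier[OF z(1)] null_carrier[OF z'(1)]
  null_carrier[OF shift_closed[OF S z(1)]] null_carrier[OF shift_closed[OF S z'(1)]]
 have "shift A S (?z \<cdot>[A,times_Nbar S] ?z') = shift A S ?z \<cdot>[A,times_Nbar S] shift A S ?z'"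
  using S m[OF z(1) z'(1)] z(1) z'(1) by (simp add: shift_eq pull_mult continuous_map_shift_map)
 hence "(y \<cdot>[A,times_Nbar S] y') \<cdot>[A,times_Nbar S] shift A S (?z \<cdot>[A,times_Nbar S] ?z')
   = (y \<cdot>[A,times_Nbar S] shift A S ?z) \<cdot>[A,times_Nbar S] (y' \<cdot>[A,times_Nbar S] shift A S ?z')"
  by (simp add: G.m_ac)
 also have "... = ?z \<cdot>[A,times_Nbar S] ?z'" using z(2) z'(2) by simp
 finally have "total S (y \<cdot>[A,times_Nbar S] y')
   = pull A S (times_Nbar S) (%p. pair_point (p, Some 0)) (?z \<cdot>[A,times_Nbar S] ?z')"
  by (intro total_eqI S m y z(1) z'(1)) simp
 thus ?thesis using S by (simp add: total_def pull_mult continuous_map_at)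
qed

text \<open>The pullback of the tails satisfies the equation for the tails of the pullback, because
  \<open>shift_map\<close> acts on the other factor; uniqueness of the solution does the
  rest.\<close>

lemma total_pull:
 assumes S: "S : MStone" "T : MStone" and f: "continuous_map S T f" and y: "y : null A T"
 shows "pull A S T f (total T y) = total S (pull A (times_Nbar S) (times_Nbar T) (pair_map f (%a. a)) y)"
proof -
 let ?F = "pull A (times_Nbar S) (times_Nbar T) (pair_map f (%a. a))"
 have id: "continuous_map Nbar Nbar (%a. a)" by simp
 note c = continuous_map_pair_map[OF f id]
 note z = tails[OF S(2) y]
 note n = pull_null[OF S f id refl]
 note tn = null_carrier[OF z(1)]
 have "?F (tails T y) = ?F y \<cdot>[A,times_Nbar S] ?F (shift A T (tails T y))"
  using z(2) S c y tn null_carrier[OF shift_closed[OF S(2) z(1)]] pull_mult[OF _ _ c, of y "shift A T (tails T y)"]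
  by (simp add: null_carrier)
 also have "?F (shift A T (tails T y)) = shift A S (?F (tails T y))"
 proof -
  have "?F (shift A T (tails T y)) = pull A (times_Nbar S) (times_Nbar T) (%q. shift_map (pair_map f (%a. a) q)) (tails T y)"
   using S z(1) tn by (simp add: shift_eq pull_pull[OF _ _ _ c continuous_map_shift_map])
  also have "... = pull A (times_Nbar S) (times_Nbar T) (%q. pair_map f (%a. a) (shift_map q)) (tails T y)"
   by (rule fun_cong[OF pull_cong]) auto
  also have "... = shift A S (?F (tails T y))"
   using S n[OF z(1)] tn by (simp add: shift_eq pull_pull[OF _ _ _ continuous_map_shift_map c])
  finally show ?thesis .
 qed
 finally have "total S (?F y) = pull A S (times_Nbar S) (%p. pair_point (p, Some 0)) (?F (tails T y))"
  by (intro total_eqI S(1) n y z(1))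
 also have "... = pull A S (times_Nbar T) (%p. pair_point (f p, Some 0)) (tails T y)"
  using S tn by (simp add: pull_pull[OF _ _ _ continuous_map_at c])
 also have "... = pull A S T f (total T y)"
  using S tn by (simp add: total_def pull_pull[OF _ _ _ f continuous_map_at])
 finally show ?thesis ..
qed

text \<open>The sum over all slots \<open>m\<close> of the terms of \<open>x\<close> with index
  \<open>k p (Some m)\<close>, as a section in \<open>p\<close>.\<close>

definition nsum :: "point topology => (point => nat option => nat option) => 'u => 'u" where
 "nsum S k x = total S (npull (times_Nbar S) (on_pairs k) x)"

lemma npull_null:
 assumes "S : MStone" "null_family S k" "x : null A one_point"
 shows "npull (times_Nbar S) (on_pairs k) x : null A S" unfolding null_iff
proof
 show "npull (times_Nbar S) (on_pairs k) x : Sec A (times_Nbar S)"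
  using assms by (simp add: null_family_continuous)
 show "pull A S (times_Nbar S) (at_inf) (npull (times_Nbar S) (on_pairs k) x) = \<one>[A,S]"
  using assms by (simp add: pull_npull[OF _ _ continuous_map_at] null_family_continuous)
   (rule npull_None, auto simp: null_family_None)
qed

lemma shift_npull:
 assumes S: "S : MStone" and k: "null_family S k" and x: "x : null A one_point"
 shows "shift A S (npull (times_Nbar S) (on_pairs k) x) = npull (times_Nbar S) (on_pairs (%p a. k p (map_option Suc a))) x"
proof -
 have "shift A S (npull (times_Nbar S) (on_pairs k) x) = npull (times_Nbar S) (%q. on_pairs k (shift_map q)) x"
  using S x by (simp add: shift_eq npull_null k pull_npull[OF _ _ continuous_map_shift_map null_family_continuous])
 also have "... = npull (times_Nbar S) (on_pairs (%p a. k p (map_option Suc a))) x" by (rule npull_cong) auto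
 finally show ?thesis .
qed

lemma nsum_closed [simp]:
 "[|S : MStone; null_family S k; x : null A one_point|] ==> nsum S k x : Sec A S"
 by (simp add: nsum_def npull_null)

lemma nsum_cong:
 assumes "!!p m. p : topspace S ==> k p (Some m) = k' p (Some m)" "null_family S k" "null_family S k'"
 shows "nsum S k x = nsum S k' x"
proof -
 have "k p a = k' p a" if "p : topspace S" for p a
  using that assms by (cases a) (auto simp: null_family_None)
 thus ?thesis unfolding nsum_def by (intro arg_cong[where f = "total S"] npull_cong) auto
qed

lemma nsum_split:
 assumes S: "S : MStone" and x: "x : null A one_point"
  and k: "null_family S u" "null_family S v" "null_family S w"
  and split: "!!p m. p : topspace S ==> u p (Some m) = v p (Some m) & w p (Some m) = None \<or> u p (Some m) = w p (Some m) & v p (Some m) = None"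
 shows "nsum S u x = nsum S v x \<cdot>[A,S] nsum S w x"
proof -
 have split': "u p a = v p a & w p a = None \<or> u p a = w p a & v p a = None" if "p : topspace S" for p a
  using split[OF that] k that by (cases a) (auto simp: null_family_None)
 have "npull (times_Nbar S) (on_pairs u) x = npull (times_Nbar S) (on_pairs v) x \<cdot>[A,times_Nbar S] npull (times_Nbar S) (on_pairs w) x"
 proof (rule npull_split)
  fix q assume "q : topspace (times_Nbar S)"
  then obtain p a where "q = pair_point (p, a)" "p : topspace S" by auto
  thus "on_pairs u q = on_pairs v q & on_pairs w q = None \<or> on_pairs u q = on_pairs w q & on_pairs v q = None"
   using split'[of p a] by simp
 qed (use S x k null_family_continuous in simp_all)
 thus ?thesis using S x k by (simp add: nsum_def total_mult npull_null)
qed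

lemma nsum_mult:
 "[|S : MStone; null_family S k; x : null A one_point; y : null A one_point|] ==>
  nsum S k (x \<cdot>[A,Nbar1] y) = nsum S k x \<cdot>[A,S] nsum S k y"
 by (simp add: nsum_def npull_mult total_mult npull_null null_family_continuous)

lemma pull_nsum:
 assumes S: "S : MStone" "T : MStone" and f: "continuous_map S T f" and k: "null_family T k" and x: "x : null A one_point"
 shows "pull A S T f (nsum T k x) = nsum S (%p. k (f p)) x"
proof -
 have c: "continuous_map (times_Nbar S) (times_Nbar T) (pair_map f (%a. a))"
  using f by (simp add: continuous_map_pair_map)
 have "pull A (times_Nbar S) (times_Nbar T) (pair_map f (%a. a)) (npull (times_Nbar T) (on_pairs k) x)
   = npull (times_Nbar S) (%q. on_pairs k (pair_map f (%a. a) q)) x"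
  using S x k by (simp add: pull_npull[OF _ _ c null_family_continuous])
 also have "... = npull (times_Nbar S) (on_pairs (%p. k (f p))) x" by (rule npull_cong) auto
 finally show ?thesis using S f k x by (simp add: nsum_def total_pull npull_null)
qed

lemma nsum_None:
 assumes S: "S : MStone" and x: "x : null A one_point" and k: "!!p a. p : topspace S ==> k p a = None"
 shows "nsum S k x = \<one>[A,S]"
proof -
 interpret G: comm_group "sect A (times_Nbar S)" using S by (simp add: comm_group_sect)
 have "npull (times_Nbar S) (on_pairs k) x = \<one>[A,times_Nbar S]" using S x k by (intro npull_None) auto
 moreover have "\<one>[A,times_Nbar S] : null A S" using subgroup.one_closed[OF subgroup_null[OF S]] .
 moreover from this have "shift A S \<one>[A,times_Nbar S] = \<one>[A,times_Nbar S]"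
  using S by (simp add: shift_eq pull_one continuous_map_shift_map)
 ultimately show ?thesis using total_eqI[OF S, of "\<one>[A,times_Nbar S]" "\<one>[A,times_Nbar S]"] S
  by (simp add: nsum_def pull_one continuous_map_at)
qed

text \<open>If at most one term is nontrivial at each point, then the tails are again pulled back from
 the given null sequence.\<close>

lemma nsum_single:
 assumes S: "S : MStone" and k: "null_family S k" and x: "x : null A one_point"
  and single: "!!p m m'. [|p : topspace S; k p (Some m) ~= None; k p (Some m') ~= None|] ==> m = m'"
  and kappa: "!!p m. p : topspace S ==> k p (Some m) ~= None ==> kappa p = k p (Some m)"
   "!!p. p : topspace S ==> (!!m. k p (Some m) = None) ==> kappa p = None"
 shows "nsum S k x = npull S kappa x"
proof -
 \<comment> \<open>The tail from \<open>j\<close> on is the single nontrivial term as long as its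
   slot has not been passed.\<close>
 define zeta where "zeta p a = (case a of None => None | Some j => if EX m>=j. k p (Some m) ~= None then kappa p else None)" for p a
 have zeta_iff: "zeta p (Some j) = Some n \<longleftrightarrow> (EX m>=j. k p (Some m) = Some n)" if "p : topspace S" for p j n
  using kappa(1)[OF that] by (auto simp: zeta_def) metis+
 have zeta: "null_family S zeta"
 proof (rule null_familyI)
  fix n
  obtain N where N: "!!p m. p : topspace S ==> k p (Some m) = Some n ==> m < N"
   using null_family_bound[OF k] by blast
  thus "EX N. ALL p:topspace S. ALL m. zeta p (Some m) = Some n --> m < N"
   by (intro exI[of _ N]) (auto simp: zeta_iff dest!: N)
  fix j
  have "{p : topspace S. zeta p (Some j) = Some n} = (\<Union>m\<in>{j..<N}. {p : topspace S. k p (Some m) = Some n})"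
   using N by (auto simp: zeta_iff) (metis atLeastLessThan_iff)
  thus "clopenin S {p : topspace S. zeta p (Some j) = Some n}"
   using k by (auto intro!: clopenin_UN null_family_clopenin)
 qed (simp add: zeta_def)
 have step: "zeta p a = k p a & zeta p (map_option Suc a) = None \<or> zeta p a = zeta p (map_option Suc a) & k p a = None"
  if p: "p : topspace S" for p a
 proof (cases a)
  case None
  thus ?thesis using null_family_None[OF k p] by (simp add: zeta_def)
 next
  case (Some j)
  show ?thesis
  proof (cases "k p (Some j) = None")
   case True
   hence "(EX m>=j. k p (Some m) ~= None) \<longleftrightarrow> (EX m>=Suc j. k p (Some m) ~= None)"
    by (metis Suc_leD Suc_leI le_neq_implies_less)
   thus ?thesis using True Some by (simp add: zeta_def)
  next
   case False
   hence "~ (EX m>=Suc j. k p (Some m) ~= None)" using single[OF p] by (metis Suc_n_not_le_n)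
   thus ?thesis using False Some kappa(1)[OF p False] by (auto simp: zeta_def)
  qed
 qed
 let ?y = "npull (times_Nbar S) (on_pairs k) x" and ?z = "npull (times_Nbar S) (on_pairs zeta) x"
 have "?z = ?y \<cdot>[A,times_Nbar S] shift A S ?z" unfolding shift_npull[OF S zeta x]
 proof (rule npull_split[OF times_Nbar_MStone[OF S] x])
  fix q assume "q : topspace (times_Nbar S)"
  then obtain p a where "q = pair_point (p, a)" "p : topspace S" by auto
  thus "on_pairs zeta q = on_pairs k q & on_pairs (%p a. zeta p (map_option Suc a)) q = None \<or>
    on_pairs zeta q = on_pairs (%p a. zeta p (map_option Suc a)) q & on_pairs k q = None"
   using step[of p a] by simp
 qed (intro null_family_continuous zeta k null_family_shift)+
 hence "nsum S k x = pull A S (times_Nbar S) (%p. pair_point (p, Some 0)) ?z"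
  unfolding nsum_def by (intro total_eqI S npull_null k zeta x)
 also have "... = npull S (%p. zeta p (Some 0)) x"
  using S x by (simp add: pull_npull[OF _ _ continuous_map_at null_family_continuous[OF zeta]])
 also have "... = npull S kappa x" using kappa by (intro npull_cong) (auto simp: zeta_def)
 finally show ?thesis .
qed

text \<open>Rearrangement of sums. The tails of the original sum are obtained from the rearranged
 families in which all terms below the tail are dropped.\<close>

lemma nsum_reindex:
 assumes S: "S : MStone" and k: "null_family S k" and h: "null_family S h" and x: "x : null A one_point"
  and ex1: "!!p n. [|p : topspace S; k p (Some n) ~= None|] ==> EX! m. h p (Some m) = Some n"
 shows "nsum S (%p a. Option.bind (h p a) (%n. k p (Some n))) x = nsum S k x"
proof -
 let ?S = "times_Nbar S"
 have S': "?S : MStone" using S by simp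
 \<comment> \<open>The position of the tail becomes a parameter: over the point (p, n) of
   \<open>times_Nbar S\<close> the rearranged family keeps only those terms whose original index
   \<open>n'\<close> satisfies \<open>P n n'\<close>, and it is empty at infinity.\<close>
 define d where "d P q a = (case unpair_point q of (p, b) => case b of None => None | Some n =>
   Option.bind (h p a) (%n'. if P n n' then k p (Some n') else None))" for P q a
 have d_pair: "d P (pair_point (p, b)) a = (case b of None => None | Some n =>
   Option.bind (h p a) (%n'. if P n n' then k p (Some n') else None))" for P p b a
  by (simp add: d_def)
 have d: "null_family ?S (d P)" if P: "!!n n'. P n n' ==> n <= n'" for P :: "nat => nat => bool"
 proof (rule null_familyI)
  show "d P q None = None" if "q : topspace ?S" for q
   using that null_family_None[OF h] by (auto simp: d_pair split: option.split)
  fix l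
  obtain L where L: "!!p n. p : topspace S ==> k p (Some n) = Some l ==> n < L"
   using null_family_bound[OF k] by blast
  obtain N where N: "!!p m n. p : topspace S ==> h p (Some m) = Some n ==> n < L ==> m < N"
   using null_family_bound_below[OF h] by blast
  have iff: "d P (pair_point (p, b)) (Some m) = Some l \<longleftrightarrow>
    (EX n n'. b = Some n & h p (Some m) = Some n' & P n n' & k p (Some n') = Some l)" for p b m
   by (auto simp: d_pair bind_eq_Some_conv split: option.split if_splits)
  have "m < N" if q: "q : topspace ?S" "d P q (Some m) = Some l" for q m
  proof -
   obtain p b where pb: "q = pair_point (p, b)" "p : topspace S" using q(1) by auto
   thus ?thesis using q(2) L N iff by blast
  qed
  thus "EX N. ALL q:topspace ?S. ALL m. d P q (Some m) = Some l --> m < N" by blast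
  fix m
  let ?Q = "%p b. EX n n'. b = Some n & h p (Some m) = Some n' & P n n' & k p (Some n') = Some l"
  have "clopenin (prod_topology S Nbar) {z : topspace (prod_topology S Nbar). ?Q (fst z) (snd z)}"
  proof (rule clopenin_prod_Nbar[where N = L])
   fix n
   have "{p : topspace S. ?Q p (Some n)} = (\<Union>n'\<in>{n'. n' < L & P n n'}.
     {p : topspace S. h p (Some m) = Some n'} Int {p : topspace S. k p (Some n') = Some l})"
    using L by auto
   thus "clopenin S {p : topspace S. ?Q p (Some n)}"
    using k h by (auto intro!: clopenin_UN clopenin_Int null_family_clopenin)
  next
   fix p n assume "p : topspace S" "?Q p (Some n)"
   then obtain n' where "P n n'" "k p (Some n') = Some l" by blast
   thus "n < L" using L[OF `p : topspace S`] P[of n n'] by fastforce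
  qed simp
  hence "clopenin ?S {q : topspace ?S. unpair_point q : {z : topspace (prod_topology S Nbar). ?Q (fst z) (snd z)}}"
   by (rule clopenin_vimage[OF continuous_map_unpair_point])
  moreover have "{q : topspace ?S. unpair_point q : {z : topspace (prod_topology S Nbar). ?Q (fst z) (snd z)}}
    = {q : topspace ?S. d P q (Some m) = Some l}"
   using iff by auto
  ultimately show "clopenin ?S {q : topspace ?S. d P q (Some m) = Some l}" by simp
 qed
 let ?ge = "d (%n n'. n <= n')" and ?gt = "d (%n n'. n < n')" and ?eq = "d (%n n'. n = n')"
 have ge: "null_family ?S ?ge" and gt: "null_family ?S ?gt" and eq: "null_family ?S ?eq" by (rule d; simp)+
 let ?y = "npull ?S (on_pairs k) x" and ?z = "nsum ?S ?ge x"
 \<comment> \<open>The tail from \<open>n\<close> on splits into the term with original index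
   \<open>n\<close>, which is the given sequence, and the tail from \<open>n + 1\<close> on, which
   is the shift of \<open>?z\<close>.\<close>
 have "?z = nsum ?S ?eq x \<cdot>[A,?S] nsum ?S ?gt x"
 proof (rule nsum_split[OF S' x ge eq gt])
  fix q m assume "q : topspace ?S"
  then obtain p b where pb: "q = pair_point (p, b)" "p : topspace S" by auto
  show "?ge q (Some m) = ?eq q (Some m) & ?gt q (Some m) = None \<or> ?ge q (Some m) = ?gt q (Some m) & ?eq q (Some m) = None"
   unfolding pb d_pair by (cases b; cases "h p (Some m)") auto
 qed
 also have "nsum ?S ?eq x = ?y"
 proof (rule nsum_single[OF S' eq x])
  have eq_iff: "?eq (pair_point (p, b)) (Some m) = Some l \<longleftrightarrow> (EX n. b = Some n & h p (Some m) = Some n & k p (Some n) = Some l)" for p b m l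
   by (auto simp: d_pair bind_eq_Some_conv split: option.split if_splits)
  fix q assume "q : topspace ?S"
  then obtain p b where pb: "q = pair_point (p, b)" "p : topspace S" by auto
  show "m = m'" if ne: "?eq q (Some m) ~= None" "?eq q (Some m') ~= None" for m m'
  proof -
   obtain l l' where "?eq q (Some m) = Some l" "?eq q (Some m') = Some l'" using ne by auto
   then obtain n where "h p (Some m) = Some n" "h p (Some m') = Some n" "k p (Some n) ~= None"
    unfolding pb eq_iff by auto
   thus ?thesis using ex1[OF pb(2)] by blast
  qed
  show "on_pairs k q = ?eq q (Some m)" if "?eq q (Some m) ~= None" for m
   using that eq_iff unfolding pb on_pairs_pair_point by (metis not_None_eq)
  show "on_pairs k q = None" if "!!m. ?eq q (Some m) = None"
  proof (rule ccontr)
   assume ne: "on_pairs k q ~= None"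
   then obtain n where b: "b = Some n" using pb null_family_None[OF k pb(2)] by (cases b) auto
   then obtain l where l: "k p (Some n) = Some l" using ne pb by auto
   then obtain m where "h p (Some m) = Some n" using ex1[OF pb(2), of n] by auto
   hence "?eq q (Some m) = Some l" unfolding pb eq_iff using b l by blast
   thus False using that by simp
  qed
 qed
 also have "nsum ?S ?gt x = shift A S ?z"
 proof -
  have z: "?z : null A S" unfolding null_iff
  proof
   have "pull A S ?S (at_inf) ?z = nsum S (%p. ?ge (pair_point (p, None))) x"
    by (rule pull_nsum[OF S S' continuous_map_at ge x])
   also have "... = \<one>[A,S]" by (rule nsum_None[OF S x]) (simp add: d_pair)
   finally show "pull A S ?S (at_inf) ?z = \<one>[A,S]" .
  qed (use S' ge x in simp)
  have "shift A S ?z = nsum ?S (%q. ?ge (shift_map q)) x"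
   unfolding shift_eq[OF S z] by (rule pull_nsum[OF S' S' continuous_map_shift_map ge x])
  also have "... = nsum ?S ?gt x"
  proof (rule nsum_cong[OF _ null_family_compose[OF ge continuous_map_shift_map] gt])
   fix q m assume "q : topspace ?S"
   thus "?ge (shift_map q) (Some m) = ?gt q (Some m)" by (auto simp: d_pair Suc_le_eq split: option.split)
  qed
  finally show ?thesis ..
 qed
 finally have z_eq: "?z = ?y \<cdot>[A,?S] shift A S ?z" .
 have z: "?z : null A S" unfolding null_iff
 proof
  have "pull A S ?S (at_inf) ?z = nsum S (%p. ?ge (pair_point (p, None))) x"
   by (rule pull_nsum[OF S S' continuous_map_at ge x])
  also have "... = \<one>[A,S]" by (rule nsum_None[OF S x]) (simp add: d_pair)
  finally show "pull A S ?S (at_inf) ?z = \<one>[A,S]" .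
 qed (use S' ge x in simp)
 have "nsum S k x = pull A S ?S (%p. pair_point (p, Some 0)) ?z"
  unfolding nsum_def[of S k] by (rule total_eqI[OF S npull_null[OF S k x] z z_eq])
 also have "... = nsum S (%p. ?ge (pair_point (p, Some 0))) x"
  by (rule pull_nsum[OF S S' continuous_map_at ge x])
 also have "... = nsum S (%p a. Option.bind (h p a) (%n. k p (Some n))) x"
  by (rule nsum_cong[OF _ null_family_compose[OF ge continuous_map_at] null_family_bind[OF k h]]) (simp add: d_pair)
 finally show ?thesis ..
qed

end

section \<open>Integration of sequences of functions against null sequences\<close>

text \<open>Continuity into a countable product of discrete spaces, stated coordinatewise.\<close>

definition cont_seq :: "'a topology => ('a => nat => 'b) => bool" where
 "cont_seq S c \<longleftrightarrow> (ALL n. locally_constant S (%p. c p n))"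

lemma cont_seq_map: "cont_seq S c ==> cont_seq S (%p n. F n (c p n))" unfolding cont_seq_def
proof
 fix n assume "ALL n. locally_constant S (%p. c p n)"
 hence "locally_constant S (F n o (%p. c p n))"
  by (intro continuous_map_compose[of _ "discrete_topology UNIV"]) (auto simp: continuous_map_def)
 thus "locally_constant S (%p. F n (c p n))" by (simp add: o_def)
qed

lemma cont_seq_binop: "cont_seq S c ==> cont_seq S d ==> cont_seq S (%p n. F (c p n) (d p n))"
 unfolding cont_seq_def using continuous_map_discrete_binop[of S _ _ F] by blast

lemma cont_seq_compose: "cont_seq T c ==> continuous_map S T f ==> cont_seq S (%p. c (f p))"
 unfolding cont_seq_def
proof
 fix n assume "ALL n. locally_constant T (%p. c p n)" "continuous_map S T f"
 hence "locally_constant S ((%p. c p n) o f)" by (intro continuous_map_compose[of S T]) simp_all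
 thus "locally_constant S (%p. c (f p) n)" by (simp add: o_def)
qed

lemma cont_seq_const: "cont_seq S (%p. c)" by (simp add: cont_seq_def)

lemma cont_seq_cong: "cont_seq S c ==> (!!p n. p : topspace S ==> c p n = d p n) ==> cont_seq S d"
 unfolding cont_seq_def
proof
 fix n assume *: "ALL n. locally_constant S (%p. c p n)" "!!p n. p : topspace S ==> c p n = d p n"
 show "locally_constant S (%p. d p n)" by (rule continuous_map_eq[where f = "%p. c p n"]) (use * in simp_all)
qed

lemma cont_seq_clopenin: "cont_seq S c ==> clopenin S {p : topspace S. P (c p n)}"
proof -
 assume c: "cont_seq S c"
 have "clopenin S {p : topspace S. c p n : {v. P v}}"
  by (rule clopenin_vimage[of S "discrete_topology UNIV"]) (use c in \<open>auto simp: cont_seq_def clopenin_def\<close>)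
 thus ?thesis by simp
qed

lemma cont_seq_clopenin2:
 assumes "cont_seq S c" "cont_seq S d"
 shows "clopenin S {p : topspace S. P (c p n) (d p n)}"
 using cont_seq_clopenin[OF cont_seq_binop[OF assms, of Pair], of "%z. P (fst z) (snd z)" n] by simp

lemma cont_seq_bound:
 fixes c :: "'a => nat => nat"
 assumes "compact_space S" "cont_seq S c"
 obtains B where "!!p. p : topspace S ==> c p n < B"
proof -
 have "compactin (discrete_topology UNIV) ((%p. c p n) ` topspace S)"
  using assms by (intro image_compactin[of S]) (auto simp: compact_space_def cont_seq_def)
 hence "finite ((%p. c p n) ` topspace S)" by (simp add: compactin_discrete_topology)
 then obtain B where "ALL v:(%p. c p n) ` topspace S. v < B" using finite_nat_set_iff_bounded by blast
 thus thesis using that by blast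
qed

text \<open>Multiplicity is turned into repetition: the slots coding (n, j) with
  \<open>j < c p n\<close> all hold the index \<open>n\<close>, so the sum of this family is the sum
  with natural coefficients \<open>c p n\<close>.\<close>

definition count_family :: "(point => nat => nat) => point => nat option => nat option" where
 "count_family c p a = (case a of None => None
   | Some m => case prod_decode m of (n, j) => if j < c p n then Some n else None)"

lemma count_family_simps [simp]:
 "count_family c p None = None"
 "count_family c p (Some (prod_encode (n, j))) = (if j < c p n then Some n else None)"
 by (simp_all add: count_family_def)

lemma prod_encode_exhaust: obtains n j where "m = prod_encode (n, j)"
 by (metis prod_decode_inverse prod.exhaust)

lemma encode_bound: "EX N. ALL j<B. prod_encode (n, j) < (N::nat)"
proof -
 have "finite ((%j. prod_encode (n, j)) ` {..<B})" by simp
 then obtain N where "ALL m:(%j. prod_encode (n, j)) ` {..<B}. m < N"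
  using finite_nat_set_iff_bounded by blast
 thus ?thesis by blast
qed

text \<open>By compactness \<open>d p n\<close> is bounded in \<open>p\<close>, so a given index
  \<open>n\<close> occupies slots from a finite set.\<close>

lemma null_family_interval:
 assumes S: "compact_space S" and cd: "cont_seq S c" "cont_seq S d"
  and k: "!!p. k p None = None"
   "!!p n j. k p (Some (prod_encode (n, j))) = (if c p n <= j & j < d p n then Some n else None)"
 shows "null_family S k"
proof (rule null_familyI)
 fix n
 obtain B where B: "!!p. p : topspace S ==> d p n < B" using cont_seq_bound[OF S cd(2)] by blast
 obtain N where N: "ALL j<B. prod_encode (n, j) < N" using encode_bound by blast
 have "m < N" if "p : topspace S" "k p (Some m) = Some n" for p m
 proof -
  obtain n' j where m: "m = prod_encode (n', j)" by (rule prod_encode_exhaust)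
  hence "n' = n" "j < d p n" using that(2) by (simp_all add: k split: if_splits)
  thus ?thesis using B[OF that(1)] N m by simp
 qed
 thus "EX N. ALL p:topspace S. ALL m. k p (Some m) = Some n --> m < N" by blast
 fix m
 obtain n' j where m: "m = prod_encode (n', j)" by (rule prod_encode_exhaust)
 have "{p : topspace S. k p (Some m) = Some n} = {p : topspace S. n' = n & c p n' <= j & j < d p n'}"
  by (auto simp: m k)
 thus "clopenin S {p : topspace S. k p (Some m) = Some n}"
  using cont_seq_clopenin2[OF cd, of "%u v. n' = n & u <= j & j < v" n'] by simp
qed (simp add: k)

lemma null_family_count: "compact_space S ==> cont_seq S c ==> null_family S (count_family c)"
 by (rule null_family_interval[where c = "%_ _. 0"]) (simp_all add: cont_seq_const)

lemma MStone_compact: "S : MStone ==> compact_space S" by (simp add: MStone_iff light_profinite_compact)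

section \<open>Sums with natural and with integer coefficients\<close>

context solid_group
begin

definition csum :: "point topology => (point => nat => nat) => 'u => 'u" where
 "csum S c x = nsum S (count_family c) x"

lemma csum_closed [simp]:
 "[|S : MStone; cont_seq S c; x : null A one_point|] ==> csum S c x : Sec A S"
 by (simp add: csum_def null_family_count MStone_compact)

lemma csum_cong:
 assumes "S : MStone" "cont_seq S c" "!!p n. p : topspace S ==> c p n = d p n"
 shows "csum S c x = csum S d x"
proof -
 have "cont_seq S d" using cont_seq_cong assms by blast
 thus ?thesis unfolding csum_def using assms
  by (intro nsum_cong null_family_count MStone_compact) (auto simp: count_family_def split: prod.split)
qed

lemma csum_pull:
 "[|S : MStone; T : MStone; continuous_map S T f; cont_seq T c; x : null A one_point|] ==>
  pull A S T f (csum T c x) = csum S (%p. c (f p)) x"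
 by (simp add: csum_def pull_nsum null_family_count MStone_compact) (simp add: count_family_def[abs_def])

lemma csum_mult:
 "[|S : MStone; cont_seq S c; x : null A one_point; y : null A one_point|] ==>
  csum S c (x \<cdot>[A,Nbar1] y) = csum S c x \<cdot>[A,S] csum S c y"
 by (simp add: csum_def nsum_mult null_family_count MStone_compact)

lemma csum_0:
 "[|S : MStone; x : null A one_point; !!p n. p : topspace S ==> c p n = 0|] ==> csum S c x = \<one>[A,S]"
 unfolding csum_def by (rule nsum_None) (auto simp: count_family_def split: option.split prod.split)

text \<open>The slots of \<open>c + d\<close> are split into those below \<open>c\<close> and the slots of \<open>d\<close> moved up by \<open>c\<close>.\<close>

lemma csum_add:
 assumes S: "S : MStone" and cd: "cont_seq S c" "cont_seq S d" and x: "x : null A one_point"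
 shows "csum S (%p n. c p n + d p n) x = csum S c x \<cdot>[A,S] csum S d x"
proof -
 note cS = MStone_compact[OF S]
 have cd': "cont_seq S (%p n. c p n + d p n)" by (rule cont_seq_binop[OF cd])
 define k where "k p a = (case a of None => None | Some m => case prod_decode m of (n, j) =>
   if c p n <= j & j < c p n + d p n then Some n else None)" for p a
 have k_simps: "k p None = None" "k p (Some (prod_encode (n, j))) = (if c p n <= j & j < c p n + d p n then Some n else None)" for p n j
  by (simp_all add: k_def)
 have k: "null_family S k" by (rule null_family_interval[OF cS cd(1) cd' k_simps])
 define h where "h p a = (case a of None => None | Some m => case prod_decode m of (n, j) =>
   if j < d p n then Some (prod_encode (n, j + c p n)) else None)" for p a
 have h_simps: "h p None = None" "h p (Some (prod_encode (n, j))) = (if j < d p n then Some (prod_encode (n, j + c p n)) else None)" for p n j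
  by (simp_all add: h_def)
 have h: "null_family S h"
 proof (rule null_familyI)
  fix l
  obtain n j where l: "l = prod_encode (n, j)" by (rule prod_encode_exhaust)
  obtain N where N: "ALL i<Suc j. prod_encode (n, i) < N" using encode_bound by blast
  have "m < N" if "h p (Some m) = Some l" for p m
  proof -
   obtain n' i where m: "m = prod_encode (n', i)" by (rule prod_encode_exhaust)
   hence "n' = n" "i + c p n = j" using that l by (auto simp: h_simps split: if_splits)
   thus ?thesis using N m by auto
  qed
  thus "EX N. ALL p:topspace S. ALL m. h p (Some m) = Some l --> m < N" by blast
  fix m
  obtain n' i where m: "m = prod_encode (n', i)" by (rule prod_encode_exhaust)
  have "{p : topspace S. h p (Some m) = Some l} = {p : topspace S. n' = n & i + c p n' = j & i < d p n'}"
   by (auto simp: m l h_simps)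
  thus "clopenin S {p : topspace S. h p (Some m) = Some l}"
   using cont_seq_clopenin2[OF cd, of "%u v. n' = n & i + u = j & i < v" n'] by simp
 qed (simp add: h_simps)
 have "csum S (%p n. c p n + d p n) x = csum S c x \<cdot>[A,S] nsum S k x" unfolding csum_def
 proof (rule nsum_split[OF S x null_family_count[OF cS cd'] null_family_count[OF cS cd(1)] k])
  fix p m
  obtain n j where m: "m = prod_encode (n, j)" by (rule prod_encode_exhaust)
  show "count_family (%p n. c p n + d p n) p (Some m) = count_family c p (Some m) & k p (Some m) = None \<or>
    count_family (%p n. c p n + d p n) p (Some m) = k p (Some m) & count_family c p (Some m) = None"
   by (auto simp: m k_simps)
 qed
 also have "nsum S k x = nsum S (%p a. Option.bind (h p a) (%n. k p (Some n))) x"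
 proof (rule nsum_reindex[OF S k h x, symmetric])
  fix p l assume "k p (Some l) ~= None"
  moreover obtain n j where l: "l = prod_encode (n, j)" by (rule prod_encode_exhaust)
  ultimately have j: "c p n <= j" "j < c p n + d p n" by (auto simp: k_simps split: if_splits)
  show "EX! m. h p (Some m) = Some l"
  proof (rule ex1I)
   show "h p (Some (prod_encode (n, j - c p n))) = Some l" using j by (simp add: h_simps l less_diff_conv2)
   fix m assume m: "h p (Some m) = Some l"
   obtain n' i where "m = prod_encode (n', i)" by (rule prod_encode_exhaust)
   thus "m = prod_encode (n, j - c p n)" using m l by (auto simp: h_simps split: if_splits)
  qed
 qed
 also have "... = csum S d x" unfolding csum_def
 proof (rule nsum_cong[OF _ null_family_bind[OF k h] null_family_count[OF cS cd(2)]])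
  fix p m
  obtain n j where m: "m = prod_encode (n, j)" by (rule prod_encode_exhaust)
  show "Option.bind (h p (Some m)) (%n. k p (Some n)) = count_family d p (Some m)"
   by (simp add: m h_simps k_simps)
 qed
 finally show ?thesis .
qed

text \<open>Repetition of slots only realises natural multiplicities, so integer coefficients are
  split into positive and negative parts.\<close>

definition integ :: "point topology => (point => nat => int) => 'u => 'u" where
 "integ S g x = csum S (%p n. nat (g p n)) x \<cdot>[A,S] inv[A,S] csum S (%p n. nat (- g p n)) x"

lemma cont_seq_parts:
 assumes "cont_seq S g"
 shows "cont_seq S (%p n. nat (g p n))" "cont_seq S (%p n. nat (- g p n))"
 using cont_seq_map[OF assms, of "%_ v. nat v"] cont_seq_map[OF assms, of "%_ v. nat (- v)"] by simp_all

lemma integ_closed [simp]: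
 assumes "S : MStone" "cont_seq S g" "x : null A one_point"
 shows "integ S g x : Sec A S"
proof -
 interpret G: comm_group "sect A S" by (rule comm_group_sect[OF assms(1)])
 show ?thesis using assms cont_seq_parts[OF assms(2)] by (simp add: integ_def)
qed

lemma integ_cong:
 "[|S : MStone; cont_seq S g; !!p n. p : topspace S ==> g p n = h p n|] ==> integ S g x = integ S h x"
 unfolding integ_def using csum_cong[OF _ cont_seq_parts(1), of S g "%p n. nat (h p n)" x]
  csum_cong[OF _ cont_seq_parts(2), of S g "%p n. nat (- h p n)" x] by simp

text \<open>Moving the subtracted parts to the other side leaves two equal sequences of natural
  coefficients, to which \<open>csum_add\<close> applies. Additivity of \<open>integ\<close> follows
  although positive parts are not additive.\<close>

lemma integ_diff:
 assumes S: "S : MStone" and cd: "cont_seq S c" "cont_seq S d" and x: "x : null A one_point"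
  and g: "cont_seq S g" "!!p n. p : topspace S ==> g p n = int (c p n) - int (d p n)"
 shows "integ S g x = csum S c x \<cdot>[A,S] inv[A,S] csum S d x"
proof -
 interpret G: comm_group "sect A S" by (rule comm_group_sect[OF S])
 note gp = cont_seq_parts[OF g(1)]
 let ?P = "csum S (%p n. nat (g p n)) x" and ?N = "csum S (%p n. nat (- g p n)) x"
 have [simp]: "?P : Sec A S" "?N : Sec A S" "csum S c x : Sec A S" "csum S d x : Sec A S"
  using S x cd gp by simp_all
 have "csum S (%p n. nat (g p n) + d p n) x = csum S (%p n. c p n + nat (- g p n)) x"
  by (rule csum_cong[OF S cont_seq_binop[OF gp(1) cd(2)]]) (simp add: g(2))
 hence "?P \<cdot>[A,S] csum S d x = csum S c x \<cdot>[A,S] ?N"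
  using csum_add[OF S gp(1) cd(2) x] csum_add[OF S cd(1) gp(2) x] by simp
 hence "?P = csum S c x \<cdot>[A,S] ?N \<cdot>[A,S] inv[A,S] csum S d x"
  by (metis G.inv_solve_right `?P : Sec A S` `csum S d x : Sec A S` G.m_closed)
 thus ?thesis unfolding integ_def by (simp add: G.m_ac)
qed

lemma integ_add:
 assumes S: "S : MStone" and g: "cont_seq S g" "cont_seq S h" and x: "x : null A one_point"
 shows "integ S (%p n. g p n + h p n) x = integ S g x \<cdot>[A,S] integ S h x"
proof -
 interpret G: comm_group "sect A S" by (rule comm_group_sect[OF S])
 note gp = cont_seq_parts[OF g(1)] cont_seq_parts[OF g(2)]
 have "integ S (%p n. g p n + h p n) x = csum S (%p n. nat (g p n) + nat (h p n)) x \<cdot>[A,S]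
   inv[A,S] csum S (%p n. nat (- g p n) + nat (- h p n)) x"
  by (rule integ_diff[OF S cont_seq_binop[OF gp(1,3)] cont_seq_binop[OF gp(2,4)] x cont_seq_binop[OF g]]) simp
 thus ?thesis using S x gp by (simp add: csum_add integ_def G.inv_mult G.m_ac)
qed

lemma integ_pull:
 "[|S : MStone; T : MStone; continuous_map S T f; cont_seq T g; x : null A one_point|] ==>
  pull A S T f (integ T g x) = integ S (%p. g (f p)) x"
 unfolding integ_def using cont_seq_parts[of T g] group.inv_closed[OF group_sect]
 by (simp add: pull_mult pull_inv csum_pull)

lemma integ_mult:
 assumes S: "S : MStone" and g: "cont_seq S g" and x: "x : null A one_point" "y : null A one_point"
 shows "integ S g (x \<cdot>[A,Nbar1] y) = integ S g x \<cdot>[A,S] integ S g y"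
proof -
 interpret G: comm_group "sect A S" by (rule comm_group_sect[OF S])
 show ?thesis using S x cont_seq_parts[OF g] by (simp add: integ_def csum_mult G.inv_mult G.m_ac)
qed

end

section \<open>Homomorphisms out of the infinite product of the integers\<close>

abbreviation ZN :: "(point => nat => int) presheaf" where
 "ZN == underlying_condensed int_power_nat"

lemma carrier_ZN: "g : Sec ZN S \<longleftrightarrow> g : extensional (topspace S) & cont_seq S g"
 by (auto simp: underlying_condensed_def cmaps_def int_power_nat_def cont_seq_def continuous_map_componentwise_UNIV)

lemma restrict_ZN: "cont_seq S g ==> restrict g (topspace S) : Sec ZN S"
 unfolding carrier_ZN using cont_seq_cong[of S g "restrict g (topspace S)"] by simp

lemma mult_ZN: "f \<cdot>[ZN,S] g = (\<lambda>p\<in>topspace S. %n. f p n + g p n)"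
 by (simp add: underlying_condensed_def int_power_nat_def)

lemma res_ZN: "res ZN S T f g = compose (topspace S) g f" by (simp add: underlying_condensed_def)

lemma res_ZN_restrict:
 assumes "f : cmaps S T"
 shows "res ZN S T f (restrict g (topspace T)) = (\<lambda>p\<in>topspace S. g (f p))"
 using continuous_map_image_subset_topspace[OF cmapsD(1)[OF assms]]
 by (auto simp: res_ZN compose_def restrict_def fun_eq_iff)

definition basis_fun :: "point => nat => int" where
 "basis_fun q k = (if snd (unpair_point q) = Some k then 1 else 0)"

lemma basis_fun_nbar_point [simp]: "basis_fun (nbar_point a) k = (if a = Some k then 1 else 0)"
 by (simp add: basis_fun_def nbar_point_def)

lemma basis_sequence_eq: "basis_sequence = restrict basis_fun (topspace Nbar1)"
 by (auto simp: basis_sequence_def basis_fun_def restrict_def fun_eq_iff)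

lemma topspace_Nbar1: "topspace Nbar1 = range nbar_point" by (auto simp: nbar_point_def)

lemma continuous_map_snd_unpair: "continuous_map Nbar1 Nbar (%q. snd (unpair_point q))"
 using continuous_map_compose[OF continuous_map_unpair_point continuous_map_snd] by (fastforce simp: o_def)

lemma cont_seq_option:
 assumes k: "continuous_map S Nbar k"
 shows "cont_seq S (%p n. if k p = Some n then (1::int) else 0)" unfolding cont_seq_def
proof
 fix n
 have "clopenin S {p : topspace S. k p = Some n}" using k by (simp add: continuous_map_into_Nbar)
 hence "locally_constant S (%p. if p : {p : topspace S. k p = Some n} then (1::int) else 0)"
  by (rule continuous_map_discrete_restrict) simp_all
 thus "locally_constant S (%p. if k p = Some n then (1::int) else 0)" by (rule continuous_map_eq) simp
qed

lemma cont_seq_basis_fun: "cont_seq Nbar1 basis_fun"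
 using cont_seq_option[OF continuous_map_snd_unpair] by (simp add: basis_fun_def[abs_def])

lemma basis_sequence_ZN: "basis_sequence : Sec ZN Nbar1"
 unfolding basis_sequence_eq by (rule restrict_ZN[OF cont_seq_basis_fun])

text \<open>The sequence of rows of a matrix, extended by 0 at infinity. Column-finiteness says
  precisely that the rows tend to 0 coordinatewise, i.e. that this map is continuous.\<close>

definition mat_fun :: "matrix => point => nat => int" where
 "mat_fun c q n = (case snd (unpair_point q) of None => 0 | Some k => c k n)"

lemma mat_fun_nbar_point [simp]: "mat_fun c (nbar_point a) n = (case a of None => 0 | Some k => c k n)"
 by (simp add: mat_fun_def nbar_point_def)

abbreviation col_finite :: "matrix set" where
 "col_finite == carrier matrix_ring"

lemma col_finite_iff: "c : col_finite \<longleftrightarrow> (ALL n. finite {k. c k n ~= 0})"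
 by (simp add: matrix_ring_def)

lemma col_finite_bound:
 assumes "c : col_finite"
 obtains N where "!!k. k >= N ==> c k n = 0"
proof -
 have "finite {k. c k n ~= 0}" using assms by (simp add: col_finite_iff)
 then obtain N where "ALL k:{k. c k n ~= 0}. k < N" using finite_nat_set_iff_bounded by blast
 thus thesis using that[of N] by (metis (mono_tags, lifting) mem_Collect_eq not_le)
qed

lemma row_times_sum:
 assumes "!!k. k >= N ==> c k n = 0"
 shows "row_times c v n = (\<Sum>k<N. v k * c k n)"
 unfolding row_times_def by (rule sum_support_bound[OF assms])

lemma row_times_add: "row_times c (%n. v n + w n) = (%n. row_times c v n + row_times c w n)"
 by (simp add: row_times_def fun_eq_iff distrib_right sum.distrib)

lemma continuous_map_discrete_sum:
 fixes f :: "'i => 'a => 'b::comm_monoid_add"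
 assumes "!!i. i : I ==> locally_constant S (f i)"
 shows "locally_constant S (%p. \<Sum>i\<in>I. f i p)" using assms
proof (induction I rule: infinite_finite_induct)
 case (insert i I)
 thus ?case using continuous_map_discrete_binop[of S "f i" "%p. \<Sum>i\<in>I. f i p" "(+)"] by simp
qed simp_all

lemma cont_seq_row_times:
 assumes c: "c : col_finite" and g: "cont_seq S g"
 shows "cont_seq S (%p. row_times c (g p))" unfolding cont_seq_def
proof
 fix n
 obtain N where "!!k. k >= N ==> c k n = 0" using col_finite_bound[OF c] by blast
 hence "row_times c v n = (\<Sum>k<N. v k * c k n)" for v by (rule row_times_sum)
 moreover have "locally_constant S (%p. \<Sum>k<N. g p k * c k n)"
  using cont_seq_map[OF g, of "%k v. v * c k n"] by (intro continuous_map_discrete_sum) (simp add: cont_seq_def)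
 ultimately show "locally_constant S (%p. row_times c (g p) n)" by simp
qed

lemma row_times_basis: "c : col_finite ==> row_times c (%k. if a = Some k then 1 else 0) = (%n. case a of None => 0 | Some k => c k n)"
proof
 fix n assume c: "c : col_finite"
 obtain N where N: "!!k. k >= N ==> c k n = 0" using col_finite_bound[OF c] by blast
 have "row_times c (%k. if a = Some k then 1 else 0) n = (\<Sum>k<N. if a = Some k then c k n else 0)"
  by (subst row_times_sum[where N = N]) (auto intro: N sum.cong)
 also have "... = (case a of None => 0 | Some k => c k n)" using N by (cases a) (auto simp: not_less)
 finally show "row_times c (%k. if a = Some k then 1 else 0) n = (case a of None => 0 | Some k => c k n)" .
qed

lemma row_times_basis_fun:
 "c : col_finite ==> q : topspace Nbar1 ==> row_times c (basis_fun q) = mat_fun c q"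
 using row_times_basis by (auto simp: topspace_Nbar1 basis_fun_def[abs_def] mat_fun_def[abs_def] nbar_point_def fun_eq_iff)

lemma cont_seq_mat_fun: "c : col_finite ==> cont_seq Nbar1 (mat_fun c)"
 by (rule cont_seq_cong[OF cont_seq_row_times[OF _ cont_seq_basis_fun]]) (auto simp: row_times_basis_fun)

lemma presheaf_homs_closed:
 "[|phi : presheaf_homs A B; S : MStone; x : Sec A S|] ==> phi S x : Sec B S"
 by (auto simp: presheaf_homs_def hom_def)

lemma presheaf_homs_mult:
 "[|phi : presheaf_homs A B; S : MStone; x : Sec A S; y : Sec A S|] ==>
  phi S (x \<cdot>[A,S] y) = phi S x \<cdot>[B,S] phi S y"
 by (auto simp: presheaf_homs_def hom_def)

lemma presheaf_homs_natural:
 "[|phi : presheaf_homs A B; S : MStone; T : MStone; f : cmaps S T; x : Sec A T|] ==>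
  phi S (res A S T f x) = res B S T f (phi T x)"
 by (auto simp: presheaf_homs_def)

lemma presheaf_homs_pull:
 "[|phi : presheaf_homs A B; S : MStone; T : MStone; continuous_map S T f; x : Sec A T|] ==>
  phi S (pull A S T f x) = pull B S T f (phi T x)"
 unfolding pull_def by (rule presheaf_homs_natural, assumption+, rule restrict_cmaps)

lemma presheaf_homs_ext:
 assumes "phi : presheaf_homs A B" "psi : presheaf_homs A B"
  and "!!S x. S : MStone ==> x : Sec A S ==> phi S x = psi S x"
 shows "phi = psi"
proof (rule extensionalityI[of _ MStone])
 fix S assume S: "S : MStone"
 show "phi S = psi S"
  by (rule extensionalityI[of _ "Sec A S"]) (use assms S in \<open>auto simp: presheaf_homs_def\<close>)
qed (use assms in \<open>auto simp: presheaf_homs_def\<close>)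

lemma presheaf_homs_compose:
 assumes phi: "phi : presheaf_homs A B" and psi: "psi : presheaf_homs B C"
  and A: "!!S. S : MStone ==> group (sect A S)"
  and resA: "!!S T f x. [|S : MStone; T : MStone; f : cmaps S T; x : Sec A T|] ==> res A S T f x : Sec A S"
 shows "(\<lambda>S\<in>MStone. compose (Sec A S) (psi S) (phi S)) : presheaf_homs A C"
 unfolding presheaf_homs_def
proof (intro CollectI conjI ballI)
 fix S assume S: "S : MStone"
 interpret group "sect A S" by (rule A[OF S])
 have "compose (Sec A S) (psi S) (phi S) : hom (sect A S) (sect C S)"
  by (rule homI) (use S phi psi in \<open>auto simp: compose_def presheaf_homs_closed presheaf_homs_mult\<close>)
 thus "(\<lambda>S\<in>MStone. compose (Sec A S) (psi S) (phi S)) S : hom (sect A S) (sect C S) Int extensional (Sec A S)"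
  using S by simp
qed (use phi psi resA in \<open>auto simp: compose_def presheaf_homs_closed presheaf_homs_natural\<close>)

lemma group_ZN: "group (sect ZN S)"
proof (rule groupI)
 show "f \<cdot>[ZN,S] g \<cdot>[ZN,S] h = f \<cdot>[ZN,S] (g \<cdot>[ZN,S] h)" for f g h
  unfolding mult_ZN by (rule restrict_ext) (simp add: add.assoc)
next
 fix f g assume fg: "f : Sec ZN S" "g : Sec ZN S"
 show "f \<cdot>[ZN,S] g : Sec ZN S"
  unfolding mult_ZN using fg by (intro restrict_ZN cont_seq_binop[where F = "(+)"]) (auto simp: carrier_ZN)
next
 show "\<one>[ZN,S] : Sec ZN S"
  using restrict_ZN[OF cont_seq_const[of S "%_. 0"]] by (simp add: underlying_condensed_def int_power_nat_def)
next
 fix f assume f: "f : Sec ZN S"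
 have one: "\<one>[ZN,S] = (\<lambda>p\<in>topspace S. %n. 0)"
  by (simp add: underlying_condensed_def int_power_nat_def)
 show "\<one>[ZN,S] \<cdot>[ZN,S] f = f"
  unfolding mult_ZN one using f by (auto simp: carrier_ZN extensional_def fun_eq_iff)
 have "cont_seq S (%p n. - f p n)" using f cont_seq_map[of S f "%_ v. - v"] by (simp add: carrier_ZN)
 hence "(\<lambda>p\<in>topspace S. %n. - f p n) : Sec ZN S" using restrict_ZN by blast
 moreover have "(\<lambda>p\<in>topspace S. %n. - f p n) \<cdot>[ZN,S] f = \<one>[ZN,S]"
  unfolding mult_ZN one by (auto simp: fun_eq_iff)
 ultimately show "EX g:Sec ZN S. g \<cdot>[ZN,S] f = \<one>[ZN,S]" by blast
qed

lemma res_ZN_closed: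
 assumes "f : cmaps S T" "g : Sec ZN T"
 shows "res ZN S T f g : Sec ZN S"
proof -
 have "cont_seq S (%p. g (f p))"
  by (rule cont_seq_compose[where T = T]) (use assms in \<open>auto simp: carrier_ZN cmaps_def\<close>)
 thus ?thesis unfolding res_ZN compose_def by (rule restrict_ZN)
qed

context solid_group
begin

definition integ_hom :: "'u => point topology => (point => nat => int) => 'u" where
 "integ_hom x = (\<lambda>S\<in>MStone. \<lambda>g\<in>Sec ZN S. integ S g x)"

lemma integ_hom_presheaf_hom:
 assumes x: "x : null A one_point"
 shows "integ_hom x : presheaf_homs ZN A" unfolding presheaf_homs_def
proof (intro CollectI conjI ballI)
 fix S assume S: "S : MStone"
 interpret Z: group "sect ZN S" by (rule group_ZN)
 have "restrict (%g. integ S g x) (Sec ZN S) : hom (sect ZN S) (sect A S)"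
 proof (rule homI)
  fix g h assume gh: "g : Sec ZN S" "h : Sec ZN S"
  thus "restrict (%g. integ S g x) (Sec ZN S) g : Sec A S" using S x by (simp add: carrier_ZN)
  have "integ S (g \<cdot>[ZN,S] h) x = integ S (%p n. g p n + h p n) x"
   using S gh by (intro integ_cong) (use Z.m_closed[OF gh] in \<open>auto simp: carrier_ZN mult_ZN\<close>)
  thus "restrict (%g. integ S g x) (Sec ZN S) (g \<cdot>[ZN,S] h) =
    restrict (%g. integ S g x) (Sec ZN S) g \<cdot>[A,S] restrict (%g. integ S g x) (Sec ZN S) h"
   using S x gh Z.m_closed[OF gh] by (simp add: integ_add carrier_ZN)
 qed
 thus "integ_hom x S : hom (sect ZN S) (sect A S) Int extensional (Sec ZN S)"
  using S by (simp add: integ_hom_def)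
next
 fix S T f g assume *: "S : MStone" "T : MStone" "f : cmaps S T" "g : Sec ZN T"
 have "integ S (res ZN S T f g) x = integ S (%p. g (f p)) x"
  using * res_ZN_closed[OF *(3,4)] by (intro integ_cong) (auto simp: carrier_ZN res_ZN compose_def)
 thus "integ_hom x S (res ZN S T f g) = res A S T f (integ_hom x T g)"
  using * x res_ZN_closed[OF *(3,4)] by (simp add: integ_hom_def res_eq_pull integ_pull carrier_ZN cmapsD)
qed (simp add: integ_hom_def)

text \<open>Over the point \<open>n\<close> of \<open>Nbar\<close> only the slot coding (n, 0) is
  filled, so the sum has a single term and \<open>nsum_single\<close> evaluates it.\<close>

lemma integ_basis:
 assumes x: "x : null A one_point"
 shows "integ Nbar1 basis_fun x = x"
proof -
 interpret G: comm_group "sect A Nbar1" by (simp add: comm_group_sect)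
 let ?c = "%q n. nat (basis_fun q n)"
 have c: "cont_seq Nbar1 ?c" using cont_seq_parts(1)[OF cont_seq_basis_fun] .
 have "csum Nbar1 ?c x = npull Nbar1 (%q. snd (unpair_point q)) x" unfolding csum_def
 proof (rule nsum_single[OF _ null_family_count[OF MStone_compact c] x])
  fix q
  have iff: "count_family ?c q (Some (prod_encode (n, j))) = (if j = 0 & snd (unpair_point q) = Some n then Some n else None)" for n j
   by (simp add: basis_fun_def)
  show "m = m'" if "count_family ?c q (Some m) ~= None" "count_family ?c q (Some m') ~= None" for m m'
  proof -
   obtain n j where m: "m = prod_encode (n, j)" by (rule prod_encode_exhaust)
   obtain n' j' where m': "m' = prod_encode (n', j')" by (rule prod_encode_exhaust)
   show ?thesis using that unfolding m m' iff by (auto split: if_splits)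
  qed
  show "snd (unpair_point q) = count_family ?c q (Some m)" if "count_family ?c q (Some m) ~= None" for m
  proof -
   obtain n j where m: "m = prod_encode (n, j)" by (rule prod_encode_exhaust)
   show ?thesis using that unfolding m iff by (auto split: if_splits)
  qed
  show "snd (unpair_point q) = None" if "!!m. count_family ?c q (Some m) = None"
  proof (rule ccontr)
   assume "snd (unpair_point q) ~= None"
   then obtain n where "snd (unpair_point q) = Some n" by blast
   thus False using that[of "prod_encode (n, 0)"] unfolding iff by simp
  qed
 qed simp_all
 also have "... = x" unfolding npull_def using x by (intro pull_id) (auto simp: null_carrier nbar_point_def)
 finally have "csum Nbar1 ?c x = x" .
 moreover have "csum Nbar1 (%q n. nat (- basis_fun q n)) x = \<one>[A,Nbar1]"
  by (rule csum_0) (simp_all add: x basis_fun_def)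
 ultimately show ?thesis using x by (simp add: integ_def null_carrier)
qed

lemma eval_basis_integ_hom: "x : null A one_point ==> eval_basis (integ_hom x) = x"
 using integ_basis[of x] integ_cong[OF _ cont_seq_basis_fun, of basis_sequence x] basis_sequence_ZN
 by (simp add: eval_basis_def integ_hom_def basis_sequence_eq)

lemma eval_basis_null:
 assumes phi: "phi : presheaf_homs ZN A"
 shows "eval_basis phi : null A one_point" unfolding null_iff
proof
 show "eval_basis phi : Sec A Nbar1"
  unfolding eval_basis_def by (rule presheaf_homs_closed[OF phi _ basis_sequence_ZN]) simp
 have "pull A one_point Nbar1 (at_inf) (eval_basis phi)
   = phi one_point (pull ZN one_point Nbar1 (at_inf) basis_sequence)"
  unfolding eval_basis_def
  by (rule presheaf_homs_pull[OF phi _ _ continuous_map_at basis_sequence_ZN, symmetric]) simp_all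
 also have "pull ZN one_point Nbar1 (at_inf) basis_sequence = \<one>[ZN,one_point]"
  unfolding pull_def basis_sequence_eq res_ZN_restrict[OF restrict_cmaps[OF continuous_map_at]]
  by (auto simp: underlying_condensed_def int_power_nat_def basis_fun_def fun_eq_iff)
 also have "phi one_point \<one>[ZN,one_point] = \<one>[A,one_point]"
  using phi by (intro hom_one[OF _ group_ZN group_sect]) (auto simp: presheaf_homs_def)
 finally show "pull A one_point Nbar1 (at_inf) (eval_basis phi) = \<one>[A,one_point]" .
qed

text \<open>The tails of the family of multiples of basis vectors that represents a sequence \<open>c\<close> of
 natural numbers form a null sequence in \<open>\<int>\<^sup>\<nat>\<close>, and a homomorphism maps tails to tails.\<close>

lemma presheaf_hom_csum:
 assumes phi: "phi : presheaf_homs ZN A" and S: "S : MStone" and c: "cont_seq S c"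
 shows "phi S (\<lambda>p\<in>topspace S. %n. int (c p n)) = csum S c (eval_basis phi)"
proof -
 let ?x = "eval_basis phi" and ?S = "times_Nbar S"
 have S': "?S : MStone" using S by simp
 have x: "?x : null A one_point" by (rule eval_basis_null[OF phi])
 have k: "null_family S (count_family c)" by (rule null_family_count[OF MStone_compact[OF S] c])
 let ?e = "%q n. if on_pairs (count_family c) q = Some n then 1 else (0::int)"
 have e: "cont_seq ?S ?e" by (rule cont_seq_option[OF null_family_continuous[OF k]])
 have y: "phi ?S (restrict ?e (topspace ?S)) = npull ?S (on_pairs (count_family c)) ?x"
 proof -
  let ?f = "%q. nbar_point (on_pairs (count_family c) q)"
  have f: "continuous_map ?S Nbar1 ?f" by (rule continuous_map_into_Nbar1[OF null_family_continuous[OF k]])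
  have "npull ?S (on_pairs (count_family c)) ?x = phi ?S (pull ZN ?S Nbar1 ?f basis_sequence)"
   unfolding npull_def eval_basis_def
   by (rule presheaf_homs_pull[OF phi S' _ f basis_sequence_ZN, symmetric]) simp
  also have "pull ZN ?S Nbar1 ?f basis_sequence = restrict ?e (topspace ?S)"
   unfolding pull_def basis_sequence_eq res_ZN_restrict[OF restrict_cmaps[OF f]] by (auto simp: fun_eq_iff)
  finally show ?thesis ..
 qed
 \<comment> \<open>The expected tail from slot \<open>m\<close> on: its \<open>n\<close>-th
   coordinate counts the filled slots (n, j) whose code is at least \<open>m\<close>.\<close>
 define zeta where "zeta = on_pairs (%p a n. case a of None => 0 | Some m => int (card {j. j < c p n & m <= prod_encode (n, j)}))"
 have zeta_pair: "zeta (pair_point (p, a)) n = (case a of None => 0 | Some m => int (card {j. j < c p n & m <= prod_encode (n, j)}))" for p a n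
  by (simp add: zeta_def)
 have zeta: "cont_seq ?S zeta" unfolding cont_seq_def
 proof
  fix n
  let ?k = "%p a. case a of None => 0 | Some m => int (card {j. j < c p n & m <= prod_encode (n, j)})"
  obtain B where B: "!!p. p : topspace S ==> c p n < B"
   using cont_seq_bound[OF MStone_compact[OF S] c] by blast
  obtain N where N: "ALL j<B. prod_encode (n, j) < N" using encode_bound by blast
  have "locally_constant ?S (on_pairs ?k)"
  proof (rule continuous_map_on_pairs_discrete[where N = N])
   show "locally_constant S (%p. ?k p (Some m))" for m
    using cont_seq_map[OF c, of "%_ u. int (card {j. j < u & m <= prod_encode (n, j)})"] by (simp add: cont_seq_def)
   show "?k p (Some m) = 0" if p: "p : topspace S" and m: "N <= m" for p m
   proof -
    have "~ m <= prod_encode (n, j)" if "j < c p n" for j using N[rule_format, of j] B[OF p] m that by linarith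
    thus ?thesis by (simp cong: conj_cong)
   qed
  qed simp
  thus "locally_constant ?S (%q. zeta q n)"
   by (rule continuous_map_eq) (simp add: zeta_def on_pairs_def split: prod.split)
 qed
 let ?z = "phi ?S (restrict zeta (topspace ?S))"
 have shift_cm: "restrict shift_map (topspace ?S) : cmaps ?S ?S"
  by (rule restrict_cmaps[OF continuous_map_shift_map])
 have phi_pull: "pull A U ?S f ?z = phi U (\<lambda>p\<in>topspace U. zeta (f p))" if "U : MStone" "continuous_map U ?S f" for U f
 proof -
  have "pull A U ?S f ?z = phi U (pull ZN U ?S f (restrict zeta (topspace ?S)))"
   by (rule presheaf_homs_pull[OF phi that(1) S' that(2) restrict_ZN[OF zeta], symmetric])
  also have "pull ZN U ?S f (restrict zeta (topspace ?S)) = (\<lambda>p\<in>topspace U. zeta (f p))"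
   unfolding pull_def res_ZN_restrict[OF restrict_cmaps[OF that(2)]] by (auto simp: fun_eq_iff)
  finally show ?thesis .
 qed
 have z: "?z : null A S" unfolding null_iff
 proof
  show "?z : Sec A ?S" by (rule presheaf_homs_closed[OF phi S' restrict_ZN[OF zeta]])
  have "pull A S ?S (at_inf) ?z = phi S \<one>[ZN,S]" unfolding phi_pull[OF S continuous_map_at]
   by (rule arg_cong[where f = "phi S"]) (auto simp: zeta_pair underlying_condensed_def int_power_nat_def fun_eq_iff)
  also have "... = \<one>[A,S]"
   using phi S by (intro hom_one[OF _ group_ZN group_sect]) (auto simp: presheaf_homs_def)
  finally show "pull A S ?S (at_inf) ?z = \<one>[A,S]" .
 qed
 have "?z = npull ?S (on_pairs (count_family c)) ?x \<cdot>[A,?S] shift A S ?z"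
 proof -
  have zetas: "cont_seq ?S (%q. zeta (shift_map q))"
   by (rule cont_seq_compose[OF zeta continuous_map_shift_map])
  have sum: "zeta q n = ?e q n + zeta (shift_map q) n" if qS: "q : topspace ?S" for q n
  proof -
   obtain p a where q: "q = pair_point (p, a)" "p : topspace S" using qS by auto
   show ?thesis
   proof (cases a)
    case None
    thus ?thesis by (simp add: q zeta_pair)
   next
    case (Some m)
    obtain n' i where m: "m = prod_encode (n', i)" by (rule prod_encode_exhaust)
    have "{j. j < c p n & m <= prod_encode (n, j)} =
      {j. j < c p n & Suc m <= prod_encode (n, j)} Un (if n' = n & i < c p n then {i} else {})"
     by (auto simp: m Suc_le_eq le_less)
    moreover have "i ~: {j. j < c p n & Suc m <= prod_encode (n, j)}" if "n' = n"
     using that by (simp add: m)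
    moreover have "finite {j. j < c p n & Suc m <= prod_encode (n, j)}" by simp
    ultimately have "card {j. j < c p n & m <= prod_encode (n, j)} =
      card {j. j < c p n & Suc m <= prod_encode (n, j)} + (if n' = n & i < c p n then 1 else 0)"
     by (cases "n' = n & i < c p n") auto
    thus ?thesis by (cases "n' = n") (simp_all add: q Some zeta_pair m)
   qed
  qed
  have "restrict zeta (topspace ?S) = restrict ?e (topspace ?S) \<cdot>[ZN,?S] (\<lambda>q\<in>topspace ?S. zeta (shift_map q))"
   unfolding mult_ZN using sum by (intro ext) (simp add: restrict_def)
  hence "?z = phi ?S (restrict ?e (topspace ?S)) \<cdot>[A,?S] phi ?S (\<lambda>q\<in>topspace ?S. zeta (shift_map q))"
   using presheaf_homs_mult[OF phi S' restrict_ZN[OF e] restrict_ZN[OF zetas]] by simp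
  thus ?thesis unfolding y shift_eq[OF S z] phi_pull[OF S' continuous_map_shift_map] .
 qed
 hence "csum S c ?x = pull A S ?S (%p. pair_point (p, Some 0)) ?z"
  unfolding csum_def nsum_def by (rule total_eqI[OF S npull_null[OF S k x] z])
 also have "... = phi S (\<lambda>p\<in>topspace S. %n. int (c p n))"
  unfolding phi_pull[OF S continuous_map_at]
  by (rule arg_cong[where f = "phi S"]) (auto simp: zeta_pair fun_eq_iff)
 finally show ?thesis ..
qed

text \<open>Positive and negative parts reduce this to \<open>presheaf_hom_csum\<close>. Together
  with \<open>eval_basis_integ_hom\<close> it identifies homomorphisms out of \<open>ZN\<close> with
  null sequences, and it is the device by which equalities of integrals are proved without touching
  sums.\<close>

theorem presheaf_hom_eq_integ:
 assumes phi: "phi : presheaf_homs ZN A" and S: "S : MStone" and g: "g : Sec ZN S"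
 shows "phi S g = integ S g (eval_basis phi)"
proof -
 interpret G: comm_group "sect A S" by (rule comm_group_sect[OF S])
 have gc: "cont_seq S g" using g by (simp add: carrier_ZN)
 note gp = cont_seq_parts[OF gc]
 let ?P = "\<lambda>p\<in>topspace S. %n. int (nat (g p n))" and ?N = "\<lambda>p\<in>topspace S. %n. int (nat (- g p n))"
 have PN: "?P : Sec ZN S" "?N : Sec ZN S"
  using cont_seq_map[OF gp(1), of "%_. int"] cont_seq_map[OF gp(2), of "%_. int"] by (simp_all add: restrict_ZN)
 have "g \<cdot>[ZN,S] ?N = ?P" unfolding mult_ZN by (auto simp: fun_eq_iff)
 hence "phi S g \<cdot>[A,S] phi S ?N = phi S ?P" using presheaf_homs_mult[OF phi S g PN(2)] by simp
 hence "phi S g = phi S ?P \<cdot>[A,S] inv[A,S] phi S ?N"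
  by (metis G.inv_solve_right presheaf_homs_closed[OF phi S g] presheaf_homs_closed[OF phi S PN(1)] presheaf_homs_closed[OF phi S PN(2)])
 thus ?thesis
  unfolding integ_def presheaf_hom_csum[OF phi S gp(1), symmetric] presheaf_hom_csum[OF phi S gp(2), symmetric] .
qed

end

section \<open>The module of null sequences of a solid group\<close>

lemma comm_group_cong:
 assumes G: "comm_group G" and eq: "carrier H = carrier G" "!!x y. x \<otimes>\<^bsub>H\<^esub> y = x \<otimes>\<^bsub>G\<^esub> y" "\<one>\<^bsub>H\<^esub> = \<one>\<^bsub>G\<^esub>"
 shows "comm_group H"
proof -
 interpret comm_group G by (rule G)
 show ?thesis
 proof (rule comm_groupI)
  show "EX y:carrier H. y \<otimes>\<^bsub>H\<^esub> x = \<one>\<^bsub>H\<^esub>" if "x : carrier H" for x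
   using that l_inv_ex by (simp add: eq)
  show "x \<otimes>\<^bsub>H\<^esub> y = y \<otimes>\<^bsub>H\<^esub> x" if "x : carrier H" "y : carrier H" for x y
   using that m_comm by (simp add: eq)
 qed (simp_all add: eq m_assoc)
qed

lemma null_module_simps [simp]:
 "carrier (null_module A) = null A one_point"
 "x \<otimes>\<^bsub>null_module A\<^esub> y = x \<cdot>[A,Nbar1] y"
 "\<one>\<^bsub>null_module A\<^esub> = \<one>[A,Nbar1]" by (simp_all add: null_module_def)

context solid_group
begin

text \<open>A basis vector times \<open>c\<close> is the corresponding row of \<open>c\<close>, so
  the basis sequence is turned into \<open>mat_fun c\<close>.\<close>

lemma eval_basis_matrix_act_hom:
 assumes phi: "phi : presheaf_homs ZN A" and c: "c : col_finite"
 shows "eval_basis (matrix_act_hom c phi) = integ Nbar1 (mat_fun c) (eval_basis phi)"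
proof -
 have 1: "cont_seq Nbar1 (%q. row_times c (basis_fun q))"
  by (rule cont_seq_row_times[OF c cont_seq_basis_fun])
 have eq: "(\<lambda>q\<in>topspace Nbar1. row_times c (basis_sequence q)) = restrict (%q. row_times c (basis_fun q)) (topspace Nbar1)"
  unfolding basis_sequence_eq by (rule restrict_ext) simp
 have "eval_basis (matrix_act_hom c phi) = phi Nbar1 (restrict (%q. row_times c (basis_fun q)) (topspace Nbar1))"
  using basis_sequence_ZN unfolding eval_basis_def matrix_act_hom_def by (simp add: eq del: topspace_times_Nbar)
 also have "... = integ Nbar1 (restrict (%q. row_times c (basis_fun q)) (topspace Nbar1)) (eval_basis phi)"
  by (rule presheaf_hom_eq_integ[OF phi _ restrict_ZN[OF 1]]) simp
 also have "... = integ Nbar1 (mat_fun c) (eval_basis phi)"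
  using row_times_basis_fun[OF c] by (intro integ_cong[symmetric] cont_seq_mat_fun c) (auto simp del: topspace_times_Nbar)
 finally show ?thesis .
qed

lemma matrix_act_hom_presheaf_hom:
 assumes phi: "phi : presheaf_homs ZN A" and c: "c : col_finite"
 shows "matrix_act_hom c phi : presheaf_homs ZN A" unfolding presheaf_homs_def
proof (intro CollectI conjI ballI)
 have closed: "(\<lambda>p\<in>topspace S. row_times c (g p)) : Sec ZN S" if "g : Sec ZN S" for S g
  using that by (intro restrict_ZN cont_seq_row_times[OF c]) (simp add: carrier_ZN)
 fix S assume S: "S : MStone"
 interpret Z: group "sect ZN S" by (rule group_ZN)
 have "matrix_act_hom c phi S : hom (sect ZN S) (sect A S)"
 proof (rule homI)
  fix g h assume gh: "g : Sec ZN S" "h : Sec ZN S"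
  thus "matrix_act_hom c phi S g : Sec A S"
   using S closed by (simp add: matrix_act_hom_def presheaf_homs_closed[OF phi])
  have "(\<lambda>p\<in>topspace S. row_times c ((g \<cdot>[ZN,S] h) p)) =
    (\<lambda>p\<in>topspace S. row_times c (g p)) \<cdot>[ZN,S] (\<lambda>p\<in>topspace S. row_times c (h p))"
   unfolding mult_ZN by (rule restrict_ext) (simp add: row_times_add)
  thus "matrix_act_hom c phi S (g \<cdot>[ZN,S] h) = matrix_act_hom c phi S g \<cdot>[A,S] matrix_act_hom c phi S h"
   using S gh Z.m_closed[OF gh] closed[OF gh(1)] closed[OF gh(2)] by (simp add: matrix_act_hom_def presheaf_homs_mult[OF phi])
 qed
 thus "matrix_act_hom c phi S : hom (sect ZN S) (sect A S) Int extensional (Sec ZN S)"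
  using S by (simp add: matrix_act_hom_def)
 fix T f g assume *: "T : MStone" "f : cmaps S T" "g : Sec ZN T"
 have "(\<lambda>p\<in>topspace S. row_times c (res ZN S T f g p)) = res ZN S T f (\<lambda>p\<in>topspace T. row_times c (g p))"
  unfolding res_ZN_restrict[OF *(2)] by (rule restrict_ext) (simp add: res_ZN compose_def)
 thus "matrix_act_hom c phi S (res ZN S T f g) = res A S T f (matrix_act_hom c phi T g)"
  using S * res_ZN_closed[OF *(2,3)] closed[OF *(3)] by (simp add: matrix_act_hom_def presheaf_homs_natural[OF phi])
qed (simp add: matrix_act_hom_def)

text \<open>\<open>integ_hom x\<close> shows that \<open>x\<close> lies in the image of
  \<open>eval_basis\<close>, so the \<open>inv_into\<close> in the definition of the action yields a
  genuine preimage.\<close>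

lemma null_module_act:
 assumes c: "c : col_finite" and x: "x : null A one_point"
 shows "act (null_module A) c x = integ Nbar1 (mat_fun c) x"
proof -
 let ?phi = "inv_into (presheaf_homs ZN A) eval_basis x"
 have "x : eval_basis ` presheaf_homs ZN A"
  using integ_hom_presheaf_hom[OF x] eval_basis_integ_hom[OF x] by (metis image_eqI)
 hence "?phi : presheaf_homs ZN A" "eval_basis ?phi = x" by (rule inv_into_into, rule f_inv_into_f)
 thus ?thesis using eval_basis_matrix_act_hom[OF _ c] by (simp add: null_module_def)
qed

lemma act_closed: "[|c : col_finite; x : null A one_point|] ==> act (null_module A) c x : null A one_point"
 using eval_basis_null[OF matrix_act_hom_presheaf_hom[OF integ_hom_presheaf_hom]]
  eval_basis_matrix_act_hom[OF integ_hom_presheaf_hom] by (simp add: null_module_act eval_basis_integ_hom)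

text \<open>An adjunction formula: the action of \<open>c\<close> on \<open>x\<close> is moved to
  right multiplication of the integrand by \<open>c\<close>. It holds because both sides are the
  homomorphism \<open>matrix_act_hom c (integ_hom x)\<close> evaluated at \<open>g\<close>.\<close>

lemma integ_act:
 assumes c: "c : col_finite" and x: "x : null A one_point" and S: "S : MStone" and g: "cont_seq S g"
 shows "integ S g (act (null_module A) c x) = integ S (%p. row_times c (g p)) x"
proof -
 let ?phi = "integ_hom x" and ?g = "restrict g (topspace S)"
 note phi = integ_hom_presheaf_hom[OF x]
 have gZ: "?g : Sec ZN S" by (rule restrict_ZN[OF g])
 have rZ: "(\<lambda>p\<in>topspace S. row_times c (?g p)) : Sec ZN S"
  using gZ[unfolded carrier_ZN] by (intro restrict_ZN cont_seq_row_times[OF c]) (elim conjE)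
 have "integ S g (act (null_module A) c x) = integ S ?g (act (null_module A) c x)"
  by (rule integ_cong[OF S g]) simp
 also have "... = integ S ?g (eval_basis (matrix_act_hom c ?phi))"
  by (simp add: eval_basis_matrix_act_hom[OF phi c] eval_basis_integ_hom x null_module_act c)
 also have "... = matrix_act_hom c ?phi S ?g"
  by (rule presheaf_hom_eq_integ[OF matrix_act_hom_presheaf_hom[OF phi c] S gZ, symmetric])
 also have "... = ?phi S (\<lambda>p\<in>topspace S. row_times c (?g p))"
  using S gZ by (simp add: matrix_act_hom_def)
 also have "... = integ S (\<lambda>p\<in>topspace S. row_times c (?g p)) x"
  using S rZ by (simp add: integ_hom_def)
 also have "... = integ S (%p. row_times c (g p)) x"
  by (rule integ_cong[OF S, symmetric]) (simp_all add: cont_seq_row_times[OF c g])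
 finally show ?thesis .
qed

theorem left_module_null_module: "left_module matrix_ring (null_module A)" unfolding left_module_def
proof (intro conjI ballI)
 show "comm_group (null_module A)" by (rule comm_group_cong[OF comm_group_null[of one_point]]) simp_all
next
 fix c x assume "c : col_finite" "x : carrier (null_module A)"
 thus "act (null_module A) c x : carrier (null_module A)" by (simp add: act_closed)
next
 fix c x y assume c: "c : col_finite" and xy: "x : carrier (null_module A)" "y : carrier (null_module A)"
 have "x \<cdot>[A,Nbar1] y : null A one_point" using subgroup.m_closed[OF subgroup_null] xy by simp
 thus "act (null_module A) c (x \<otimes>\<^bsub>null_module A\<^esub> y) = act (null_module A) c x \<otimes>\<^bsub>null_module A\<^esub> act (null_module A) c y"
  using c xy by (simp add: null_module_act integ_mult cont_seq_mat_fun)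
next
 fix c d x assume cd: "c : col_finite" "d : col_finite" and x: "x : carrier (null_module A)"
 have add: "c \<oplus>\<^bsub>matrix_ring\<^esub> d = (%k n. c k n + d k n)" by (simp add: matrix_ring_def)
 have "finite {k. c k n + d k n ~= 0}" for n
  by (rule finite_subset[of _ "{k. c k n ~= 0} Un {k. d k n ~= 0}"]) (use cd in \<open>auto simp: col_finite_iff\<close>)
 hence cdR: "c \<oplus>\<^bsub>matrix_ring\<^esub> d : col_finite" by (simp add: add col_finite_iff)
 have "integ Nbar1 (mat_fun (c \<oplus>\<^bsub>matrix_ring\<^esub> d)) x = integ Nbar1 (%q n. mat_fun c q n + mat_fun d q n) x"
  by (rule integ_cong[OF _ cont_seq_mat_fun[OF cdR]]) (simp_all add: add mat_fun_def split: option.split)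
 thus "act (null_module A) (c \<oplus>\<^bsub>matrix_ring\<^esub> d) x = act (null_module A) c x \<otimes>\<^bsub>null_module A\<^esub> act (null_module A) d x"
  using cd cdR x by (simp add: null_module_act integ_add cont_seq_mat_fun)
next
 fix c d x assume cd: "c : col_finite" "d : col_finite" and x: "x : carrier (null_module A)"
 \<comment> \<open>Row \<open>k\<close> of a product is row \<open>k\<close> of \<open>c\<close>
   multiplied by \<open>d\<close>; associativity of the action is then \<open>integ_act\<close> for
   the integrand \<open>mat_fun c\<close>.\<close>
 have mult: "c \<otimes>\<^bsub>matrix_ring\<^esub> d = (%k. row_times d (c k))"
  by (simp add: matrix_ring_def row_times_def fun_eq_iff)
 have cdR: "c \<otimes>\<^bsub>matrix_ring\<^esub> d : col_finite" unfolding col_finite_iff mult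
 proof
  fix n
  have "row_times d (c k) n = 0" if "ALL m:{m. d m n ~= 0}. c k m = 0" for k
   unfolding row_times_def by (rule sum.neutral) (use that in auto)
  hence "{k. row_times d (c k) n ~= 0} <= (\<Union>m\<in>{m. d m n ~= 0}. {k. c k m ~= 0})" by blast
  moreover have "finite (\<Union>m\<in>{m. d m n ~= 0}. {k. c k m ~= 0})"
   using cd by (intro finite_UN_I) (auto simp: col_finite_iff)
  ultimately show "finite {k. row_times d (c k) n ~= 0}" by (rule finite_subset)
 qed
 have row0: "row_times d (%n. 0) = (%n. 0)" by (simp add: row_times_def fun_eq_iff)
 have eq: "mat_fun (c \<otimes>\<^bsub>matrix_ring\<^esub> d) q = row_times d (mat_fun c q)" for q
  by (cases "snd (unpair_point q)") (simp_all add: mat_fun_def[abs_def] mult row0)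
 have "act (null_module A) c (act (null_module A) d x) = integ Nbar1 (mat_fun c) (act (null_module A) d x)"
  using cd x by (simp add: null_module_act[OF cd(1)] act_closed)
 also have "... = integ Nbar1 (%q. row_times d (mat_fun c q)) x"
  using cd x by (intro integ_act) (simp_all add: cont_seq_mat_fun)
 finally show "act (null_module A) (c \<otimes>\<^bsub>matrix_ring\<^esub> d) x = act (null_module A) c (act (null_module A) d x)"
  using cdR x by (simp add: null_module_act eq[abs_def])
next
 fix x assume x: "x : carrier (null_module A)"
 have one: "\<one>\<^bsub>matrix_ring\<^esub> = (%k n. if k = n then 1 else 0)" and oneR: "\<one>\<^bsub>matrix_ring\<^esub> : col_finite"
  by (simp_all add: matrix_ring_def)
 have "integ Nbar1 (mat_fun \<one>\<^bsub>matrix_ring\<^esub>) x = integ Nbar1 basis_fun x"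
  by (rule integ_cong[OF _ cont_seq_mat_fun[OF oneR]]) (auto simp: one mat_fun_def basis_fun_def split: option.split)
 thus "act (null_module A) \<one>\<^bsub>matrix_ring\<^esub> x = x"
  using x oneR by (simp add: null_module_act integ_basis)
qed

end

lemma solid_groupI: "light_condensed A ==> solid A ==> solid_group A"
 by (simp add: solid_group_def light_condensed_group_def solid_group_axioms_def)

lemma presheaf_hom_null:
 assumes "ab_presheaf A" "ab_presheaf B" and phi: "phi : presheaf_homs A B" and S: "S : MStone" and x: "x : null A S"
 shows "phi (times_Nbar S) x : null B S"
proof -
 interpret A: ab_presheaf A by fact
 interpret B: ab_presheaf B by fact
 have "pull B S (times_Nbar S) (at_inf) (phi (times_Nbar S) x)
   = phi S (pull A S (times_Nbar S) (at_inf) x)"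
  using S x by (intro presheaf_homs_pull[OF phi, symmetric] continuous_map_at) (simp_all add: null_iff)
 also have "... = phi S \<one>[A,S]" using x by (simp add: null_iff)
 also have "... = \<one>[B,S]"
  using phi S by (intro hom_one A.group_sect B.group_sect) (auto simp: presheaf_homs_def)
 finally show ?thesis using S x presheaf_homs_closed[OF phi times_Nbar_MStone[OF S]] by (simp add: null_iff)
qed

text \<open>The composite of \<open>integ_hom x\<close> with \<open>phi\<close> is a homomorphism
  out of \<open>ZN\<close>, hence again integration against its value on the basis sequence.\<close>

lemma presheaf_hom_integ:
 assumes A: "solid_group A" and B: "solid_group B" and phi: "phi : presheaf_homs A B"
  and S: "S : MStone" and g: "cont_seq S g" and x: "x : null A one_point"
 shows "phi S (solid_group.integ A S g x) = solid_group.integ B S g (phi Nbar1 x)"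
proof -
 interpret A: solid_group A by (rule A)
 interpret B: solid_group B by (rule B)
 let ?psi = "\<lambda>S\<in>MStone. compose (Sec ZN S) (phi S) (A.integ_hom x S)" and ?g = "restrict g (topspace S)"
 have psi: "?psi : presheaf_homs ZN B"
  by (rule presheaf_homs_compose[OF A.integ_hom_presheaf_hom[OF x] phi group_ZN res_ZN_closed])
 have gZ: "?g : Sec ZN S" by (rule restrict_ZN[OF g])
 have "eval_basis ?psi = phi Nbar1 (eval_basis (A.integ_hom x))"
  using basis_sequence_ZN by (simp add: eval_basis_def compose_def)
 hence ev: "eval_basis ?psi = phi Nbar1 x" by (simp add: A.eval_basis_integ_hom x)
 have "phi S (A.integ S g x) = phi S (A.integ S ?g x)"
  by (rule arg_cong[where f = "phi S"], rule A.integ_cong[OF S g]) simp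
 also have "... = ?psi S ?g" using S gZ by (simp add: compose_def A.integ_hom_def)
 also have "... = B.integ S ?g (phi Nbar1 x)" using B.presheaf_hom_eq_integ[OF psi S gZ] ev by simp
 also have "... = B.integ S g (phi Nbar1 x)" by (rule B.integ_cong[OF S g, symmetric]) simp
 finally show ?thesis .
qed

lemma null_module_map_hom:
 assumes A: "solid_group A" and B: "solid_group B" and phi: "phi : presheaf_homs A B"
 shows "null_module_map A B phi : module_homs matrix_ring (null_module A) (null_module B)"
proof -
 interpret A: solid_group A by (rule A)
 interpret B: solid_group B by (rule B)
 have closed: "phi Nbar1 x : null B one_point" if "x : null A one_point" for x
  by (rule presheaf_hom_null[OF A.ab_presheaf_axioms B.ab_presheaf_axioms phi _ that]) simp
 have "null_module_map A B phi : hom (null_module A) (null_module B)"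
  by (rule homI) (use subgroup.m_closed[OF A.subgroup_null[of one_point]] closed in
   \<open>simp_all add: null_module_map_def presheaf_homs_mult[OF phi] A.null_carrier\<close>)
 moreover have "null_module_map A B phi (act (null_module A) c x) = act (null_module B) c (null_module_map A B phi x)"
  if "c : col_finite" "x : null A one_point" for c x using that A.act_closed[OF that] closed[OF that(2)]
  by (simp add: null_module_map_def A.null_module_act B.null_module_act presheaf_hom_integ[OF A B phi] cont_seq_mat_fun)
 ultimately show ?thesis by (simp add: module_homs_def null_module_map_def)
qed

section \<open>The categories\<close>

lemma left_module_comm_group: "left_module R M ==> comm_group M" by (simp add: left_module_def)

lemma left_module_act_closed: "left_module R M ==> r : carrier R ==> x : carrier M ==> act M r x : carrier M"
 by (simp add: left_module_def)

lemma module_homs_closed: "h : module_homs R M N ==> x : carrier M ==> h x : carrier N"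
 by (auto simp: module_homs_def hom_def)

lemma module_homs_mult:
 "h : module_homs R M N ==> x : carrier M ==> y : carrier M ==> h (x \<otimes>\<^bsub>M\<^esub> y) = h x \<otimes>\<^bsub>N\<^esub> h y"
 by (auto simp: module_homs_def hom_def)

lemma module_homs_act:
 "h : module_homs R M N ==> r : carrier R ==> x : carrier M ==> h (act M r x) = act N r (h x)"
 by (auto simp: module_homs_def)

lemma module_homsI:
 assumes "!!x. x : carrier M ==> h x : carrier N"
  and "!!x y. x : carrier M ==> y : carrier M ==> h (x \<otimes>\<^bsub>M\<^esub> y) = h x \<otimes>\<^bsub>N\<^esub> h y"
  and "!!r x. r : carrier R ==> x : carrier M ==> h (act M r x) = act N r (h x)"
  and "h : extensional (carrier M)"
 shows "h : module_homs R M N" using assms by (auto simp: module_homs_def intro: homI)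

lemma module_homs_compose:
 assumes M: "comm_group M" "!!r x. [|r : carrier R; x : carrier M|] ==> act M r x : carrier M"
  and g: "g : module_homs R M N" and h: "h : module_homs R N P"
 shows "compose (carrier M) h g : module_homs R M P"
proof -
 interpret comm_group M by (rule M)
 show ?thesis by (rule module_homsI)
   (use M(2) in \<open>simp_all add: compose_def module_homs_closed[OF g] module_homs_closed[OF h]
    module_homs_mult[OF g] module_homs_mult[OF h] module_homs_act[OF g] module_homs_act[OF h]\<close>)
qed

lemma compose_assoc_extensional:
 "(!!x. x : X ==> f x : Y) ==> compose X h (compose X g f) = compose X (compose Y h g) f"
 by (auto simp: compose_def fun_eq_iff restrict_def)

lemma category_left_modules: "category (left_modules R)" unfolding category_def
proof (intro conjI ballI)
 fix M assume "M : Obj (left_modules R)"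
 hence M: "left_module R M" by (simp add: left_modules_def)
 interpret comm_group M by (rule left_module_comm_group[OF M])
 show "Ident (left_modules R) M : Arr (left_modules R) M M"
  unfolding left_modules_def by (simp, rule module_homsI) (simp_all add: left_module_act_closed[OF M])
next
 fix M N P f g assume "M : Obj (left_modules R)" "f : Arr (left_modules R) M N" "g : Arr (left_modules R) N P"
 thus "Comp (left_modules R) M N P g f : Arr (left_modules R) M P"
  by (simp add: left_modules_def module_homs_compose left_module_comm_group left_module_act_closed)
next
 fix M N f assume "f : Arr (left_modules R) M N"
 hence f: "f : extensional (carrier M)" "!!x. x : carrier M ==> f x : carrier N"
  by (auto simp: left_modules_def module_homs_def hom_def)
 show "Comp (left_modules R) M M N f (Ident (left_modules R) M) = f"
  "Comp (left_modules R) M N N (Ident (left_modules R) N) f = f"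
  using f by (auto simp: left_modules_def compose_def fun_eq_iff extensional_def)
next
 fix M N P Q f g h assume "f : Arr (left_modules R) M N"
 hence "!!x. x : carrier M ==> f x : carrier N" by (simp add: left_modules_def module_homs_closed)
 thus "Comp (left_modules R) M P Q h (Comp (left_modules R) M N P g f)
   = Comp (left_modules R) M N Q (Comp (left_modules R) N P Q h g) f"
  by (simp add: left_modules_def compose_assoc_extensional)
qed

lemma light_solid_simps [simp]:
 "A : Obj light_solid_groups \<longleftrightarrow> solid_group A"
 "Arr light_solid_groups A B = presheaf_homs A B"
 "Comp light_solid_groups A B D psi phi = (\<lambda>S\<in>MStone. compose (Sec A S) (psi S) (phi S))"
 "Ident light_solid_groups A = (\<lambda>S\<in>MStone. \<lambda>x\<in>Sec A S. x)"
 by (auto simp: light_solid_groups_def full_subcategory_def light_condensed_groups_def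
   solid_group_def light_condensed_group_def solid_group_axioms_def)

lemma left_modules_simps [simp]:
 "M : Obj (left_modules R) \<longleftrightarrow> left_module R M"
 "Arr (left_modules R) M N = module_homs R M N"
 "Comp (left_modules R) M N P g f = compose (carrier M) g f"
 "Ident (left_modules R) M = (\<lambda>x\<in>carrier M. x)" by (auto simp: left_modules_def)

lemma res_closed:
 "ab_presheaf A ==> S : MStone ==> T : MStone ==> f : cmaps S T ==> x : Sec A T ==>
  res A S T f x : Sec A S"
 by (simp add: res_eq_pull ab_presheaf.pull_closed cmapsD)

lemma category_light_solid_groups: "category light_solid_groups" unfolding category_def
proof (intro conjI ballI)
 fix A :: "'u presheaf" assume "A : Obj light_solid_groups"
 then interpret solid_group A by simp
 have "restrict (%x. x) (Sec A S) : hom (sect A S) (sect A S)" if "S : MStone" for S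
  by (rule homI) (use monoid.m_closed[OF group.is_monoid[OF group_sect[OF that]]] in auto)
 thus "Ident light_solid_groups A : Arr light_solid_groups A A"
  by (auto simp: presheaf_homs_def res_closed[OF ab_presheaf_axioms])
next
 fix A B D :: "'u presheaf" and f g
 assume A: "A : Obj light_solid_groups" and fg: "f : Arr light_solid_groups A B" "g : Arr light_solid_groups B D"
 from A interpret solid_group A by simp
 show "Comp light_solid_groups A B D g f : Arr light_solid_groups A D"
  using presheaf_homs_compose[of f A B g D] fg group_sect res_closed[OF ab_presheaf_axioms] by simp
next
 fix A B :: "'u presheaf" and f assume "A : Obj light_solid_groups" and f: "f : Arr light_solid_groups A B"
 hence *: "f : extensional MStone" "!!S. S : MStone ==> f S : extensional (Sec A S)"
   "!!S x. S : MStone ==> x : Sec A S ==> f S x : Sec B S" by (auto simp: presheaf_homs_def hom_def)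
 show "Comp light_solid_groups A A B f (Ident light_solid_groups A) = f"
  "Comp light_solid_groups A B B (Ident light_solid_groups B) f = f"
  by (rule extensionalityI[of _ MStone], use * in \<open>auto intro!: extensionalityI[of _ "Sec A _"] simp: compose_def\<close>)+
next
 fix A B D E :: "'u presheaf" and f g h assume "A : Obj light_solid_groups" and f: "f : Arr light_solid_groups A B"
 hence "!!S x. S : MStone ==> x : Sec A S ==> f S x : Sec B S" by (simp add: presheaf_homs_closed)
 thus "Comp light_solid_groups A D E h (Comp light_solid_groups A B D g f) =
   Comp light_solid_groups A B E (Comp light_solid_groups B D E h g) f"
  by (auto intro!: restrict_ext simp: compose_assoc_extensional)
qed

lemma is_functor_null_module:
 "is_functor (light_solid_groups :: ('u presheaf, point topology => 'u => 'u) cat) (left_modules matrix_ring) null_module null_module_map"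
 unfolding is_functor_def
proof (intro conjI ballI category_light_solid_groups category_left_modules)
 fix A :: "'u presheaf" assume A: "A : Obj light_solid_groups"
 thus "null_module A : Obj (left_modules matrix_ring)" by (simp add: solid_group.left_module_null_module)
 from A interpret solid_group A by simp
 show "null_module_map A A (Ident light_solid_groups A) = Ident (left_modules matrix_ring) (null_module A)"
  by (auto simp: null_module_map_def null_carrier intro!: restrict_ext)
 fix B D :: "'u presheaf" and f g assume "f : Arr light_solid_groups A B" "g : Arr light_solid_groups B D" "B : Obj light_solid_groups"
 hence f: "f : presheaf_homs A B" and B: "solid_group B" by simp_all
 interpret B: solid_group B by (rule B)
 have "f Nbar1 x : null B one_point" if "x : null A one_point" for x
  by (rule presheaf_hom_null[OF ab_presheaf_axioms B.ab_presheaf_axioms f _ that]) simp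
 thus "null_module_map A D (Comp light_solid_groups A B D g f) =
   Comp (left_modules matrix_ring) (null_module A) (null_module B) (null_module D) (null_module_map B D g) (null_module_map A B f)"
  by (auto simp: null_module_map_def compose_def null_carrier intro!: restrict_ext)
next
 fix A B :: "'u presheaf" and f assume "A : Obj light_solid_groups" "B : Obj light_solid_groups" "f : Arr light_solid_groups A B"
 thus "null_module_map A B f : Arr (left_modules matrix_ring) (null_module A) (null_module B)"
  by (simp add: null_module_map_hom)
qed

section \<open>The bidual of the free topological group\<close>

lemma carrier_dual: "phi : carrier (dual V) \<longleftrightarrow> (ALL x:carrier V. ALL y:carrier V. phi (x \<otimes>\<^bsub>V\<^esub> y) = phi x + phi y) &
  phi : extensional (carrier V) & locally_constant (topo V) phi"
 by (auto simp: dual_def dual_carrier_def hom_def)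

lemma mult_dual: "phi \<otimes>\<^bsub>dual V\<^esub> psi = (\<lambda>x\<in>carrier V. phi x + psi x)"
 and one_dual: "\<one>\<^bsub>dual V\<^esub> = (\<lambda>x\<in>carrier V. 0)" by (simp_all add: dual_def)

lemma comm_group_dual:
 assumes "group V" and top: "topspace (topo V) = carrier V"
 shows "comm_group (dual V)"
proof -
 interpret group V by fact
 have cont: "locally_constant (topo V) (\<lambda>x\<in>carrier V. F (phi x) (psi x))"
  if "locally_constant (topo V) phi" "locally_constant (topo V) psi"
  for phi psi :: "_ => int" and F :: "int => int => int"
  by (rule continuous_map_eq[OF continuous_map_discrete_binop[OF that, of F]]) (use top in auto)
 show ?thesis
 proof (rule comm_groupI)
  fix phi psi assume "phi : carrier (dual V)" "psi : carrier (dual V)"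
  thus "phi \<otimes>\<^bsub>dual V\<^esub> psi : carrier (dual V)"
   using cont[of phi psi "(+)"] by (simp add: carrier_dual mult_dual)
  show "phi \<otimes>\<^bsub>dual V\<^esub> psi = psi \<otimes>\<^bsub>dual V\<^esub> phi"
   by (simp add: mult_dual add.commute)
 next
  have "locally_constant (topo V) (\<lambda>x\<in>carrier V. 0 :: int)"
   using cont[of "%_. 0" "%_. 0" "(+)"] by simp
  thus "\<one>\<^bsub>dual V\<^esub> : carrier (dual V)" by (simp add: carrier_dual one_dual)
 next
  fix phi assume phi: "phi : carrier (dual V)"
  show "\<one>\<^bsub>dual V\<^esub> \<otimes>\<^bsub>dual V\<^esub> phi = phi"
   using phi by (auto simp: carrier_dual mult_dual one_dual extensional_def fun_eq_iff)
  have "(\<lambda>x\<in>carrier V. - phi x) : carrier (dual V)"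
   using phi cont[of phi phi "%a b. - a"] by (simp add: carrier_dual)
  moreover have "(\<lambda>x\<in>carrier V. - phi x) \<otimes>\<^bsub>dual V\<^esub> phi = \<one>\<^bsub>dual V\<^esub>"
   by (auto simp: mult_dual one_dual fun_eq_iff)
  ultimately show "EX psi:carrier (dual V). psi \<otimes>\<^bsub>dual V\<^esub> phi = \<one>\<^bsub>dual V\<^esub>"
   by blast
 qed (auto simp: mult_dual add.assoc intro!: restrict_ext)
qed

lemma dual_basis_open:
 "compactin (topo V) K ==> openin (topo (dual V)) {phi : carrier (dual V). phi ` K <= U}"
 unfolding dual_def by (auto intro!: topology_generated_by_Basis)

lemma topspace_dual [simp]: "topspace (topo (dual V)) = carrier (dual V)"
proof
 show "topspace (topo (dual V)) <= carrier (dual V)" by (auto simp: dual_def)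
 have "openin (topo (dual V)) {phi : carrier (dual V). phi ` {} <= {}}" by (rule dual_basis_open) simp
 thus "carrier (dual V) <= topspace (topo (dual V))" by (auto dest: openin_subset)
qed

definition point_values :: "'a topology => (('a \<Rightarrow>\<^sub>0 int) => int) => 'a => int" where
 "point_values S psi = pull_fun S frag_of psi"

lemma point_values_apply: "p : topspace S ==> point_values S psi p = psi (frag_of p)"
 by (simp add: point_values_def pull_fun_def)

abbreviation characters :: "'a topology => (('a \<Rightarrow>\<^sub>0 int) => int) set" where
 "characters S == carrier (dual (free_tag S))"

lemma group_free_tag: "comm_group (free_tag S)" by (simp add: free_tag_def comm_group_free_group_with)

lemma mult_free_tag: "x \<otimes>\<^bsub>free_tag S\<^esub> y = x + y"
 by (simp add: free_tag_def free_group_with_def)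

lemma free_tag_hom_eq:
 fixes phi psi :: "('a \<Rightarrow>\<^sub>0 int) => int"
 assumes phi: "!!x y. [|x : carrier (free_tag S); y : carrier (free_tag S)|] ==> phi (x + y) = phi x + phi y"
  and psi: "!!x y. [|x : carrier (free_tag S); y : carrier (free_tag S)|] ==> psi (x + y) = psi x + psi y"
  and eq: "!!s. s : topspace S ==> phi (frag_of s) = psi (frag_of s)" and x: "x : carrier (free_tag S)"
 shows "phi x = psi x"
proof -
 have "Poly_Mapping.keys x <= topspace S" using x by (simp add: carrier_free_tag)
 thus ?thesis
 proof (rule free_Abelian_group_induct)
  show "phi 0 = psi 0" using phi[of 0 0] psi[of 0 0] by (simp add: carrier_free_tag)
 next
  fix x y :: "'a \<Rightarrow>\<^sub>0 int" assume *: "Poly_Mapping.keys x <= topspace S" "Poly_Mapping.keys y <= topspace S"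
   "phi x = psi x" "phi y = psi y"
  have d: "x - y : carrier (free_tag S)" "y : carrier (free_tag S)"
   using *(1,2) keys_diff[of x y] by (simp_all add: carrier_free_tag) blast
  have "phi (x - y + y) = phi (x - y) + phi y" "psi (x - y + y) = psi (x - y) + psi y"
   by (rule phi[OF d], rule psi[OF d])
  thus "phi (x - y) = psi (x - y)" using *(3,4) by simp
 qed (use eq in auto)
qed

definition discrete_int :: "int topgroup" where
 "discrete_int = \<lparr>carrier = UNIV, monoid.mult = (+), one = 0, topo = discrete_topology UNIV\<rparr>"

lemma topological_ab_group_discrete_int: "topological_ab_group discrete_int"
proof -
 have c: "comm_group discrete_int"
  by (rule comm_group_cong[OF abelian_integer_group]) (simp_all add: discrete_int_def)
 have "continuous_map (prod_topology (discrete_topology UNIV) (discrete_topology UNIV)) (discrete_topology UNIV) (f :: int \<times> int => int)" for f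
  unfolding prod_topology_discrete_topology[symmetric] by simp
 thus ?thesis using c by (simp add: topological_ab_group_def discrete_int_def)
qed

text \<open>The universal property of the free topological group for maps into the discrete
  integers.\<close>

lemma bij_point_values:
 "bij_betw (point_values S) (characters S) (cont_int S)"
proof (rule bij_betwI')
 fix phi psi assume phi: "phi : characters S" and psi: "psi : characters S"
 show "point_values S phi = point_values S psi \<longleftrightarrow> phi = psi"
 proof
  assume eq: "point_values S phi = point_values S psi"
  show "phi = psi"
  proof (rule extensionalityI[of _ "carrier (free_tag S)"])
   fix x assume x: "x : carrier (free_tag S)"
   have "phi (frag_of s) = psi (frag_of s)" if "s : topspace S" for s
    using fun_cong[OF eq, of s] that by (simp add: point_values_apply)
   thus "phi x = psi x"
    using phi psi x unfolding carrier_dual mult_free_tag by (intro free_tag_hom_eq[of S phi psi x]) blast+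
  qed (use phi psi in \<open>auto simp: carrier_dual\<close>)
 qed simp
next
 fix phi assume phi: "phi : characters S"
 show "point_values S phi : cont_int S"
 proof (rule cont_intI)
  have "locally_constant S (phi o frag_of)"
   using phi free_tag_universal(2) by (intro continuous_map_compose[of S "topo (free_tag S)"]) (auto simp: carrier_dual)
  thus "locally_constant S (point_values S phi)" by (rule continuous_map_eq) (simp add: point_values_apply)
 qed (simp add: point_values_def pull_fun_def)
next
 fix g assume g: "g : cont_int S"
 hence "continuous_map S (topo discrete_int) g" by (simp add: cont_int_def discrete_int_def)
 then obtain h where h: "h : hom (free_tag S) discrete_int Int extensional (carrier (free_tag S))"
   "continuous_map (topo (free_tag S)) (topo discrete_int) h" "ALL s:topspace S. h (frag_of s) = g s"
  using free_tag_universal(3)[OF topological_ab_group_discrete_int] by blast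
 have "h : characters S" using h by (auto simp: carrier_dual hom_def discrete_int_def)
 moreover have "g = point_values S h"
  using h(3) cont_int_outside[OF g] by (auto simp: point_values_def pull_fun_def fun_eq_iff)
 ultimately show "EX phi:characters S. g = point_values S phi" by blast
qed

definition character :: "'a topology => ('a => int) => ('a \<Rightarrow>\<^sub>0 int) => int" where
 "character S = inv_into (characters S) (point_values S)"

lemma point_values_closed: "psi : characters S ==> point_values S psi : cont_int S"
 using bij_point_values bij_betw_imp_surj_on by blast

lemma character_closed: "g : cont_int S ==> character S g : characters S"
 using bij_point_values[of S] by (simp add: character_def bij_betw_def inv_into_into)

lemma point_values_character: "g : cont_int S ==> point_values S (character S g) = g"
 using bij_point_values[of S] by (simp add: character_def bij_betw_def f_inv_into_f)

lemma character_point_values: "psi : characters S ==> character S (point_values S psi) = psi"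
 using bij_point_values[of S] by (simp add: character_def bij_betw_def)

lemma comm_group_characters: "comm_group (dual (free_tag S))"
 by (rule comm_group_dual[OF comm_group.axioms(2)[OF group_free_tag] topspace_free_tag])

lemma comm_group_bidual: "comm_group (bidual_free S)"
 unfolding bidual_free_def by (rule comm_group_dual[OF comm_group.axioms(2)[OF comm_group_characters]]) simp

lemma characters_add:
 "[|phi : characters S; psi : characters S|] ==> phi \<otimes>\<^bsub>dual (free_tag S)\<^esub> psi : characters S"
 using monoid.m_closed[OF group.is_monoid[OF comm_group.axioms(2)[OF comm_group_characters]]] .

lemma point_values_mult:
 "point_values S (phi \<otimes>\<^bsub>dual (free_tag S)\<^esub> psi) = point_values S phi + point_values S psi"
 by (auto simp: point_values_def pull_fun_def mult_dual fun_eq_iff carrier_free_tag)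

lemma character_add:
 assumes "g : cont_int S" "h : cont_int S"
 shows "character S (g + h) = character S g \<otimes>\<^bsub>dual (free_tag S)\<^esub> character S h"
 using character_point_values[OF characters_add[OF character_closed[OF assms(1)] character_closed[OF assms(2)]]]
 by (simp add: point_values_mult point_values_character assms)

text \<open>A continuous integer function on a compact space has finitely many level sets, all
  compact. Prescribing the value on each is an open condition in the compact-open topology and
  singles out one character.\<close>

lemma topo_characters:
 assumes S: "compact_space S"
 shows "topo (dual (free_tag S)) = discrete_topology (characters S)"
proof -
 have "openin (topo (dual (free_tag S))) {psi}" if psi: "psi : characters S" for psi
 proof -
  let ?g = "point_values S psi"
  have g: "?g : cont_int S" by (rule point_values_closed[OF psi])
  let ?K = "%a. frag_of ` {s : topspace S. ?g s = a}"
  let ?U = "%a. {phi : characters S. phi ` ?K a <= {a}}"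
  have "openin (topo (dual (free_tag S))) (?U a)" for a
  proof (rule dual_basis_open, rule image_compactin)
   show "compactin S {s : topspace S. ?g s = a}"
    using S cont_int_clopenin[OF g] by (intro closedin_compact_space) (simp_all add: clopenin_def)
  qed (rule free_tag_universal(2))
  hence "openin (topo (dual (free_tag S))) ((\<Inter>a\<in>?g ` topspace S. ?U a) Int topspace (topo (dual (free_tag S))))"
   using cont_int_finite_range[OF S g] by (intro openin_INT) auto
  moreover have "phi : (\<Inter>a\<in>?g ` topspace S. ?U a) Int topspace (topo (dual (free_tag S))) \<longleftrightarrow> phi = psi" for phi
  proof
   assume phi: "phi : (\<Inter>a\<in>?g ` topspace S. ?U a) Int topspace (topo (dual (free_tag S)))"
   hence phic: "phi : characters S" by simp
   have "phi (frag_of s) = ?g s" if "s : topspace S" for s using phi that by auto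
   hence "point_values S phi = ?g"
    using cont_int_outside[OF g] by (intro ext) (simp add: point_values_def pull_fun_def)
   thus "phi = psi" using character_point_values[OF phic] character_point_values[OF psi] by metis
  next
   assume "phi = psi"
   moreover have "psi ` ?K a <= {a}" for a by (auto simp: point_values_apply)
   ultimately show "phi : (\<Inter>a\<in>?g ` topspace S. ?U a) Int topspace (topo (dual (free_tag S)))"
    using psi by simp
  qed
  hence "(\<Inter>a\<in>?g ` topspace S. ?U a) Int topspace (topo (dual (free_tag S))) = {psi}"
   by (intro Set.set_eqI) (simp only: singleton_iff)
  ultimately show ?thesis by metis
 qed
 thus ?thesis by (subst eq_commute, subst discrete_topology_unique) simp
qed

lemma carrier_bidual:
 assumes S: "compact_space S"
 shows "mu : carrier (bidual_free S) \<longleftrightarrow>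
  (ALL phi:characters S. ALL psi:characters S. mu (phi \<otimes>\<^bsub>dual (free_tag S)\<^esub> psi) = mu phi + mu psi) & mu : extensional (characters S)"
 by (simp add: bidual_free_def carrier_dual topo_characters[OF S])

text \<open>The dual being discrete, its compact subsets are finite, and the compact-open topology
  on the bidual is that of pointwise convergence.\<close>

lemma limitin_bidual:
 assumes S: "compact_space S"
 shows "limitin (topo (bidual_free S)) s l sequentially \<longleftrightarrow> l : carrier (bidual_free S) &
  (\<forall>\<^sub>F n in sequentially. s n : carrier (bidual_free S)) & (ALL psi:characters S. \<forall>\<^sub>F n in sequentially. s n psi = l psi)"
  (is "?L \<longleftrightarrow> ?R")
proof
 let ?B = "{{phi : dual_carrier (dual (free_tag S)). phi ` K <= U} | K U. compactin (topo (dual (free_tag S))) K}"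
 have topo: "topo (bidual_free S) = topology_generated_by ?B" and car: "carrier (bidual_free S) = dual_carrier (dual (free_tag S))"
  by (simp_all add: bidual_free_def dual_def)
 assume L: ?L
 have top: "topspace (topo (bidual_free S)) = carrier (bidual_free S)" by (simp add: bidual_free_def)
 have l: "l : carrier (bidual_free S)" using L top by (auto simp: limitin_def)
 moreover have "\<forall>\<^sub>F n in sequentially. s n : carrier (bidual_free S)"
  using L l top openin_topspace[of "topo (bidual_free S)"] unfolding limitin_def by metis
 moreover have "\<forall>\<^sub>F n in sequentially. s n psi = l psi" if psi: "psi : characters S" for psi
 proof -
  have "compactin (topo (dual (free_tag S))) {psi}" using psi by simp
  hence "openin (topo (bidual_free S)) {mu : carrier (bidual_free S). mu ` {psi} <= {l psi}}"
   unfolding bidual_free_def by (rule dual_basis_open)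
  hence "\<forall>\<^sub>F n in sequentially. s n : {mu : carrier (bidual_free S). mu ` {psi} <= {l psi}}"
   using L l unfolding limitin_def by auto
  thus ?thesis by eventually_elim simp
 qed
 ultimately show ?R by blast
next
 let ?B = "{{phi : dual_carrier (dual (free_tag S)). phi ` K <= U} | K U. compactin (topo (dual (free_tag S))) K}"
 assume R: ?R
 have "\<forall>\<^sub>F n in sequentially. s n : U" if "generate_topology_on ?B U" "l : U" for U using that
 proof (induction rule: generate_topology_on.induct)
  case (Int a b)
  thus ?case by (simp add: eventually_conj)
 next
  case (UN K)
  then obtain k where k: "k : K" "l : k" by blast
  hence "\<forall>\<^sub>F n in sequentially. s n : k" using UN by blast
  thus ?case by eventually_elim (use k in blast)
 next
  case (Basis W)
  then obtain K U where W: "W = {phi : dual_carrier (dual (free_tag S)). phi ` K <= U}" "compactin (topo (dual (free_tag S))) K"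
   by blast
  hence K: "finite K" "K <= characters S"
   by (simp_all add: topo_characters[OF S] compactin_discrete_topology)
  hence "\<forall>\<^sub>F n in sequentially. ALL psi:K. s n psi = l psi"
   using R by (intro eventually_ball_finite) auto
  hence "\<forall>\<^sub>F n in sequentially. s n : carrier (bidual_free S) & (ALL psi:K. s n psi = l psi)"
   using R by (intro eventually_conj) auto
  thus ?case
  proof eventually_elim
   case (elim n)
   thus ?case using Basis(2) by (auto simp: W bidual_free_def dual_def)
  qed
 qed simp
 moreover have "l : topspace (topo (bidual_free S))" using R by (simp add: bidual_free_def)
 moreover have "openin (topo (bidual_free S)) U \<longleftrightarrow> generate_topology_on ?B U" for U
  by (simp add: bidual_free_def dual_def[of "dual (free_tag S)"] openin_topology_generated_by_iff)
 ultimately show ?L by (auto simp: limitin_def)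
qed

abbreviation null_bidual :: "point topology => (matrix, bidual_seq) lmodule" where
 "null_bidual S == null_sequences (bidual_free S)"

lemma carrier_null_bidual:
 assumes S: "compact_space S"
 shows "s : carrier (null_bidual S) \<longleftrightarrow> (ALL n. s n : carrier (bidual_free S)) & (ALL psi:characters S. EX N. ALL n>=N. s n psi = 0)"
proof -
 interpret B: comm_group "bidual_free S" by (rule comm_group_bidual)
 have one: "\<one>\<^bsub>bidual_free S\<^esub> = (\<lambda>psi\<in>characters S. 0)" "\<one>\<^bsub>bidual_free S\<^esub> : carrier (bidual_free S)"
  by (simp add: bidual_free_def one_dual, rule B.one_closed)
 show ?thesis
  using one(2) by (auto simp: null_sequences_def limitin_bidual[OF S] one(1) eventually_sequentially)
qed

lemma mult_null_bidual: "s \<otimes>\<^bsub>null_bidual S\<^esub> t = (%n. \<lambda>psi\<in>characters S. s n psi + t n psi)"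
 by (simp add: null_sequences_def bidual_free_def mult_dual)

lemma one_bidual: "\<one>\<^bsub>bidual_free S\<^esub> = (\<lambda>psi\<in>characters S. 0)"
 by (simp add: bidual_free_def one_dual)

lemma bidual_pow:
 assumes mu: "mu : carrier (bidual_free S)" and psi: "psi : characters S"
 shows "(mu [^]\<^bsub>bidual_free S\<^esub> (z::int)) psi = z * mu psi"
proof -
 interpret B: comm_group "bidual_free S" by (rule comm_group_bidual)
 have "group_hom (bidual_free S) integer_group (%mu. mu psi)"
  using psi B.group_axioms by (simp add: group_hom_def group_hom_axioms_def hom_def) (simp add: bidual_free_def mult_dual)
 thus ?thesis using group_hom.hom_int_pow[of "bidual_free S" integer_group "%mu. mu psi" mu z] mu by simp
qed

lemma bidual_finprod:
 assumes f: "!!n. f n : carrier (bidual_free S)" and psi: "psi : characters S"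
 shows "finprod (bidual_free S) f {..<N::nat} : carrier (bidual_free S) & finprod (bidual_free S) f {..<N} psi = (\<Sum>n<N. f n psi)"
proof -
 interpret B: comm_group "bidual_free S" by (rule comm_group_bidual)
 have f': "f : A \<rightarrow> carrier (bidual_free S)" for A using f by auto
 show ?thesis
 proof (induction N)
  case 0
  show ?case by (simp add: B.one_closed) (simp add: one_bidual psi)
 next
  case (Suc N)
  thus ?case
   using psi f f' by (simp add: lessThan_Suc B.finprod_insert) (simp add: bidual_free_def mult_dual add.commute)
 qed
qed

text \<open>At each character only finitely many terms of the series are nonzero, so the partial
  sums are eventually constant there; this pointwise limit is the sum in the bidual.\<close>

lemma act_null_bidual:
 assumes S: "compact_space S" and s: "s : carrier (null_bidual S)"
 shows "act (null_bidual S) c s = (%k. \<lambda>psi\<in>characters S. \<Sum>n | s n psi ~= 0. c k n * s n psi)"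
proof
 fix k
 let ?V = "bidual_free S"
 let ?f = "%n. s n [^]\<^bsub>?V\<^esub> c k n" and ?l = "\<lambda>psi\<in>characters S. \<Sum>n | s n psi ~= 0. c k n * s n psi"
 interpret B: comm_group ?V by (rule comm_group_bidual)
 have sn: "s n : carrier ?V" for n using s by (simp add: carrier_null_bidual[OF S])
 have f: "?f n : carrier ?V" for n using sn by simp
 have f_val: "?f n psi = c k n * s n psi" if "psi : characters S" for n psi using bidual_pow[OF sn that] .
 have partial: "EX M. ALL N>=M. finprod ?V ?f {..<N} psi = ?l psi" if psi: "psi : characters S" for psi
 proof -
  obtain M where M: "!!n. n >= M ==> s n psi = 0" using s psi unfolding carrier_null_bidual[OF S] by blast
  have "finprod ?V ?f {..<N} psi = ?l psi" if "N >= M" for N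
  proof -
   have "finprod ?V ?f {..<N} psi = (\<Sum>n<N. c k n * s n psi)"
    using bidual_finprod[of ?f, OF f psi] f_val[OF psi] by simp
   also have "... = (\<Sum>n | s n psi ~= 0. c k n * s n psi)"
    using sum_support_bound[of N "%n. s n psi" "c k"] M that by simp
   finally show ?thesis using psi by simp
  qed
  thus ?thesis by blast
 qed
 have l: "?l : carrier ?V" unfolding carrier_bidual[OF S]
 proof (intro conjI ballI)
  \<comment> \<open>Additivity is inherited from one partial sum, taken long enough to agree with
    the limit at both characters and at their product.\<close>
  fix phi psi assume phipsi: "phi : characters S" "psi : characters S"
  note m = characters_add[OF phipsi]
  obtain M1 where M1: "ALL N>=M1. finprod ?V ?f {..<N} phi = ?l phi" using partial[OF phipsi(1)] ..
  obtain M2 where M2: "ALL N>=M2. finprod ?V ?f {..<N} psi = ?l psi" using partial[OF phipsi(2)] ..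
  obtain M3 where M3: "ALL N>=M3. finprod ?V ?f {..<N} (phi \<otimes>\<^bsub>dual (free_tag S)\<^esub> psi) = ?l (phi \<otimes>\<^bsub>dual (free_tag S)\<^esub> psi)"
   using partial[OF m] ..
  have eqs: "finprod ?V ?f {..<M1 + M2 + M3} phi = ?l phi" "finprod ?V ?f {..<M1 + M2 + M3} psi = ?l psi"
    "finprod ?V ?f {..<M1 + M2 + M3} (phi \<otimes>\<^bsub>dual (free_tag S)\<^esub> psi) = ?l (phi \<otimes>\<^bsub>dual (free_tag S)\<^esub> psi)"
   by (rule M1[rule_format], simp, rule M2[rule_format], simp, rule M3[rule_format], simp)
  have "finprod ?V ?f {..<M1 + M2 + M3} : carrier ?V" using bidual_finprod[of ?f, OF f phipsi(1)] by blast
  thus "?l (phi \<otimes>\<^bsub>dual (free_tag S)\<^esub> psi) = ?l phi + ?l psi"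
   using phipsi unfolding carrier_bidual[OF S] eqs[symmetric] by blast
 qed simp
 have sums: "group_sums ?V ?f x \<longleftrightarrow> x = ?l" for x
 proof
  assume "group_sums ?V ?f x"
  hence x: "x : carrier ?V" "ALL psi:characters S. EX M. ALL N>=M. finprod ?V ?f {..<N} psi = x psi"
   by (auto simp: group_sums_def limitin_bidual[OF S] eventually_sequentially)
  show "x = ?l"
  proof (rule extensionalityI[of _ "characters S"])
   fix psi assume psi: "psi : characters S"
   obtain M where M: "ALL N>=M. finprod ?V ?f {..<N} psi = x psi" using x(2) psi by blast
   obtain M' where M': "ALL N>=M'. finprod ?V ?f {..<N} psi = ?l psi" using partial[OF psi] ..
   show "x psi = ?l psi" using M[rule_format, of "max M M'"] M'[rule_format, of "max M M'"] by simp
  qed (use x l in \<open>simp_all add: carrier_bidual[OF S]\<close>)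
 next
  have closed: "finprod ?V ?f {..<N} : carrier ?V" for N using f by (intro B.finprod_closed) auto
  assume "x = ?l"
  thus "group_sums ?V ?f x"
   unfolding group_sums_def limitin_bidual[OF S] eventually_sequentially using l partial closed by blast
 qed
 have "act (null_bidual S) c s k = (THE x. group_sums ?V ?f x)" by (simp add: null_sequences_def)
 also have "... = ?l" unfolding sums by simp
 finally show "act (null_bidual S) c s k = ?l" .
qed

section \<open>Null measures as a module\<close>

definition measure_module :: "'a topology => (matrix, nat => ('a => int) => int) lmodule" where
 "measure_module X = \<lparr>carrier = null_measures X, monoid.mult = (+), one = 0,
   act = (%c v k g. \<Sum>n | v n g ~= 0. c k n * v n g)\<rparr>"

lemma measure_module_simps [simp]:
 "carrier (measure_module X) = null_measures X"
 "v \<otimes>\<^bsub>measure_module X\<^esub> w = v + w"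
 "\<one>\<^bsub>measure_module X\<^esub> = 0" by (simp_all add: measure_module_def)

lemma act_measure_module: "act (measure_module X) c v k g = (\<Sum>n | v n g ~= 0. c k n * v n g)"
 by (simp add: measure_module_def)

lemma act_measure_module_bound:
 "(!!n. n >= N ==> v n g = 0) ==> act (measure_module X) c v k g = (\<Sum>n<N. c k n * v n g)"
 unfolding act_measure_module by (rule sum_support_bound)

lemma comm_group_measure_module: "comm_group (measure_module X)"
proof (rule comm_groupI)
 fix v assume "v : carrier (measure_module X)"
 thus "EX w:carrier (measure_module X). w \<otimes>\<^bsub>measure_module X\<^esub> v = \<one>\<^bsub>measure_module X\<^esub>"
  by (intro bexI[of _ "- v"]) (simp_all add: add_subgroup_uminus)
qed (simp_all add: add_subgroup_0 add_subgroup_add add.assoc add.commute)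

lemma act_measure_closed:
 assumes c: "c : col_finite" and v: "v : null_measures X"
 shows "act (measure_module X) c v : null_measures X" unfolding null_measures_def
proof safe
 fix k
 show "additive_on (cont_int X) (act (measure_module X) c v k)" unfolding additive_on_def
 proof (intro ballI)
  fix g h assume gh: "g : cont_int X" "h : cont_int X"
  obtain N where N: "!!n. n >= N ==> v n g = 0" "!!n. n >= N ==> v n h = 0"
   by (rule null_measures_bound2[OF v v, of g h]) (rule that, assumption+)
  have add: "v n (g + h) = v n g + v n h" for n
   by (rule additive_on_add[OF null_measures_additive[OF v] gh])
  show "act (measure_module X) c v k (g + h) = act (measure_module X) c v k g + act (measure_module X) c v k h"
   using N add by (simp add: act_measure_module_bound[of N] distrib_left sum.distrib)
 qed
next
 fix g
 obtain N where N: "!!n. n >= N ==> v n g = 0"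
  by (rule null_measures_bound[OF v, of g]) (rule that, assumption)
 have "finite (\<Union>n<N. {k. c k n ~= 0})" using c by (auto simp: col_finite_iff)
 then obtain M where M: "ALL k:(\<Union>n<N. {k. c k n ~= 0}). k < M"
  using finite_nat_set_iff_bounded by blast
 have "act (measure_module X) c v k g = 0" if "k >= M" for k
 proof -
  have "c k n = 0" if "n < N" for n using M that `k >= M` by force
  thus ?thesis using N by (simp add: act_measure_module_bound[of N])
 qed
 thus "EX M. ALL k>=M. act (measure_module X) c v k g = 0" by blast
qed (simp add: act_measure_module null_measures_outside[OF v])

lemma push_measure_module_hom:
 assumes Lambda: "Lambda : additive_maps X Y"
 shows "restrict (push_measure X Lambda) (null_measures Y) : module_homs matrix_ring (measure_module Y) (measure_module X)"
proof (rule module_homsI)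
 fix c v assume "c : col_finite" "v : carrier (measure_module Y)"
 thus "restrict (push_measure X Lambda) (null_measures Y) (act (measure_module Y) c v) =
   act (measure_module X) c (restrict (push_measure X Lambda) (null_measures Y) v)"
  by (auto simp: act_measure_closed fun_eq_iff push_measure_def act_measure_module)
qed (use push_measure_null[OF Lambda] in \<open>simp_all add: push_measure_add add_subgroup_add\<close>)

text \<open>Transport along the bijection between characters and functions. With its inverse
  \<open>measure_seq\<close> it identifies \<open>null_bidual S\<close> with
  \<open>measure_module S\<close> as modules, so that topologies disappear from the
  argument.\<close>

definition seq_measure :: "point topology => bidual_seq => nat => (point => int) => int" where
 "seq_measure S s = (%n g. if g : cont_int S then s n (character S g) else 0)"

definition measure_seq :: "point topology => (nat => (point => int) => int) => bidual_seq" where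
 "measure_seq S v = (%n. \<lambda>psi\<in>characters S. v n (point_values S psi))"

lemma seq_measure_closed:
 assumes S: "compact_space S" and s: "s : carrier (null_bidual S)"
 shows "seq_measure S s : null_measures S" unfolding null_measures_def
proof safe
 fix n
 have "s n : carrier (bidual_free S)" using s by (simp add: carrier_null_bidual[OF S])
 thus "additive_on (cont_int S) (seq_measure S s n)"
  by (auto simp: additive_on_def seq_measure_def character_add carrier_bidual[OF S] character_closed add_subgroup_add)
next
 fix g assume "g : cont_int S"
 hence "character S g : characters S" by (rule character_closed)
 thus "EX N. ALL n>=N. seq_measure S s n g = 0"
  using s unfolding carrier_null_bidual[OF S] seq_measure_def by metis
qed (simp add: seq_measure_def)

lemma measure_seq_closed:
 assumes S: "compact_space S" and v: "v : null_measures S"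
 shows "measure_seq S v : carrier (null_bidual S)" unfolding carrier_null_bidual[OF S]
proof (intro conjI allI ballI)
 fix n
 show "measure_seq S v n : carrier (bidual_free S)" using additive_on_add[OF null_measures_additive[OF v]]
  by (simp add: carrier_bidual[OF S] measure_seq_def characters_add point_values_mult point_values_closed)
next
 fix psi assume "psi : characters S"
 thus "EX N. ALL n>=N. measure_seq S v n psi = 0"
  using null_measures_bound[OF v, of "point_values S psi"] unfolding measure_seq_def by (metis restrict_apply')
qed

lemma measure_seq_measure:
 assumes S: "compact_space S" and s: "s : carrier (null_bidual S)"
 shows "measure_seq S (seq_measure S s) = s"
proof
 fix n
 have "s n : extensional (characters S)"
  using s by (simp add: carrier_null_bidual[OF S] carrier_bidual[OF S])
 thus "measure_seq S (seq_measure S s) n = s n"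
  by (auto simp: measure_seq_def seq_measure_def point_values_closed character_point_values extensional_def fun_eq_iff)
qed

lemma seq_measure_seq: "v : null_measures S ==> seq_measure S (measure_seq S v) = v"
 by (auto simp: measure_seq_def seq_measure_def point_values_character character_closed null_measures_outside fun_eq_iff)

lemma seq_measure_add:
 "seq_measure S (s \<otimes>\<^bsub>null_bidual S\<^esub> t) = seq_measure S s + seq_measure S t"
 by (auto simp: seq_measure_def mult_null_bidual character_closed fun_eq_iff)

lemma seq_measure_act:
 assumes "compact_space S" "s : carrier (null_bidual S)"
 shows "seq_measure S (act (null_bidual S) c s) = act (measure_module S) c (seq_measure S s)"
 by (auto simp: act_null_bidual[OF assms] seq_measure_def act_measure_module character_closed fun_eq_iff)

lemma act_null_bidual_closed:
 assumes S: "compact_space S" and c: "c : col_finite" and s: "s : carrier (null_bidual S)"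
 shows "act (null_bidual S) c s : carrier (null_bidual S)"
proof -
 have "measure_seq S (act (measure_module S) c (seq_measure S s)) = act (null_bidual S) c s"
  by (auto simp: measure_seq_def seq_measure_act[OF S s, symmetric] seq_measure_def point_values_closed
    character_point_values act_null_bidual[OF S s] act_measure_module fun_eq_iff)
 thus ?thesis using measure_seq_closed[OF S act_measure_closed[OF c seq_measure_closed[OF S s]]] by simp
qed

lemma mult_null_bidual_closed:
 assumes S: "compact_space S" and s: "s : carrier (null_bidual S)" "t : carrier (null_bidual S)"
 shows "s \<otimes>\<^bsub>null_bidual S\<^esub> t : carrier (null_bidual S)"
proof -
 have "measure_seq S (seq_measure S s + seq_measure S t) = s \<otimes>\<^bsub>null_bidual S\<^esub> t"
  by (auto simp: measure_seq_def seq_measure_def point_values_closed character_point_values mult_null_bidual fun_eq_iff)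
 thus ?thesis
  using measure_seq_closed[OF S add_subgroup_add[OF add_subgroup_null_measures seq_measure_closed[OF S s(1)] seq_measure_closed[OF S s(2)]]]
  by simp
qed

lemma point_values_dual_map:
 assumes f: "continuous_map S T f" and psi: "psi : characters T"
 shows "point_values S (dual_map (free_tag S) (free_tag T) (free_tag_map S f) psi) = pull_fun S f (point_values T psi)"
proof
 fix p
 show "point_values S (dual_map (free_tag S) (free_tag T) (free_tag_map S f) psi) p = pull_fun S f (point_values T psi) p"
 proof (cases "p : topspace S")
  case True
  hence "f p : topspace T" "frag_of p : carrier (free_tag S)"
   using f by (auto simp: continuous_map_def carrier_free_tag)
  thus ?thesis
   using True psi by (simp add: point_values_def pull_fun_def dual_map_def free_tag_map_def compose_def)
 qed (simp add: point_values_def pull_fun_def)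
qed

lemma dual_map_closed:
 assumes S: "compact_space S" and f: "continuous_map S T f" and psi: "psi : characters T"
 shows "dual_map (free_tag S) (free_tag T) (free_tag_map S f) psi = character S (pull_fun S f (point_values T psi))"
proof (rule extensionalityI[of _ "carrier (free_tag S)"])
 let ?psi = "dual_map (free_tag S) (free_tag T) (free_tag_map S f) psi" and ?g = "pull_fun S f (point_values T psi)"
 have g: "?g : cont_int S" by (rule pull_fun_cont_int[OF f point_values_closed[OF psi]])
 have ch: "character S ?g : characters S" by (rule character_closed[OF g])
 thus "character S ?g : extensional (carrier (free_tag S))" by (simp add: carrier_dual)
 show "?psi : extensional (carrier (free_tag S))" using psi by (simp add: dual_map_def)
 fix x assume x: "x : carrier (free_tag S)"
 have fT: "f ` topspace S <= topspace T" using f by (auto simp: continuous_map_def)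
 let ?h = "frag_extend (%s. frag_of (f s))"
 have h: "?h x : carrier (free_tag T)" if "x : carrier (free_tag S)" for x
 proof -
  have "Poly_Mapping.keys (?h x) <= (\<Union>s\<in>Poly_Mapping.keys x. Poly_Mapping.keys (frag_of (f s)))"
   by (rule keys_frag_extend)
  also have "... <= topspace T" using that fT by (auto simp: carrier_free_tag)
  finally show ?thesis by (simp add: carrier_free_tag)
 qed
 have val: "?psi x = psi (?h x)" if "x : carrier (free_tag S)" for x
  using psi that by (simp add: dual_map_def free_tag_map_def compose_def)
 have add: "x + y : carrier (free_tag S)" if "x : carrier (free_tag S)" "y : carrier (free_tag S)" for x y
  using that Poly_Mapping.keys_add[of x y] by (auto simp: carrier_free_tag)
 show "?psi x = character S ?g x"
 proof (rule free_tag_hom_eq[OF _ _ _ x])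
  show "?psi (x + y) = ?psi x + ?psi y" if "x : carrier (free_tag S)" "y : carrier (free_tag S)" for x y
   using psi h[OF that(1)] h[OF that(2)] by (simp add: val that add frag_extend_add carrier_dual mult_free_tag)
  show "character S ?g (x + y) = character S ?g x + character S ?g y" if "x : carrier (free_tag S)" "y : carrier (free_tag S)" for x y
   using ch that by (simp add: carrier_dual mult_free_tag)
  fix s assume s: "s : topspace S"
  have "?psi (frag_of s) = point_values S ?psi s" "character S ?g (frag_of s) = point_values S (character S ?g) s"
   by (simp_all add: point_values_apply s)
  thus "?psi (frag_of s) = character S ?g (frag_of s)"
   by (simp add: point_values_character[OF g] point_values_dual_map[OF f psi])
 qed
qed

text \<open>Dualising the map induced by \<open>f\<close> once gives \<open>pull_fun S f\<close> on
  functions, and dualising again gives its transpose.\<close>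

lemma bidual_map_seq:
 assumes S: "compact_space S" and f: "continuous_map S T f" and s: "s : carrier (null_bidual S)"
 shows "null_sequences_map (bidual_free S) (bidual_free_map S T f) s = measure_seq T (push_measure T (pull_fun S f) (seq_measure S s))"
proof (intro ext)
 fix n psi
 have "s n : carrier (bidual_free S)" using s by (simp add: carrier_null_bidual[OF S])
 hence sn: "s n : carrier (dual (dual (free_tag S)))" by (simp add: bidual_free_def)
 show "null_sequences_map (bidual_free S) (bidual_free_map S T f) s n psi = measure_seq T (push_measure T (pull_fun S f) (seq_measure S s)) n psi"
  using s sn by (simp add: null_sequences_map_def bidual_free_map_def dual_map_def[of "dual (free_tag T)"] compose_def measure_seq_def
   push_measure_def seq_measure_def point_values_closed pull_fun_cont_int[OF f] dual_map_closed[OF S f] restrict_def)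
qed

section \<open>Descent for null measures\<close>

abbreviation push :: "'a topology => 'b topology => ('a => 'b) => (nat => ('a => int) => int) => nat => ('b => int) => int" where
 "push X Y f == push_measure Y (pull_fun X f)"

lemma push_closed: "continuous_map X Y f ==> v : null_measures X ==> push X Y f v : null_measures Y"
 by (rule push_measure_null[OF pull_fun_additive_maps])

lemma push_push:
 assumes "continuous_map X Y f" "continuous_map Y Z g"
 shows "push Y Z g (push X Y f v) = push X Z (%x. g (f x)) v"
 unfolding push_measure_compose[OF pull_fun_additive_maps[OF assms(2)]]
 using continuous_map_image_subset_topspace[OF assms(1)]
 by (intro push_measure_cong) (auto simp: pull_fun_def fun_eq_iff)

lemma push_cong: "(!!x. x : topspace X ==> f x = g x) ==> push X Y f v = push X Y g v"
 by (rule push_measure_cong) (auto simp: pull_fun_def)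

lemma push_id:
 assumes "v : null_measures X" "!!x. x : topspace X ==> f x = x"
 shows "push X X f v = v"
proof -
 have "push X X f v = push_measure X (%g. g) v"
  by (rule push_measure_cong) (auto simp: pull_fun_def assms(2) cont_int_outside fun_eq_iff)
 thus ?thesis by (simp add: push_measure_id[OF assms(1)])
qed

lemma push_measure_diff: "push_measure X Lambda (v - w) = push_measure X Lambda v - push_measure X Lambda w"
 by (simp add: push_measure_def fun_eq_iff)

section \<open>Disjoint sums and finite covers\<close>

lemma continuous_map_from_sum_topology:
 assumes "!!i. i : I ==> continuous_map (X i) Z (%x. f (i, x))"
 shows "continuous_map (sum_topology X I) Z f"
proof -
 have "openin (X i) {x. (i, x) : {z : topspace (sum_topology X I). f z : W}}" if "i : I" "openin Z W" for i W
  using openin_continuous_map_preimage[OF assms that(2), of i] that(1) by simp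
 thus ?thesis using assms by (auto simp: continuous_map openin_sum_topology image_subset_iff)
qed

definition component_fun :: "(nat => 'a topology) => nat => ('a => int) => nat \<times> 'a => int" where
 "component_fun T i g = (%(j, t). if j = i then g t else 0)"

lemma component_fun_additive_maps:
 assumes i: "i < n"
 shows "component_fun T i : additive_maps (T i) (sum_topology T {..<n})" unfolding additive_maps_def
proof safe
 show "additive_on (cont_int (T i)) (component_fun T i)" by (auto simp: additive_on_def component_fun_def)
 fix g assume g: "g : cont_int (T i)"
 show "component_fun T i g : cont_int (sum_topology T {..<n})"
 proof (rule cont_intI)
  show "locally_constant (sum_topology T {..<n}) (component_fun T i g)"
   using cont_int_continuous[OF g] by (intro continuous_map_from_sum_topology) (auto simp: component_fun_def)
  fix z assume "z ~: topspace (sum_topology T {..<n})"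
  thus "component_fun T i g z = 0"
   using i cont_int_outside[OF g] by (cases z) (auto simp: component_fun_def)
 qed
qed

text \<open>The projection to the \<open>i\<close>-th summand; its transpose extends a function on
  \<open>T i\<close> by zero to the disjoint sum.\<close>

definition component :: "(nat => 'a topology) => nat => (nat => (nat \<times> 'a => int) => int) => nat => ('a => int) => int" where
 "component T i = push_measure (T i) (component_fun T i)"

lemma component_closed: "i < n ==> v : null_measures (sum_topology T {..<n}) ==> component T i v : null_measures (T i)"
 unfolding component_def by (rule push_measure_null[OF component_fun_additive_maps])

lemma component_add: "component T i (v + w) = component T i v + component T i w"
 by (simp add: component_def push_measure_add)

lemma component_push:
 assumes "i < n" "j < n" and w: "w : null_measures (T j)"
 shows "component T i (push (T j) (sum_topology T {..<n}) (Pair j) w) = (if i = j then w else 0)"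
proof (intro ext)
 fix k g
 show "component T i (push (T j) (sum_topology T {..<n}) (Pair j) w) k g = (if i = j then w else 0) k g"
 proof (cases "g : cont_int (T i)")
  case True
  hence "component_fun T i g : cont_int (sum_topology T {..<n})"
   using component_fun_additive_maps[OF assms(1)] by (auto simp: additive_maps_def)
  moreover have "pull_fun (T j) (Pair j) (component_fun T i g) = (if i = j then g else 0)"
   using True by (auto simp: pull_fun_def component_fun_def cont_int_outside fun_eq_iff)
  moreover have "w k 0 = 0" by (rule additive_on_0[OF null_measures_additive[OF w]]) simp
  ultimately show ?thesis using True by (simp add: component_def push_measure_def)
 qed (use w in \<open>auto simp: component_def push_measure_def null_measures_outside\<close>)
qed

lemma component_sum:
 assumes v: "v : null_measures (sum_topology T {..<n})"
 shows "v = (\<Sum>i<n. push (T i) (sum_topology T {..<n}) (Pair i) (component T i v))"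
proof (intro ext)
 fix k g
 let ?Y = "sum_topology T {..<n}"
 show "v k g = (\<Sum>i<n. push (T i) ?Y (Pair i) (component T i v)) k g"
 proof (cases "g : cont_int ?Y")
  case True
  have c: "pull_fun (T i) (Pair i) g : cont_int (T i)" if "i < n" for i
   using that by (intro pull_fun_cont_int[OF _ True]) (simp add: continuous_map_component_injection)
  have "g = (\<Sum>i<n. component_fun T i (pull_fun (T i) (Pair i) g))"
  proof
   fix z
   show "g z = (\<Sum>i<n. component_fun T i (pull_fun (T i) (Pair i) g)) z"
   proof (cases z)
    case (Pair j t)
    have "(\<Sum>i<n. component_fun T i (pull_fun (T i) (Pair i) g)) z = (\<Sum>i<n. if i = j then pull_fun (T i) (Pair i) g t else 0)"
     unfolding sum_fun_apply by (intro sum.cong) (auto simp: Pair component_fun_def)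
    also have "... = (if j < n then pull_fun (T j) (Pair j) g t else 0)" by (simp add: sum.delta)
    also have "... = g z" using True by (auto simp: Pair pull_fun_def cont_int_outside)
    finally show ?thesis ..
   qed
  qed
  hence "v k g = v k (\<Sum>i<n. component_fun T i (pull_fun (T i) (Pair i) g))" by simp
  also have "... = (\<Sum>i<n. v k (component_fun T i (pull_fun (T i) (Pair i) g)))"
   using component_fun_additive_maps[of _ n T] c
   by (intro additive_on_sum[OF null_measures_additive[OF v]]) (simp_all add: additive_maps_def image_subset_iff)
  also have "... = (\<Sum>i<n. push (T i) ?Y (Pair i) (component T i v)) k g"
   using True c by (simp add: sum_fun_apply component_def push_measure_def)
  finally show ?thesis .
 qed (simp add: sum_fun_apply null_measures_outside[OF v] push_measure_def)
qed

text \<open>The analogue of \<open>covering\<close> for spaces on arbitrary types, needed because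
  the fibre product to be covered has pairs as points.\<close>

definition finite_cover :: "nat => (nat => 'a topology) => (nat => 'a => 'b) => 'b topology => bool" where
 "finite_cover n T f X \<longleftrightarrow> light_profinite X & (ALL i<n. light_profinite (T i) & continuous_map (T i) X (f i)) &
   topspace X <= (\<Union>i<n. f i ` topspace (T i))"

lemma finite_cover_surjection:
 assumes "finite_cover n T f X"
 shows "light_surjection (sum_topology T {..<n}) X (%(i, t). f i t)"
proof
 have c: "continuous_map (T i) X (f i)" "light_profinite (T i)" if "i < n" for i
  using assms that by (auto simp: finite_cover_def)
 show "light_profinite (sum_topology T {..<n})" by (rule light_profinite_sum_topology) (rule c)
 show "light_profinite X" using assms by (simp add: finite_cover_def)
 show "continuous_map (sum_topology T {..<n}) X (%(i, t). f i t)"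
  using c by (intro continuous_map_from_sum_topology) auto
 thus "(%(i, t). f i t) ` topspace (sum_topology T {..<n}) = topspace X"
  using assms continuous_map_image_subset_topspace by (force simp: finite_cover_def)
qed

lemma finite_cover_decompose:
 assumes cover: "finite_cover n T f X" and u: "u : null_measures X"
 obtains w where "!!i. i < n ==> w i : null_measures (T i)" "u = (\<Sum>i<n. push (T i) X (f i) (w i))"
proof -
 let ?Y = "sum_topology T {..<n}"
 interpret light_surjection ?Y X "%(i, t). f i t" by (rule finite_cover_surjection[OF cover])
 obtain v where v: "v : null_measures ?Y" "push ?Y X (%(i, t). f i t) v = u"
  by (rule null_measures_lift[OF u]) (rule that, assumption+)
 have "u = push ?Y X (%(i, t). f i t) (\<Sum>i<n. push (T i) ?Y (Pair i) (component T i v))"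
  using v(2) component_sum[OF v(1)] by simp
 also have "... = (\<Sum>i<n. push ?Y X (%(i, t). f i t) (push (T i) ?Y (Pair i) (component T i v)))"
  by (simp add: push_measure_def sum_fun_apply fun_eq_iff)
 also have "... = (\<Sum>i<n. push (T i) X (f i) (component T i v))"
  by (intro sum.cong refl) (simp add: push_push[OF continuous_map_component_injection f])
 finally show ?thesis using component_closed[OF _ v(1)] by (intro that[of "%i. component T i v"])
qed

text \<open>Matching families are tested on members of \<open>MStone\<close>, so the fibre product
  is replaced by a homeomorphic copy together with its two projections.\<close>

lemma cospan_cover:
 assumes T: "T : MStone" "T' : MStone" and S: "S : MStone" and f: "continuous_map T S f" "continuous_map T' S g"
 obtains U a b where "U : MStone" "continuous_map U T a" "continuous_map U T' b"
  "!!u. u : topspace U ==> f (a u) = g (b u)"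
  "!!p q. [|p : topspace T; q : topspace T'; f p = g q|] ==> EX u:topspace U. a u = p & b u = q"
proof -
 let ?P = "prod_topology T T'"
 let ?C = "{z : topspace ?P. f (fst z) = g (snd z)}"
 have "closedin ?P ?C"
 proof (rule closedin_equalizer[OF light_profinite_imp_Hausdorff[OF S[unfolded MStone_iff]]])
  show "continuous_map ?P S (%z. f (fst z))"
   using continuous_map_compose[OF continuous_map_fst f(1)] by (simp add: o_def)
  show "continuous_map ?P S (%z. g (snd z))"
   using continuous_map_compose[OF continuous_map_snd f(2)] by (simp add: o_def)
 qed
 hence "light_profinite (subtopology ?P ?C)"
  using T by (intro light_profinite_subtopology light_profinite_prod_topology) (simp_all add: MStone_iff)
 then obtain U e where U: "U : MStone" and e: "homeomorphic_map (subtopology ?P ?C) U e"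
  by (rule light_profinite_representative)
 obtain d where d: "homeomorphic_maps (subtopology ?P ?C) U e d" using e homeomorphic_map_maps by blast
 hence dU: "continuous_map U (subtopology ?P ?C) d" and eU: "continuous_map (subtopology ?P ?C) U e"
   and de: "!!z. z : topspace (subtopology ?P ?C) ==> d (e z) = z" by (simp_all add: homeomorphic_maps_def)
 have dc: "continuous_map U ?P d" "!!u. u : topspace U ==> d u : ?C"
  using dU by (auto simp: continuous_map_in_subtopology)
 show ?thesis
 proof (rule that[OF U])
  show "continuous_map U T (%u. fst (d u))" "continuous_map U T' (%u. snd (d u))"
   using continuous_map_compose[OF dc(1) continuous_map_fst] continuous_map_compose[OF dc(1) continuous_map_snd]
   by (simp_all add: o_def)
  show "f (fst (d u)) = g (snd (d u))" if "u : topspace U" for u using dc(2) that by blast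
  show "EX u:topspace U. fst (d u) = p & snd (d u) = q" if "p : topspace T" "q : topspace T'" "f p = g q" for p q
   using de[of "(p, q)"] continuous_map_image_subset_topspace[OF eU] that
   by (intro bexI[of _ "e (p, q)"]) (auto simp: image_subset_iff)
 qed
qed

section \<open>Homomorphisms out of null measures\<close>

locale matrix_module =
 fixes M :: "(matrix, 'u) lmodule"
 assumes left_module: "left_module matrix_ring M"

sublocale matrix_module \<subseteq> comm_group M by (rule left_module_comm_group[OF left_module])

definition additive_to :: "(matrix, 'u) lmodule => 'a topology => ((nat => ('a => int) => int) => 'u) => bool" where
 "additive_to M X phi \<longleftrightarrow> (ALL v:null_measures X. phi v : carrier M) &
   (ALL v:null_measures X. ALL w:null_measures X. phi (v + w) = phi v \<otimes>\<^bsub>M\<^esub> phi w)"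

abbreviation measure_homs :: "(matrix, 'u) lmodule => 'a topology => ((nat => ('a => int) => int) => 'u) set" where
 "measure_homs M X == module_homs matrix_ring (measure_module X) M"

context matrix_module
begin

lemma act_M_closed [simp]: "c : col_finite ==> x : carrier M ==> act M c x : carrier M"
 using left_module by (simp add: left_module_def)

lemma act_M_mult: "c : col_finite ==> x : carrier M ==> y : carrier M ==> act M c (x \<otimes>\<^bsub>M\<^esub> y) = act M c x \<otimes>\<^bsub>M\<^esub> act M c y"
 using left_module by (simp add: left_module_def)

lemma act_M_hom: "c : col_finite ==> group_hom M M (act M c)"
 using group_axioms by (simp add: group_hom_def group_hom_axioms_def hom_def act_M_mult)

lemma additive_to_closed: "additive_to M X phi ==> v : null_measures X ==> phi v : carrier M"
 and additive_to_add: "additive_to M X phi ==> v : null_measures X ==> w : null_measures X ==> phi (v + w) = phi v \<otimes>\<^bsub>M\<^esub> phi w"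
 by (simp_all add: additive_to_def)

lemma additive_to_zero:
 assumes "additive_to M X phi"
 shows "phi 0 = \<one>\<^bsub>M\<^esub>"
proof -
 have "0 : null_measures X" by (rule add_subgroup_0) simp
 hence "phi 0 : carrier M" "phi 0 = phi 0 \<otimes>\<^bsub>M\<^esub> phi 0"
  using assms add_0_right[of 0] unfolding additive_to_def by metis+
 thus ?thesis using r_cancel_one' by blast
qed

lemma additive_to_diff:
 assumes phi: "additive_to M X phi" and vw: "v : null_measures X" "w : null_measures X"
 shows "phi (v - w) = phi v \<otimes>\<^bsub>M\<^esub> inv\<^bsub>M\<^esub> phi w"
proof -
 have d: "v - w : null_measures X" by (rule add_subgroup_diff[OF _ vw]) simp
 hence c: "phi (v - w) : carrier M" "phi v : carrier M" "phi w : carrier M"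
  using phi vw by (auto simp: additive_to_def)
 have "phi (v - w + w) = phi (v - w) \<otimes>\<^bsub>M\<^esub> phi w"
  by (rule additive_to_add[OF phi d vw(2)])
 hence "phi v = phi (v - w) \<otimes>\<^bsub>M\<^esub> phi w" by (simp only: diff_add_cancel)
 thus ?thesis using c by (simp add: inv_solve_right)
qed

lemma additive_to_sum_eq:
 assumes phi: "additive_to M X phi" and psi: "additive_to M X psi"
  and w: "!!i. i < (n::nat) ==> w i : null_measures X" and eq: "!!i. i < n ==> phi (w i) = psi (w i)"
 shows "phi (\<Sum>i<n. w i) = psi (\<Sum>i<n. w i)" using w eq
proof (induction n)
 case 0
 show ?case by (simp only: lessThan_0 sum.empty additive_to_zero[OF phi] additive_to_zero[OF psi])
next
 case (Suc n)
 have "(\<Sum>i<n. w i) : null_measures X" using Suc.prems by (intro add_subgroup_sum) auto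
 thus ?case
  using Suc by (simp only: sum.lessThan_Suc additive_to_add[OF phi] additive_to_add[OF psi] less_Suc_eq simp_thms)
qed

lemma additive_to_push:
 "additive_to M Y phi ==> continuous_map X Y f ==> additive_to M X (%v. phi (push X Y f v))"
 by (simp add: additive_to_def push_closed push_measure_add)

text \<open>By \<open>finite_cover_decompose\<close> every null measure on \<open>X\<close> is a sum
  of pushforwards from the pieces of the cover.\<close>

lemma finite_cover_eqI:
 assumes cover: "finite_cover n T f X" and phi: "additive_to M X phi" and psi: "additive_to M X psi"
  and eq: "!!i w. i < n ==> w : null_measures (T i) ==> phi (push (T i) X (f i) w) = psi (push (T i) X (f i) w)"
  and u: "u : null_measures X"
 shows "phi u = psi u"
proof -
 obtain w where w: "!!i. i < n ==> w i : null_measures (T i)" "u = (\<Sum>i<n. push (T i) X (f i) (w i))"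
  by (rule finite_cover_decompose[OF cover u]) (rule that, assumption+)
 have "continuous_map (T i) X (f i)" if "i < n" for i using cover that by (simp add: finite_cover_def)
 thus ?thesis
  unfolding w(2) using w(1) eq by (intro additive_to_sum_eq[OF phi psi]) (auto intro: push_closed)
qed

lemma measure_homs_additive: "phi : measure_homs M X ==> additive_to M X phi"
 using module_homs_closed[of phi matrix_ring "measure_module X" M] module_homs_mult[of phi matrix_ring "measure_module X" M]
 by (simp add: additive_to_def)

lemma measure_homsI:
 assumes "additive_to M X phi" "!!c v. c : col_finite ==> v : null_measures X ==> phi (act (measure_module X) c v) = act M c (phi v)"
 shows "restrict phi (null_measures X) : measure_homs M X"
 using assms by (intro module_homsI) (simp_all add: additive_to_def act_measure_closed add_subgroup_add)

lemma measure_homs_act: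
 "phi : measure_homs M X ==> c : col_finite ==> v : null_measures X ==> phi (act (measure_module X) c v) = act M c (phi v)"
 using module_homs_act[of phi matrix_ring "measure_module X" M c v] by simp

lemma push_act:
 assumes "continuous_map X Y f" "c : col_finite" "v : null_measures X"
 shows "push X Y f (act (measure_module X) c v) = act (measure_module Y) c (push X Y f v)"
 using module_homs_act[OF push_measure_module_hom[OF pull_fun_additive_maps[OF assms(1)]], of c v] assms
 by (simp add: act_measure_closed)

text \<open>The difference \<open>v - w\<close> dies on \<open>S\<close>, hence by
  \<open>null_measures_kernel\<close> it is the difference of the two pushforwards of some
  \<open>omega\<close> on the fibre product of the disjoint sum with itself. That space is covered
  by the fibre products of pairs of pieces, and on each of them the matching condition identifies
  the two contributions.\<close>

lemma matching_descent:
 fixes T :: "nat => point topology" and n :: nat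
 assumes MS: "S : MStone" and MT: "!!i. i < n ==> T i : MStone & continuous_map (T i) S (f i)"
  and cover: "topspace S <= (\<Union>i<n. f i ` topspace (T i))"
  and x: "!!i. i < n ==> additive_to M (T i) (x i)"
  and match: "!!i j U g h w. [|i < n; j < n; U : MStone; continuous_map U (T i) g; continuous_map U (T j) h;
   !!p. p : topspace U ==> f i (g p) = f j (h p); w : null_measures U|] ==> x i (push U (T i) g w) = x j (push U (T j) h w)"
  and Psi: "additive_to M (sum_topology T {..<n}) Psi"
   "!!i w. i < n ==> w : null_measures (T i) ==> Psi (push (T i) (sum_topology T {..<n}) (Pair i) w) = x i w"
  and vw: "v : null_measures (sum_topology T {..<n})" "w : null_measures (sum_topology T {..<n})"
  and eq: "push (sum_topology T {..<n}) S (%(i, t). f i t) v = push (sum_topology T {..<n}) S (%(i, t). f i t) w"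
 shows "Psi v = Psi w"
proof -
 let ?Y = "sum_topology T {..<n}" and ?F = "%(i, t). f i t"
 let ?P = "fibre_product ?Y ?F"
 have fc: "finite_cover n T f S" using MS MT cover by (auto simp: finite_cover_def MStone_iff)
 interpret light_surjection ?Y S ?F by (rule finite_cover_surjection[OF fc])
 have d: "v - w : null_measures ?Y" "push ?Y S ?F (v - w) = 0"
  by (rule add_subgroup_diff[OF _ vw], simp, simp only: push_measure_diff eq diff_self)
 then obtain omega where omega: "omega : null_measures ?P" "v - w = push ?P ?Y fst omega - push ?P ?Y snd omega"
  by (rule null_measures_kernel)
 have inj: "continuous_map (T i) ?Y (Pair i)" if "i < n" for i
  using that by (simp add: continuous_map_component_injection)
 \<comment> \<open>A pair of pieces is numbered by \<open>k < n * n\<close> through division with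
   remainder by \<open>n\<close>.\<close>
 define i j where "i k = k div n" and "j k = k mod n" for k
 have ij: "i k < n" "j k < n" if "k < n * n" for k
  using that by (auto simp: i_def j_def less_mult_imp_div_less gr_implies_not0 intro!: mod_less_divisor gr0I)
 have "EX U a b. k < n * n --> U : MStone & continuous_map U (T (i k)) a & continuous_map U (T (j k)) b &
   (ALL u:topspace U. f (i k) (a u) = f (j k) (b u)) &
   (ALL p:topspace (T (i k)). ALL q:topspace (T (j k)). f (i k) p = f (j k) q --> (EX u:topspace U. a u = p & b u = q))" for k
 proof (cases "k < n * n")
  case True
  obtain U a b where "U : MStone" "continuous_map U (T (i k)) a" "continuous_map U (T (j k)) b"
    "!!u. u : topspace U ==> f (i k) (a u) = f (j k) (b u)"
    "!!p q. [|p : topspace (T (i k)); q : topspace (T (j k)); f (i k) p = f (j k) q|] ==> EX u:topspace U. a u = p & b u = q"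
   by (rule cospan_cover[of "T (i k)" "T (j k)" S "f (i k)" "f (j k)"]) (use MT ij[OF True] MS in auto)
  thus ?thesis by (intro exI[of _ U] exI[of _ a] exI[of _ b]) simp
 qed simp
 then obtain U a b where U: "!!k. k < n * n ==> U k : MStone & continuous_map (U k) (T (i k)) (a k) & continuous_map (U k) (T (j k)) (b k)"
   and ab: "!!k u. k < n * n ==> u : topspace (U k) ==> f (i k) (a k u) = f (j k) (b k u)"
   and onto: "!!k p q. [|k < n * n; p : topspace (T (i k)); q : topspace (T (j k)); f (i k) p = f (j k) q|] ==>
    EX u:topspace (U k). a k u = p & b k u = q"
  by metis
 define e where "e k u = ((i k, a k u), (j k, b k u))" for k u
 have e: "continuous_map (U k) ?P (e k)" if "k < n * n" for k
 proof -
  have "continuous_map (U k) ?Y (%u. (i k, a k u))" "continuous_map (U k) ?Y (%u. (j k, b k u))"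
   using continuous_map_compose[OF _ inj] U[OF that] ij[OF that] by (auto simp: o_def)
  hence "continuous_map (U k) (prod_topology ?Y ?Y) (e k)"
   unfolding e_def continuous_map_pairwise by (simp add: o_def)
  thus ?thesis using ab[OF that] by (auto simp: fibre_product_def continuous_map_in_subtopology e_def)
 qed
 have "finite_cover (n * n) U e ?P" unfolding finite_cover_def
 proof (intro conjI allI impI subsetI)
  fix z assume z: "z : topspace ?P"
  then obtain i' p j' q where z': "z = ((i', p), (j', q))" "i' < n" "j' < n" "p : topspace (T i')" "q : topspace (T j')" "f i' p = f j' q"
   by auto
  let ?k = "i' * n + j'"
  have "?k < (i' + 1) * n" using z'(3) by simp
  also have "... <= n * n" using z'(2) by (intro mult_le_mono1) simp
  finally have k: "?k < n * n" "i ?k = i'" "j ?k = j'" using z'(3) by (simp_all add: i_def j_def)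
  then obtain u where "u : topspace (U ?k)" "a ?k u = p" "b ?k u = q" using onto[OF k(1), of p q] z' by auto
  hence "z = e ?k u" by (simp add: e_def z'(1) k)
  thus "z : (\<Union>k<n * n. e k ` topspace (U k))" using k(1) `u : _` by blast
 qed (use U e light_fibre_product MStone_iff in blast)+
 hence "Psi (push ?P ?Y fst omega) = Psi (push ?P ?Y snd omega)"
 proof (rule finite_cover_eqI[where phi = "%omega. Psi (push ?P ?Y fst omega)" and psi = "%omega. Psi (push ?P ?Y snd omega)"])
  show "additive_to M ?P (%omega. Psi (push ?P ?Y fst omega))" "additive_to M ?P (%omega. Psi (push ?P ?Y snd omega))"
   by (rule additive_to_push[OF Psi(1) continuous_fst], rule additive_to_push[OF Psi(1) continuous_snd])
  show "omega : null_measures ?P" by (rule omega(1))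
  fix k w assume k: "k < n * n" and w: "w : null_measures (U k)"
  have push: "push ?P ?Y fst (push (U k) ?P (e k) w) = push (T (i k)) ?Y (Pair (i k)) (push (U k) (T (i k)) (a k) w)"
    "push ?P ?Y snd (push (U k) ?P (e k) w) = push (T (j k)) ?Y (Pair (j k)) (push (U k) (T (j k)) (b k) w)"
   using U[OF k] ij[OF k] by (simp_all add: push_push[OF e[OF k] continuous_fst] push_push[OF e[OF k] continuous_snd] push_push[OF _ inj] e_def)
  show "Psi (push ?P ?Y fst (push (U k) ?P (e k) w)) = Psi (push ?P ?Y snd (push (U k) ?P (e k) w))"
   unfolding push using match[of "i k" "j k" "U k" "a k" "b k" w] U[OF k] ij[OF k] ab[OF k] w
   by (simp add: Psi(2) push_closed)
 qed
 moreover have "Psi (push ?P ?Y fst omega - push ?P ?Y snd omega) = Psi (push ?P ?Y fst omega) \<otimes>\<^bsub>M\<^esub> inv\<^bsub>M\<^esub> Psi (push ?P ?Y snd omega)"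
  by (rule additive_to_diff[OF Psi(1) push_closed[OF continuous_fst omega(1)] push_closed[OF continuous_snd omega(1)]])
 ultimately have "Psi (v - w) = \<one>\<^bsub>M\<^esub>"
  using additive_to_closed[OF Psi(1) push_closed[OF continuous_snd omega(1)]] by (simp add: omega(2))
 thus ?thesis
  using additive_to_diff[OF Psi(1) vw] additive_to_closed[OF Psi(1) vw(1)] additive_to_closed[OF Psi(1) vw(2)]
   inv_solve_right[of "\<one>\<^bsub>M\<^esub>" "Psi v" "Psi w"] by simp
qed

text \<open>Null measures on a finite disjoint sum are the direct sum of those on the summands, so
  local homomorphisms combine to one on the sum.\<close>

lemma sum_of_components:
 assumes x: "!!i. i < n ==> x i : measure_homs M (T i)"
 defines "Psi == %v. finprod M (%i. x i (component T i v)) {..<n}"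
 shows "additive_to M (sum_topology T {..<n}) Psi"
  and "!!i w. i < n ==> w : null_measures (T i) ==> Psi (push (T i) (sum_topology T {..<n}) (Pair i) w) = x i w"
  and "!!c v. [|c : col_finite; v : null_measures (sum_topology T {..<n})|] ==>
   Psi (act (measure_module (sum_topology T {..<n})) c v) = act M c (Psi v)"
proof -
 let ?Y = "sum_topology T {..<n}"
 note add = measure_homs_additive[OF x]
 have cl: "(%i. x i (component T i v)) : {..<n} \<rightarrow> carrier M" if "v : null_measures ?Y" for v
  using additive_to_closed[OF add component_closed[OF _ that]] by auto
 show "additive_to M ?Y Psi" unfolding additive_to_def
 proof (intro conjI ballI)
  fix v assume v: "v : null_measures ?Y"
  show "Psi v : carrier M" unfolding Psi_def by (rule finprod_closed[OF cl[OF v]])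
  fix w assume w: "w : null_measures ?Y"
  have "Psi (v + w) = finprod M (%i. x i (component T i v) \<otimes>\<^bsub>M\<^esub> x i (component T i w)) {..<n}"
   unfolding Psi_def component_add
   using cl[OF v] cl[OF w] by (intro finprod_cong') (auto simp: additive_to_add[OF add component_closed[OF _ v] component_closed[OF _ w]] Pi_iff)
  also have "... = Psi v \<otimes>\<^bsub>M\<^esub> Psi w"
   unfolding Psi_def by (rule finprod_multf[OF cl[OF v] cl[OF w]])
  finally show "Psi (v + w) = Psi v \<otimes>\<^bsub>M\<^esub> Psi w" .
 qed
 show "Psi (push (T i) ?Y (Pair i) w) = x i w" if i: "i < n" and w: "w : null_measures (T i)" for i w
 proof -
  have "component T j (push (T i) ?Y (Pair i) w) = (if j = i then w else 0)" if "j < n" for j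
   by (rule component_push[where T = T, OF that i w])
  moreover have "x j 0 = \<one>\<^bsub>M\<^esub>" if "j < n" for j
   by (rule additive_to_zero[OF add[OF that]])
  ultimately have "Psi (push (T i) ?Y (Pair i) w) = finprod M (%j. if i = j then x i w else \<one>\<^bsub>M\<^esub>) {..<n}"
   unfolding Psi_def using additive_to_closed[OF add[OF i] w] by (intro finprod_cong') auto
  also have "... = x i w"
   using finprod_singleton[of i "{..<n}" "%j. x i w"] i additive_to_closed[OF add[OF i] w] by simp
  finally show ?thesis .
 qed
 fix c v assume c: "c : col_finite" and v: "v : null_measures ?Y"
 interpret c: group_hom M M "act M c" by (rule act_M_hom[OF c])
 have comp: "component T i (act (measure_module ?Y) c v) = act (measure_module (T i)) c (component T i v)" if i: "i < n" for i
 proof -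
  have "restrict (component T i) (null_measures ?Y) : module_homs matrix_ring (measure_module ?Y) (measure_module (T i))"
   unfolding component_def by (rule push_measure_module_hom[OF component_fun_additive_maps[OF i]])
  thus ?thesis
   using module_homs_act[of "restrict (component T i) (null_measures ?Y)" matrix_ring "measure_module ?Y" "measure_module (T i)" c v] c v
   by (simp add: act_measure_closed)
 qed
 have "finprod M (%i. x i (component T i (act (measure_module ?Y) c v))) {..<m} = act M c (finprod M (%i. x i (component T i v)) {..<m})" if "m <= n" for m
  using that
 proof (induction m)
  case (Suc m)
  have cl': "(%i. x i (component T i v)) : {..<m} \<rightarrow> carrier M" "(%i. x i (component T i (act (measure_module ?Y) c v))) : {..<m} \<rightarrow> carrier M"
    "x m (component T m v) : carrier M"
   using cl[OF v] cl[OF act_measure_closed[OF c v]] Suc.prems by (auto simp: Pi_iff)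
  have "x m (component T m (act (measure_module ?Y) c v)) = act M c (x m (component T m v))"
   using Suc.prems x[of m] c component_closed[OF _ v, of m] by (simp add: comp measure_homs_act)
  thus ?case using Suc cl' c by (simp add: lessThan_Suc finprod_insert act_M_mult finprod_closed)
 qed simp
 thus "Psi (act (measure_module ?Y) c v) = act M c (Psi v)" unfolding Psi_def by simp
qed

text \<open>The combined homomorphism on the disjoint sum factors through the pushforward to
  \<open>S\<close>: null measures on \<open>S\<close> are lifted arbitrarily, and
  \<open>matching_descent\<close> makes the value independent of the lift, hence additive and
  compatible with matrices.\<close>

theorem measure_homs_sheaf:
 fixes T :: "nat => point topology" and n :: nat
 assumes MS: "S : MStone" and MT: "!!i. i < n ==> T i : MStone & continuous_map (T i) S (f i)"
  and cover: "topspace S <= (\<Union>i<n. f i ` topspace (T i))"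
  and x: "!!i. i < n ==> x i : measure_homs M (T i)"
  and match: "!!i j U g h w. [|i < n; j < n; U : MStone; continuous_map U (T i) g; continuous_map U (T j) h;
   !!p. p : topspace U ==> f i (g p) = f j (h p); w : null_measures U|] ==> x i (push U (T i) g w) = x j (push U (T j) h w)"
 obtains s where "s : measure_homs M S" "!!i w. i < n ==> w : null_measures (T i) ==> s (push (T i) S (f i) w) = x i w"
proof -
 let ?Y = "sum_topology T {..<n}" and ?F = "%(i, t). f i t"
 define Psi where "Psi v = finprod M (%i. x i (component T i v)) {..<n}" for v
 have Psi: "additive_to M ?Y Psi"
   "!!i w. i < n ==> w : null_measures (T i) ==> Psi (push (T i) ?Y (Pair i) w) = x i w"
   "!!c v. [|c : col_finite; v : null_measures ?Y|] ==> Psi (act (measure_module ?Y) c v) = act M c (Psi v)"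
  using sum_of_components[of n x T, folded Psi_def] x by blast+
 have fc: "finite_cover n T f S" using MS MT cover by (auto simp: finite_cover_def MStone_iff)
 interpret light_surjection ?Y S ?F by (rule finite_cover_surjection[OF fc])
 define lift where "lift u = (SOME v. v : null_measures ?Y & push ?Y S ?F v = u)" for u
 have lift: "lift u : null_measures ?Y" "push ?Y S ?F (lift u) = u" if u: "u : null_measures S" for u
 proof -
  have "EX v. v : null_measures ?Y & push ?Y S ?F v = u" by (rule null_measures_lift[OF u]) blast
  from someI_ex[OF this] show "lift u : null_measures ?Y" "push ?Y S ?F (lift u) = u"
   by (simp_all add: lift_def)
 qed
 have eqI: "Psi (lift (push ?Y S ?F v)) = Psi v" if v: "v : null_measures ?Y" for v
  by (rule matching_descent[where T = T and f = f and n = n and x = x, OF MS MT cover measure_homs_additive[OF x] match Psi(1,2)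
     lift(1)[OF push_closed[OF f v]] v lift(2)[OF push_closed[OF f v]]])
 have sub: "u + w : null_measures ?Y" if "u : null_measures ?Y" "w : null_measures ?Y" for u w
  by (rule add_subgroup_add[OF _ that]) simp
 have "additive_to M S (%u. Psi (lift u))" unfolding additive_to_def
 proof (intro conjI ballI)
  fix u w assume u: "u : null_measures S" and w: "w : null_measures S"
  have "Psi (lift (push ?Y S ?F (lift u + lift w))) = Psi (lift u + lift w)"
   by (rule eqI[OF sub[OF lift(1)[OF u] lift(1)[OF w]]])
  thus "Psi (lift (u + w)) = Psi (lift u) \<otimes>\<^bsub>M\<^esub> Psi (lift w)"
   by (simp only: push_measure_add lift(2)[OF u] lift(2)[OF w] additive_to_add[OF Psi(1) lift(1)[OF u] lift(1)[OF w]])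
 qed (rule additive_to_closed[OF Psi(1) lift(1)])
 moreover have "Psi (lift (act (measure_module S) c u)) = act M c (Psi (lift u))" if c: "c : col_finite" and u: "u : null_measures S" for c u
  using eqI[OF act_measure_closed[OF c lift(1)[OF u]]] by (simp add: push_act[OF f c lift(1)[OF u]] lift(2)[OF u] Psi(3)[OF c lift(1)[OF u]])
 ultimately have s: "restrict (%u. Psi (lift u)) (null_measures S) : measure_homs M S"
  by (rule measure_homsI)
 show ?thesis
 proof (rule that[OF s])
  fix i w assume i: "i < n" and w: "w : null_measures (T i)"
  have inj: "continuous_map (T i) ?Y (Pair i)" using i by (simp add: continuous_map_component_injection)
  have "push (T i) S (f i) w = push ?Y S ?F (push (T i) ?Y (Pair i) w)" by (simp add: push_push[OF inj f])
  thus "restrict (%u. Psi (lift u)) (null_measures S) (push (T i) S (f i) w) = x i w"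
   using eqI[OF push_closed[OF inj w]] push_closed[OF _ w, of S "f i"] MT[OF i] Psi(2)[OF i w] by simp
 qed
qed

end

section \<open>The condensed group of a module\<close>

text \<open>Every section of \<open>cond code M\<close> arises in this way from a homomorphism out
  of null measures, unique by \<open>encode_eqD\<close>. Later arguments work with that homomorphism
  and return to sections through this map.\<close>

definition encode :: "((bidual_seq => 'u) => 'u) => point topology => ((nat => (point => int) => int) => 'u) => 'u" where
 "encode code S phi = code (\<lambda>s\<in>carrier (null_bidual S). phi (seq_measure S s))"

lemma carrier_cond: "Sec (cond code M) S = code ` module_homs matrix_ring (null_bidual S) M"
 by (simp add: cond_def transport_group_def condensed_homs_def module_hom_group_def)

lemma measure_seq_add: "measure_seq S (v + w) = measure_seq S v \<otimes>\<^bsub>null_bidual S\<^esub> measure_seq S w"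
 by (auto simp: measure_seq_def mult_null_bidual fun_eq_iff)

lemma measure_seq_act:
 assumes "compact_space S" "v : null_measures S"
 shows "measure_seq S (act (measure_module S) c v) = act (null_bidual S) c (measure_seq S v)"
 unfolding act_null_bidual[OF assms(1) measure_seq_closed[OF assms]]
 by (auto simp: measure_seq_def act_measure_module fun_eq_iff)

lemma encode_cong: "compact_space S ==> (!!v. v : null_measures S ==> phi v = psi v) ==> encode code S phi = encode code S psi"
 unfolding encode_def by (rule arg_cong[where f = code], rule restrict_ext) (simp add: seq_measure_closed)

locale coded_module = matrix_module M for M :: "(matrix, 'u) lmodule" +
 fixes code :: "(bidual_seq => 'u) => 'u"
 assumes inj_code: "inj code"
begin

abbreviation "C == cond code M"

lemma encode_aux:
 assumes S: "compact_space S" and phi: "phi : measure_homs M S"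
 shows "(\<lambda>s\<in>carrier (null_bidual S). phi (seq_measure S s)) : module_homs matrix_ring (null_bidual S) M"
proof (rule module_homsI)
 fix s t assume s: "s : carrier (null_bidual S)" and t: "t : carrier (null_bidual S)"
 note cl = seq_measure_closed[OF S s] seq_measure_closed[OF S t]
 show "(\<lambda>s\<in>carrier (null_bidual S). phi (seq_measure S s)) (s \<otimes>\<^bsub>null_bidual S\<^esub> t) =
   (\<lambda>s\<in>carrier (null_bidual S). phi (seq_measure S s)) s \<otimes>\<^bsub>M\<^esub> (\<lambda>s\<in>carrier (null_bidual S). phi (seq_measure S s)) t"
  using s t by (simp add: mult_null_bidual_closed[OF S] seq_measure_add additive_to_add[OF measure_homs_additive[OF phi] cl])
next
 fix c s assume c: "c : col_finite" and s: "s : carrier (null_bidual S)"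
 thus "(\<lambda>s\<in>carrier (null_bidual S). phi (seq_measure S s)) (act (null_bidual S) c s) =
   act M c ((\<lambda>s\<in>carrier (null_bidual S). phi (seq_measure S s)) s)"
  by (simp add: act_null_bidual_closed[OF S] seq_measure_act[OF S] measure_homs_act[OF phi] seq_measure_closed[OF S])
qed (use additive_to_closed[OF measure_homs_additive[OF phi]] seq_measure_closed[OF S] in auto)

lemma encode_closed: "compact_space S ==> phi : measure_homs M S ==> encode code S phi : Sec C S"
 unfolding carrier_cond encode_def by (rule imageI[OF encode_aux])

lemma encode_eqD:
 assumes S: "compact_space S" and eq: "encode code S phi = encode code S psi" and v: "v : null_measures S"
 shows "phi v = psi v"
proof -
 have "(\<lambda>s\<in>carrier (null_bidual S). phi (seq_measure S s)) = (\<lambda>s\<in>carrier (null_bidual S). psi (seq_measure S s))"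
  using eq inj_code by (simp add: encode_def inj_eq)
 from fun_cong[OF this, of "measure_seq S v"] show ?thesis
  using measure_seq_closed[OF S v] by (simp add: seq_measure_seq[OF v])
qed

lemma encode_exhaust:
 assumes S: "compact_space S" and x: "x : Sec C S"
 obtains phi where "phi : measure_homs M S" "x = encode code S phi"
proof -
 obtain h where h: "h : module_homs matrix_ring (null_bidual S) M" "x = code h"
  using x by (auto simp: carrier_cond)
 have "additive_to M S (%v. h (measure_seq S v))"
  using measure_seq_closed[OF S] module_homs_closed[OF h(1)] module_homs_mult[OF h(1)]
  by (simp add: additive_to_def measure_seq_add)
 moreover have "h (measure_seq S (act (measure_module S) c v)) = act M c (h (measure_seq S v))"
  if "c : col_finite" "v : null_measures S" for c v
  using that module_homs_act[OF h(1), of c "measure_seq S v"] by (simp add: measure_seq_act[OF S] measure_seq_closed[OF S])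
 ultimately have "restrict (%v. h (measure_seq S v)) (null_measures S) : measure_homs M S"
  by (rule measure_homsI)
 moreover have "h = (\<lambda>s\<in>carrier (null_bidual S). restrict (%v. h (measure_seq S v)) (null_measures S) (seq_measure S s))"
  using h(1) by (intro extensionalityI[of h "carrier (null_bidual S)"])
   (simp_all add: module_homs_def seq_measure_closed[OF S] measure_seq_measure[OF S])
 ultimately show ?thesis using that h(2) by (simp add: encode_def)
qed

lemma encode_mult:
 assumes S: "compact_space S" and phi: "phi : measure_homs M S" and psi: "psi : measure_homs M S"
 shows "encode code S phi \<cdot>[C,S] encode code S psi = encode code S (%v. phi v \<otimes>\<^bsub>M\<^esub> psi v)"
 using inj_code by (auto simp: cond_def transport_group_def condensed_homs_def module_hom_group_def encode_def
   intro!: arg_cong[where f = code] restrict_ext)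

lemma one_cond: "\<one>[C,S] = encode code S (%v. \<one>\<^bsub>M\<^esub>)"
 by (simp add: cond_def transport_group_def condensed_homs_def module_hom_group_def encode_def)

lemma pull_encode:
 assumes S: "S : MStone" and T: "T : MStone" and f: "continuous_map S T f" and phi: "phi : measure_homs M T"
 shows "pull C S T f (encode code T phi) = encode code S (%v. phi (push S T f v))"
proof -
 let ?f = "restrict f (topspace S)" and ?N = "%S. carrier (null_bidual S)"
 have f': "continuous_map S T ?f" by (rule continuous_map_eq[OF f]) simp
 have "compose (?N S) (\<lambda>s\<in>?N T. phi (seq_measure T s)) (null_sequences_map (bidual_free S) (bidual_free_map S T ?f))
   = (\<lambda>s\<in>?N S. phi (push S T f (seq_measure S s)))"
  unfolding compose_def
 proof (rule restrict_ext)
  fix s assume s: "s : ?N S"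
  have w: "push S T ?f (seq_measure S s) : null_measures T"
   by (rule push_closed[OF f' seq_measure_closed[OF MStone_compact[OF S] s]])
  have "push S T ?f (seq_measure S s) = push S T f (seq_measure S s)" by (rule push_cong) simp
  thus "(\<lambda>s\<in>?N T. phi (seq_measure T s)) (null_sequences_map (bidual_free S) (bidual_free_map S T ?f) s) = phi (push S T f (seq_measure S s))"
   using measure_seq_closed[OF MStone_compact[OF T] w] seq_measure_seq[OF w]
   by (simp add: bidual_map_seq[OF MStone_compact[OF S] f' s])
 qed
 thus ?thesis using encode_aux[OF MStone_compact[OF T] phi] inj_code
  by (simp add: pull_def cond_def transport_map_def condensed_homs_def module_hom_group_def encode_def)
qed

lemma measure_homs_mult:
 assumes phi: "phi : measure_homs M X" and psi: "psi : measure_homs M X"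
 shows "restrict (%v. phi v \<otimes>\<^bsub>M\<^esub> psi v) (null_measures X) : measure_homs M X"
proof (rule measure_homsI)
 note a = measure_homs_additive[OF phi] measure_homs_additive[OF psi]
 show "additive_to M X (%v. phi v \<otimes>\<^bsub>M\<^esub> psi v)"
  using a by (simp add: additive_to_def m_ac)
 show "phi (act (measure_module X) c v) \<otimes>\<^bsub>M\<^esub> psi (act (measure_module X) c v) = act M c (phi v \<otimes>\<^bsub>M\<^esub> psi v)"
  if "c : col_finite" "v : null_measures X" for c v
  using that a[THEN additive_to_closed] by (simp add: measure_homs_act[OF phi] measure_homs_act[OF psi] act_M_mult)
qed

lemma measure_homs_one: "restrict (%v. \<one>\<^bsub>M\<^esub>) (null_measures X) : measure_homs M X"
proof (rule measure_homsI)
 show "\<one>\<^bsub>M\<^esub> = act M c \<one>\<^bsub>M\<^esub>" if "c : col_finite" for c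
  using group_hom.hom_one[OF act_M_hom[OF that]] by simp
qed (simp add: additive_to_def)

lemma measure_homs_inv:
 assumes phi: "phi : measure_homs M X"
 shows "restrict (%v. inv\<^bsub>M\<^esub> phi v) (null_measures X) : measure_homs M X"
proof (rule measure_homsI)
 note a = measure_homs_additive[OF phi]
 show "additive_to M X (%v. inv\<^bsub>M\<^esub> phi v)" using a by (simp add: additive_to_def inv_mult)
 show "inv\<^bsub>M\<^esub> phi (act (measure_module X) c v) = act M c (inv\<^bsub>M\<^esub> phi v)"
  if "c : col_finite" "v : null_measures X" for c v
  using group_hom.hom_inv[OF act_M_hom[OF that(1)], of "phi v"] that additive_to_closed[OF a]
  by (simp add: measure_homs_act[OF phi])
qed

lemma measure_homs_push:
 assumes phi: "phi : measure_homs M Y" and Lambda: "Lambda : additive_maps Y X"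
 shows "restrict (%v. phi (push_measure Y Lambda v)) (null_measures X) : measure_homs M X"
proof (rule measure_homsI)
 note a = measure_homs_additive[OF phi]
 show "additive_to M X (%v. phi (push_measure Y Lambda v))"
  using a push_measure_null[OF Lambda] by (simp add: additive_to_def push_measure_add)
 show "phi (push_measure Y Lambda (act (measure_module X) c v)) = act M c (phi (push_measure Y Lambda v))"
  if "c : col_finite" "v : null_measures X" for c v
  using module_homs_act[OF push_measure_module_hom[OF Lambda], of c v] that
  by (simp add: act_measure_closed measure_homs_act[OF phi] push_measure_null[OF Lambda])
qed

lemma encode_restrict: "compact_space S ==> encode code S (restrict phi (null_measures S)) = encode code S phi"
 by (rule encode_cong) simp_all

lemma res_cond: "f : cmaps S T ==> res C S T f = pull C S T f" by (rule res_eq_pull)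

lemma comm_group_cond:
 assumes S: "S : MStone"
 shows "comm_group (sect C S)"
proof -
 have K: "compact_space S" by (rule MStone_compact[OF S])
 note ex = encode_exhaust[OF K]
 have mult: "encode code S phi \<cdot>[C,S] encode code S psi = encode code S (restrict (%v. phi v \<otimes>\<^bsub>M\<^esub> psi v) (null_measures S))"
  if "phi : measure_homs M S" "psi : measure_homs M S" for phi psi
  by (simp add: encode_mult[OF K that] encode_restrict[OF K])
 have one: "\<one>[C,S] = encode code S (restrict (%v. \<one>\<^bsub>M\<^esub>) (null_measures S))"
  by (simp add: one_cond encode_restrict[OF K])
 note cl = additive_to_closed[OF measure_homs_additive]
 show ?thesis
 proof (rule comm_groupI)
  fix x y assume "x : Sec C S" "y : Sec C S"
  then obtain phi psi where *: "phi : measure_homs M S" "x = encode code S phi" "psi : measure_homs M S" "y = encode code S psi"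
   by (elim ex)
  show "x \<cdot>[C,S] y : Sec C S"
   unfolding *(2,4) mult[OF *(1,3)] by (rule encode_closed[OF K measure_homs_mult[OF *(1,3)]])
  show "x \<cdot>[C,S] y = y \<cdot>[C,S] x"
   unfolding *(2,4) encode_mult[OF K *(1,3)] encode_mult[OF K *(3,1)]
   using cl[OF *(1)] cl[OF *(3)] by (intro encode_cong[OF K]) (simp add: m_comm)
  fix z assume "z : Sec C S"
  then obtain theta where **: "theta : measure_homs M S" "z = encode code S theta" by (elim ex)
  show "x \<cdot>[C,S] y \<cdot>[C,S] z = x \<cdot>[C,S] (y \<cdot>[C,S] z)"
   unfolding *(2,4) **(2) mult[OF *(1,3)] mult[OF *(3) **(1)]
    mult[OF measure_homs_mult[OF *(1,3)] **(1)] mult[OF *(1) measure_homs_mult[OF *(3) **(1)]]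
   using cl[OF *(1)] cl[OF *(3)] cl[OF **(1)] by (intro encode_cong[OF K]) (simp add: m_assoc)
 next
  show "\<one>[C,S] : Sec C S" unfolding one by (rule encode_closed[OF K measure_homs_one])
 next
  fix x assume "x : Sec C S"
  then obtain phi where *: "phi : measure_homs M S" "x = encode code S phi" by (elim ex)
  show "\<one>[C,S] \<cdot>[C,S] x = x" unfolding *(2) one mult[OF measure_homs_one *(1)]
   using cl[OF *(1)] by (intro encode_cong[OF K]) simp
  have "encode code S (restrict (%v. inv\<^bsub>M\<^esub> phi v) (null_measures S)) \<cdot>[C,S] x = \<one>[C,S]"
   unfolding *(2) one mult[OF measure_homs_inv[OF *(1)] *(1)]
   using cl[OF *(1)] by (intro encode_cong[OF K]) (simp add: l_inv)
  thus "EX y:Sec C S. y \<cdot>[C,S] x = \<one>[C,S]"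
   using encode_closed[OF K measure_homs_inv[OF *(1)]] by blast
 qed
qed

lemma measure_homs_push_map:
 "phi : measure_homs M Y ==> continuous_map X Y f ==> restrict (%v. phi (push X Y f v)) (null_measures X) : measure_homs M X"
 by (rule measure_homs_push[OF _ pull_fun_additive_maps])

lemma pull_encode':
 assumes "S : MStone" "T : MStone" "continuous_map S T f" "phi : measure_homs M T"
 shows "pull C S T f (encode code T phi) = encode code S (restrict (%v. phi (push S T f v)) (null_measures S))"
 using assms by (simp add: pull_encode encode_restrict MStone_compact)

lemma ab_presheaf_cond: "Defs.ab_presheaf C" unfolding Defs.ab_presheaf_def
proof (intro conjI ballI)
 fix S T f assume S: "S : MStone" and T: "T : MStone" and "f : cmaps S T"
 hence f: "continuous_map S T f" "res C S T f = pull C S T f" by (auto dest: cmapsD simp: res_cond)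
 note KS = MStone_compact[OF S] and KT = MStone_compact[OF T]
 show "res C S T f : hom (sect C T) (sect C S)" unfolding f(2)
 proof (rule homI)
  fix x y assume "x : Sec C T" "y : Sec C T"
  then obtain phi psi where *: "phi : measure_homs M T" "x = encode code T phi" "psi : measure_homs M T" "y = encode code T psi"
   by (elim encode_exhaust[OF KT])
  show "pull C S T f x : Sec C S"
   unfolding *(2) pull_encode'[OF S T f(1) *(1)] by (rule encode_closed[OF KS measure_homs_push_map[OF *(1) f(1)]])
  have "x \<cdot>[C,T] y = encode code T (restrict (%v. phi v \<otimes>\<^bsub>M\<^esub> psi v) (null_measures T))"
   by (simp add: * encode_mult[OF KT *(1,3)] encode_restrict[OF KT])
  thus "pull C S T f (x \<cdot>[C,T] y) = pull C S T f x \<cdot>[C,S] pull C S T f y"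
   unfolding *(2,4) pull_encode'[OF S T f(1) *(1)] pull_encode'[OF S T f(1) *(3)]
    encode_mult[OF KS measure_homs_push_map[OF *(1) f(1)] measure_homs_push_map[OF *(3) f(1)]]
   by (simp only: pull_encode[OF S T f(1) measure_homs_mult[OF *(1,3)]])
    (rule encode_cong[OF KS], simp add: push_closed[OF f(1)])
 qed
next
 fix S x assume S: "S : MStone" and "x : Sec C S"
 then obtain phi where *: "phi : measure_homs M S" "x = encode code S phi"
  by (elim encode_exhaust[OF MStone_compact])
 have id: "continuous_map S S (\<lambda>p\<in>topspace S. p)"
  by (rule continuous_map_eq[OF continuous_map_id]) simp
 hence "(\<lambda>p\<in>topspace S. p) : cmaps S S" by (simp add: cmaps_def)
 thus "res C S S (\<lambda>p\<in>topspace S. p) x = x"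
  by (simp add: *(2) res_cond pull_encode[OF S S id *(1)]) (rule encode_cong[OF MStone_compact[OF S]], simp add: push_id)
next
 fix S T U f g x
 assume S: "S : MStone" and T: "T : MStone" and U: "U : MStone" and fg: "f : cmaps S T" "g : cmaps T U" and "x : Sec C U"
 then obtain phi where *: "phi : measure_homs M U" "x = encode code U phi"
  using encode_exhaust[OF MStone_compact[OF U]] by blast
 note f = cmapsD(1)[OF fg(1)] and g = cmapsD(1)[OF fg(2)]
 have c: "continuous_map S U (compose (topspace S) g f)"
  by (rule continuous_map_eq[OF continuous_map_compose[OF f g]]) (simp add: compose_def)
 hence "compose (topspace S) g f : cmaps S U" by (simp add: cmaps_def compose_def)
 hence "res C S U (compose (topspace S) g f) x = encode code S (%v. phi (push S U (compose (topspace S) g f) v))"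
  by (simp add: *(2) res_cond pull_encode[OF S U c *(1)])
 also have "... = encode code S (%v. restrict (%v. phi (push T U g v)) (null_measures T) (push S T f v))"
 proof (rule encode_cong[OF MStone_compact[OF S]])
  fix v assume v: "v : null_measures S"
  have "push S U (compose (topspace S) g f) v = push S U (%p. g (f p)) v"
   by (rule push_cong) (simp add: compose_def)
  thus "phi (push S U (compose (topspace S) g f) v) = restrict (%v. phi (push T U g v)) (null_measures T) (push S T f v)"
   using push_closed[OF f v] by (simp add: push_push[OF f g])
 qed
 also have "... = res C S T f (res C T U g x)"
  by (simp add: *(2) res_cond fg pull_encode'[OF T U g *(1)] pull_encode[OF S T f measure_homs_push_map[OF *(1) g]])
 finally show "res C S U (compose (topspace S) g f) x = res C S T f (res C T U g x)" .
qed (rule comm_group_cond)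

text \<open>Existence of a glued section is \<open>measure_homs_sheaf\<close>, uniqueness is
  \<open>finite_cover_eqI\<close>.\<close>

theorem light_condensed_cond: "light_condensed C" unfolding light_condensed_def
proof (intro conjI ballI allI impI)
 show "Defs.ab_presheaf C" by (rule ab_presheaf_cond)
 fix S n T f x assume S: "S : MStone" and cov: "covering n T f S" and mf: "matching_family C n T f x"
 have T: "!!i. i < n ==> T i : MStone & continuous_map (T i) S (f i)" and cover: "topspace S <= (\<Union>i<n. f i ` topspace (T i))"
   and res: "!!i. i < n ==> res C (T i) S (f i) = pull C (T i) S (f i)"
  using cov by (auto simp: covering_def res_cond dest: cmapsD)
 have "EX phi. i < n --> phi : measure_homs M (T i) & x i = encode code (T i) phi" for i
  using mf encode_exhaust[OF MStone_compact, of "T i" "x i"] T[of i] unfolding matching_family_def by metis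
 then obtain phi where phi: "!!i. i < n ==> phi i : measure_homs M (T i)" "!!i. i < n ==> x i = encode code (T i) (phi i)"
  by metis
 have match: "phi i (push U (T i) g w) = phi j (push U (T j) h w)"
  if i: "i < n" and j: "j < n" and U: "U : MStone" and g: "continuous_map U (T i) g" and h: "continuous_map U (T j) h"
   and eq: "!!p. p : topspace U ==> f i (g p) = f j (h p)" and w: "w : null_measures U" for i j U g h w
 proof -
  have "pull C U (T i) g (x i) = pull C U (T j) h (x j)"
   unfolding pull_def by (rule mf[unfolded matching_family_def, THEN conjunct2, rule_format, OF i j U restrict_cmaps[OF g] restrict_cmaps[OF h]]) (simp add: eq)
  hence "encode code U (%v. phi i (push U (T i) g v)) = encode code U (%v. phi j (push U (T j) h v))"
   using T[OF i] T[OF j] by (simp add: phi(2)[OF i] phi(2)[OF j] pull_encode[OF U _ g phi(1)[OF i]] pull_encode[OF U _ h phi(1)[OF j]])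
  from encode_eqD[OF MStone_compact[OF U] this w] show ?thesis .
 qed
 have "EX s:measure_homs M S. ALL i<n. ALL w:null_measures (T i). s (push (T i) S (f i) w) = phi i w"
 proof (rule measure_homs_sheaf[where T = T and x = phi and f = f and n = n, OF S T cover phi(1)])
  show "phi i (push U (T i) g w) = phi j (push U (T j) h w)"
   if "i < n" "j < n" "U : MStone" "continuous_map U (T i) g" "continuous_map U (T j) h"
    "!!p. p : topspace U ==> f i (g p) = f j (h p)" "w : null_measures U" for i j U g h w
   by (rule match[OF that])
 qed blast+
 then obtain s where s: "s : measure_homs M S" "!!i w. i < n ==> w : null_measures (T i) ==> s (push (T i) S (f i) w) = phi i w"
  by blast
 show "EX! s. s : Sec C S & (ALL i<n. res C (T i) S (f i) s = x i)"
 proof (intro ex1I conjI allI impI)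
  show "encode code S s : Sec C S" by (rule encode_closed[OF MStone_compact[OF S] s(1)])
  show "res C (T i) S (f i) (encode code S s) = x i" if i: "i < n" for i
   using T[OF i] s i by (simp add: res[OF i] pull_encode[OF _ S _ s(1)] phi(2)[OF i]) (rule encode_cong, auto intro: MStone_compact)
  fix t assume t: "t : Sec C S & (ALL i<n. res C (T i) S (f i) t = x i)"
  then obtain psi where psi: "psi : measure_homs M S" "t = encode code S psi"
   using encode_exhaust[OF MStone_compact[OF S]] by blast
  have "psi (push (T i) S (f i) w) = s (push (T i) S (f i) w)" if i: "i < n" and w: "w : null_measures (T i)" for i w
  proof -
   have "encode code (T i) (%v. psi (push (T i) S (f i) v)) = encode code (T i) (phi i)"
    using t T[OF i] i by (simp add: res[OF i, symmetric] psi(2) phi(2)[OF i, symmetric] pull_encode[OF _ S _ psi(1), symmetric])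
   from encode_eqD[OF MStone_compact this w] show ?thesis using T[OF i] s(2)[OF i w] by simp
  qed
  moreover have "finite_cover n T f S" using S T cover by (auto simp: finite_cover_def MStone_iff)
  ultimately have "psi u = s u" if "u : null_measures S" for u
   using finite_cover_eqI[OF _ measure_homs_additive[OF psi(1)] measure_homs_additive[OF s(1)] _ that] by blast
  thus "t = encode code S s" unfolding psi(2) by (rule encode_cong[OF MStone_compact[OF S]])
 qed
qed

end

section \<open>Solidity of the condensed group of a module\<close>

text \<open>The summation operator on functions over \<open>times_Nbar S\<close>, normalised by
  subtracting the value at infinity. For continuous functions it is a finite sum, because they are
  eventually constant along \<open>Nbar\<close>.\<close>

definition tail_sum :: "(point => int) => point => nat => int" where
 "tail_sum F p n = (\<Sum>m | n <= m & F (pair_point (p, Some m)) ~= F (pair_point (p, None)).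
   F (pair_point (p, Some m)) - F (pair_point (p, None)))"

text \<open>The inner map is the identity on pairs; \<open>pull_fun\<close> only forces the value 0
  off the space.\<close>

definition tail_fun :: "point topology => (point => int) => point => int" where
 "tail_fun S F = pull_fun (times_Nbar S) (on_pairs (%p a. pair_point (p, a))) (on_pairs (%p a. case a of None => 0 | Some n => tail_sum F p n))"

lemma tail_fun_apply:
 "p : topspace S ==> tail_fun S F (pair_point (p, None)) = 0"
 "p : topspace S ==> tail_fun S F (pair_point (p, Some n)) = tail_sum F p n"
 by (simp_all add: tail_fun_def pull_fun_def)

lemma tail_fun_outside: "q ~: topspace (times_Nbar S) ==> tail_fun S F q = 0"
 by (simp add: tail_fun_def pull_fun_def)

text \<open>The locus where \<open>F\<close> differs from its value at infinity is clopen and avoids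
  infinity, so compactness bounds it uniformly in \<open>p\<close>.\<close>

lemma cont_int_Nbar_bound:
 assumes S: "compact_space S" and F: "F : cont_int (times_Nbar S)"
 obtains N where "!!p m. p : topspace S ==> m >= N ==> F (pair_point (p, Some m)) = F (pair_point (p, None))"
proof -
 let ?P = "%p a. F (pair_point (p, a)) ~= F (pair_point (p, None))"
 have inf: "continuous_map (prod_topology S Nbar) (times_Nbar S) (%z. pair_point (fst z, None))"
  by (intro continuous_map_pair_pointI continuous_map_fst) simp
 have "locally_constant (prod_topology S Nbar) (%z. F (pair_point z))"
   "locally_constant (prod_topology S Nbar) (%z. F (pair_point (fst z, None)))"
  using continuous_map_compose[OF continuous_map_pair_point cont_int_continuous[OF F]]
   continuous_map_compose[OF inf cont_int_continuous[OF F]] by (simp_all add: o_def)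
 hence "locally_constant (prod_topology S Nbar) (%z. F (pair_point z) ~= F (pair_point (fst z, None)))"
  by (rule continuous_map_discrete_binop)
 from this[unfolded continuous_map_discrete_iff, rule_format, of True]
 have W: "clopenin (prod_topology S Nbar) {z : topspace (prod_topology S Nbar). ?P (fst z) (snd z)}" by simp
 obtain N where N: "!!p m. p : topspace S ==> ?P p (Some m) ==> m < N"
  using clopenin_prod_Nbar_bounded[OF S W] by blast
 thus ?thesis using that[of N] not_le by metis
qed

lemma tail_sum_bound:
 assumes "!!m. m >= N ==> F (pair_point (p, Some m)) = F (pair_point (p, None))"
 shows "tail_sum F p n = (\<Sum>m\<in>{n..<N}. F (pair_point (p, Some m)) - F (pair_point (p, None)))"
 unfolding tail_sum_def using assms by (intro sum.mono_neutral_left) (auto simp: not_le[symmetric])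

lemma tail_fun_cont_int:
 assumes S: "compact_space S" and F: "F : cont_int (times_Nbar S)"
 shows "tail_fun S F : cont_int (times_Nbar S)"
proof (rule cont_intI)
 obtain N where N: "!!p m. p : topspace S ==> m >= N ==> F (pair_point (p, Some m)) = F (pair_point (p, None))"
  using cont_int_Nbar_bound[OF S F] by blast
 let ?k = "%p a. case a of None => 0 | Some n => \<Sum>m\<in>{n..<N}. F (pair_point (p, Some m)) - F (pair_point (p, None))"
 have at: "locally_constant S (%p. F (pair_point (p, a)))" for a
  using continuous_map_compose[OF continuous_map_at cont_int_continuous[OF F]] by (simp add: o_def)
 have slice: "locally_constant S (%p. ?k p (Some n))" for n
  by (simp, intro continuous_map_discrete_sum continuous_map_discrete_binop[where F = "(-)"] at)
 have c: "locally_constant (times_Nbar S) (on_pairs ?k)"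
  by (rule continuous_map_on_pairs_discrete[where N = N and k = ?k]) (use slice in simp_all)
 have "on_pairs ?k q = tail_fun S F q" if "q : topspace (times_Nbar S)" for q
  using that N by (auto simp: tail_fun_apply tail_sum_bound[of N] split: option.split)
 thus "locally_constant (times_Nbar S) (tail_fun S F)" by (rule continuous_map_eq[OF c])
qed (rule tail_fun_outside)

lemma times_Nbar_ext:
 assumes "F : cont_int (times_Nbar S)" "G : cont_int (times_Nbar S)"
  and "!!p. p : topspace S ==> F (pair_point (p, None)) = G (pair_point (p, None))"
  and "!!p n. p : topspace S ==> F (pair_point (p, Some n)) = G (pair_point (p, Some n))"
 shows "F = G"
proof
 fix q
 show "F q = G q"
 proof (cases "q : topspace (times_Nbar S)")
  case True
  then obtain p a where "p : topspace S" "q = pair_point (p, a)" by auto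
  thus ?thesis using assms(3,4) by (cases a) auto
 qed (simp add: cont_int_outside[OF assms(1)] cont_int_outside[OF assms(2)])
qed

lemma tail_fun_additive_maps:
 assumes S: "compact_space S"
 shows "tail_fun S : additive_maps (times_Nbar S) (times_Nbar S)" unfolding additive_maps_def additive_on_def
proof (intro CollectI conjI ballI image_subsetI)
 fix F G assume F: "F : cont_int (times_Nbar S)" and G: "G : cont_int (times_Nbar S)"
 hence FG: "F + G : cont_int (times_Nbar S)" by (intro add_subgroup_add) simp_all
 show "tail_fun S (F + G) = tail_fun S F + tail_fun S G"
 proof (rule times_Nbar_ext)
  show "tail_fun S F + tail_fun S G : cont_int (times_Nbar S)"
   by (rule add_subgroup_add[OF _ tail_fun_cont_int[OF S F] tail_fun_cont_int[OF S G]]) simp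
  fix p n assume p: "p : topspace S"
  show "tail_fun S (F + G) (pair_point (p, None)) = (tail_fun S F + tail_fun S G) (pair_point (p, None))"
   using p by (simp add: tail_fun_apply)
  obtain N1 N2 where "!!m. m >= N1 ==> F (pair_point (p, Some m)) = F (pair_point (p, None))"
    "!!m. m >= N2 ==> G (pair_point (p, Some m)) = G (pair_point (p, None))"
   using cont_int_Nbar_bound[OF S F] cont_int_Nbar_bound[OF S G] p by metis
  thus "tail_fun S (F + G) (pair_point (p, Some n)) = (tail_fun S F + tail_fun S G) (pair_point (p, Some n))"
   using p by (simp add: tail_fun_apply tail_sum_bound[of "max N1 N2"] sum.distrib[symmetric] algebra_simps)
 qed (rule tail_fun_cont_int[OF S FG])
qed (rule tail_fun_cont_int[OF S])

text \<open>With J = \<open>tail_fun S\<close>, the identities read (1 - sig) J = 1 - c and J (1 -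
  sig) = 1 - c, where \<open>c\<close> replaces a function by its values at infinity. Thus J inverts
  1 - sig up to a correction that null sections do not see.\<close>

lemma tail_fun_shift:
 assumes S: "compact_space S" and F: "F : cont_int (times_Nbar S)"
 defines "sig == pull_fun (times_Nbar S) shift_map"
  and "c == pull_fun (times_Nbar S) (on_pairs (%p a. p)) (pull_fun S (at_inf) F)"
 shows "tail_fun S F = sig (tail_fun S F) + F - c" "tail_fun S F = tail_fun S (sig F) + F - c"
proof -
 let ?X = "times_Nbar S"
 have sig: "sig G : cont_int ?X" if "G : cont_int ?X" for G
  unfolding sig_def by (rule pull_fun_cont_int[OF continuous_map_shift_map that])
 have "continuous_map ?X S (on_pairs (%p a. p))" by (intro continuous_map_on_pairs) (rule continuous_map_fst)
 hence c: "c : cont_int ?X"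
  unfolding c_def by (rule pull_fun_cont_int[OF _ pull_fun_cont_int[OF continuous_map_at F]])
 have sig_apply: "sig G (pair_point (p, None)) = G (pair_point (p, None))" "sig G (pair_point (p, Some n)) = G (pair_point (p, Some (Suc n)))"
  if "p : topspace S" for p n G using that by (simp_all add: sig_def pull_fun_def)
 have c_apply: "c (pair_point (p, a)) = F (pair_point (p, None))" if "p : topspace S" for p a
  using that by (simp add: c_def pull_fun_def)
 have closed: "G + F - c : cont_int ?X" if "G : cont_int ?X" for G
  using that F c by (intro add_subgroup_add add_subgroup_diff) simp_all
 note J = tail_fun_cont_int[OF S]
 obtain N where N: "!!p m. p : topspace S ==> m >= N ==> F (pair_point (p, Some m)) = F (pair_point (p, None))"
  using cont_int_Nbar_bound[OF S F] by blast
 have step: "tail_sum F p n = tail_sum F p (Suc n) + F (pair_point (p, Some n)) - F (pair_point (p, None))" if p: "p : topspace S" for p n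
  using N[OF p] by (cases "n < N") (simp_all add: tail_sum_bound[of N] sum.atLeast_Suc_lessThan)
 show "tail_fun S F = sig (tail_fun S F) + F - c"
 proof (rule times_Nbar_ext[OF J[OF F] closed[OF sig[OF J[OF F]]]])
  fix p n assume p: "p : topspace S"
  show "tail_fun S F (pair_point (p, None)) = (sig (tail_fun S F) + F - c) (pair_point (p, None))"
   by (simp add: tail_fun_apply sig_apply c_apply p)
  show "tail_fun S F (pair_point (p, Some n)) = (sig (tail_fun S F) + F - c) (pair_point (p, Some n))"
   using step[OF p, of n] by (simp add: tail_fun_apply sig_apply c_apply p)
 qed
 have "tail_sum (sig F) p n = tail_sum F p (Suc n)" if p: "p : topspace S" for p n
 proof -
  have "tail_sum (sig F) p n = (\<Sum>m\<in>{n..<N}. F (pair_point (p, Some (Suc m))) - F (pair_point (p, None)))"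
   using N[OF p] p by (subst tail_sum_bound[of N]) (simp_all add: sig_apply)
  also have "... = (\<Sum>m\<in>{Suc n..<Suc N}. F (pair_point (p, Some m)) - F (pair_point (p, None)))"
   by (rule sum.shift_bounds_Suc_ivl[symmetric])
  also have "... = tail_sum F p (Suc n)" using N[OF p] by (subst tail_sum_bound[of "Suc N"]) simp_all
  finally show ?thesis .
 qed
 note shift = this
 show "tail_fun S F = tail_fun S (sig F) + F - c"
 proof (rule times_Nbar_ext[OF J[OF F] closed[OF J[OF sig[OF F]]]])
  fix p n assume p: "p : topspace S"
  show "tail_fun S F (pair_point (p, None)) = (tail_fun S (sig F) + F - c) (pair_point (p, None))"
   by (simp add: tail_fun_apply c_apply p)
  show "tail_fun S F (pair_point (p, Some n)) = (tail_fun S (sig F) + F - c) (pair_point (p, Some n))"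
   using step[OF p, of n] by (simp add: tail_fun_apply shift c_apply p)
 qed
qed

abbreviation tail_measure :: "point topology => (nat => (point => int) => int) => nat => (point => int) => int" where
 "tail_measure S == push_measure (times_Nbar S) (tail_fun S)"

text \<open>The transposed identities. Transposition reverses composites, so the shift applied after
  \<open>tail_fun\<close> becomes the pushforward taken before \<open>tail_measure\<close>.\<close>

lemma tail_measure_shift:
 assumes S: "compact_space S" and v: "v : null_measures (times_Nbar S)"
 defines "s == push (times_Nbar S) (times_Nbar S) shift_map"
  and "c == push S (times_Nbar S) (at_inf) (push (times_Nbar S) S (on_pairs (%p a. p)) v)"
 shows "tail_measure S v = tail_measure S (s v) + v - c" "tail_measure S v = s (tail_measure S v) + v - c"
proof -
 let ?X = "times_Nbar S"
 let ?sig = "pull_fun ?X shift_map" and ?c = "%F. pull_fun (times_Nbar S) (on_pairs (%p a. p)) (pull_fun S (at_inf) F)"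
 have sig: "?sig G : cont_int ?X" if "G : cont_int ?X" for G
  by (rule pull_fun_cont_int[OF continuous_map_shift_map that])
 have \<pi>: "continuous_map ?X S (on_pairs (%p a. p))"
  by (intro continuous_map_on_pairs) (rule continuous_map_fst)
 have i: "pull_fun S (at_inf) G : cont_int S" if "G : cont_int ?X" for G
  by (rule pull_fun_cont_int[OF continuous_map_at that])
 note J = tail_fun_cont_int[OF S]
 have v3: "v n (F + G - H) = v n F + v n G - v n H" if "F : cont_int ?X" "G : cont_int ?X" "H : cont_int ?X" for n F G H
  using that additive_on_diff[OF null_measures_additive[OF v], of "F + G" H n] additive_on_add[OF null_measures_additive[OF v], of F G n]
  by (simp add: add_subgroup_add)
 have *: "v n (tail_fun S F) = v n (?sig (tail_fun S F)) + v n F - v n (?c F)"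
   "v n (tail_fun S F) = v n (tail_fun S (?sig F)) + v n F - v n (?c F)" if F: "F : cont_int ?X" for n F
  by (rule v3[OF sig[OF J[OF F]] F pull_fun_cont_int[OF \<pi> i[OF F]], folded tail_fun_shift(1)[OF S F]],
   rule v3[OF J[OF sig[OF F]] F pull_fun_cont_int[OF \<pi> i[OF F]], folded tail_fun_shift(2)[OF S F]])
 show "tail_measure S v = tail_measure S (s v) + v - c" "tail_measure S v = s (tail_measure S v) + v - c"
 proof (safe intro!: ext)
  fix n F
  show "tail_measure S v n F = (tail_measure S (s v) + v - c) n F" "tail_measure S v n F = (s (tail_measure S v) + v - c) n F"
  proof (atomize (full), cases "F : cont_int ?X")
   case True
   thus "tail_measure S v n F = (tail_measure S (s v) + v - c) n F & tail_measure S v n F = (s (tail_measure S v) + v - c) n F"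
    using *(1)[OF True, of n] *(2)[OF True, of n] J[OF True] sig[OF True] sig[OF J[OF True]] J[OF sig[OF True]] i[OF True]
    by (simp add: push_measure_def s_def c_def)
  qed (simp add: push_measure_def s_def c_def null_measures_outside[OF v])
 qed
qed

context coded_module
begin

sublocale C: ab_presheaf C by unfold_locales (rule ab_presheaf_cond)

lemma encode_null:
 assumes S: "S : MStone" and phi: "phi : measure_homs M (times_Nbar S)"
 shows "encode code (times_Nbar S) phi : null C S \<longleftrightarrow> (ALL v:null_measures S. phi (push S (times_Nbar S) (at_inf) v) = \<one>\<^bsub>M\<^esub>)"
proof -
 have "encode code S (%v. phi (push S (times_Nbar S) (at_inf) v)) = encode code S (%v. \<one>\<^bsub>M\<^esub>) \<longleftrightarrow>
   (ALL v:null_measures S. phi (push S (times_Nbar S) (at_inf) v) = \<one>\<^bsub>M\<^esub>)"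
  by (intro iffI ballI, erule (1) encode_eqD[OF MStone_compact[OF S]], rule encode_cong[OF MStone_compact[OF S]], erule (1) bspec)
 thus ?thesis unfolding null_iff one_cond pull_encode[OF S times_Nbar_MStone[OF S] continuous_map_at phi]
  using encode_closed[OF MStone_compact[OF times_Nbar_MStone[OF S]] phi] by blast
qed

lemma null_exhaust:
 assumes S: "S : MStone" and x: "x : null C S"
 obtains phi where "phi : measure_homs M (times_Nbar S)" "x = encode code (times_Nbar S) phi"
  "!!v. v : null_measures S ==> phi (push S (times_Nbar S) (at_inf) v) = \<one>\<^bsub>M\<^esub>"
 using encode_exhaust[OF MStone_compact[OF times_Nbar_MStone[OF S]] C.null_carrier[OF x]] encode_null[OF S] x by metis

lemma mult_shift_encode:
 assumes S: "S : MStone" and phi: "phi : measure_homs M (times_Nbar S)" and zeta: "zeta : measure_homs M (times_Nbar S)"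
  and null: "encode code (times_Nbar S) zeta : null C S"
 shows "encode code (times_Nbar S) phi \<cdot>[C,times_Nbar S] shift C S (encode code (times_Nbar S) zeta)
  = encode code (times_Nbar S) (%v. phi v \<otimes>\<^bsub>M\<^esub> zeta (push (times_Nbar S) (times_Nbar S) shift_map v))"
proof -
 let ?X = "times_Nbar S"
 have X: "?X : MStone" "compact_space ?X" using S by (simp_all add: MStone_compact)
 show ?thesis unfolding C.shift_eq[OF S null] pull_encode'[OF X(1) X(1) continuous_map_shift_map zeta]
   encode_mult[OF X(2) phi measure_homs_push_map[OF zeta continuous_map_shift_map]]
  by (rule encode_cong[OF X(2)]) simp
qed

text \<open>Composition with \<open>tail_measure\<close> inverts 1 - t on homomorphisms: the
  correction in \<open>tail_measure_shift\<close> is carried by infinity, where null sections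
  vanish. Its first identity yields a solution, the second yields uniqueness.\<close>

theorem solid_cond: "solid C" unfolding C.solid_iff
proof (intro ballI)
 fix S y assume S: "S : MStone" and y: "y : null C S"
 let ?X = "times_Nbar S"
 let ?s = "push ?X ?X shift_map" and ?i = "push S ?X (at_inf)" and ?p = "push ?X S (on_pairs (%p a. p))"
 have X: "?X : MStone" "compact_space ?X" using S by (simp_all add: MStone_compact)
 note KS = MStone_compact[OF S]
 obtain phi where phi: "phi : measure_homs M ?X" "y = encode code ?X phi" "!!v. v : null_measures S ==> phi (?i v) = \<one>\<^bsub>M\<^esub>"
  using null_exhaust[OF S y] by blast
 have cl: "tail_measure S v : null_measures ?X" "?s v : null_measures ?X" "?i (?p v) : null_measures ?X" "?p v : null_measures S"
  if "v : null_measures ?X" for v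
 proof -
  show p: "?p v : null_measures S"
   by (intro push_closed[OF continuous_map_on_pairs that] continuous_map_fst)
  show "?i (?p v) : null_measures ?X" by (rule push_closed[OF continuous_map_at p])
 qed (rule push_measure_null[OF tail_fun_additive_maps[OF KS] that], rule push_closed[OF continuous_map_shift_map that])
 have split: "theta (w + v - u) = theta w \<otimes>\<^bsub>M\<^esub> theta v" if "theta : measure_homs M ?X" "w : null_measures ?X" "v : null_measures ?X" "u : null_measures ?X" "theta u = \<one>\<^bsub>M\<^esub>" for theta w v u
 proof -
  note a = measure_homs_additive[OF that(1)]
  have "w + v : null_measures ?X" using that by (intro add_subgroup_add) simp_all
  from additive_to_diff[OF a this that(4)] show ?thesis
   using additive_to_closed[OF a that(2)] additive_to_closed[OF a that(3)] by (simp only: additive_to_add[OF a that(2,3)] that(5)) simp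
 qed
 define zeta where "zeta = restrict (%v. phi (tail_measure S v)) (null_measures ?X)"
 have zeta: "zeta : measure_homs M ?X"
  unfolding zeta_def by (rule measure_homs_push[OF phi(1) tail_fun_additive_maps[OF KS]])
 have "tail_fun S F = (%q. tail_fun S F q)" for F by simp
 \<comment> \<open>\<open>tail_fun\<close> takes the value 0 at infinity, so the proposed solution
   \<open>zeta\<close> is a null section.\<close>
 have "tail_measure S (?i v) = 0" if v: "v : null_measures S" for v
 proof (intro ext)
  fix n F
  have "pull_fun S (at_inf) (tail_fun S F) = 0" by (auto simp: pull_fun_def tail_fun_apply)
  thus "tail_measure S (?i v) n F = 0 n F"
   using additive_on_0[OF null_measures_additive[OF v]] by (simp add: push_measure_def)
 qed
 hence "zeta (?i v) = \<one>\<^bsub>M\<^esub>" if "v : null_measures S" for v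
  using that push_closed[OF continuous_map_at that] additive_to_zero[OF measure_homs_additive[OF phi(1)]] by (simp add: zeta_def del: zero_fun_apply)
 hence z: "encode code ?X zeta : null C S" by (simp add: encode_null[OF S zeta])
 have eq: "encode code ?X zeta = encode code ?X (%v. phi v \<otimes>\<^bsub>M\<^esub> zeta (?s v))"
  proof (rule encode_cong[OF X(2)])
   fix v assume v: "v : null_measures ?X"
   have "phi (tail_measure S v) = phi (tail_measure S (?s v)) \<otimes>\<^bsub>M\<^esub> phi v"
    unfolding tail_measure_shift(1)[OF KS v] by (rule split[OF phi(1)]) (intro cl v phi(3))+
   thus "zeta v = phi v \<otimes>\<^bsub>M\<^esub> zeta (?s v)"
    using additive_to_closed[OF measure_homs_additive[OF phi(1)]] cl v by (simp add: zeta_def m_comm)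
  qed
 have eq': "y \<cdot>[C,?X] shift C S (encode code ?X zeta) = encode code ?X (%v. phi v \<otimes>\<^bsub>M\<^esub> zeta (?s v))"
  by (rule mult_shift_encode[OF S phi(1) zeta z, folded phi(2)])
 have unique: "z' = encode code ?X zeta" if z': "z' : null C S" "z' = y \<cdot>[C,?X] shift C S z'" for z'
 proof -
  obtain theta where theta: "theta : measure_homs M ?X" "z' = encode code ?X theta" "!!v. v : null_measures S ==> theta (?i v) = \<one>\<^bsub>M\<^esub>"
   using null_exhaust[OF S z'(1)] by metis
  have "encode code ?X theta = encode code ?X (%v. phi v \<otimes>\<^bsub>M\<^esub> theta (?s v))"
   using z' mult_shift_encode[OF S phi(1) theta(1)] unfolding theta(2) phi(2) by metis
  note eq = encode_eqD[OF X(2) this]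
  have "theta v = zeta v" if v: "v : null_measures ?X" for v
  proof -
   note a = measure_homs_additive[OF theta(1)] measure_homs_additive[OF phi(1)]
   \<comment> \<open>The value of \<open>theta\<close> on the tails of \<open>v\<close> is computed
     twice, by the second shift identity and by the equation that \<open>theta\<close> solves;
     cancelling the common term leaves \<open>theta v\<close>.\<close>
   have "theta (tail_measure S v) = theta (?s (tail_measure S v) + v - ?i (?p v))"
    by (rule arg_cong[OF tail_measure_shift(2)[OF KS v]])
   also have "... = theta (?s (tail_measure S v)) \<otimes>\<^bsub>M\<^esub> theta v"
    by (rule split[OF theta(1)]) (intro cl v theta(3))+
   finally have "theta (tail_measure S v) = theta (?s (tail_measure S v)) \<otimes>\<^bsub>M\<^esub> theta v" .
   moreover have "theta (tail_measure S v) = phi (tail_measure S v) \<otimes>\<^bsub>M\<^esub> theta (?s (tail_measure S v))"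
    by (rule eq[OF cl(1)[OF v]])
   ultimately have "theta (?s (tail_measure S v)) \<otimes>\<^bsub>M\<^esub> theta v = theta (?s (tail_measure S v)) \<otimes>\<^bsub>M\<^esub> phi (tail_measure S v)"
    using additive_to_closed[OF a(2) cl(1)[OF v]] additive_to_closed[OF a(1) cl(2)[OF cl(1)[OF v]]] by (simp add: m_comm)
   hence "theta v = phi (tail_measure S v)"
    by (subst (asm) Units_l_cancel) (auto intro: additive_to_closed[OF a(1)] additive_to_closed[OF a(2)] cl v)
   thus ?thesis using v by (simp add: zeta_def)
  qed
  thus ?thesis unfolding theta(2) by (rule encode_cong[OF X(2)])
 qed
 show "EX! z. z : null C S & z = y \<cdot>[C,?X] shift C S z"
  by (intro ex1I[where a = "encode code ?X zeta"] conjI z trans[OF eq eq'[symmetric]], elim conjE, rule unique)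
qed

sublocale C: solid_group C by (rule solid_groupI[OF light_condensed_cond solid_cond])

lemma cond_map_encode:
 assumes N: "left_module matrix_ring N" and h: "h : module_homs matrix_ring M N" and S: "S : MStone" and phi: "phi : measure_homs M S"
 shows "cond_map code M N h S (encode code S phi) = encode code S (%v. h (phi v))"
 using S encode_aux[OF MStone_compact[OF S] phi] inj_code
 by (auto simp: cond_map_def transport_map_def condensed_homs_def module_hom_group_def encode_def compose_def intro!: arg_cong[where f = code] restrict_ext)

lemma measure_homs_compose:
 assumes N: "left_module matrix_ring N" and h: "h : module_homs matrix_ring M N" and phi: "phi : measure_homs M X"
 shows "restrict (%v. h (phi v)) (null_measures X) : measure_homs N X"
proof -
 have "compose (carrier (measure_module X)) h phi : measure_homs N X"
  by (rule module_homs_compose[OF comm_group_measure_module _ phi h]) (simp add: act_measure_closed)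
 thus ?thesis by (simp add: compose_def)
qed

lemma cond_map_presheaf_hom:
 assumes N: "left_module matrix_ring N" and h: "h : module_homs matrix_ring M N"
 shows "cond_map code M N h : presheaf_homs C (cond code N)"
proof -
 interpret N: coded_module N code using N inj_code by unfold_locales
 note enc = cond_map_encode[OF N h] and comp = measure_homs_compose[OF N h]
 have enc': "cond_map code M N h S (encode code S phi) = encode code S (restrict (%v. h (phi v)) (null_measures S))"
  if "S : MStone" "phi : measure_homs M S" for S phi
  by (simp add: enc[OF that] encode_restrict[OF MStone_compact[OF that(1)]])
 show ?thesis unfolding presheaf_homs_def
 proof (intro CollectI conjI ballI IntI)
  show "cond_map code M N h : extensional MStone" by (simp add: cond_map_def)
  fix S assume S: "S : MStone"
  note K = MStone_compact[OF S]
  show "cond_map code M N h S : extensional (Sec C S)"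
   using S by (simp add: cond_map_def transport_map_def condensed_homs_def module_hom_group_def carrier_cond)
  show "cond_map code M N h S : hom (sect C S) (sect (cond code N) S)"
  proof (rule homI)
   fix x y assume "x : Sec C S" "y : Sec C S"
   then obtain phi psi where *: "phi : measure_homs M S" "x = encode code S phi" "psi : measure_homs M S" "y = encode code S psi"
    by (elim encode_exhaust[OF K])
   show "cond_map code M N h S x : Sec (cond code N) S"
    unfolding *(2) enc'[OF S *(1)] by (rule N.encode_closed[OF K comp[OF *(1)]])
   have "x \<cdot>[C,S] y = encode code S (restrict (%v. phi v \<otimes>\<^bsub>M\<^esub> psi v) (null_measures S))"
    by (simp add: * encode_mult[OF K *(1,3)] encode_restrict[OF K])
   thus "cond_map code M N h S (x \<cdot>[C,S] y) = cond_map code M N h S x \<cdot>[cond code N,S] cond_map code M N h S y"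
    unfolding *(2,4) enc'[OF S *(1)] enc'[OF S *(3)] N.encode_mult[OF K comp[OF *(1)] comp[OF *(3)]]
    using additive_to_closed[OF measure_homs_additive[OF *(1)]] additive_to_closed[OF measure_homs_additive[OF *(3)]]
    by (simp only: enc[OF S measure_homs_mult[OF *(1,3)]]) (rule encode_cong[OF K], simp add: module_homs_mult[OF h])
  qed
  fix T f x assume T: "T : MStone" and fx: "f : cmaps S T" "x : Sec C T"
  then obtain phi where *: "phi : measure_homs M T" "x = encode code T phi"
   using encode_exhaust[OF MStone_compact[OF T]] by blast
  note f = cmapsD(1)[OF fx(1)]
  show "cond_map code M N h S (res C S T f x) = res (cond code N) S T f (cond_map code M N h T x)"
   unfolding *(2) res_cond[OF fx(1)] N.res_cond[OF fx(1)] pull_encode'[OF S T f *(1)] enc[OF S measure_homs_push_map[OF *(1) f]]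
    enc'[OF T *(1)] N.pull_encode[OF S T f comp[OF *(1)]]
   by (rule encode_cong[OF K]) (simp add: push_closed[OF f])
 qed
qed

end

lemma coded_moduleI: "left_module matrix_ring M ==> inj code ==> coded_module M code" by unfold_locales

theorem is_functor_cond:
 fixes code :: "(bidual_seq => 'u) => 'u"
 assumes inj: "inj code"
 shows "is_functor (left_modules matrix_ring :: ((matrix, 'u) lmodule, 'u => 'u) cat)
  (light_solid_groups :: ('u presheaf, point topology => 'u => 'u) cat) (cond code) (cond_map code)"
 unfolding is_functor_def left_modules_simps light_solid_simps
proof (intro conjI ballI category_left_modules category_light_solid_groups)
 fix M :: "(matrix, 'u) lmodule"
 assume "M : Obj (left_modules matrix_ring)"
 hence M: "left_module matrix_ring M" by simp
 interpret coded_module M code by (rule coded_moduleI[OF M inj])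
 show "solid_group C" by (rule C.solid_group_axioms)
 show "cond_map code M M (\<lambda>x\<in>carrier M. x) = (\<lambda>S\<in>MStone. \<lambda>x\<in>Sec C S. x)"
 proof -
  have "compose (carrier (null_bidual S)) (\<lambda>x\<in>carrier M. x) h = h" if h: "h : module_homs matrix_ring (null_bidual S) M" for S h
   by (rule extensionalityI[of _ "carrier (null_bidual S)"])
    (use module_homs_closed[OF h] h in \<open>simp_all add: compose_def module_homs_def\<close>)
  thus ?thesis
   using inj by (auto simp: cond_map_def transport_map_def condensed_homs_def module_hom_group_def carrier_cond intro!: restrict_ext)
 qed
 fix N :: "(matrix, 'u) lmodule" and h assume "N : Obj (left_modules matrix_ring)" and h: "h : module_homs matrix_ring M N"
 hence N: "left_module matrix_ring N" by simp
 show "cond_map code M N h : presheaf_homs C (cond code N)" by (rule cond_map_presheaf_hom[OF N h])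
 interpret N: coded_module N code by (rule coded_moduleI[OF N inj])
 fix P :: "(matrix, 'u) lmodule" and g assume "P : Obj (left_modules matrix_ring)" and g: "g : module_homs matrix_ring N P"
 hence P: "left_module matrix_ring P" by simp
 have gh: "compose (carrier M) g h : module_homs matrix_ring M P"
  by (rule module_homs_compose[OF comm_group_axioms _ h g]) simp
 show "cond_map code M P (compose (carrier M) g h) = (\<lambda>S\<in>MStone. compose (Sec C S) (cond_map code N P g S) (cond_map code M N h S))"
 proof (rule presheaf_homs_ext[OF cond_map_presheaf_hom[OF P gh]])
  show "(\<lambda>S\<in>MStone. compose (Sec C S) (cond_map code N P g S) (cond_map code M N h S)) : presheaf_homs C (cond code P)"
   by (rule presheaf_homs_compose[OF cond_map_presheaf_hom[OF N h] N.cond_map_presheaf_hom[OF P g]])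
    (simp_all add: C.group_sect res_closed[OF C.ab_presheaf_axioms])
  fix S x assume S: "S : MStone" and x: "x : Sec C S"
  obtain phi where *: "phi : measure_homs M S" "x = encode code S phi"
   using encode_exhaust[OF MStone_compact[OF S] x] .
  have "cond_map code M N h S x = encode code S (restrict (%v. h (phi v)) (null_measures S))"
   by (simp add: *(2) cond_map_encode[OF N h S *(1)] encode_restrict[OF MStone_compact[OF S]])
  thus "cond_map code M P (compose (carrier M) g h) S x = (\<lambda>S\<in>MStone. compose (Sec C S) (cond_map code N P g S) (cond_map code M N h S)) S x"
   using S x additive_to_closed[OF measure_homs_additive[OF *(1)]]
   by (simp add: compose_def[of "Sec C S"] *(2) cond_map_encode[OF P gh S *(1)] N.cond_map_encode[OF P g S measure_homs_compose[OF N h *(1)]])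
    (rule encode_cong[OF MStone_compact[OF S]], simp add: compose_def)
 qed
qed

section \<open>The unit\<close>

definition coordinate :: "'a topology => ('a => nat => int) => nat => 'a => int" where
 "coordinate S g n = pull_fun S (%p. p) (%p. g p n)"

text \<open>The pushforward of the sequence \<open>v\<close> along \<open>g\<close>, read as a map
  to integer sequences: row \<open>k\<close> integrates \<open>g\<close> against \<open>v k\<close>.
  Column-finiteness is the nullity of \<open>v\<close>.\<close>

definition measure_matrix :: "'a topology => (nat => ('a => int) => int) => ('a => nat => int) => matrix" where
 "measure_matrix S v g = (%k n. v k (coordinate S g n))"

lemma coordinate_cont_int:
 assumes "cont_seq S g"
 shows "coordinate S g n : cont_int S"
proof (rule cont_intI)
 have "locally_constant S (%p. g p n)" using assms by (simp add: cont_seq_def)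
 thus "locally_constant S (coordinate S g n)"
  by (rule continuous_map_eq) (simp add: coordinate_def pull_fun_def)
qed (simp add: coordinate_def pull_fun_def)

lemma coordinate_cong: "(!!p. p : topspace S ==> g p n = h p n) ==> coordinate S g n = coordinate S h n"
 by (auto simp: coordinate_def pull_fun_def fun_eq_iff)

lemma measure_matrix_cong:
 assumes "!!p n. p : topspace S ==> g p n = h p n"
 shows "measure_matrix S v g = measure_matrix S v h"
 unfolding measure_matrix_def using coordinate_cong[of S g _ h] assms by metis

lemma measure_matrix_closed: "v : null_measures S ==> measure_matrix S v g : col_finite"
 unfolding col_finite_iff measure_matrix_def using null_measures_finite by blast

lemma add_matrix_ring: "c \<oplus>\<^bsub>matrix_ring\<^esub> d = c + d"
 by (simp add: matrix_ring_def fun_eq_iff)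

lemma measure_matrix_add: "measure_matrix S (v + w) g = measure_matrix S v g \<oplus>\<^bsub>matrix_ring\<^esub> measure_matrix S w g"
 by (simp add: measure_matrix_def add_matrix_ring fun_eq_iff)

lemma measure_matrix_add_fun:
 assumes v: "v : null_measures S" and g: "cont_seq S g" "cont_seq S h"
 shows "measure_matrix S v (%p n. g p n + h p n) = measure_matrix S v g \<oplus>\<^bsub>matrix_ring\<^esub> measure_matrix S v h"
proof -
 have "coordinate S (%p n. g p n + h p n) n = coordinate S g n + coordinate S h n" for n
  by (auto simp: coordinate_def pull_fun_def fun_eq_iff)
 thus ?thesis using coordinate_cont_int[OF g(1)] coordinate_cont_int[OF g(2)]
  by (intro ext) (simp add: measure_matrix_def add_matrix_ring additive_on_add[OF null_measures_additive[OF v]])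
qed

lemma measure_matrix_act:
 "measure_matrix S (act (measure_module S) c v) g = c \<otimes>\<^bsub>matrix_ring\<^esub> measure_matrix S v g"
 by (simp add: measure_matrix_def matrix_ring_def act_measure_module)

lemma measure_matrix_push:
 assumes f: "continuous_map S T f" and g: "cont_seq T g"
 shows "measure_matrix T (push S T f v) g = measure_matrix S v (%p. g (f p))"
proof -
 have "pull_fun S f (coordinate T g n) = coordinate S (%p. g (f p)) n" for n
  using continuous_map_image_subset_topspace[OF f] by (auto simp: coordinate_def pull_fun_def fun_eq_iff)
 thus ?thesis by (simp add: measure_matrix_def push_measure_def coordinate_cont_int[OF g])
qed

text \<open>Each coordinate of \<open>row_times c (g p)\<close> is a finite integer combination of
  coordinates of \<open>g\<close>, with a column of \<open>c\<close> as coefficients, and each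
  \<open>v k\<close> is additive.\<close>

lemma measure_matrix_row_times:
 assumes c: "c : col_finite" and v: "v : null_measures S" and g: "cont_seq S g"
 shows "measure_matrix S v (%p. row_times c (g p)) = measure_matrix S v g \<otimes>\<^bsub>matrix_ring\<^esub> c"
proof (intro ext)
 fix k n
 obtain N where N: "!!j. j >= N ==> c j n = 0" using col_finite_bound[OF c] by blast
 note add = null_measures_additive[OF v] and G = coordinate_cont_int[OF g]
 have "row_times c w n = (\<Sum>j<N. w j * c j n)" for w by (rule row_times_sum) (rule N)
 hence "coordinate S (%p. row_times c (g p)) n = (\<Sum>j<N. (%p. c j n * coordinate S g j p))"
  by (auto simp: coordinate_def pull_fun_def sum_fun_apply fun_eq_iff mult.commute)
 hence "v k (coordinate S (%p. row_times c (g p)) n) = (\<Sum>j<N. v k (%p. c j n * coordinate S g j p))"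
  by (simp only:) (rule additive_on_sum[where G = "cont_int S"], rule add, simp, rule add_subgroup_int_scale[OF add_subgroup_cont_int G])
 also have "... = (\<Sum>j<N. v k (coordinate S g j) * c j n)"
  by (intro sum.cong refl, subst additive_on_int_scale[OF add add_subgroup_cont_int G]) (rule mult.commute)
 also have "... = (\<Sum>j | c j n ~= 0. v k (coordinate S g j) * c j n)"
  by (rule sum_support_bound[symmetric]) (rule N)
 finally show "measure_matrix S v (%p. row_times c (g p)) k n = (measure_matrix S v g \<otimes>\<^bsub>matrix_ring\<^esub> c) k n"
  by (simp add: measure_matrix_def matrix_ring_def)
qed

text \<open>The null sequence of evaluations at \<open>n\<close> minus evaluation at infinity. It
  generates the null measures on \<open>Nbar1\<close> modulo those carried by infinity.\<close>

definition point_differences :: "nat => (point => int) => int" where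
 "point_differences n F = (if F : cont_int Nbar1 then F (nbar_point (Some n)) - F (nbar_point None) else 0)"

lemma nbar_point_topspace [simp]: "nbar_point a : topspace Nbar1"
 by (simp add: topspace_Nbar1 del: topspace_times_Nbar)

lemma Nbar1_bound:
 assumes "F : cont_int Nbar1"
 obtains N where "!!n. n >= N ==> F (nbar_point (Some n)) = F (nbar_point None)"
proof -
 obtain N where "!!p m. p : topspace one_point ==> m >= N ==> F (pair_point (p, Some m)) = F (pair_point (p, None))"
  using cont_int_Nbar_bound[OF MStone_compact[OF one_point_MStone] assms] by blast
 thus thesis using that[of N] by (simp add: nbar_point_def)
qed

lemma point_differences_null: "point_differences : null_measures Nbar1" unfolding null_measures_def
proof safe
 fix n
 show "additive_on (cont_int Nbar1) (point_differences n)"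
  by (auto simp: additive_on_def point_differences_def add_subgroup_add)
 fix F assume "F : cont_int Nbar1"
 thus "EX N. ALL n>=N. point_differences n F = 0" by (rule Nbar1_bound) (auto simp: point_differences_def)
qed (simp add: point_differences_def)

lemma measure_matrix_point_differences:
 "measure_matrix Nbar1 point_differences basis_fun = \<one>\<^bsub>matrix_ring\<^esub>"
 using coordinate_cont_int[OF cont_seq_basis_fun]
 by (auto simp: measure_matrix_def point_differences_def coordinate_def pull_fun_def matrix_ring_def fun_eq_iff simp del: topspace_times_Nbar)

text \<open>A continuous function on \<open>Nbar1\<close> is its value at infinity plus a finite
  combination of indicators of points \<open>n\<close>, with coefficients F(n) - F(infinity);
  \<open>v\<close> is applied to this expansion.\<close>

lemma point_differences_decompose:
 assumes v: "v : null_measures Nbar1"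
 shows "v = act (measure_module Nbar1) (measure_matrix Nbar1 v basis_fun) point_differences
  + push one_point Nbar1 (at_inf) (push Nbar1 one_point (on_pairs (%p a. p)) v)"
proof (intro ext)
 fix k F
 let ?c = "%F. pull_fun Nbar1 (on_pairs (%p a. p)) (pull_fun one_point (at_inf) F)"
 show "v k F = (act (measure_module Nbar1) (measure_matrix Nbar1 v basis_fun) point_differences
  + push one_point Nbar1 (at_inf) (push Nbar1 one_point (on_pairs (%p a. p)) v)) k F"
 proof (cases "F : cont_int Nbar1")
  case True
  obtain N where N: "!!n. n >= N ==> F (nbar_point (Some n)) = F (nbar_point None)"
   using Nbar1_bound[OF True] by blast
  let ?B = "%n. coordinate Nbar1 basis_fun n" and ?D = "%n. point_differences n F"
  note B = coordinate_cont_int[OF cont_seq_basis_fun]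
  have \<pi>: "continuous_map Nbar1 one_point (on_pairs (%p a. p))"
   by (intro continuous_map_on_pairs) (rule continuous_map_fst)
  have i: "pull_fun one_point (at_inf) F : cont_int one_point"
   by (rule pull_fun_cont_int[OF continuous_map_at True])
  have c: "?c F : cont_int Nbar1" by (rule pull_fun_cont_int[OF \<pi> i])
  have D: "?D n = 0" if "n >= N" for n using N[OF that] by (simp add: point_differences_def)
  have "F = (\<Sum>n<N. (%q. ?D n * ?B n q)) + ?c F"
  proof
   fix q
   show "F q = ((\<Sum>n<N. (%q. ?D n * ?B n q)) + ?c F) q"
   proof (cases "q : topspace Nbar1")
    case q: True
    then obtain a where a: "q = nbar_point a" by (auto simp: topspace_Nbar1 simp del: topspace_times_Nbar)
    have "(\<Sum>n<N. ?D n * ?B n q) = (\<Sum>n<N. if a = Some n then ?D n else 0)"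
     by (intro sum.cong) (simp_all add: a coordinate_def pull_fun_def del: topspace_times_Nbar)
    also have "... = F q - F (nbar_point None)"
     using D True by (cases a) (auto simp: a point_differences_def not_less)
    finally have "(\<Sum>n<N. ?D n * ?B n q) = F q - F (nbar_point None)" .
    moreover have "?c F q = F (nbar_point None)"
     using q by (simp add: a pull_fun_def del: topspace_times_Nbar) (simp add: nbar_point_def)
    ultimately show ?thesis by (simp add: sum_fun_apply)
   qed (simp add: sum_fun_apply cont_int_outside[OF True] coordinate_def pull_fun_def)
  qed
  hence "v k F = v k ((\<Sum>n<N. (%q. ?D n * ?B n q)) + ?c F)" by simp
  also have "... = v k (\<Sum>n<N. (%q. ?D n * ?B n q)) + v k (?c F)"
   using c by (intro additive_on_add[OF null_measures_additive[OF v]] add_subgroup_sum add_subgroup_int_scale[OF _ B]) simp_all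
  also have "v k (\<Sum>n<N. (%q. ?D n * ?B n q)) = (\<Sum>n<N. v k (%q. ?D n * ?B n q))"
   by (rule additive_on_sum[OF null_measures_additive[OF v]]) (simp_all add: add_subgroup_int_scale[OF _ B])
  also have "... = (\<Sum>n<N. measure_matrix Nbar1 v basis_fun k n * ?D n)"
   using additive_on_int_scale[OF null_measures_additive[OF v] _ B] by (simp add: measure_matrix_def mult.commute)
  finally show ?thesis using True i D by (simp add: push_measure_def act_measure_module_bound[of N])
 qed (simp add: push_measure_def act_measure_module null_measures_outside[OF v] null_measures_outside[OF point_differences_null])
qed

section \<open>Matrix coefficients and the unit map\<close>

context matrix_module
begin

lemma act_M_add: "c : col_finite ==> d : col_finite ==> m : carrier M ==> act M (c \<oplus>\<^bsub>matrix_ring\<^esub> d) m = act M c m \<otimes>\<^bsub>M\<^esub> act M d m"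
 using left_module by (simp add: left_module_def)

lemma act_M_act: "c : col_finite ==> d : col_finite ==> m : carrier M ==> act M (c \<otimes>\<^bsub>matrix_ring\<^esub> d) m = act M c (act M d m)"
 using left_module by (simp add: left_module_def)

lemma act_M_one: "m : carrier M ==> act M \<one>\<^bsub>matrix_ring\<^esub> m = m"
 using left_module by (simp add: left_module_def)

text \<open>Integrating \<open>g\<close> against a null measure gives a matrix, which then acts on
  the fixed element \<open>m\<close>. These homomorphisms serve both as the unit and as preimages
  under the counit.\<close>

definition matrix_coefficient :: "'a topology => ('a => nat => int) => 'u => (nat => ('a => int) => int) => 'u" where
 "matrix_coefficient S g m = restrict (%v. act M (measure_matrix S v g) m) (null_measures S)"

lemma matrix_coefficient_hom:
 assumes "m : carrier M"
 shows "matrix_coefficient S g m : measure_homs M S" unfolding matrix_coefficient_def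
proof (rule measure_homsI)
 show "additive_to M S (%v. act M (measure_matrix S v g) m)"
  using assms by (simp add: additive_to_def measure_matrix_closed measure_matrix_add act_M_add)
qed (use assms in \<open>simp add: measure_matrix_act measure_matrix_closed act_M_act\<close>)

end

context coded_module
begin

definition unit :: "'u => 'u" where
 "unit = (\<lambda>m\<in>carrier M. encode code Nbar1 (matrix_coefficient Nbar1 basis_fun m))"

text \<open>Exhibiting the coefficients as a homomorphism out of \<open>ZN\<close>, natural in the
  space and additive in \<open>g\<close>, allows \<open>presheaf_hom_eq_integ\<close> to compute
  integrals against \<open>unit m\<close>.\<close>

lemma coefficient_presheaf_hom:
 assumes m: "m : carrier M"
 shows "(\<lambda>S\<in>MStone. \<lambda>g\<in>Sec ZN S. encode code S (matrix_coefficient S g m)) : presheaf_homs ZN C"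
 unfolding presheaf_homs_def
proof (intro CollectI conjI ballI IntI)
 fix S assume S: "S : MStone"
 note K = MStone_compact[OF S]
 interpret Z: group "sect ZN S" by (rule group_ZN)
 show "(\<lambda>S\<in>MStone. \<lambda>g\<in>Sec ZN S. encode code S (matrix_coefficient S g m)) S : extensional (Sec ZN S)"
  using S by simp
 have "restrict (%g. encode code S (matrix_coefficient S g m)) (Sec ZN S) : hom (sect ZN S) (sect C S)"
 proof (rule homI)
  fix g h assume gh: "g : Sec ZN S" "h : Sec ZN S"
  thus "restrict (%g. encode code S (matrix_coefficient S g m)) (Sec ZN S) g : Sec C S"
   by (simp add: encode_closed[OF K matrix_coefficient_hom[OF m]])
  have gh': "cont_seq S g" "cont_seq S h" using gh by (simp_all add: carrier_ZN)
  have eq: "matrix_coefficient S (g \<cdot>[ZN,S] h) m v = matrix_coefficient S g m v \<otimes>\<^bsub>M\<^esub> matrix_coefficient S h m v"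
   if v: "v : null_measures S" for v
  proof -
   have "measure_matrix S v (g \<cdot>[ZN,S] h) = measure_matrix S v (%p n. g p n + h p n)"
    by (rule measure_matrix_cong) (simp add: mult_ZN)
   thus ?thesis
    using v m by (simp add: matrix_coefficient_def measure_matrix_add_fun[OF v gh'] act_M_add measure_matrix_closed)
  qed
  show "restrict (%g. encode code S (matrix_coefficient S g m)) (Sec ZN S) (g \<cdot>[ZN,S] h) =
    restrict (%g. encode code S (matrix_coefficient S g m)) (Sec ZN S) g \<cdot>[C,S]
    restrict (%g. encode code S (matrix_coefficient S g m)) (Sec ZN S) h"
   using gh Z.m_closed[OF gh] by (simp add: encode_mult[OF K matrix_coefficient_hom[OF m] matrix_coefficient_hom[OF m]])
    (rule encode_cong[OF K eq])
 qed
 thus "(\<lambda>S\<in>MStone. \<lambda>g\<in>Sec ZN S. encode code S (matrix_coefficient S g m)) S : hom (sect ZN S) (sect C S)"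
  using S by simp
 fix T f g assume T: "T : MStone" and f: "f : cmaps S T" and g: "g : Sec ZN T"
 have g': "cont_seq T g" using g by (simp add: carrier_ZN)
 have eq: "matrix_coefficient S (res ZN S T f g) m v = matrix_coefficient T g m (push S T f v)" if v: "v : null_measures S" for v
  using v push_closed[OF cmapsD(1)[OF f] v] measure_matrix_cong[of S "res ZN S T f g" "%p. g (f p)" v]
  by (simp add: matrix_coefficient_def measure_matrix_push[OF cmapsD(1)[OF f] g'] res_ZN compose_def)
 show "(\<lambda>S\<in>MStone. \<lambda>g\<in>Sec ZN S. encode code S (matrix_coefficient S g m)) S (res ZN S T f g) =
   res C S T f ((\<lambda>S\<in>MStone. \<lambda>g\<in>Sec ZN S. encode code S (matrix_coefficient S g m)) T g)"
  using S T g res_ZN_closed[OF f g]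
  by (simp add: res_cond[OF f] pull_encode[OF S T cmapsD(1)[OF f] matrix_coefficient_hom[OF m]]) (rule encode_cong[OF K eq])
qed simp

lemma unit_eval_basis:
 assumes m: "m : carrier M"
 shows "unit m = eval_basis (\<lambda>S\<in>MStone. \<lambda>g\<in>Sec ZN S. encode code S (matrix_coefficient S g m))"
proof -
 have "measure_matrix Nbar1 v basis_sequence = measure_matrix Nbar1 v basis_fun" for v
  by (rule measure_matrix_cong) (simp add: basis_sequence_eq del: topspace_times_Nbar)
 thus ?thesis using m basis_sequence_ZN by (simp add: unit_def eval_basis_def matrix_coefficient_def)
qed

lemma unit_null: "m : carrier M ==> unit m : null C one_point"
 unfolding unit_eval_basis by (rule C.eval_basis_null[OF coefficient_presheaf_hom])

lemma integ_unit:
 assumes m: "m : carrier M" and S: "S : MStone" and g: "cont_seq S g"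
 shows "C.integ S g (unit m) = encode code S (matrix_coefficient S g m)"
proof -
 have g': "restrict g (topspace S) : Sec ZN S" by (rule restrict_ZN[OF g])
 have "C.integ S g (unit m) = C.integ S (restrict g (topspace S)) (unit m)"
  by (rule C.integ_cong[OF S g]) simp
 also have "... = encode code S (matrix_coefficient S (restrict g (topspace S)) m)"
  using C.presheaf_hom_eq_integ[OF coefficient_presheaf_hom[OF m] S g'] S g' by (simp add: unit_eval_basis[OF m])
 also have "matrix_coefficient S (restrict g (topspace S)) m = matrix_coefficient S g m"
  unfolding matrix_coefficient_def by (rule restrict_ext) (simp add: measure_matrix_cong[of S "restrict g (topspace S)" g])
 finally show ?thesis .
qed

lemma compact_Nbar1: "compact_space Nbar1" by (rule MStone_compact[OF times_Nbar_MStone[OF one_point_MStone]])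

lemma unit_hom: "unit : module_homs matrix_ring M (null_module C)"
proof (rule module_homsI)
 fix m n assume m: "m : carrier M" and n: "n : carrier M"
 have eq: "matrix_coefficient Nbar1 basis_fun (m \<otimes>\<^bsub>M\<^esub> n) v = matrix_coefficient Nbar1 basis_fun m v \<otimes>\<^bsub>M\<^esub> matrix_coefficient Nbar1 basis_fun n v"
  if "v : null_measures Nbar1" for v
  using that m n by (simp add: matrix_coefficient_def measure_matrix_closed act_M_mult)
 show "unit (m \<otimes>\<^bsub>M\<^esub> n) = unit m \<otimes>\<^bsub>null_module C\<^esub> unit n"
  using m n by (simp add: unit_def encode_mult[OF compact_Nbar1 matrix_coefficient_hom matrix_coefficient_hom])
   (rule encode_cong[OF compact_Nbar1 eq])
next
 fix c m assume c: "c : col_finite" and m: "m : carrier M"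
 have eq: "matrix_coefficient Nbar1 basis_fun (act M c m) v = matrix_coefficient Nbar1 (mat_fun c) m v"
  if v: "v : null_measures Nbar1" for v
 proof -
  have "measure_matrix Nbar1 v (mat_fun c) = measure_matrix Nbar1 v basis_fun \<otimes>\<^bsub>matrix_ring\<^esub> c"
   unfolding measure_matrix_row_times[OF c v cont_seq_basis_fun, symmetric]
   by (rule measure_matrix_cong) (simp add: row_times_basis_fun[OF c] del: topspace_times_Nbar)
  thus ?thesis using v c m by (simp add: matrix_coefficient_def measure_matrix_closed act_M_act)
 qed
 have "unit (act M c m) = encode code Nbar1 (matrix_coefficient Nbar1 basis_fun (act M c m))"
  using c m by (simp add: unit_def)
 also have "... = encode code Nbar1 (matrix_coefficient Nbar1 (mat_fun c) m)"
  by (rule encode_cong[OF compact_Nbar1 eq])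
 finally show "unit (act M c m) = act (null_module C) c (unit m)"
  using c m by (simp add: C.null_module_act unit_null integ_unit cont_seq_mat_fun)
qed (simp_all add: unit_null, simp add: unit_def)

text \<open>Evaluation at \<open>point_differences\<close>, whose matrix is the identity, recovers
  \<open>m\<close>. Conversely a homomorphism that is trivial on measures carried by infinity is
  determined by its value there, by \<open>point_differences_decompose\<close>.\<close>

lemma bij_unit: "bij_betw unit (carrier M) (null C one_point)"
proof (rule bij_betwI')
 fix m n assume m: "m : carrier M" and n: "n : carrier M"
 have "matrix_coefficient Nbar1 basis_fun k point_differences = k" if "k : carrier M" for k
  using that by (simp add: matrix_coefficient_def point_differences_null measure_matrix_point_differences act_M_one)
 thus "unit m = unit n \<longleftrightarrow> m = n"
  using encode_eqD[OF compact_Nbar1 _ point_differences_null] m n unfolding unit_def by (metis restrict_apply')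
next
 fix x assume "x : null C one_point"
 then obtain phi where phi: "phi : measure_homs M Nbar1" "x = encode code Nbar1 phi"
   "!!v. v : null_measures one_point ==> phi (push one_point Nbar1 (at_inf) v) = \<one>\<^bsub>M\<^esub>"
  using null_exhaust[OF one_point_MStone] by blast
 note add = measure_homs_additive[OF phi(1)]
 let ?m = "phi point_differences"
 have m: "?m : carrier M" by (rule additive_to_closed[OF add point_differences_null])
 have eq: "phi v = matrix_coefficient Nbar1 basis_fun ?m v" if v: "v : null_measures Nbar1" for v
 proof -
  let ?V = "measure_matrix Nbar1 v basis_fun" and ?w = "push Nbar1 one_point (on_pairs (%p a. p)) v"
  let ?iw = "push one_point Nbar1 (at_inf) ?w"
  have V: "?V : col_finite" by (rule measure_matrix_closed[OF v])
  have w: "?w : null_measures one_point"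
   by (intro push_closed[OF continuous_map_on_pairs v]) (rule continuous_map_fst)
  have "phi v = phi (act (measure_module Nbar1) ?V point_differences + ?iw)"
   by (rule arg_cong[OF point_differences_decompose[OF v]])
  also have "... = phi (act (measure_module Nbar1) ?V point_differences) \<otimes>\<^bsub>M\<^esub> phi ?iw"
   by (rule additive_to_add[OF add act_measure_closed[OF V point_differences_null] push_closed[OF continuous_map_at w]])
  finally show ?thesis
   using v V m by (simp add: phi(3)[OF w] measure_homs_act[OF phi(1) V point_differences_null] matrix_coefficient_def)
 qed
 have "x = unit ?m" using m by (simp add: phi(2) unit_def) (rule encode_cong[OF compact_Nbar1 eq])
 thus "EX m:carrier M. x = unit m" using m by blast
qed (rule unit_null)

lemma unit_natural:
 assumes N: "left_module matrix_ring N" and h: "h : module_homs matrix_ring M N" and m: "m : carrier M"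
 shows "null_module_map C (cond code N) (cond_map code M N h) (unit m) = coded_module.unit N code (h m)"
proof -
 interpret N: coded_module N code by (rule coded_moduleI[OF N inj_code])
 have hm: "h m : carrier N" by (rule module_homs_closed[OF h m])
 have "null_module_map C (cond code N) (cond_map code M N h) (unit m) = encode code Nbar1 (%v. h (matrix_coefficient Nbar1 basis_fun m v))"
  using unit_null[OF m] m
  by (simp add: null_module_map_def) (simp add: unit_def cond_map_encode[OF N h _ matrix_coefficient_hom[OF m]])
 also have "... = encode code Nbar1 (N.matrix_coefficient Nbar1 basis_fun (h m))"
  using m by (intro encode_cong[OF compact_Nbar1])
   (simp add: matrix_coefficient_def N.matrix_coefficient_def module_homs_act[OF h] measure_matrix_closed)
 finally show ?thesis using hm by (simp add: N.unit_def)
qed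

end

lemma isomorphism_left_modulesI:
 assumes M: "left_module R M" and h: "h : module_homs R M N" and bij: "bij_betw h (carrier M) (carrier N)"
 shows "isomorphism (left_modules R) M N h"
proof -
 let ?g = "\<lambda>y\<in>carrier N. inv_into (carrier M) h y"
 have g: "?g y : carrier M & h (?g y) = y" if "y : carrier N" for y
  using that bij by (simp add: bij_betw_def inv_into_into f_inv_into_f)
 have gh: "?g (h x) = x" if "x : carrier M" for x
  using that bij module_homs_closed[OF h] by (simp add: bij_betw_def)
 interpret comm_group M by (rule left_module_comm_group[OF M])
 have "?g : module_homs R N M"
 proof (rule module_homsI)
  fix x y assume "x : carrier N" "y : carrier N"
  thus "?g (x \<otimes>\<^bsub>N\<^esub> y) = ?g x \<otimes>\<^bsub>M\<^esub> ?g y"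
   using gh[of "?g x \<otimes>\<^bsub>M\<^esub> ?g y"] module_homs_mult[OF h, of "?g x" "?g y"] module_homs_closed[OF h, of "?g x \<otimes>\<^bsub>M\<^esub> ?g y"] g by simp
 next
  fix r x assume "r : carrier R" "x : carrier N"
  thus "?g (act N r x) = act M r (?g x)"
   using gh[of "act M r (?g x)"] module_homs_act[OF h, of r "?g x"] module_homs_closed[OF h, of "act M r (?g x)"] g left_module_act_closed[OF M] by simp
 qed (use g in auto)
 moreover have "compose (carrier M) ?g h = (\<lambda>x\<in>carrier M. x)" "compose (carrier N) h ?g = (\<lambda>y\<in>carrier N. y)"
  using g gh by (auto simp: compose_def restrict_def fun_eq_iff)
 ultimately show ?thesis using h by (auto simp: isomorphism_def)
qed

section \<open>The counit\<close>

lemma dual_basisD: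
 assumes "dual_basis S rho iota"
 shows "rho : null_measures S" "iota n : cont_int S" "g : cont_int S ==> g x = (\<Sum>n | rho n g ~= 0. iota n x * rho n g)"
 using assms by (simp_all add: dual_basis_def)

lemma dual_basis_cont_seq: "dual_basis S rho iota ==> cont_seq S (%p n. iota n p)"
 by (simp add: cont_seq_def cont_int_continuous dual_basisD(2))

lemma measure_matrix_dual_basis:
 assumes "dual_basis S rho iota"
 shows "measure_matrix S v (%p n. iota n p) = (%k n. v k (iota n))"
proof -
 have "coordinate S (%p n. iota n p) n = iota n" for n
  using cont_int_outside[OF dual_basisD(2)[OF assms]] by (auto simp: coordinate_def pull_fun_def fun_eq_iff)
 thus ?thesis by (simp add: measure_matrix_def)
qed

text \<open>Applying \<open>v\<close> to the expansion of \<open>g\<close> shows that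
  \<open>rho\<close> generates the module of null measures; a homomorphism \<open>phi\<close> is
  known once \<open>phi rho\<close> is.\<close>

lemma dual_basis_expand:
 assumes b: "dual_basis S rho iota" and v: "v : null_measures S"
 shows "v = act (measure_module S) (measure_matrix S v (%p n. iota n p)) rho"
proof (intro ext)
 fix k g
 show "v k g = act (measure_module S) (measure_matrix S v (%p n. iota n p)) rho k g"
 proof (cases "g : cont_int S")
  case True
  let ?F = "{n. rho n g ~= 0}"
  have "g = (\<Sum>n\<in>?F. (%x. rho n g * iota n x))"
   using dual_basisD(3)[OF b True] by (simp add: fun_eq_iff sum_fun_apply mult.commute)
  hence "v k g = v k (\<Sum>n\<in>?F. (%x. rho n g * iota n x))" by (rule arg_cong)
  also have "... = (\<Sum>n\<in>?F. v k (%x. rho n g * iota n x))"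
   by (rule additive_on_sum[where G = "cont_int S"]) (simp_all add: null_measures_additive[OF v] add_subgroup_int_scale dual_basisD(2)[OF b])
  also have "... = (\<Sum>n\<in>?F. v k (iota n) * rho n g)"
   by (intro sum.cong refl, subst additive_on_int_scale[OF null_measures_additive[OF v] add_subgroup_cont_int dual_basisD(2)[OF b]])
    (rule mult.commute)
  finally show ?thesis by (simp add: act_measure_module measure_matrix_dual_basis[OF b])
 qed (simp add: act_measure_module null_measures_outside[OF v] null_measures_outside[OF dual_basisD(1)[OF b]])
qed

lemma row_times_dual_basis:
 assumes b: "dual_basis S rho iota" and h: "cont_seq S h" and p: "p : topspace S"
 shows "row_times (measure_matrix S rho h) (%n. iota n p) n = h p n"
 using dual_basisD(3)[OF b coordinate_cont_int[OF h], of n p] p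
 by (simp add: row_times_def measure_matrix_def) (simp add: coordinate_def pull_fun_def)

section \<open>Evaluation of homomorphisms by integration\<close>

locale coded_solid_group = solid_group A for A :: "'u presheaf" +
 fixes code :: "(bidual_seq => 'u) => 'u"
 assumes code: "inj code"

sublocale coded_solid_group \<subseteq> M: coded_module "null_module A" code
 by (rule coded_moduleI[OF left_module_null_module code])

context coded_solid_group
begin

lemma hom_value_null:
 assumes "phi : measure_homs (null_module A) S" "v : null_measures S"
 shows "phi v : null A one_point"
 using M.additive_to_closed[OF M.measure_homs_additive[OF assms(1)] assms(2)] by simp

lemma integ_measure:
 assumes phi: "phi : measure_homs (null_module A) T" and b: "dual_basis T rho iota" and v: "v : null_measures T"
  and S: "S : MStone" and g: "cont_seq S g"
 shows "integ S g (phi v) = integ S (%p. row_times (measure_matrix T v (%p n. iota n p)) (g p)) (phi rho)"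
proof -
 have c: "measure_matrix T v (%p n. iota n p) : col_finite" by (rule measure_matrix_closed[OF v])
 note rho = dual_basisD(1)[OF b]
 have "phi v = phi (act (measure_module T) (measure_matrix T v (%p n. iota n p)) rho)"
  by (rule arg_cong[OF dual_basis_expand[OF b v]])
 also have "... = act (null_module A) (measure_matrix T v (%p n. iota n p)) (phi rho)"
  by (rule M.measure_homs_act[OF phi c rho])
 finally show ?thesis using integ_act[OF c hom_value_null[OF phi rho] S g] by simp
qed

text \<open>Both sides are the integral of \<open>iota'\<close> along \<open>f\<close> against
  \<open>phi rho'\<close>. Naturality of the counit comes from this, and the case of the identity
  map gives independence of the dual basis.\<close>

lemma integ_dual_basis_pull:
 assumes S: "S : MStone" and T: "T : MStone" and f: "continuous_map S T f"
  and b: "dual_basis S rho iota" and b': "dual_basis T rho' iota'" and phi: "phi : measure_homs (null_module A) T"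
 shows "integ S (%p n. iota n p) (phi (push S T f rho)) = pull A S T f (integ T (%p n. iota' n p) (phi rho'))"
proof -
 have v: "push S T f rho : null_measures T" by (rule push_closed[OF f dual_basisD(1)[OF b]])
 have h: "cont_seq S (%p n. iota' n (f p))" by (rule cont_seq_compose[OF dual_basis_cont_seq[OF b'] f])
 have m: "measure_matrix T (push S T f rho) (%p n. iota' n p) = measure_matrix S rho (%p n. iota' n (f p))"
  by (rule measure_matrix_push[OF f dual_basis_cont_seq[OF b']])
 have "integ S (%p n. iota n p) (phi (push S T f rho)) = integ S (%p. row_times (measure_matrix S rho (%p n. iota' n (f p))) (%n. iota n p)) (phi rho')"
  unfolding m[symmetric] by (rule integ_measure[OF phi b' v S dual_basis_cont_seq[OF b]])
 also have "... = integ S (%p n. iota' n (f p)) (phi rho')"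
  by (rule integ_cong[OF S h, symmetric]) (simp add: row_times_dual_basis[OF b h])
 also have "... = pull A S T f (integ T (%p n. iota' n p) (phi rho'))"
  by (rule integ_pull[OF S T f dual_basis_cont_seq[OF b'] hom_value_null[OF phi dual_basisD(1)[OF b']], symmetric])
 finally show ?thesis .
qed

definition some_basis :: "point topology => (nat => (point => int) => int) \<times> (nat => point => int)" where
 "some_basis S = (SOME z. dual_basis S (fst z) (snd z))"

lemma some_basis:
 assumes "S : MStone"
 shows "dual_basis S (fst (some_basis S)) (snd (some_basis S))"
proof -
 obtain rho iota where "dual_basis S rho iota" using dual_basis_exists[of S] assms by (auto simp: MStone_iff)
 hence "dual_basis S (fst (rho, iota)) (snd (rho, iota))" by simp
 thus ?thesis unfolding some_basis_def by (rule someI[where P = "%z. dual_basis S (fst z) (snd z)"])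
qed

text \<open>Since \<open>g p\<close> is the sum of the products of \<open>iota n p\<close> and
  \<open>rho n g\<close>, this is formally \<open>phi\<close> applied to evaluation at the variable
  point \<open>p\<close>.\<close>

definition evaluate :: "point topology => ((nat => (point => int) => int) => 'u) => 'u" where
 "evaluate S phi = integ S (%p n. snd (some_basis S) n p) (phi (fst (some_basis S)))"

lemma evaluate_closed:
 assumes S: "S : MStone" and phi: "phi : measure_homs (null_module A) S"
 shows "evaluate S phi : Sec A S" unfolding evaluate_def
 by (rule integ_closed[OF S dual_basis_cont_seq[OF some_basis[OF S]] hom_value_null[OF phi dual_basisD(1)[OF some_basis[OF S]]]])

lemma evaluate_pull:
 assumes S: "S : MStone" and T: "T : MStone" and f: "continuous_map S T f" and phi: "phi : measure_homs (null_module A) T"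
 shows "evaluate S (%v. phi (push S T f v)) = pull A S T f (evaluate T phi)"
 unfolding evaluate_def by (rule integ_dual_basis_pull[OF S T f some_basis[OF S] some_basis[OF T] phi])

lemma evaluate_eq:
 assumes S: "S : MStone" and b: "dual_basis S rho iota" and phi: "phi : measure_homs (null_module A) S"
 shows "evaluate S phi = integ S (%p n. iota n p) (phi rho)"
proof -
 have id: "continuous_map S S (%p. p)" by simp
 have "integ S (%p n. iota n p) (phi (push S S (%p. p) rho)) = pull A S S (%p. p) (evaluate S phi)"
  unfolding evaluate_def by (rule integ_dual_basis_pull[OF S S id b some_basis[OF S] phi])
 also have "... = evaluate S phi" by (rule pull_id[OF S evaluate_closed[OF S phi]]) (rule refl)
 finally show ?thesis unfolding push_id[OF dual_basisD(1)[OF b] refl] by (rule sym)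
qed

lemma evaluate_mult:
 assumes S: "S : MStone" and phi: "phi : measure_homs (null_module A) S" and psi: "psi : measure_homs (null_module A) S"
 shows "evaluate S (%v. phi v \<cdot>[A,Nbar1] psi v) = evaluate S phi \<cdot>[A,S] evaluate S psi"
 unfolding evaluate_def by (rule integ_mult[OF S dual_basis_cont_seq[OF some_basis[OF S]]
   hom_value_null[OF phi dual_basisD(1)[OF some_basis[OF S]]] hom_value_null[OF psi dual_basisD(1)[OF some_basis[OF S]]]])

end

section \<open>Retractions along a tree as maps over \<open>Nbar\<close>\<close>

locale pointed_tree = coded_solid_group A code + retraction_tree S b r p q U
 for A :: "'u presheaf" and code and S :: "point topology" and b r p q U +
 assumes S: "S : MStone"
begin

abbreviation SN :: "point topology" where
 "SN == times_Nbar S"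

text \<open>The index is lowered by one so that at level \<open>Suc m\<close> this is
  \<open>r m\<close> and its shift is \<open>r (Suc m)\<close>. At level 0 both are
  \<open>r 0\<close>, because \<open>0 - 1 = 0\<close> in the naturals.\<close>

definition retract :: "point => point" where
 "retract = on_pairs (%s a. case a of None => s | Some m => r (m - 1) s)"

lemma retract_simps [simp]: "retract (pair_point (s, None)) = s" "retract (pair_point (s, Some m)) = r (m - 1) s"
 by (simp_all add: retract_def)

lemma continuous_retract: "continuous_map SN S retract"
proof -
 have "continuous_map Nbar Nbar (map_option (%m. m - 1))" unfolding continuous_map_into_Nbar
 proof
  fix n
  have "{a : topspace Nbar. map_option (%m. m - 1) a = Some n} = (\<Union>m\<in>{m. m - 1 = n}. {Some m})"
   by auto
  moreover have "finite {m :: nat. m - 1 = n}" by (rule finite_subset[of _ "{..Suc n}"]) auto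
  ultimately show "clopenin Nbar {a : topspace Nbar. map_option (%m. m - 1) a = Some n}"
   using clopenin_UN[of _ Nbar "%m. {Some m}"] clopenin_Nbar_Some by simp
 qed
 hence "continuous_map (prod_topology S Nbar) (prod_topology S Nbar) (%z. (fst z, map_option (%m. m - 1) (snd z)))"
  using continuous_map_compose[OF continuous_map_snd, of Nbar Nbar _ S]
  by (auto simp: continuous_map_pairwise o_def continuous_map_fst)
 from continuous_map_compose[OF this continuous_map_r]
 have "continuous_map (prod_topology S Nbar) S (%z. case snd z of None => fst z | Some m => r (m - 1) (fst z))"
  by (rule continuous_map_eq) (auto split: option.split)
 thus ?thesis unfolding retract_def by (rule continuous_map_on_pairs)
qed

text \<open>Level \<open>Suc m\<close> in \<open>Z\<close> is kept where membership of
  \<open>s\<close> in \<open>U m\<close> equals \<open>B m\<close>. With \<open>B\<close> true these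
  are the levels at which the retraction of \<open>s\<close> may move; with \<open>B\<close> false
  they are the levels to be cut out.\<close>

definition steps :: "nat set => (nat => bool) => point => nat option => nat option" where
 "steps Z B s a = (case a of None => None | Some 0 => if 0 : Z then Some 0 else None
   | Some (Suc m) => if Suc m : Z & (s : U m) = B m then Some (Suc m) else None)"

lemma steps_simps [simp]:
 "steps Z B s None = None"
 "steps Z B s (Some 0) = (if 0 : Z then Some 0 else None)"
 "steps Z B s (Some (Suc m)) = (if Suc m : Z & (s : U m) = B m then Some (Suc m) else None)"
 by (simp_all add: steps_def)

lemma steps_eq: "steps Z B s (Some m) = Some n ==> m = n" by (cases m) (auto split: if_splits)

lemma null_family_steps: "null_family S (steps Z B)"
proof (rule null_familyI)
 fix m n
 have c: "clopenin S {s : topspace S. s : U k}" for k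
  using U[of k] clopenin_subset[OF U, of k] by (simp add: Collect_conj_eq Int_absorb1)
 have "clopenin S {s : topspace S. s ~: U k}" for k by (rule clopenin_not[OF c])
 with c have c': "clopenin S {s : topspace S. (s : U k) = B'}" for k B' by (cases B') simp_all
 show "clopenin S {s : topspace S. steps Z B s (Some m) = Some n}"
 proof (cases m)
  case (Suc k)
  have "{s : topspace S. steps Z B s (Some m) = Some n} =
    (if Suc k : Z & Suc k = n then {s : topspace S. (s : U k) = B k} else {})"
   by (auto simp: Suc)
  thus ?thesis using c'[of k "B k"] by simp
 qed (cases "0 : Z & n = 0"; auto)
next
 show "EX N. ALL s:topspace S. ALL m. steps Z B s (Some m) = Some n --> m < N" for n
  by (intro exI[of _ "Suc n"]) (auto dest: steps_eq)
qed simp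

text \<open>The closed subspace that remains when the levels selected by \<open>steps Z B\<close>
  are removed; infinity always remains.\<close>

definition piece :: "nat set => (nat => bool) => point topology" where
 "piece Z B = subtopology SN {x : topspace SN. on_pairs (steps Z B) x = None}"

lemma closedin_piece: "closedin SN {x : topspace SN. on_pairs (steps Z B) x = None}"
 using null_family_continuous[OF null_family_steps] light_profinite_imp_Hausdorff[OF light_profinite_Nbar]
 by (intro closedin_equalizer[of Nbar]) simp_all

lemma piece_MStone: "piece Z B : MStone"
 unfolding piece_def using S by (intro subtopology_MStone closedin_piece) simp

lemma topspace_piece: "x : topspace (piece Z B) \<longleftrightarrow> (EX s a. s : topspace S & x = pair_point (s, a) & steps Z B s a = None)"
 by (auto simp: piece_def) blast

lemma continuous_piece: "continuous_map SN Y f ==> continuous_map (piece Z B) Y f"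
 unfolding piece_def by (rule continuous_map_from_subtopology)

text \<open>The part of \<open>S \<times> \<nat>\<^sub>\<infinity>\<close> lying over infinity and over those \<open>m + 1\<close> for which \<open>s \<in> U m\<close> or \<open>U m\<close> is empty:
 together with the point \<open>0\<close> it covers \<open>\<nat>\<^sub>\<infinity>\<close>, and the pair \<open>(r (m + 1) s, r m s)\<close> is
 \<open>(p m, q m)\<close> or diagonal on it.\<close>

definition D :: "point topology" where
 "D = piece ({0} Un {Suc m | m. U m ~= {}}) (%_. False)"

lemma D_MStone: "D : MStone" unfolding D_def by (rule piece_MStone)

lemma continuous_D: "continuous_map SN Y f ==> continuous_map D Y f"
 unfolding D_def by (rule continuous_piece)

abbreviation level :: "point => point" where
 "level x == nbar_point (snd (unpair_point x))"

abbreviation next_retract :: "point => point" where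
 "next_retract x == retract (shift_map x)"

lemma continuous_next_retract: "continuous_map SN S next_retract"
 using continuous_map_compose[OF continuous_map_shift_map continuous_retract] by (simp add: o_def)

lemma continuous_level: "continuous_map SN Nbar1 level"
 using continuous_map_compose[OF continuous_map_unpair_point continuous_map_snd]
 by (intro continuous_map_into_Nbar1) (simp add: o_def)

lemma D_cases:
 assumes "x : topspace D"
 obtains s where "s : topspace S" "x = pair_point (s, None)"
 | s m where "s : topspace S" "x = pair_point (s, Some (Suc m))" "s : U m" "next_retract x = p m" "retract x = q m"
 | s m where "s : topspace S" "x = pair_point (s, Some (Suc m))" "U m = {}" "next_retract x = retract x" "p m = q m"
proof -
 obtain s a where x: "s : topspace S" "x = pair_point (s, a)" "steps ({0} Un {Suc m | m. U m ~= {}}) (%_. False) s a = None"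
  using assms by (auto simp: topspace_piece D_def)
 show thesis
 proof (cases a)
  case None
  thus thesis using x by (intro that(1)[of s]) simp_all
 next
  case (Some n)
  then obtain m where m: "n = Suc m" using x(3) by (cases n) auto
  show thesis
  proof (cases "U m = {}")
   case True
   thus thesis using x(1,2) Some m by (intro that(3)[of s m]) (simp_all add: r_Suc U_empty)
  next
   case False
   hence "s : U m" using x(3) Some m by (auto split: if_splits)
   thus thesis using x(1,2) Some m by (intro that(2)[of s m]) (simp_all add: r_Suc r_U)
  qed
 qed
qed

text \<open>Level \<open>Suc m\<close> is reached by a point of \<open>U m\<close> if there is one;
  otherwise nothing was removed at that level and the base point \<open>b\<close> serves.\<close>

lemma cover_Nbar1: "topspace Nbar1 <= (%_. nbar_point (Some 0)) ` topspace one_point Un level ` topspace D"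
proof
 fix z assume "z : topspace Nbar1"
 then obtain a where z: "z = nbar_point a" by (auto simp: topspace_Nbar1 simp del: topspace_times_Nbar)
 have "z : level ` topspace D" if "s : topspace S" "steps ({0} Un {Suc m | m. U m ~= {}}) (%_. False) s a = None" for s
  using that by (intro image_eqI[of _ _ "pair_point (s, a)"]) (auto simp: topspace_piece D_def z)
 moreover have "EX s:topspace S. steps ({0} Un {Suc m | m. U m ~= {}}) (%_. False) s a = None" if a: "a ~= Some 0"
 proof (cases a)
  case (Some n)
  then obtain m where m: "n = Suc m" using a Some by (cases n) auto
  show ?thesis
  proof (cases "U m = {}")
   case False
   then obtain s where "s : U m" by blast
   thus ?thesis using clopenin_subset[OF U] by (intro bexI[of _ s]) (auto simp: Some m)
  qed (use b in \<open>auto simp: Some m intro: bexI[of _ b]\<close>)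
 qed (use b in auto)
 ultimately show "z : (%_. nbar_point (Some 0)) ` topspace one_point Un level ` topspace D"
  using z by (cases "a = Some 0") auto
qed

lemma continuous_zero: "continuous_map X Nbar1 (%_. nbar_point (Some 0))" by (simp del: topspace_times_Nbar)

text \<open>The element \<open>phi rho\<close> is itself an integral, of the rows with entries
  \<open>rho k (iota n)\<close>. Row 0 is \<open>iota\<close> at \<open>b\<close>, and row
  \<open>Suc m\<close> is the difference of \<open>iota\<close> at \<open>p m\<close> and
  \<open>q m\<close>. All these are obtained from the integral of \<open>iota\<close> over
  \<open>S\<close>, which is trivial, by pulling back to the point and to \<open>D\<close>.\<close>

lemma evaluate_inj:
 assumes phi: "phi : measure_homs (null_module A) S" and 1: "evaluate S phi = \<one>[A,S]" and v: "v : null_measures S"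
 shows "phi v = \<one>[A,Nbar1]"
proof -
 let ?i = "%s n. iota n s" and ?c = "measure_matrix S rho (%s n. iota n s)" and ?y = "phi rho"
 note i = dual_basis_cont_seq[OF dual_basis]
 have y: "?y : null A one_point" by (rule hom_value_null[OF phi rho_null])
 have c: "?c : col_finite" by (rule measure_matrix_closed[OF rho_null])
 have c_eq: "?c k n = rho k (iota n)" for k n by (simp add: measure_matrix_dual_basis[OF dual_basis])
 have one: "integ S ?i ?y = \<one>[A,S]" using 1 by (simp add: evaluate_eq[OF S dual_basis phi])
 \<comment> \<open>The generator \<open>rho\<close> is expanded in terms of itself.\<close>
 have y_eq: "?y = integ Nbar1 (mat_fun ?c) ?y"
  using arg_cong[OF dual_basis_expand[OF dual_basis rho_null], of phi] M.measure_homs_act[OF phi c rho_null] null_module_act[OF c y] by simp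
 have m: "cont_seq Nbar1 (mat_fun ?c)" by (rule cont_seq_mat_fun[OF c])
 interpret D: comm_group "sect A D" by (rule comm_group_sect[OF D_MStone])
 have "integ Nbar1 (mat_fun ?c) ?y = \<one>[A,Nbar1]"
 proof (rule cover2_eqI[OF _ one_point_MStone D_MStone continuous_zero continuous_D[OF continuous_level] cover_Nbar1])
  have "pull A one_point Nbar1 (%_. nbar_point (Some 0)) (integ Nbar1 (mat_fun ?c) ?y) = integ one_point (%_. ?i b) ?y"
   unfolding integ_pull[OF one_point_MStone times_Nbar_MStone[OF one_point_MStone] continuous_zero m y]
   by (rule integ_cong[OF one_point_MStone]) (simp_all add: cont_seq_const c_eq rho_def iota_cont_int)
  also have "... = pull A one_point S (%_. b) (integ S ?i ?y)"
   using b by (intro integ_pull[OF one_point_MStone S _ i y, symmetric]) simp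
  finally show "pull A one_point Nbar1 (%_. nbar_point (Some 0)) (integ Nbar1 (mat_fun ?c) ?y)
    = pull A one_point Nbar1 (%_. nbar_point (Some 0)) \<one>[A,Nbar1]"
   using b by (simp only: one pull_one[OF one_point_MStone times_Nbar_MStone[OF one_point_MStone] continuous_zero]
     pull_one[OF one_point_MStone S continuous_map_const[THEN iffD2, OF disjI2]])
  let ?g = "%x. mat_fun ?c (level x)"
  have g: "cont_seq D ?g" by (rule cont_seq_compose[OF m continuous_D[OF continuous_level]])
  have w: "cont_seq D (%x. ?i (retract x))"
   by (rule cont_seq_compose[OF i continuous_D[OF continuous_retract]])
  \<comment> \<open>On \<open>D\<close> the shifted and unshifted retractions are the points
    \<open>p m\<close> and \<open>q m\<close>, or they coincide and the row vanishes.\<close>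
  have "?g x n + ?i (retract x) n = ?i (next_retract x) n" if "x : topspace D" for x n
   using that by (cases rule: D_cases) (simp_all add: c_eq rho_def iota_cont_int)
  hence "integ D (%x n. ?g x n + ?i (retract x) n) ?y = integ D (%x. ?i (next_retract x)) ?y"
   by (intro integ_cong D_MStone cont_seq_binop[where F = "(+)"] g w)
  hence "integ D ?g ?y \<cdot>[A,D] integ D (%x. ?i (retract x)) ?y = integ D (%x. ?i (next_retract x)) ?y"
   unfolding integ_add[OF D_MStone g w y] .
  moreover have "integ D (%x. ?i (retract x)) ?y = \<one>[A,D]" "integ D (%x. ?i (next_retract x)) ?y = \<one>[A,D]"
   using integ_pull[OF D_MStone S continuous_D[OF continuous_retract] i y]
    integ_pull[OF D_MStone S continuous_D[OF continuous_next_retract] i y]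
    pull_one[OF D_MStone S continuous_D[OF continuous_retract]] pull_one[OF D_MStone S continuous_D[OF continuous_next_retract]] one
   by simp_all
  ultimately have "integ D ?g ?y = \<one>[A,D]" using integ_closed[OF D_MStone g y] by simp
  thus "pull A D Nbar1 level (integ Nbar1 (mat_fun ?c) ?y) = pull A D Nbar1 level \<one>[A,Nbar1]"
   by (simp add: integ_pull[OF D_MStone _ continuous_D[OF continuous_level] m y]
     pull_one[OF D_MStone _ continuous_D[OF continuous_level]] del: topspace_times_Nbar)
 qed (use m y comm_group.axioms(2)[OF comm_group_sect, THEN group.is_monoid, THEN monoid.one_closed] in auto)
 hence "?y = \<one>[A,Nbar1]" using y_eq by simp
 moreover have "phi v = act (null_module A) (measure_matrix S v (%s n. iota n s)) ?y"
  using arg_cong[OF dual_basis_expand[OF dual_basis v], of phi] M.measure_homs_act[OF phi measure_matrix_closed[OF v] rho_null] by simp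
 ultimately show ?thesis using group_hom.hom_one[OF M.act_M_hom[OF measure_matrix_closed[OF v]]] by simp
qed

end

section \<open>Reconstruction of a section from its increments\<close>

context pointed_tree
begin

text \<open>The change of \<open>x\<close> from one retraction to the next. It is formed over
  \<open>D\<close>, where it descends to a function of the level alone.\<close>

definition increment :: "'u => 'u" where
 "increment x = pull A D S next_retract x \<cdot>[A,D] inv[A,D] pull A D S retract x"

lemma increment_closed:
 assumes "x : Sec A S"
 shows "increment x : Sec A D"
proof -
 interpret D: group "sect A D" by (rule group_sect[OF D_MStone])
 show ?thesis using pull_closed[OF D_MStone S continuous_D[OF continuous_retract] assms]
   pull_closed[OF D_MStone S continuous_D[OF continuous_next_retract] assms] by (simp add: increment_def)
qed

lemma pull_increment:
 assumes V: "V : MStone" and k: "continuous_map V D k" and x: "x : Sec A S"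
 shows "pull A V D k (increment x) = pull A V S (%p. next_retract (k p)) x \<cdot>[A,V] inv[A,V] pull A V S (%p. retract (k p)) x"
proof -
 interpret D: group "sect A D" by (rule group_sect[OF D_MStone])
 note c = continuous_D[OF continuous_retract] continuous_D[OF continuous_next_retract]
 note cl = pull_closed[OF D_MStone S c(1) x] pull_closed[OF D_MStone S c(2) x]
 show ?thesis
  unfolding increment_def pull_mult[OF V D_MStone k cl(2) D.inv_closed[OF cl(1)]] pull_inv[OF V D_MStone k cl(1)]
   pull_pull[OF V D_MStone S k c(1) x] pull_pull[OF V D_MStone S k c(2) x] ..
qed

lemma pull_increment_one:
 assumes V: "V : MStone" and k: "continuous_map V D k" and x: "x : Sec A S"
  and eq: "!!p. p : topspace V ==> next_retract (k p) = retract (k p)"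
 shows "pull A V D k (increment x) = \<one>[A,V]"
proof -
 interpret V: group "sect A V" by (rule group_sect[OF V])
 have c: "continuous_map V S (%p. retract (k p))"
  using continuous_map_compose[OF k continuous_D[OF continuous_retract]] by (simp add: o_def)
 have "pull A V S (%p. next_retract (k p)) = pull A V S (%p. retract (k p))" by (rule pull_cong[OF eq])
 thus ?thesis using V.r_inv[OF pull_closed[OF V S c x]] by (simp add: pull_increment[OF V k x])
qed

text \<open>Two points of \<open>D\<close> at the same level either have the same pair of successive
  retractions, namely \<open>p m\<close> and \<open>q m\<close>, or both have coinciding retractions
  and hence a trivial increment. Both alternatives are closed conditions.\<close>

lemma increment_matching:
 assumes V: "V : MStone" and g: "continuous_map V D g" and h: "continuous_map V D h" and x: "x : Sec A S"
  and eq: "!!p. p : topspace V ==> level (g p) = level (h p)"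
 shows "pull A V D g (increment x) = pull A V D h (increment x)"
proof -
 have closed: "closedin V {p : topspace V. u p = w p & u' p = w' p}"
  if "continuous_map V S u" "continuous_map V S w" "continuous_map V S u'" "continuous_map V S w'" for u w u' w'
 proof -
  have "closedin V ({p : topspace V. u p = w p} Int {p : topspace V. u' p = w' p})"
   by (intro closedin_Int closedin_equalizer[OF light_profinite_imp_Hausdorff[OF light]] that)
  thus ?thesis by (rule back_subst[of "closedin V"]) blast
 qed
 have c: "continuous_map V S (%p. next_retract (k p))" "continuous_map V S (%p. retract (k p))" if "continuous_map V D k" for k
  using continuous_map_compose[OF that continuous_D[OF continuous_next_retract]]
   continuous_map_compose[OF that continuous_D[OF continuous_retract]] by (simp_all add: o_def)
 let ?E = "{p : topspace V. next_retract (g p) = next_retract (h p) & retract (g p) = retract (h p)}"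
 let ?F = "{p : topspace V. next_retract (g p) = retract (g p) & next_retract (h p) = retract (h p)}"
 have E: "closedin V ?E" and F: "closedin V ?F"
  by (rule closed[OF c(1)[OF g] c(1)[OF h] c(2)[OF g] c(2)[OF h]], rule closed[OF c(1)[OF g] c(2)[OF g] c(1)[OF h] c(2)[OF h]])
 have sub: "subtopology V G : MStone" "continuous_map (subtopology V G) V (%p. p)" "continuous_map (subtopology V G) D k"
  if "closedin V G" "continuous_map V D k" for G k
  using that subtopology_MStone[OF V] by (simp_all add: continuous_map_from_subtopology)
 note X = increment_closed[OF x]
 show ?thesis
 proof (rule closed_cover_eqI[OF V E F])
  show "topspace V <= ?E Un ?F"
  proof
   fix p assume p: "p : topspace V"
   hence gh: "g p : topspace D" "h p : topspace D" using g h by (auto simp: continuous_map_def)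
   have lev: "level (g p) = level (h p)" by (rule eq[OF p])
   have inj: "nbar_point a = nbar_point a' \<longleftrightarrow> a = a'" for a a'
    using inj_pair_point by (auto simp: nbar_point_def inj_eq)
   show "p : ?E Un ?F" using gh(1)
   proof (cases rule: D_cases)
    case (1 s)
    show ?thesis using gh(2) by (cases rule: D_cases) (use 1 lev p in \<open>simp_all add: inj\<close>)
   next
    case (2 s m)
    show ?thesis using gh(2) by (cases rule: D_cases) (use 2 lev p in \<open>auto simp: inj\<close>)
   next
    case (3 s m)
    show ?thesis using gh(2) by (cases rule: D_cases) (use 3 lev p in \<open>auto simp: inj\<close>)
   qed
  qed
  show "pull A V D g (increment x) : Sec A V" "pull A V D h (increment x) : Sec A V"
   by (rule pull_closed[OF V D_MStone g X], rule pull_closed[OF V D_MStone h X])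
  have "pull A (subtopology V ?E) S (%p. next_retract (g p)) = pull A (subtopology V ?E) S (%p. next_retract (h p))"
    "pull A (subtopology V ?E) S (%p. retract (g p)) = pull A (subtopology V ?E) S (%p. retract (h p))"
   by (rule pull_cong; simp)+
  thus "pull A (subtopology V ?E) V (%p. p) (pull A V D g (increment x)) = pull A (subtopology V ?E) V (%p. p) (pull A V D h (increment x))"
   unfolding pull_pull[OF sub(1)[OF E g] V D_MStone sub(2)[OF E g] g X] pull_pull[OF sub(1)[OF E h] V D_MStone sub(2)[OF E h] h X]
    pull_increment[OF sub(1)[OF E g] sub(3)[OF E g] x] pull_increment[OF sub(1)[OF E h] sub(3)[OF E h] x]
   by (simp only:)
  have "pull A (subtopology V ?F) D g (increment x) = pull A (subtopology V ?F) D h (increment x)"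
   using pull_increment_one[OF sub(1)[OF F g] sub(3)[OF F g] x] pull_increment_one[OF sub(1)[OF F h] sub(3)[OF F h] x] by simp
  thus "pull A (subtopology V ?F) V (%p. p) (pull A V D g (increment x)) = pull A (subtopology V ?F) V (%p. p) (pull A V D h (increment x))"
   unfolding pull_pull[OF sub(1)[OF F g] V D_MStone sub(2)[OF F g] g X] pull_pull[OF sub(1)[OF F h] V D_MStone sub(2)[OF F h] h X] .
 qed
qed

text \<open>The increments are glued along the cover of \<open>Nbar1\<close> by the point 0 and
  \<open>D\<close>; at 0 the value of \<open>x\<close> at the base point is used.\<close>

lemma increments_exist:
 assumes x: "x : Sec A S"
 obtains a where "a : null A one_point" "pull A one_point Nbar1 (%_. nbar_point (Some 0)) a = pull A one_point S (%_. b) x"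
  "pull A D Nbar1 level a = increment x"
proof -
 let ?T = "%i::nat. if i = 0 then one_point else D" and ?f = "%i::nat. if i = 0 then (%_. nbar_point (Some 0)) else level"
 let ?y = "%i::nat. if i = 0 then pull A one_point S (%_. b) x else increment x"
 have N1: "Nbar1 : MStone" by simp
 have cb: "continuous_map one_point S (%_. b)" using b by simp
 \<comment> \<open>Level 0 was removed from \<open>D\<close>, so the two members of the cover have
   disjoint images.\<close>
 have zero: False if "h p : topspace D" "nbar_point (Some 0) = level (h p)" for h p
  using that(1) by (cases rule: D_cases) (use that(2) inj_pair_point in \<open>auto simp: nbar_point_def inj_eq\<close>)
 have "EX! a. a : Sec A Nbar1 & (ALL i<2. pull A (?T i) Nbar1 (?f i) a = ?y i)"
 proof (rule gluing[OF N1])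
  show "?T i : MStone & continuous_map (?T i) Nbar1 (?f i)" for i
   using D_MStone one_point_MStone continuous_zero[of one_point] continuous_D[OF continuous_level]
   by (cases "i = 0") (simp_all only: if_True if_False simp_thms)
  have "(\<Union>i<2. ?f i ` topspace (?T i)) = (%_. nbar_point (Some 0)) ` topspace one_point Un level ` topspace D"
   by (auto simp: numeral_2_eq_2 lessThan_Suc)
  thus "topspace Nbar1 <= (\<Union>i<2. ?f i ` topspace (?T i))" using cover_Nbar1 by simp
  show "?y i : Sec A (?T i)" for i
   using pull_closed[OF one_point_MStone S cb x] increment_closed[OF x] by simp
  fix i j V g h
  assume V: "V : MStone" and g: "continuous_map V (?T i) g" and h: "continuous_map V (?T j) h"
   and eq: "!!p. p : topspace V ==> ?f i (g p) = ?f j (h p)"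
  have cl': "pull A V (?T i) g (?y i) : Sec A V" if "continuous_map V (?T i) g" for i g
   using pull_closed[OF V one_point_MStone _ pull_closed[OF one_point_MStone S cb x]] pull_closed[OF V D_MStone _ increment_closed[OF x]] that
   by (cases "i = 0") simp_all
  note cl = cl'[OF g] cl'[OF h]
  consider "i = 0" "j = 0" | "i = 0" "j ~= 0" | "i ~= 0" "j = 0" | "i ~= 0" "j ~= 0" by blast
  thus "pull A V (?T i) g (?y i) = pull A V (?T j) h (?y j)"
  proof cases
   case 1
   have "pull A V one_point g = pull A V one_point h"
   proof (rule pull_cong)
    fix p assume "p : topspace V"
    hence "g p : topspace one_point" "h p : topspace one_point"
     using g h 1 by (auto simp: continuous_map_def)
    thus "g p = h p" by simp
   qed
   thus ?thesis using 1 by simp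
  next
   case 2
   have "topspace V = {}"
   proof (rule equals0I)
    fix p assume p: "p : topspace V"
    hence "h p : topspace D" using h 2 by (auto simp: continuous_map_def)
    thus False by (rule zero) (use eq[OF p] 2 in simp)
   qed
   thus ?thesis by (rule empty_eqI[OF V _ cl])
  next
   case 3
   have "topspace V = {}"
   proof (rule equals0I)
    fix p assume p: "p : topspace V"
    hence "g p : topspace D" using g 3 by (auto simp: continuous_map_def)
    thus False by (rule zero) (use eq[OF p] 3 in simp)
   qed
   thus ?thesis by (rule empty_eqI[OF V _ cl])
  next
   case 4
   thus ?thesis using increment_matching[OF V _ _ x, of g h] g h eq by simp
  qed
 qed
 then obtain a where a: "a : Sec A Nbar1" "ALL i<2. pull A (?T i) Nbar1 (?f i) a = ?y i" by blast
 have a0: "pull A one_point Nbar1 (%_. nbar_point (Some 0)) a = pull A one_point S (%_. b) x"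
  using a(2)[rule_format, of 0] by simp
 have a1: "pull A D Nbar1 level a = increment x" using a(2)[rule_format, of 1] by simp
 have inD: "pair_point (b, None) : topspace D"
  unfolding D_def topspace_piece by (intro exI[of _ b] exI[of _ None] conjI) (use b in simp_all)
 hence c: "continuous_map one_point D (%_. pair_point (b, None))" by simp
 \<comment> \<open>At infinity both retractions are the identity, so the increment is trivial
   there.\<close>
 have "pull A one_point Nbar1 (at_inf) a = pull A one_point Nbar1 (%_. level (pair_point (b, None))) a"
  by (rule fun_cong[OF pull_cong]) (simp add: nbar_point_def)
 also have "... = pull A one_point D (%_. pair_point (b, None)) (increment x)"
  unfolding a1[symmetric] by (rule pull_pull[OF one_point_MStone D_MStone N1 c continuous_D[OF continuous_level] a(1), symmetric])
 also have "... = \<one>[A,one_point]" by (rule pull_increment_one[OF one_point_MStone c x]) simp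
 finally show ?thesis using that[OF _ a0 a1] a(1) by (simp add: null_iff)
qed

abbreviation jumps :: "nat set => point => nat option => nat option" where
 "jumps Z == steps Z (%_. True)"

text \<open>On the closed piece made of infinity and the levels \<open>Suc m\<close> with
  \<open>s\<close> in \<open>U m\<close>, each selected index is the level itself and the claim is
  the choice of \<open>a\<close>. On the other piece no index is selected and the retraction does
  not move.\<close>

lemma jumps_increment:
 assumes x: "x : Sec A S" and a: "a : null A one_point" and a1: "pull A D Nbar1 level a = increment x"
 shows "npull SN (on_pairs (jumps (range Suc))) a = pull A SN S next_retract x \<cdot>[A,SN] inv[A,SN] pull A SN S retract x"
  (is "?Y = ?R' \<otimes>\<^bsub>_\<^esub> inv\<^bsub>_\<^esub> ?R")
proof -
 have SN: "SN : MStone" using S by simp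
 interpret SN: comm_group "sect A SN" by (rule comm_group_sect[OF SN])
 note R = pull_closed[OF SN S continuous_retract x] and R' = pull_closed[OF SN S continuous_next_retract x]
 let ?E = "%Z B. {z : topspace SN. on_pairs (steps Z B) z = None}"
 note k = null_family_continuous[OF null_family_steps]
 have Y: "?Y : Sec A SN" by (rule npull_closed[OF SN k a])
 have id: "continuous_map (piece Z B) SN (%z. z)" for Z B by (rule continuous_piece) simp
 have pullY: "pull A (piece Z B) SN (%z. z) ?Y = npull (piece Z B) (on_pairs (jumps (range Suc))) a" for Z B
  by (rule pull_npull[OF piece_MStone SN id k a])
 have pullR: "pull A (piece Z B) SN (%z. z) (?R' \<cdot>[A,SN] inv[A,SN] ?R) =
   pull A (piece Z B) S next_retract x \<cdot>[A,piece Z B] inv[A,piece Z B] pull A (piece Z B) S retract x" for Z B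
  unfolding pull_mult[OF piece_MStone SN id R' SN.inv_closed[OF R]] pull_inv[OF piece_MStone SN id R]
   pull_pull[OF piece_MStone SN S id continuous_retract x] pull_pull[OF piece_MStone SN S id continuous_next_retract x] ..
 show ?thesis
 proof (rule closed_cover_eqI[OF SN closedin_piece[of UNIV "%_. False"] closedin_piece[of "range Suc" "%_. True"]], fold piece_def)
  show "topspace SN <= ?E UNIV (%_. False) Un ?E (range Suc) (%_. True)"
  proof
   fix z assume z: "z : topspace SN"
   then obtain s n where "z = pair_point (s, n)" by auto
   thus "z : ?E UNIV (%_. False) Un ?E (range Suc) (%_. True)"
    using z by (auto simp: steps_def split: option.split nat.split)
  qed
  show "?Y : Sec A SN" by (rule Y)
  show "?R' \<cdot>[A,SN] inv[A,SN] ?R : Sec A SN" using R R' by simp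
 next
  let ?P = "piece UNIV (%_. False)"
  have inD: "z : topspace D" if zP: "z : topspace ?P" for z
  proof -
   obtain s n where z: "s : topspace S" "z = pair_point (s, n)" "steps UNIV (%_. False) s n = None"
    using zP unfolding topspace_piece by blast
   hence "steps ({0} Un {Suc m | m. U m ~= {}}) (%_. False) s n = None"
    by (auto simp: steps_def split: option.splits nat.splits if_splits)
   thus ?thesis using z(1,2) by (auto simp: D_def topspace_piece)
  qed
  hence incl: "continuous_map ?P D (%z. z)"
   using id[of UNIV "%_. False"] unfolding D_def piece_def[of "{0} Un _"] continuous_map_in_subtopology
   by (auto simp: piece_def)
  have lev: "nbar_point (on_pairs (jumps (range Suc)) z) = level z" if zP: "z : topspace ?P" for z
  proof -
   obtain s n where z: "z = pair_point (s, n)" "steps UNIV (%_. False) s n = None"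
    using zP unfolding topspace_piece by blast
   have "steps (range Suc) (%_. True) s n = n"
    using z(2) by (auto simp: steps_def split: option.splits nat.splits if_splits)
   thus ?thesis by (simp add: z(1))
  qed
  have "npull ?P (on_pairs (jumps (range Suc))) a = pull A ?P Nbar1 level a"
   unfolding npull_def by (rule fun_cong[OF pull_cong[OF lev]])
  also have "... = pull A ?P D (%z. z) (increment x)" unfolding a1[symmetric]
   by (rule pull_pull[OF piece_MStone D_MStone _ incl continuous_D[OF continuous_level] null_carrier[OF a], symmetric]) simp
  also have "... = pull A ?P S next_retract x \<cdot>[A,?P] inv[A,?P] pull A ?P S retract x"
   by (rule pull_increment[OF piece_MStone incl x])
  finally show "pull A ?P SN (%z. z) ?Y = pull A ?P SN (%z. z) (?R' \<cdot>[A,SN] inv[A,SN] ?R)"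
   unfolding pullY pullR .
 next
  let ?P = "piece (range Suc) (%_. True)"
  interpret P: group "sect A ?P" by (rule group_sect[OF piece_MStone])
  have "npull ?P (on_pairs (jumps (range Suc))) a = \<one>[A,?P]"
   by (rule npull_None[OF piece_MStone a]) (auto simp: topspace_piece)
  moreover have "pull A ?P S next_retract = pull A ?P S retract"
  proof (rule pull_cong)
   fix z assume "z : topspace ?P"
   then obtain s n where z: "s : topspace S" "z = pair_point (s, n)" "steps (range Suc) (%_. True) s n = None"
    by (auto simp: topspace_piece)
   show "next_retract z = retract z"
   proof (cases n)
    case (Some m)
    thus ?thesis using z by (cases m) (auto simp: r_Suc split: if_splits)
   qed (simp add: z(2))
  qed
  ultimately show "pull A ?P SN (%z. z) ?Y = pull A ?P SN (%z. z) (?R' \<cdot>[A,SN] inv[A,SN] ?R)"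
   unfolding pullY pullR using P.r_inv[OF pull_closed[OF piece_MStone S continuous_piece[OF continuous_retract] x]] by simp
 qed
qed

text \<open>A telescoping series: term 0 is the value of \<open>x\<close> at the base point, and the
  later terms add up to the rest by \<open>jumps_increment\<close>.\<close>

lemma nsum_jumps:
 assumes x: "x : Sec A S" and a: "a : null A one_point"
  and a0: "pull A one_point Nbar1 (%_. nbar_point (Some 0)) a = pull A one_point S (%_. b) x"
  and a1: "pull A D Nbar1 level a = increment x"
 shows "nsum S (jumps UNIV) a = x"
proof -
 have SN: "SN : MStone" using S by simp
 interpret S: comm_group "sect A S" by (rule comm_group_sect[OF S])
 interpret SN: comm_group "sect A SN" by (rule comm_group_sect[OF SN])
 have \<pi>: "continuous_map SN S (on_pairs (%p a. p))"
  by (intro continuous_map_on_pairs) (rule continuous_map_fst)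
 let ?X = "pull A SN S (on_pairs (%p a. p)) x" and ?R = "pull A SN S retract x" and ?R' = "pull A SN S next_retract x"
 note X = pull_closed[OF SN S \<pi> x] and R = pull_closed[OF SN S continuous_retract x] and R' = pull_closed[OF SN S continuous_next_retract x]
 \<comment> \<open>The tails of the increments are the differences between \<open>x\<close> and its
   pullback along the retractions, a null section because the retractions tend to the
   identity.\<close>
 let ?Z = "?X \<cdot>[A,SN] inv[A,SN] ?R"
 have pullZ: "pull A V SN k ?Z = pull A V S (%p. on_pairs (%p a. p) (k p)) x \<cdot>[A,V] inv[A,V] pull A V S (%p. retract (k p)) x"
  if V: "V : MStone" and k: "continuous_map V SN k" for V k
  unfolding pull_mult[OF V SN k X SN.inv_closed[OF R]] pull_inv[OF V SN k R] pull_pull[OF V SN S k \<pi> x] pull_pull[OF V SN S k continuous_retract x] ..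
 have self: "pull A S S (%p. p) x = x" by (rule pull_id[OF S x]) simp
 have Z: "?Z : null A S" unfolding null_iff pullZ[OF S continuous_map_at] using X R x by (simp add: self)
 have "shift A S ?Z = pull A SN S (%p. on_pairs (%p a. p) (shift_map p)) x \<cdot>[A,SN] inv[A,SN] ?R'"
  unfolding shift_eq[OF S Z] by (rule pullZ[OF SN continuous_map_shift_map])
 also have "pull A SN S (%p. on_pairs (%p a. p) (shift_map p)) = pull A SN S (on_pairs (%p a. p))"
  by (rule pull_cong) auto
 finally have shift_Z: "shift A S ?Z = ?X \<cdot>[A,SN] inv[A,SN] ?R'" .
 have "?Z = npull SN (on_pairs (jumps (range Suc))) a \<cdot>[A,SN] shift A S ?Z"
  unfolding jumps_increment[OF x a a1] shift_Z
  using X R R' by (simp add: SN.m_ac SN.inv_solve_left' SN.inv_solve_right')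
 hence "nsum S (jumps (range Suc)) a = pull A S SN (%p. pair_point (p, Some 0)) ?Z"
  unfolding nsum_def by (rule total_eqI[OF S npull_null[OF S null_family_steps a] Z])
 also have "... = x \<cdot>[A,S] inv[A,S] pull A S S (%p. r 0 p) x"
  unfolding pullZ[OF S continuous_map_at] by (simp add: self)
 also have "pull A S S (%p. r 0 p) = pull A S S (%_. b)" by (rule pull_cong) (rule r_0)
 finally have tail: "nsum S (jumps (range Suc)) a = x \<cdot>[A,S] inv[A,S] pull A S S (%_. b) x" .
 have cb: "continuous_map one_point S (%_. b)" "continuous_map S S (%_. b)" "continuous_map S one_point (%_ _. False)"
  using b by simp_all
 have "nsum S (jumps {0}) a = npull S (%_. Some 0) a"
 proof (rule nsum_single[OF S null_family_steps a])
  fix p m m'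
  show "jumps {0} p (Some m) ~= None ==> jumps {0} p (Some m') ~= None ==> m = m'"
   by (cases m; cases m') simp_all
  show "jumps {0} p (Some m) ~= None ==> Some 0 = jumps {0} p (Some m)" by (cases m) simp_all
  show "Some 0 = None" if "!!m. jumps {0} p (Some m) = None" using that[of 0] by simp
 qed
 also have "... = pull A S one_point (%_ _. False) (pull A one_point Nbar1 (%_. nbar_point (Some 0)) a)"
  unfolding npull_def by (rule pull_pull[OF S one_point_MStone _ cb(3) continuous_zero null_carrier[OF a], symmetric]) simp
 also have "... = pull A S S (%_. b) x"
  unfolding a0 by (rule pull_pull[OF S one_point_MStone S cb(3) cb(1) x])
 finally have head: "nsum S (jumps {0}) a = pull A S S (%_. b) x" .
 have "nsum S (jumps UNIV) a = nsum S (jumps {0}) a \<cdot>[A,S] nsum S (jumps (range Suc)) a"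
  by (rule nsum_split[OF S a null_family_steps null_family_steps null_family_steps]) (auto simp: steps_def split: nat.splits)
 thus ?thesis unfolding head tail using pull_closed[OF S S cb(2) x] x by (simp add: S.m_lcomm)
qed

text \<open>The functions \<open>iota n\<close> take only the values 0 and 1, so the multiplicities
  fill at most the slots coding (n, 0). Reindexing these by \<open>n\<close> gives the family of
  jumps.\<close>

lemma integ_jumps:
 assumes a: "a : null A one_point"
 shows "integ S (%s n. iota n s) a = nsum S (jumps UNIV) a"
proof -
 interpret S: comm_group "sect A S" by (rule comm_group_sect[OF S])
 note K = MStone_compact[OF S]
 let ?c = "%s n. nat (iota n s)"
 have c: "cont_seq S ?c" using cont_seq_map[OF dual_basis_cont_seq[OF dual_basis], of "%_ v. nat v"] .
 have "csum S (%s n. nat (- iota n s)) a = \<one>[A,S]"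
  by (rule csum_0[OF S a]) (auto simp: iota_def indicat_def split: nat.split)
 hence "integ S (%s n. iota n s) a = csum S ?c a" using csum_closed[OF S c a] by (simp add: integ_def)
 also have "... = nsum S (%s m. Option.bind (count_family (%_ _. 1) s m) (%n. jumps UNIV s (Some n))) a"
  unfolding csum_def
 proof (rule nsum_cong)
  show "null_family S (count_family ?c)" by (rule null_family_count[OF K c])
  show "null_family S (%s m. Option.bind (count_family (%_ _. 1) s m) (%n. jumps UNIV s (Some n)))"
   by (rule null_family_bind[OF null_family_steps null_family_count[OF K cont_seq_const]])
  fix s m assume s: "s : topspace S"
  obtain n j where m: "m = prod_encode (n, j)" by (rule prod_encode_exhaust)
  show "count_family ?c s (Some m) = Option.bind (count_family (%_ _. 1) s (Some m)) (%n. jumps UNIV s (Some n))"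
   using s by (cases n) (auto simp: m iota_def indicat_def)
 qed
 also have "... = nsum S (jumps UNIV) a"
 proof (rule nsum_reindex[OF S null_family_steps null_family_count[OF K cont_seq_const] a])
  fix s n
  show "EX! m. count_family (%_ _. 1) s (Some m) = Some n"
  proof (rule ex1I)
   show "count_family (%_ _. 1) s (Some (prod_encode (n, 0))) = Some n" by simp
   fix m assume eq: "count_family (%_ _. 1) s (Some m) = Some n"
   obtain n' j where "m = prod_encode (n', j)" by (rule prod_encode_exhaust)
   thus "m = prod_encode (n, 0)" using eq by (auto split: if_splits)
  qed
 qed
 finally show ?thesis .
qed

text \<open>The preimage is the matrix coefficient of \<open>iota\<close> and the null sequence
  \<open>a\<close> of increments. Its evaluation is the integral of \<open>iota\<close> against
  \<open>a\<close> by the dual basis property, hence the telescoping sum \<open>x\<close>.\<close>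

lemma evaluate_surj:
 assumes x: "x : Sec A S"
 obtains phi where "phi : measure_homs (null_module A) S" "evaluate S phi = x"
proof -
 obtain a where a: "a : null A one_point" "pull A one_point Nbar1 (%_. nbar_point (Some 0)) a = pull A one_point S (%_. b) x"
   "pull A D Nbar1 level a = increment x" by (rule increments_exist[OF x])
 let ?i = "%s n. iota n s" and ?phi = "M.matrix_coefficient S (%s n. iota n s) a"
 note i = dual_basis_cont_seq[OF dual_basis]
 have phi: "?phi : measure_homs (null_module A) S" using a(1) by (intro M.matrix_coefficient_hom) simp
 have "evaluate S ?phi = integ S ?i (?phi rho)" by (rule evaluate_eq[OF S dual_basis phi])
 also have "... = integ S (%s. row_times (measure_matrix S rho ?i) (?i s)) a"
  using integ_act[OF measure_matrix_closed[OF rho_null] a(1) S i] by (simp add: M.matrix_coefficient_def rho_null)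
 also have "... = integ S ?i a"
  by (rule integ_cong[OF S i, symmetric]) (simp add: row_times_dual_basis[OF dual_basis i])
 also have "... = x" by (simp add: integ_jumps[OF a(1)] nsum_jumps[OF x a])
 finally show ?thesis by (rule that[OF phi])
qed

end

section \<open>The counit as a natural isomorphism\<close>

context coded_solid_group
begin

lemma evaluate_cong:
 assumes "S : MStone" "!!v. v : null_measures S ==> phi v = psi v"
 shows "evaluate S phi = evaluate S psi"
 using assms(2)[OF dual_basisD(1)[OF some_basis[OF assms(1)]]] by (simp add: evaluate_def)

lemma empty_null_measures:
 assumes "topspace S = {}" and v: "v : null_measures S"
 shows "v = 0"
proof (intro ext)
 fix n g
 show "v n g = 0 n g"
 proof (cases "g : cont_int S")
  case True
  hence "g = 0" using assms(1) cont_int_outside[OF True] by (auto simp: fun_eq_iff)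
  thus ?thesis using additive_on_0[OF null_measures_additive[OF v] add_subgroup_cont_int] by simp
 qed (simp add: null_measures_outside[OF v])
qed

lemma pointed_tree_exists:
 assumes S: "S : MStone" and "topspace S ~= {}"
 shows "EX b r p q U. pointed_tree A code S b r p q U"
proof -
 obtain b where b: "b : topspace S" using assms(2) by blast
 obtain r p q U where "retraction_tree S b r p q U"
  by (rule retraction_tree_exists[OF S[unfolded MStone_iff] b])
 then interpret retraction_tree S b r p q U .
 have "pointed_tree A code S b r p q U" by unfold_locales (rule S)
 thus ?thesis by blast
qed

lemma evaluate_kernel:
 assumes S: "S : MStone" and phi: "phi : measure_homs (null_module A) S" and one: "evaluate S phi = \<one>[A,S]"
  and v: "v : null_measures S"
 shows "phi v = \<one>[A,Nbar1]"
proof (cases "topspace S = {}")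
 case True
 show ?thesis
  using M.additive_to_zero[OF M.measure_homs_additive[OF phi]] by (simp only: empty_null_measures[OF True v] null_module_simps)
next
 case False
 then obtain b r p q U where "pointed_tree A code S b r p q U" using pointed_tree_exists[OF S] by blast
 then interpret pointed_tree A code S b r p q U .
 show ?thesis by (rule evaluate_inj[OF phi one v])
qed

lemma evaluate_onto:
 assumes S: "S : MStone" and x: "x : Sec A S"
 shows "EX phi:measure_homs (null_module A) S. evaluate S phi = x"
proof (cases "topspace S = {}")
 case True
 thus ?thesis
  using empty_eqI[OF S True evaluate_closed[OF S M.measure_homs_one] x] M.measure_homs_one by blast
next
 case False
 then obtain b r p q U where "pointed_tree A code S b r p q U" using pointed_tree_exists[OF S] by blast
 then interpret pointed_tree A code S b r p q U .
 show ?thesis by (rule evaluate_surj[OF x]) blast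
qed

text \<open>The decoding by choice is harmless: \<open>inj code\<close> determines the homomorphism
  on all null measures, and \<open>evaluate\<close> depends on nothing else.\<close>

definition counit :: "point topology => 'u => 'u" where
 "counit = (\<lambda>S\<in>MStone. \<lambda>y\<in>Sec M.C S.
   evaluate S (SOME phi. phi : measure_homs (null_module A) S & y = encode code S phi))"

lemma counit_encode:
 assumes S: "S : MStone" and phi: "phi : measure_homs (null_module A) S"
 shows "counit S (encode code S phi) = evaluate S phi"
proof -
 let ?psi = "SOME psi. psi : measure_homs (null_module A) S & encode code S phi = encode code S psi"
 have "EX psi. psi : measure_homs (null_module A) S & encode code S phi = encode code S psi"
  using phi by blast
 from someI_ex[OF this] have "encode code S ?psi = encode code S phi" by simp
 note eq = M.encode_eqD[OF MStone_compact[OF S] this]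
 show ?thesis
  using S M.encode_closed[OF MStone_compact[OF S] phi] by (simp add: counit_def) (rule evaluate_cong[OF S eq])
qed

lemma counit_presheaf_hom: "counit : presheaf_homs M.C A" unfolding presheaf_homs_def
proof (intro CollectI conjI ballI IntI)
 show "counit : extensional MStone" by (simp add: counit_def)
 fix S assume S: "S : MStone"
 note K = MStone_compact[OF S]
 show "counit S : extensional (Sec M.C S)" using S by (simp add: counit_def)
 show "counit S : hom (sect M.C S) (sect A S)"
 proof (rule homI)
  fix x y assume x: "x : Sec M.C S" and y: "y : Sec M.C S"
  obtain phi where phi: "phi : measure_homs (null_module A) S" "x = encode code S phi"
   by (rule M.encode_exhaust[OF K x])
  obtain psi where psi: "psi : measure_homs (null_module A) S" "y = encode code S psi"
   by (rule M.encode_exhaust[OF K y])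
  show "counit S x : Sec A S"
   unfolding phi(2) counit_encode[OF S phi(1)] by (rule evaluate_closed[OF S phi(1)])
  have "x \<cdot>[M.C,S] y = encode code S (restrict (%v. phi v \<otimes>\<^bsub>null_module A\<^esub> psi v) (null_measures S))"
   unfolding phi(2) psi(2) M.encode_mult[OF K phi(1) psi(1)] by (rule encode_cong[OF K]) simp
  hence "counit S (x \<cdot>[M.C,S] y) = evaluate S (restrict (%v. phi v \<otimes>\<^bsub>null_module A\<^esub> psi v) (null_measures S))"
   by (simp only: counit_encode[OF S M.measure_homs_mult[OF phi(1) psi(1)]])
  also have "... = evaluate S (%v. phi v \<cdot>[A,Nbar1] psi v)" by (rule evaluate_cong[OF S]) simp
  finally show "counit S (x \<cdot>[M.C,S] y) = counit S x \<cdot>[A,S] counit S y"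
   unfolding evaluate_mult[OF S phi(1) psi(1)] phi(2) psi(2) counit_encode[OF S phi(1)] counit_encode[OF S psi(1)] .
 qed
 fix T f x assume T: "T : MStone" and f: "f : cmaps S T" and x: "x : Sec M.C T"
 obtain phi where phi: "phi : measure_homs (null_module A) T" "x = encode code T phi"
  by (rule M.encode_exhaust[OF MStone_compact[OF T] x])
 note c = cmapsD(1)[OF f]
 have "counit S (res M.C S T f x) = evaluate S (restrict (%v. phi (push S T f v)) (null_measures S))"
  unfolding phi(2) M.res_cond[OF f] M.pull_encode'[OF S T c phi(1)] by (rule counit_encode[OF S M.measure_homs_push_map[OF phi(1) c]])
 also have "... = evaluate S (%v. phi (push S T f v))" by (rule evaluate_cong[OF S]) simp
 finally show "counit S (res M.C S T f x) = res A S T f (counit T x)"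
  unfolding evaluate_pull[OF S T c phi(1)] phi(2) counit_encode[OF T phi(1)] res_eq_pull[OF f] .
qed

lemma bij_counit:
 assumes S: "S : MStone"
 shows "bij_betw (counit S) (Sec M.C S) (Sec A S)"
proof (rule bij_betwI')
 note K = MStone_compact[OF S]
 interpret C: group "sect M.C S" by (rule M.C.group_sect[OF S])
 interpret h: group_hom "sect M.C S" "sect A S" "counit S"
  using counit_presheaf_hom S group_sect[OF S] C.group_axioms
  by (simp add: group_hom_def group_hom_axioms_def presheaf_homs_def)
 have trivial: "z = \<one>[M.C,S]" if z: "z : Sec M.C S" and one: "counit S z = \<one>[A,S]" for z
 proof -
  obtain phi where phi: "phi : measure_homs (null_module A) S" "z = encode code S phi"
   by (rule M.encode_exhaust[OF K z])
  hence "evaluate S phi = \<one>[A,S]" using one by (simp add: counit_encode[OF S phi(1)])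
  note eq = evaluate_kernel[OF S phi(1) this]
  show ?thesis unfolding phi(2) M.one_cond by (rule encode_cong[OF K]) (simp add: eq)
 qed
 fix x y assume xy: "x : Sec M.C S" "y : Sec M.C S"
 show "counit S x = counit S y \<longleftrightarrow> x = y"
 proof
  assume "counit S x = counit S y"
  hence "counit S (x \<cdot>[M.C,S] inv[M.C,S] y) = \<one>[A,S]"
   using xy by (simp add: h.hom_mult h.hom_inv)
  thus "x = y"
   using trivial[of "x \<cdot>[M.C,S] inv[M.C,S] y"] xy C.inv_solve_right[of "\<one>[M.C,S]" x y] by simp
 qed simp
next
 fix x assume "x : Sec M.C S"
 thus "counit S x : Sec A S" by (rule presheaf_homs_closed[OF counit_presheaf_hom S])
next
 fix x assume "x : Sec A S"
 then obtain phi where phi: "phi : measure_homs (null_module A) S" "evaluate S phi = x"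
  using evaluate_onto[OF S] by blast
 thus "EX y:Sec M.C S. x = counit S y"
  using M.encode_closed[OF MStone_compact[OF S] phi(1)] counit_encode[OF S phi(1)] by metis
qed

lemma isomorphism_counit: "isomorphism light_condensed_groups M.C A counit"
 by (rule isomorphism_presheafI[OF counit_presheaf_hom])
  (simp_all add: bij_counit M.C.group_sect res_closed[OF M.C.ab_presheaf_axioms])

end

text \<open>By \<open>evaluate_eq\<close> the evaluation for \<open>B\<close> may use the dual basis
  chosen for \<open>A\<close>; then \<open>psi\<close> commutes with the integral by
  \<open>presheaf_hom_integ\<close>.\<close>

lemma counit_natural:
 assumes A: "coded_solid_group A code" and B: "coded_solid_group B code" and psi: "psi : presheaf_homs A B"
  and S: "S : MStone" and x: "x : carrier (sect (cond code (null_module A)) S)"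
 shows "coded_solid_group.counit B code S (cond_map code (null_module A) (null_module B) (null_module_map A B psi) S x) =
  psi S (coded_solid_group.counit A code S x)"
proof -
 interpret A: coded_solid_group A code by fact
 interpret B: coded_solid_group B code by fact
 let ?h = "null_module_map A B psi"
 have h: "?h : module_homs matrix_ring (null_module A) (null_module B)"
  by (rule null_module_map_hom[OF A.solid_group_axioms B.solid_group_axioms psi])
 obtain phi where phi: "phi : measure_homs (null_module A) S" "x = encode code S phi"
  by (rule A.M.encode_exhaust[OF MStone_compact[OF S] x])
 note hphi = A.M.measure_homs_compose[OF B.left_module_null_module h phi(1)]
 note bas = A.some_basis[OF S]
 have y: "phi (fst (A.some_basis S)) : null A one_point"
  by (rule A.hom_value_null[OF phi(1) dual_basisD(1)[OF bas]])
 have "cond_map code (null_module A) (null_module B) ?h S x = encode code S (restrict (%v. ?h (phi v)) (null_measures S))"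
  unfolding phi(2) A.M.cond_map_encode[OF B.left_module_null_module h S phi(1)] by (rule encode_cong[OF MStone_compact[OF S]]) simp
 hence "B.counit S (cond_map code (null_module A) (null_module B) ?h S x) = B.evaluate S (restrict (%v. ?h (phi v)) (null_measures S))"
  by (simp only: B.counit_encode[OF S hphi])
 also have "... = B.integ S (%p n. snd (A.some_basis S) n p) (psi Nbar1 (phi (fst (A.some_basis S))))"
  unfolding B.evaluate_eq[OF S bas hphi] using dual_basisD(1)[OF bas] y by (simp add: null_module_map_def)
 also have "... = psi S (A.evaluate S phi)" unfolding A.evaluate_def
  by (rule presheaf_hom_integ[OF A.solid_group_axioms B.solid_group_axioms psi S dual_basis_cont_seq[OF bas] y, symmetric])
 finally show ?thesis unfolding phi(2) A.counit_encode[OF S phi(1)] .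
qed

lemma light_solid_isomorphism:
 assumes "solid_group A" "solid_group B" "isomorphism light_condensed_groups A B phi"
 shows "isomorphism light_solid_groups A B phi"
 using assms unfolding isomorphism_def by (simp add: light_solid_groups_def full_subcategory_def)

theorem theorem7p9:
  fixes code :: "(bidual_seq \<Rightarrow> 'u) \<Rightarrow> 'u"
  assumes "inj code"
  shows "equivalence_with_inverse
    (left_modules matrix_ring :: ((matrix, 'u) lmodule, 'u \<Rightarrow> 'u) cat)
    (light_solid_groups :: ('u presheaf, point topology \<Rightarrow> 'u \<Rightarrow> 'u) cat)
    (cond code) (cond_map code)
    null_module null_module_map"
 unfolding equivalence_with_inverse_def
proof (intro conjI)
 show "is_functor (left_modules matrix_ring :: ((matrix, 'u) lmodule, 'u => 'u) cat) light_solid_groups (cond code) (cond_map code)"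
  by (rule is_functor_cond[OF assms])
 show "is_functor (light_solid_groups :: ('u presheaf, point topology => 'u => 'u) cat) (left_modules matrix_ring) null_module null_module_map"
  by (rule is_functor_null_module)
 have "natural_isomorphism (left_modules matrix_ring :: ((matrix, 'u) lmodule, 'u => 'u) cat) (left_modules matrix_ring)
  (%A. A) (%A B f. f) (%A. null_module (cond code A))
  (%A B f. null_module_map (cond code A) (cond code B) (cond_map code A B f)) (%M. coded_module.unit M code)"
  unfolding natural_isomorphism_def left_modules_simps
 proof (intro conjI ballI)
  fix M :: "(matrix, 'u) lmodule"
  assume "M : Obj (left_modules matrix_ring)"
  hence M: "left_module matrix_ring M" by simp
  interpret M: coded_module M code by (rule coded_moduleI[OF M assms])
  show "isomorphism (left_modules matrix_ring) M (null_module M.C) M.unit"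
   using M.bij_unit by (intro isomorphism_left_modulesI[OF M M.unit_hom]) simp
  fix N :: "(matrix, 'u) lmodule" and h
  assume "N : Obj (left_modules matrix_ring)" and h: "h : module_homs matrix_ring M N"
  hence N: "left_module matrix_ring N" by simp
  show "compose (carrier M) (coded_module.unit N code) h =
    compose (carrier M) (null_module_map M.C (cond code N) (cond_map code M N h)) M.unit"
   by (auto simp: compose_def M.unit_natural[OF N h] intro!: restrict_ext)
 qed
 thus "EX \<eta>. natural_isomorphism (left_modules matrix_ring :: ((matrix, 'u) lmodule, 'u => 'u) cat) (left_modules matrix_ring)
  (%A. A) (%A B f. f) (%A. null_module (cond code A))
  (%A B f. null_module_map (cond code A) (cond code B) (cond_map code A B f)) \<eta>"
  by blast
 have "natural_isomorphism (light_solid_groups :: ('u presheaf, point topology => 'u => 'u) cat) light_solid_groups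
  (%X. cond code (null_module X))
  (%X Y f. cond_map code (null_module X) (null_module Y) (null_module_map X Y f)) (%X. X) (%X Y f. f)
  (%A. coded_solid_group.counit A code)"
  unfolding natural_isomorphism_def light_solid_simps
 proof (intro conjI ballI)
  fix A :: "'u presheaf"
  assume "A : Obj light_solid_groups"
  hence A: "coded_solid_group A code"
   using assms by (simp add: coded_solid_group_def coded_solid_group_axioms_def)
  interpret A: coded_solid_group A code by (rule A)
  show "isomorphism light_solid_groups A.M.C A A.counit"
   by (rule light_solid_isomorphism[OF A.M.C.solid_group_axioms A.solid_group_axioms A.isomorphism_counit])
  fix B :: "'u presheaf" and psi
  assume "B : Obj light_solid_groups" and psi: "psi : presheaf_homs A B"
  hence B: "coded_solid_group B code"
   using assms by (simp add: coded_solid_group_def coded_solid_group_axioms_def)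
  show "(\<lambda>S\<in>MStone. compose (Sec A.M.C S) (coded_solid_group.counit B code S)
     (cond_map code (null_module A) (null_module B) (null_module_map A B psi) S)) =
    (\<lambda>S\<in>MStone. compose (Sec A.M.C S) (psi S) (A.counit S))"
   by (auto simp: compose_def counit_natural[OF A B psi] intro!: restrict_ext)
 qed
 thus "EX \<epsilon>. natural_isomorphism (light_solid_groups :: ('u presheaf, point topology => 'u => 'u) cat) light_solid_groups
  (%X. cond code (null_module X))
  (%X Y f. cond_map code (null_module X) (null_module Y) (null_module_map X Y f)) (%X. X) (%X Y f. f) \<epsilon>"
  by blast
qed

end
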